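(* Let $k$ be a field and let $A = k\times k$, $e=(1,0)$, $1_A=(1,1)$. Then every unital Hopf algebra coaction on $A$ is equivalent via $\mathrm{id}_A$ to one of the following three unital coactions: (1) $\rho_1\colon A\to A\otimes k$, $\rho_1(a)=a\otimes 1$ for all $a\in A$. The cosupport $\mathrm{cosupp}\,\rho_1$ is one-dimensional and consists of all scalar operators on $A$. (2) $\rho_2=\Delta_{(kC_2)^*}$, the comultiplication of the Hopf algebra $(kC_2)^*$ dual to the group algebra $kC_2$ of the cyclic group $C_2=\langle c\rangle$ of order $2$, where $A$ is identified with $(kC_2)^*$ via $(1,0)\mapsto\delta_1$, $(0,1)\mapsto\delta_c$, and $\delta_1,\delta_c$ is the basis dual to the basis $1,c$ of $kC_2$ (so $\rho_2\colon A\to A\otimes (kC_2)^*$). The cosupport $\mathrm{cosupp}\,\rho_2$ is two-dimensional and consists of all linear operators on $A$ that have matrices of the form $\left(\begin{smallmatrix}\alpha&\beta\\ \beta&\alpha\end{smallmatrix}\right)$, $\alpha,\beta\in k$, in the basis $(1,0),(0,1)$. (3) $\rho_3\colon A\to A\otimes k\langle c,d,h\rangle/I$ where $\rho_3(e)=1_A\otimes\bar h+e\otimes\bar c$ and $k\langle c,d,h\rangle/I$ is the Hopf algebra defined in the context. The cosupport $\mathrm{cosupp}\,\rho_3$ is three-dimensional and consists of all linear operators on $A$ that have upper triangular matrices in the basis $1_A,e$. This class of equivalent coactions contains a representative $\rho_{3a}$ with a finite dimensional coacting Hopf algebra: namely, it is sufficient to replace $k\langle c,d,h\rangle/I$ with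 $k\langle c,d,h\rangle/(I+I_1)$, where $I_1$ is the ideal generated by $c^2-1$. If $\mathrm{char}\,k\neq 2$, then this class contains the $H_4$-coaction $\rho_{3b}\colon A\to A\otimes H_4$ where $H_4$ is the Sweedler algebra and $\rho_{3b}(1,-1)=(1,-1)\otimes c+(1,1)\otimes cv$. Finally, for $w=1,2,3$ the coaction $\rho_w$ together with the corresponding Hopf algebra is $(\mathrm{cosupp}\,\rho_w)$-universal.
   Context: Coactions. For a Hopf algebra $H$ over $k$ and a unital $k$-algebra $A$, an $H$-coaction on $A$ is an algebra homomorphism $\rho\colon A\to A\otimes H$ that makes $A$ a right $H$-comodule; it is unital if $\rho(1_A)=1_A\otimes 1_H$. A (unital) Hopf algebra coaction on $A$ is a (unital) $H$-coaction for some Hopf algebra $H$. Cosupport and equivalence. For $\rho\colon A\to A\otimes H$ put $\rho^\vee(\lambda\otimes a)=\lambda(a_{(1)})a_{(0)}$ for $\lambda\in H^*$, $a\in A$, where $\rho(a)=a_{(0)}\otimes a_{(1)}$. The cosupport is the unital subalgebra $\mathrm{cosupp}\,\rho=\{\rho^\vee(\lambda\otimes(-))\mid\lambda\in H^*\}\subseteq\mathrm{End}_k(A)$. Coactions $\rho_1$ on $A_1$ and $\rho_2$ on $A_2$ are equivalent via an algebra isomorphism $\varphi\colon A_1\to A_2$ if $\varphi(\mathrm{cosupp}\,\rho_1)\varphi^{-1}=\mathrm{cosupp}\,\rho_2$; in particular, coactions on the same $A$ are equivalent via $\mathrm{id}_A$ iff their cosupports coincide. Matrices of operators: the $j$-th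 column contains the coordinates of the image of the $j$-th basis vector. Universality. For a unital subalgebra $V\subseteq\mathrm{End}_k(A)$, a Hopf algebra $H_0$ with an $H_0$-coaction $\rho_0$ on $A$, $\mathrm{cosupp}\,\rho_0\subseteq V$, is $V$-universal if for every Hopf algebra $H$ and every $H$-coaction $\rho$ on $A$ with $\mathrm{cosupp}\,\rho\subseteq V$ there is a unique Hopf algebra homomorphism $\varphi\colon H_0\to H$ with $\rho=(\mathrm{id}_A\otimes\varphi)\rho_0$. Convention: (co)actions on unital associative algebras are assumed unital. The Hopf algebra $k\langle c,d,h\rangle/I$: $k\langle c,d,h\rangle$ is the free unital associative algebra, $I$ is the two-sided ideal generated by $cd-1$, $dc-1$, $h^2-h$, $hc+ch+c^2-c$; $\Delta,\varepsilon$ are induced by the unital algebra homomorphisms with $\Delta c=c\otimes c$, $\Delta d=d\otimes d$, $\Delta h=h\otimes c+1\otimes h$, $\varepsilon(c)=\varepsilon(d)=1$, $\varepsilon(h)=0$, and $S$ is induced by the unital anti-homomorphism with $Sc=d$, $Sd=c$, $Sh=-hd$. Bars denote images in the quotient. $k\langle c,d,h\rangle/(I+I_1)$ carries the induced Hopf algebra structure. Sweedler algebra $H_4$: generated as a unital algebra by $c,v$ with $c^2=1$, $v^2=0$, $vc=-cv$, basis $1,c,v,cv$; $\Delta c=c\otimes c$, $\Delta v=c\otimes v+v\otimes 1$, $\varepsilon(c)=1$, $\varepsilon(v)=0$, $Sc=c$, $Sv=-cv$. *)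

theory Defs
  imports "HOL-Algebra.Algebra"
begin

section \<open>Algebras and linear maps\<close>

text \<open>
  The locale \<^locale>\<open>algebra\<close> of the library describes commutative algebras only.
  All algebras below are associative and unital, but not necessarily commutative.
\<close>

locale unital_algebra = module K A + ring A for K :: "'k ring" and A (structure) +
  assumes smult_mult_left:
      "\<lbrakk>a \<in> carrier K; x \<in> carrier A; y \<in> carrier A\<rbrakk>
        \<Longrightarrow> (a \<odot>\<^bsub>A\<^esub> x) \<otimes>\<^bsub>A\<^esub> y = a \<odot>\<^bsub>A\<^esub> (x \<otimes>\<^bsub>A\<^esub> y)"
    and smult_mult_right:
      "\<lbrakk>a \<in> carrier K; x \<in> carrier A; y \<in> carrier A\<rbrakk>
        \<Longrightarrow> x \<otimes>\<^bsub>A\<^esub> (a \<odot>\<^bsub>A\<^esub> y) = a \<odot>\<^bsub>A\<^esub> (x \<otimes>\<^bsub>A\<^esub> y)"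

definition lin_hom :: "'k ring \<Rightarrow> ('k, 'a, 'x) module_scheme \<Rightarrow> ('k, 'b, 'y) module_scheme \<Rightarrow> ('a \<Rightarrow> 'b) set"
  where "lin_hom K M N =
    {f \<in> carrier M \<rightarrow> carrier N.
      (\<forall>x\<in>carrier M. \<forall>y\<in>carrier M. f (x \<oplus>\<^bsub>M\<^esub> y) = f x \<oplus>\<^bsub>N\<^esub> f y) \<and>
      (\<forall>a\<in>carrier K. \<forall>x\<in>carrier M. f (a \<odot>\<^bsub>M\<^esub> x) = a \<odot>\<^bsub>N\<^esub> f x)}"

text \<open>Algebra homomorphisms are unital, because the elements of \<^const>\<open>ring_hom\<close> are.\<close>

definition alg_hom :: "'k ring \<Rightarrow> ('k, 'a, 'x) module_scheme \<Rightarrow> ('k, 'b, 'y) module_scheme \<Rightarrow> ('a \<Rightarrow> 'b) set"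
  where "alg_hom K A B = ring_hom A B \<inter> lin_hom K A B"

definition alg_iso :: "'k ring \<Rightarrow> ('k, 'a, 'x) module_scheme \<Rightarrow> ('k, 'b, 'y) module_scheme \<Rightarrow> ('a \<Rightarrow> 'b) set"
  where "alg_iso K A B = {f \<in> alg_hom K A B. bij_betw f (carrier A) (carrier B)}"

definition base_alg :: "'k ring \<Rightarrow> ('k, 'k) module"
  where "base_alg K = ring.extend K (module.fields (\<lambda>a x. a \<otimes>\<^bsub>K\<^esub> x))"

definition opp_alg :: "('k, 'a) module \<Rightarrow> ('k, 'a) module"
  where "opp_alg A = A\<lparr>monoid.mult := (\<lambda>x y. y \<otimes>\<^bsub>A\<^esub> x)\<rparr>"

definition unital_subalgebra :: "'k ring \<Rightarrow> ('k, 'a, 'x) module_scheme \<Rightarrow> 'a set \<Rightarrow> bool"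
  where "unital_subalgebra K B V \<longleftrightarrow> subring V B \<and> submodule V K B"

text \<open>
  The library measures dimension inside a ring over a subfield of that ring; for a
  \<open>k\<close>-algebra the relevant subfield is the image \<open>k\<cdot>1\<close> of the ground field.
\<close>

definition scalars :: "'k ring \<Rightarrow> ('k, 'a, 'x) module_scheme \<Rightarrow> 'a set"
  where "scalars K A = (\<lambda>a. a \<odot>\<^bsub>A\<^esub> \<one>\<^bsub>A\<^esub>) ` carrier K"

definition has_dim :: "'k ring \<Rightarrow> ('k, 'a, 'x) module_scheme \<Rightarrow> 'a set \<Rightarrow> nat \<Rightarrow> bool"
  where "has_dim K A V n \<longleftrightarrow> ring.dimension A n (scalars K A) V"

definition finite_dim_alg :: "'k ring \<Rightarrow> ('k, 'a, 'x) module_scheme \<Rightarrow> bool"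
  where "finite_dim_alg K A \<longleftrightarrow> ring.finite_dimension A (scalars K A) (carrier A)"

text \<open>Operators are extensional functions, so that equality of operators is equality of functions.\<close>

definition End_alg :: "'k ring \<Rightarrow> ('k, 'a, 'x) module_scheme \<Rightarrow> ('k, 'a \<Rightarrow> 'a) module"
  where "End_alg K A =
    \<lparr>carrier = lin_hom K A A \<inter> extensional (carrier A),
     monoid.mult = compose (carrier A),
     one = (\<lambda>x\<in>carrier A. x),
     ring.zero = (\<lambda>x\<in>carrier A. \<zero>\<^bsub>A\<^esub>),
     ring.add = (\<lambda>f g. \<lambda>x\<in>carrier A. f x \<oplus>\<^bsub>A\<^esub> g x),
     smult = (\<lambda>a f. \<lambda>x\<in>carrier A. a \<odot>\<^bsub>A\<^esub> f x)\<rparr>"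

text \<open>Column \<open>j\<close> of the matrix contains the coordinates of the image of the \<open>j\<close>-th basis vector.\<close>

definition has_matrix ::
    "'k ring \<Rightarrow> ('k, 'a, 'x) module_scheme \<Rightarrow> 'a list \<Rightarrow> ('a \<Rightarrow> 'a) \<Rightarrow> (nat \<Rightarrow> nat \<Rightarrow> 'k) \<Rightarrow> bool"
  where "has_matrix K A bs f M \<longleftrightarrow>
    (\<forall>i<length bs. \<forall>j<length bs. M i j \<in> carrier K) \<and>
    (\<forall>j<length bs. f (bs ! j) = (\<Oplus>\<^bsub>A\<^esub>i\<in>{..<length bs}. M i j \<odot>\<^bsub>A\<^esub> (bs ! i)))"


section \<open>Monoid algebras, free algebras and quotients\<close>

definition supp :: "'k ring \<Rightarrow> ('m \<Rightarrow> 'k) \<Rightarrow> 'm set"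
  where "supp K f = {x. f x \<noteq> \<zero>\<^bsub>K\<^esub>}"

text \<open>\<open>k[M]\<close> as finitely supported functions with the convolution product\<close>

definition monoid_alg :: "'k ring \<Rightarrow> ('m, 'x) monoid_scheme \<Rightarrow> ('k, 'm \<Rightarrow> 'k) module"
  where "monoid_alg K M =
    \<lparr>carrier = {f. range f \<subseteq> carrier K \<and> finite (supp K f) \<and> supp K f \<subseteq> carrier M},
     monoid.mult = (\<lambda>f g x. \<Oplus>\<^bsub>K\<^esub>p\<in>{p \<in> supp K f \<times> supp K g. fst p \<otimes>\<^bsub>M\<^esub> snd p = x}.
        f (fst p) \<otimes>\<^bsub>K\<^esub> g (snd p)),
     one = (\<lambda>x. if x = \<one>\<^bsub>M\<^esub> then \<one>\<^bsub>K\<^esub> else \<zero>\<^bsub>K\<^esub>),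
     ring.zero = (\<lambda>x. \<zero>\<^bsub>K\<^esub>),
     ring.add = (\<lambda>f g x. f x \<oplus>\<^bsub>K\<^esub> g x),
     smult = (\<lambda>a f x. a \<otimes>\<^bsub>K\<^esub> f x)\<rparr>"

definition basis_elt :: "'k ring \<Rightarrow> 'm \<Rightarrow> 'm \<Rightarrow> 'k"
  where "basis_elt K m = (\<lambda>x. if x = m then \<one>\<^bsub>K\<^esub> else \<zero>\<^bsub>K\<^esub>)"

text \<open>The linear map from the finitely supported functions to \<open>M\<close> with \<open>basis_elt K x \<mapsto> \<phi> x\<close>\<close>

definition lin_ext :: "'k ring \<Rightarrow> ('k, 'a, 'x) module_scheme \<Rightarrow> ('m \<Rightarrow> 'a) \<Rightarrow> ('m \<Rightarrow> 'k) \<Rightarrow> 'a"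
  where "lin_ext K M \<phi> f = (\<Oplus>\<^bsub>M\<^esub>x\<in>supp K f. f x \<odot>\<^bsub>M\<^esub> \<phi> x)"

definition word_monoid :: "'g list monoid"
  where "word_monoid = \<lparr>carrier = UNIV, monoid.mult = (@), one = []\<rparr>"

definition free_alg :: "'k ring \<Rightarrow> ('k, 'g list \<Rightarrow> 'k) module"
  where "free_alg K = monoid_alg K word_monoid"

definition free_gen :: "'k ring \<Rightarrow> 'g \<Rightarrow> 'g list \<Rightarrow> 'k"
  where "free_gen K x = basis_elt K [x]"

text \<open>The unital algebra homomorphism from the free algebra to \<open>B\<close> that extends \<open>g\<close>\<close>

definition free_eval :: "'k ring \<Rightarrow> ('k, 'b, 'x) module_scheme \<Rightarrow> ('g \<Rightarrow> 'b) \<Rightarrow> ('g list \<Rightarrow> 'k) \<Rightarrow> 'b"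
  where "free_eval K B g = lin_ext K B (\<lambda>w. foldr (\<lambda>x y. g x \<otimes>\<^bsub>B\<^esub> y) w \<one>\<^bsub>B\<^esub>)"

definition quot_alg :: "('k, 'a, 'x) module_scheme \<Rightarrow> 'a set \<Rightarrow> ('k, 'a set) module"
  where "quot_alg A N =
    ring.extend (A Quot N) (module.fields (\<lambda>a Y. \<Union>x\<in>Y. N +>\<^bsub>A\<^esub> (a \<odot>\<^bsub>A\<^esub> x)))"


section \<open>Tensor products\<close>

text \<open>
  \<open>A \<otimes> B\<close> is the quotient of the vector space with basis \<open>A \<times> B\<close> by the subspace spanned by the
  bilinearity relations. As the vector space with basis \<open>A \<times> B\<close> we take the monoid algebra of
  the multiplicative monoid \<open>A \<times> B\<close>; the subspace is then a two-sided ideal (multiplying a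
  relation by a basis element yields a relation), and the quotient product
  satisfies \<open>(a \<otimes> b)(a' \<otimes> b') = aa' \<otimes> bb'\<close>.
\<close>

definition bilin_rels ::
    "'k ring \<Rightarrow> ('k, 'a, 'x) module_scheme \<Rightarrow> ('k, 'b, 'y) module_scheme \<Rightarrow> ('a \<times> 'b \<Rightarrow> 'k) set"
  where "bilin_rels K A B = (let F = monoid_alg K (A \<times>\<times> B); \<delta> = (\<lambda>a b. basis_elt K (a, b)) in
      {\<delta> (a \<oplus>\<^bsub>A\<^esub> a') b \<ominus>\<^bsub>F\<^esub> (\<delta> a b \<oplus>\<^bsub>F\<^esub> \<delta> a' b) | a a' b.
        a \<in> carrier A \<and> a' \<in> carrier A \<and> b \<in> carrier B}
    \<union> {\<delta> a (b \<oplus>\<^bsub>B\<^esub> b') \<ominus>\<^bsub>F\<^esub> (\<delta> a b \<oplus>\<^bsub>F\<^esub> \<delta> a b') | a b b'.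
        a \<in> carrier A \<and> b \<in> carrier B \<and> b' \<in> carrier B}
    \<union> {\<delta> (r \<odot>\<^bsub>A\<^esub> a) b \<ominus>\<^bsub>F\<^esub> r \<odot>\<^bsub>F\<^esub> \<delta> a b | r a b.
        r \<in> carrier K \<and> a \<in> carrier A \<and> b \<in> carrier B}
    \<union> {\<delta> a (r \<odot>\<^bsub>B\<^esub> b) \<ominus>\<^bsub>F\<^esub> r \<odot>\<^bsub>F\<^esub> \<delta> a b | r a b.
        r \<in> carrier K \<and> a \<in> carrier A \<and> b \<in> carrier B})"

definition bilin_sub ::
    "'k ring \<Rightarrow> ('k, 'a, 'x) module_scheme \<Rightarrow> ('k, 'b, 'y) module_scheme \<Rightarrow> ('a \<times> 'b \<Rightarrow> 'k) set"
  where "bilin_sub K A B = (\<lambda>N. submodule N K (monoid_alg K (A \<times>\<times> B))) hull bilin_rels K A B"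

definition tensor ::
    "'k ring \<Rightarrow> ('k, 'a, 'x) module_scheme \<Rightarrow> ('k, 'b, 'y) module_scheme
      \<Rightarrow> ('k, ('a \<times> 'b \<Rightarrow> 'k) set) module"
  where "tensor K A B = quot_alg (monoid_alg K (A \<times>\<times> B)) (bilin_sub K A B)"

definition tens ::
    "'k ring \<Rightarrow> ('k, 'a, 'x) module_scheme \<Rightarrow> ('k, 'b, 'y) module_scheme
      \<Rightarrow> 'a \<Rightarrow> 'b \<Rightarrow> ('a \<times> 'b \<Rightarrow> 'k) set"
  where "tens K A B a b = bilin_sub K A B +>\<^bsub>monoid_alg K (A \<times>\<times> B)\<^esub> basis_elt K (a, b)"

text \<open>The linear map \<open>A \<otimes> B \<rightarrow> M\<close>, \<open>a \<otimes> b \<mapsto> \<beta> a b\<close>, induced by a bilinear map \<open>\<beta>\<close>\<close>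

definition tlift ::
    "'k ring \<Rightarrow> ('k, 'm, 'x) module_scheme \<Rightarrow> ('a \<Rightarrow> 'b \<Rightarrow> 'm) \<Rightarrow> ('a \<times> 'b \<Rightarrow> 'k) set \<Rightarrow> 'm"
  where "tlift K M \<beta> Y = the_elem (lin_ext K M (\<lambda>(a, b). \<beta> a b) ` Y)"

text \<open>\<open>f \<otimes> g\<close>, where \<open>A\<close> and \<open>B\<close> are the codomains of \<open>f\<close> and \<open>g\<close>\<close>

definition tmap ::
    "'k ring \<Rightarrow> ('k, 'a, 'x) module_scheme \<Rightarrow> ('k, 'b, 'y) module_scheme
      \<Rightarrow> ('c \<Rightarrow> 'a) \<Rightarrow> ('d \<Rightarrow> 'b) \<Rightarrow> ('c \<times> 'd \<Rightarrow> 'k) set \<Rightarrow> ('a \<times> 'b \<Rightarrow> 'k) set"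
  where "tmap K A B f g = tlift K (tensor K A B) (\<lambda>x y. tens K A B (f x) (g y))"

text \<open>\<open>(A \<otimes> B) \<otimes> C \<rightarrow> A \<otimes> (B \<otimes> C)\<close>\<close>

definition tassoc ::
    "'k ring \<Rightarrow> ('k, 'a, 'x) module_scheme \<Rightarrow> ('k, 'b, 'y) module_scheme \<Rightarrow> ('k, 'c, 'z) module_scheme
      \<Rightarrow> (('a \<times> 'b \<Rightarrow> 'k) set \<times> 'c \<Rightarrow> 'k) set \<Rightarrow> ('a \<times> ('b \<times> 'c \<Rightarrow> 'k) set \<Rightarrow> 'k) set"
  where "tassoc K A B C = (let T = tensor K A (tensor K B C) in
    tlift K T (\<lambda>Y c. tlift K T (\<lambda>a b. tens K A (tensor K B C) a (tens K B C b c)) Y))"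


section \<open>Hopf algebras and coactions\<close>

record ('k, 'h) hopf = "('k, 'h) module" +
  comult :: "'h \<Rightarrow> ('h \<times> 'h \<Rightarrow> 'k) set"
  counit :: "'h \<Rightarrow> 'k"
  antipode :: "'h \<Rightarrow> 'h"

locale hopf_algebra = unital_algebra K H for K :: "'k ring" and H :: "('k, 'h) hopf" (structure) +
  assumes comult_hom: "comult H \<in> alg_hom K H (tensor K H H)"
    and counit_hom: "counit H \<in> alg_hom K H (base_alg K)"
    and coassoc: "x \<in> carrier H \<Longrightarrow>
      tassoc K H H H (tmap K (tensor K H H) H (comult H) (\<lambda>y. y) (comult H x))
        = tmap K H (tensor K H H) (\<lambda>y. y) (comult H) (comult H x)"
    and counit_left: "x \<in> carrier H \<Longrightarrow>
      tlift K H (\<lambda>y z. counit H y \<odot>\<^bsub>H\<^esub> z) (comult H x) = x"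
    and counit_right: "x \<in> carrier H \<Longrightarrow>
      tlift K H (\<lambda>y z. counit H z \<odot>\<^bsub>H\<^esub> y) (comult H x) = x"
    and antipode_lin: "antipode H \<in> lin_hom K H H"
    and antipode_left: "x \<in> carrier H \<Longrightarrow>
      tlift K H (\<lambda>y z. antipode H y \<otimes>\<^bsub>H\<^esub> z) (comult H x) = counit H x \<odot>\<^bsub>H\<^esub> \<one>\<^bsub>H\<^esub>"
    and antipode_right: "x \<in> carrier H \<Longrightarrow>
      tlift K H (\<lambda>y z. y \<otimes>\<^bsub>H\<^esub> antipode H z) (comult H x) = counit H x \<odot>\<^bsub>H\<^esub> \<one>\<^bsub>H\<^esub>"

definition hopf_hom :: "'k ring \<Rightarrow> ('k, 'g) hopf \<Rightarrow> ('k, 'h) hopf \<Rightarrow> ('g \<Rightarrow> 'h) set"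
  where "hopf_hom K G H =
    {\<phi> \<in> alg_hom K G H. \<forall>x\<in>carrier G.
      comult H (\<phi> x) = tmap K H H \<phi> \<phi> (comult G x) \<and>
      counit H (\<phi> x) = counit G x \<and>
      antipode H (\<phi> x) = \<phi> (antipode G x)}"

text \<open>\<open>\<rho>\<close> is a unital \<open>H\<close>-coaction on \<open>A\<close>\<close>

definition hopf_coaction ::
    "'k ring \<Rightarrow> ('k, 'a, 'x) module_scheme \<Rightarrow> ('k, 'h) hopf \<Rightarrow> ('a \<Rightarrow> ('a \<times> 'h \<Rightarrow> 'k) set) \<Rightarrow> bool"
  where "hopf_coaction K A H \<rho> \<longleftrightarrow>
    unital_algebra K A \<and> hopf_algebra K H \<and>
    \<rho> \<in> alg_hom K A (tensor K A H) \<and>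
    (\<forall>a\<in>carrier A.
      tassoc K A H H (tmap K (tensor K A H) H \<rho> (\<lambda>y. y) (\<rho> a))
        = tmap K A (tensor K H H) (\<lambda>y. y) (comult H) (\<rho> a) \<and>
      tlift K A (\<lambda>x h. counit H h \<odot>\<^bsub>A\<^esub> x) (\<rho> a) = a)"

text \<open>\<open>\<rho>\<^sup>\<or>(\<lambda> \<otimes> a) = \<lambda>(a\<^sub>1) a\<^sub>0\<close>\<close>

definition rho_vee ::
    "'k ring \<Rightarrow> ('k, 'a, 'x) module_scheme \<Rightarrow> ('a \<Rightarrow> ('a \<times> 'h \<Rightarrow> 'k) set) \<Rightarrow> ('h \<Rightarrow> 'k) \<Rightarrow> 'a \<Rightarrow> 'a"
  where "rho_vee K A \<rho> l a = tlift K A (\<lambda>x h. l h \<odot>\<^bsub>A\<^esub> x) (\<rho> a)"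

definition cosupp ::
    "'k ring \<Rightarrow> ('k, 'a, 'x) module_scheme \<Rightarrow> ('k, 'h) hopf \<Rightarrow> ('a \<Rightarrow> ('a \<times> 'h \<Rightarrow> 'k) set)
      \<Rightarrow> ('a \<Rightarrow> 'a) set"
  where "cosupp K A H \<rho> =
    {\<lambda>a\<in>carrier A. rho_vee K A \<rho> l a | l. l \<in> lin_hom K H (base_alg K)}"

definition coaction_equiv_via ::
    "'k ring \<Rightarrow> ('a \<Rightarrow> 'b)
      \<Rightarrow> ('k, 'a, 'x) module_scheme \<Rightarrow> ('k, 'g) hopf \<Rightarrow> ('a \<Rightarrow> ('a \<times> 'g \<Rightarrow> 'k) set)
      \<Rightarrow> ('k, 'b, 'y) module_scheme \<Rightarrow> ('k, 'h) hopf \<Rightarrow> ('b \<Rightarrow> ('b \<times> 'h \<Rightarrow> 'k) set) \<Rightarrow> bool"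
  where "coaction_equiv_via K \<phi> A\<^sub>1 H\<^sub>1 \<rho>\<^sub>1 A\<^sub>2 H\<^sub>2 \<rho>\<^sub>2 \<longleftrightarrow>
    \<phi> \<in> alg_iso K A\<^sub>1 A\<^sub>2 \<and>
    (\<lambda>f. \<lambda>x\<in>carrier A\<^sub>2. \<phi> (f (inv_into (carrier A\<^sub>1) \<phi> x))) ` cosupp K A\<^sub>1 H\<^sub>1 \<rho>\<^sub>1
      = cosupp K A\<^sub>2 H\<^sub>2 \<rho>\<^sub>2"

text \<open>
  The first argument is the type that carries the competing Hopf algebras \<open>H\<close>; a theorem about
  \<open>V_universal TYPE('h)\<close> with \<open>'h\<close> free ranges over all Hopf algebras. Homomorphisms are
  compared on the carrier only, hence \<^const>\<open>extensional\<close>.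
\<close>

definition V_universal ::
    "'h itself \<Rightarrow> 'k ring \<Rightarrow> ('k, 'a, 'x) module_scheme \<Rightarrow> ('a \<Rightarrow> 'a) set
      \<Rightarrow> ('k, 'g) hopf \<Rightarrow> ('a \<Rightarrow> ('a \<times> 'g \<Rightarrow> 'k) set) \<Rightarrow> bool"
  where "V_universal T K A V H\<^sub>0 \<rho>\<^sub>0 \<longleftrightarrow>
    unital_subalgebra K (End_alg K A) V \<and>
    hopf_coaction K A H\<^sub>0 \<rho>\<^sub>0 \<and> cosupp K A H\<^sub>0 \<rho>\<^sub>0 \<subseteq> V \<and>
    (\<forall>(H :: ('k, 'h) hopf) \<rho>. hopf_coaction K A H \<rho> \<and> cosupp K A H \<rho> \<subseteq> V \<longrightarrow>
      (\<exists>!\<phi>. \<phi> \<in> hopf_hom K H\<^sub>0 H \<and> \<phi> \<in> extensional (carrier H\<^sub>0) \<and>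
        (\<forall>a\<in>carrier A. \<rho> a = tmap K A H (\<lambda>x. x) \<phi> (\<rho>\<^sub>0 a))))"


section \<open>Group algebras and duals\<close>

definition base_hopf :: "'k ring \<Rightarrow> ('k, 'k) hopf"
  where "base_hopf K = module.extend (base_alg K)
    (hopf.fields (\<lambda>x. tens K (base_alg K) (base_alg K) x \<one>\<^bsub>K\<^esub>) (\<lambda>x. x) (\<lambda>x. x))"

definition group_hopf :: "'k ring \<Rightarrow> 'g monoid \<Rightarrow> ('k, 'g \<Rightarrow> 'k) hopf"
  where "group_hopf K G = (let B = monoid_alg K G in module.extend B (hopf.fields
      (lin_ext K (tensor K B B) (\<lambda>g. tens K B B (basis_elt K g) (basis_elt K g)))
      (lin_ext K (base_alg K) (\<lambda>g. \<one>\<^bsub>K\<^esub>))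
      (lin_ext K B (\<lambda>g. basis_elt K (inv\<^bsub>G\<^esub> g)))))"

text \<open>The convolution algebra \<open>H\<^sup>*\<close>\<close>

definition dual_alg :: "'k ring \<Rightarrow> ('k, 'h) hopf \<Rightarrow> ('k, 'h \<Rightarrow> 'k) module"
  where "dual_alg K H =
    \<lparr>carrier = lin_hom K H (base_alg K) \<inter> extensional (carrier H),
     monoid.mult = (\<lambda>f g. \<lambda>x\<in>carrier H. tlift K (base_alg K) (\<lambda>y z. f y \<otimes>\<^bsub>K\<^esub> g z) (comult H x)),
     one = restrict (counit H) (carrier H),
     ring.zero = (\<lambda>x\<in>carrier H. \<zero>\<^bsub>K\<^esub>),
     ring.add = (\<lambda>f g. \<lambda>x\<in>carrier H. f x \<oplus>\<^bsub>K\<^esub> g x),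
     smult = (\<lambda>a f. \<lambda>x\<in>carrier H. a \<otimes>\<^bsub>K\<^esub> f x)\<rparr>"

text \<open>
  The dual of a finite-dimensional Hopf algebra: \<open>\<Delta> f\<close> is the unique element of \<open>H\<^sup>* \<otimes> H\<^sup>*\<close> that,
  as a functional on \<open>H \<otimes> H\<close>, equals \<open>x \<otimes> y \<mapsto> f (xy)\<close>.
\<close>

definition dual_hopf :: "'k ring \<Rightarrow> ('k, 'h) hopf \<Rightarrow> ('k, 'h \<Rightarrow> 'k) hopf"
  where "dual_hopf K H = (let D = dual_alg K H in module.extend D (hopf.fields
      (\<lambda>f. THE T. T \<in> carrier (tensor K D D) \<and>
        (\<forall>x\<in>carrier H. \<forall>y\<in>carrier H.
          tlift K (base_alg K) (\<lambda>g g'. g x \<otimes>\<^bsub>K\<^esub> g' y) T = f (x \<otimes>\<^bsub>H\<^esub> y)))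
      (\<lambda>f. f \<one>\<^bsub>H\<^esub>)
      (\<lambda>f. \<lambda>x\<in>carrier H. f (antipode H x))))"


section \<open>Hopf algebras given by generators and relations\<close>

text \<open>
  Quotient of the free algebra by the ideal \<open>J\<close>. The structure maps are induced by the unital
  algebra homomorphisms (for the antipode: the unital anti-homomorphism) with the values
  \<open>D\<close>, \<open>E\<close>, \<open>S\<close> on the generators; \<open>D\<close> and \<open>S\<close> already take their values in the quotients.
\<close>

definition presented_hopf ::
    "'k ring \<Rightarrow> ('g list \<Rightarrow> 'k) set
      \<Rightarrow> ('g \<Rightarrow> (('g list \<Rightarrow> 'k) set \<times> ('g list \<Rightarrow> 'k) set \<Rightarrow> 'k) set)
      \<Rightarrow> ('g \<Rightarrow> 'k) \<Rightarrow> ('g \<Rightarrow> ('g list \<Rightarrow> 'k) set) \<Rightarrow> ('k, ('g list \<Rightarrow> 'k) set) hopf"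
  where "presented_hopf K J D E S = (let Q = quot_alg (free_alg K) J in
    module.extend Q (hopf.fields
      (\<lambda>Y. the_elem (free_eval K (tensor K Q Q) D ` Y))
      (\<lambda>Y. the_elem (free_eval K (base_alg K) E ` Y))
      (\<lambda>Y. the_elem (free_eval K (opp_alg Q) S ` Y))))"

text \<open>The image of a generator in the quotient of the free algebra by \<open>J\<close>\<close>

definition quot_gen :: "'k ring \<Rightarrow> ('g list \<Rightarrow> 'k) set \<Rightarrow> 'g \<Rightarrow> ('g list \<Rightarrow> 'k) set"
  where "quot_gen K J x = J +>\<^bsub>free_alg K\<^esub> free_gen K x"

subsection \<open>The quotients of \<open>k\<langle>c,d,h\<rangle>\<close>\<close>

datatype cdh = Gc | Gd | Gh

definition ideal_I :: "'k ring \<Rightarrow> (cdh list \<Rightarrow> 'k) set"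
  where "ideal_I K = (let F = free_alg K; c = free_gen K Gc; d = free_gen K Gd; h = free_gen K Gh in
    Idl\<^bsub>F\<^esub> {c \<otimes>\<^bsub>F\<^esub> d \<ominus>\<^bsub>F\<^esub> \<one>\<^bsub>F\<^esub>,
          d \<otimes>\<^bsub>F\<^esub> c \<ominus>\<^bsub>F\<^esub> \<one>\<^bsub>F\<^esub>,
          h \<otimes>\<^bsub>F\<^esub> h \<ominus>\<^bsub>F\<^esub> h,
          h \<otimes>\<^bsub>F\<^esub> c \<oplus>\<^bsub>F\<^esub> c \<otimes>\<^bsub>F\<^esub> h \<oplus>\<^bsub>F\<^esub> c \<otimes>\<^bsub>F\<^esub> c \<ominus>\<^bsub>F\<^esub> c})"

definition ideal_I1 :: "'k ring \<Rightarrow> (cdh list \<Rightarrow> 'k) set"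
  where "ideal_I1 K = (let F = free_alg K; c = free_gen K Gc in Idl\<^bsub>F\<^esub> {c \<otimes>\<^bsub>F\<^esub> c \<ominus>\<^bsub>F\<^esub> \<one>\<^bsub>F\<^esub>})"

definition cdh_hopf :: "'k ring \<Rightarrow> (cdh list \<Rightarrow> 'k) set \<Rightarrow> ('k, (cdh list \<Rightarrow> 'k) set) hopf"
  where "cdh_hopf K J = (let Q = quot_alg (free_alg K) J; T = tensor K Q Q; t = tens K Q Q;
      c = quot_gen K J Gc; d = quot_gen K J Gd; h = quot_gen K J Gh in
    presented_hopf K J
      (\<lambda>x. case x of Gc \<Rightarrow> t c c | Gd \<Rightarrow> t d d | Gh \<Rightarrow> t h c \<oplus>\<^bsub>T\<^esub> t \<one>\<^bsub>Q\<^esub> h)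
      (\<lambda>x. case x of Gc \<Rightarrow> \<one>\<^bsub>K\<^esub> | Gd \<Rightarrow> \<one>\<^bsub>K\<^esub> | Gh \<Rightarrow> \<zero>\<^bsub>K\<^esub>)
      (\<lambda>x. case x of Gc \<Rightarrow> d | Gd \<Rightarrow> c | Gh \<Rightarrow> \<ominus>\<^bsub>Q\<^esub> (h \<otimes>\<^bsub>Q\<^esub> d)))"

definition H_I :: "'k ring \<Rightarrow> ('k, (cdh list \<Rightarrow> 'k) set) hopf"
  where "H_I K = cdh_hopf K (ideal_I K)"

definition ideal_II1 :: "'k ring \<Rightarrow> (cdh list \<Rightarrow> 'k) set"
  where "ideal_II1 K = ideal_I K <+>\<^bsub>free_alg K\<^esub> ideal_I1 K"

definition H_II1 :: "'k ring \<Rightarrow> ('k, (cdh list \<Rightarrow> 'k) set) hopf"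
  where "H_II1 K = cdh_hopf K (ideal_II1 K)"

subsection \<open>The Sweedler algebra\<close>

datatype sweedler_gen = Sc | Sv

definition sweedler_ideal :: "'k ring \<Rightarrow> (sweedler_gen list \<Rightarrow> 'k) set"
  where "sweedler_ideal K = (let F = free_alg K; c = free_gen K Sc; v = free_gen K Sv in
    Idl\<^bsub>F\<^esub> {c \<otimes>\<^bsub>F\<^esub> c \<ominus>\<^bsub>F\<^esub> \<one>\<^bsub>F\<^esub>, v \<otimes>\<^bsub>F\<^esub> v, v \<otimes>\<^bsub>F\<^esub> c \<oplus>\<^bsub>F\<^esub> c \<otimes>\<^bsub>F\<^esub> v})"

definition sweedler_c :: "'k ring \<Rightarrow> (sweedler_gen list \<Rightarrow> 'k) set"
  where "sweedler_c K = quot_gen K (sweedler_ideal K) Sc"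

definition sweedler_v :: "'k ring \<Rightarrow> (sweedler_gen list \<Rightarrow> 'k) set"
  where "sweedler_v K = quot_gen K (sweedler_ideal K) Sv"

definition sweedler_hopf :: "'k ring \<Rightarrow> ('k, (sweedler_gen list \<Rightarrow> 'k) set) hopf"
  where "sweedler_hopf K = (let Q = quot_alg (free_alg K) (sweedler_ideal K);
      T = tensor K Q Q; t = tens K Q Q; c = sweedler_c K; v = sweedler_v K in
    presented_hopf K (sweedler_ideal K)
      (\<lambda>x. case x of Sc \<Rightarrow> t c c | Sv \<Rightarrow> t c v \<oplus>\<^bsub>T\<^esub> t v \<one>\<^bsub>Q\<^esub>)
      (\<lambda>x. case x of Sc \<Rightarrow> \<one>\<^bsub>K\<^esub> | Sv \<Rightarrow> \<zero>\<^bsub>K\<^esub>)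
      (\<lambda>x. case x of Sc \<Rightarrow> c | Sv \<Rightarrow> \<ominus>\<^bsub>Q\<^esub> (c \<otimes>\<^bsub>Q\<^esub> v)))"


section \<open>The algebra \<open>k \<times> k\<close> and its coactions\<close>

text \<open>The characteristic: the additive order of \<open>1\<close>, where \<open>ord\<close> is \<open>0\<close> for infinite order\<close>

definition ring_char :: "'k ring \<Rightarrow> nat"
  where "ring_char K = group.ord (add_monoid K) \<one>\<^bsub>K\<^esub>"

definition kxk :: "'k ring \<Rightarrow> ('k, 'k \<times> 'k) module"
  where "kxk K = ring.extend (RDirProd K K)
    (module.fields (\<lambda>a p. (a \<otimes>\<^bsub>K\<^esub> fst p, a \<otimes>\<^bsub>K\<^esub> snd p)))"

definition elt_e :: "'k ring \<Rightarrow> 'k \<times> 'k"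
  where "elt_e K = (\<one>\<^bsub>K\<^esub>, \<zero>\<^bsub>K\<^esub>)"

definition rho1 :: "'k ring \<Rightarrow> 'k \<times> 'k \<Rightarrow> (('k \<times> 'k) \<times> 'k \<Rightarrow> 'k) set"
  where "rho1 K a = tens K (kxk K) (base_hopf K) a \<one>\<^bsub>K\<^esub>"

text \<open>\<open>C\<^sub>2\<close> is \<open>{0, 1}\<close> with addition modulo \<open>2\<close>, so the group element \<open>1\<close> is \<open>0\<close> and \<open>c\<close> is \<open>1\<close>.\<close>

definition kC2 :: "'k ring \<Rightarrow> ('k, int \<Rightarrow> 'k) hopf"
  where "kC2 K = group_hopf K (integer_mod_group 2)"

definition kC2_dual :: "'k ring \<Rightarrow> ('k, (int \<Rightarrow> 'k) \<Rightarrow> 'k) hopf"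
  where "kC2_dual K = dual_hopf K (kC2 K)"

text \<open>The dual basis: \<open>\<delta>\<^sub>g\<close> is the coefficient at \<open>g\<close>.\<close>

definition delta :: "'k ring \<Rightarrow> int \<Rightarrow> (int \<Rightarrow> 'k) \<Rightarrow> 'k"
  where "delta K g = (\<lambda>f\<in>carrier (kC2 K). f g)"

text \<open>The identification \<open>(1, 0) \<mapsto> \<delta>\<^sub>1\<close>, \<open>(0, 1) \<mapsto> \<delta>\<^sub>c\<close> of \<open>k \<times> k\<close> with the dual of \<open>kC\<^sub>2\<close>\<close>

definition kxk_to_dual :: "'k ring \<Rightarrow> 'k \<times> 'k \<Rightarrow> (int \<Rightarrow> 'k) \<Rightarrow> 'k"
  where "kxk_to_dual K p =
    fst p \<odot>\<^bsub>kC2_dual K\<^esub> delta K 0 \<oplus>\<^bsub>kC2_dual K\<^esub> snd p \<odot>\<^bsub>kC2_dual K\<^esub> delta K 1"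

definition rho2 :: "'k ring \<Rightarrow> 'k \<times> 'k \<Rightarrow> (('k \<times> 'k) \<times> ((int \<Rightarrow> 'k) \<Rightarrow> 'k) \<Rightarrow> 'k) set"
  where "rho2 K a = tmap K (kxk K) (kC2_dual K)
    (inv_into (carrier (kxk K)) (kxk_to_dual K)) (\<lambda>x. x) (comult (kC2_dual K) (kxk_to_dual K a))"

text \<open>The linear map with \<open>1 \<mapsto> 1 \<otimes> 1\<close>, \<open>e \<mapsto> w\<close>; note \<open>(x, y) = y 1 + (x - y) e\<close>.\<close>

definition unital_ext ::
    "'k ring \<Rightarrow> ('k, 'h) hopf \<Rightarrow> (('k \<times> 'k) \<times> 'h \<Rightarrow> 'k) set \<Rightarrow> 'k \<times> 'k
      \<Rightarrow> (('k \<times> 'k) \<times> 'h \<Rightarrow> 'k) set"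
  where "unital_ext K H w p = (let T = tensor K (kxk K) H in
    snd p \<odot>\<^bsub>T\<^esub> \<one>\<^bsub>T\<^esub> \<oplus>\<^bsub>T\<^esub> (fst p \<ominus>\<^bsub>K\<^esub> snd p) \<odot>\<^bsub>T\<^esub> w)"

text \<open>\<open>1 \<otimes> h + e \<otimes> c\<close>\<close>

definition rho3_e :: "'k ring \<Rightarrow> (cdh list \<Rightarrow> 'k) set \<Rightarrow> (('k \<times> 'k) \<times> (cdh list \<Rightarrow> 'k) set \<Rightarrow> 'k) set"
  where "rho3_e K J =
    tens K (kxk K) (cdh_hopf K J) \<one>\<^bsub>kxk K\<^esub> (quot_gen K J Gh)
      \<oplus>\<^bsub>tensor K (kxk K) (cdh_hopf K J)\<^esub>
    tens K (kxk K) (cdh_hopf K J) (elt_e K) (quot_gen K J Gc)"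

definition rho3 :: "'k ring \<Rightarrow> 'k \<times> 'k \<Rightarrow> (('k \<times> 'k) \<times> (cdh list \<Rightarrow> 'k) set \<Rightarrow> 'k) set"
  where "rho3 K = unital_ext K (H_I K) (rho3_e K (ideal_I K))"

definition rho3a :: "'k ring \<Rightarrow> 'k \<times> 'k \<Rightarrow> (('k \<times> 'k) \<times> (cdh list \<Rightarrow> 'k) set \<Rightarrow> 'k) set"
  where "rho3a K = unital_ext K (H_II1 K) (rho3_e K (ideal_II1 K))"

text \<open>\<open>(1, -1) \<otimes> c + (1, 1) \<otimes> cv\<close>\<close>

definition rho3b_f :: "'k ring \<Rightarrow> (('k \<times> 'k) \<times> (sweedler_gen list \<Rightarrow> 'k) set \<Rightarrow> 'k) set"
  where "rho3b_f K =
    tens K (kxk K) (sweedler_hopf K) (\<one>\<^bsub>K\<^esub>, \<ominus>\<^bsub>K\<^esub> \<one>\<^bsub>K\<^esub>) (sweedler_c K)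
      \<oplus>\<^bsub>tensor K (kxk K) (sweedler_hopf K)\<^esub>
    tens K (kxk K) (sweedler_hopf K) (\<one>\<^bsub>K\<^esub>, \<one>\<^bsub>K\<^esub>) (sweedler_c K \<otimes>\<^bsub>sweedler_hopf K\<^esub> sweedler_v K)"

text \<open>
  The linear map with \<open>1 \<mapsto> 1 \<otimes> 1\<close> and \<open>(1, -1) \<mapsto> (1, -1) \<otimes> c + (1, 1) \<otimes> cv\<close>, for
  characteristic different from 2; note \<open>2 (x, y) = (x + y) 1 + (x - y) (1, -1)\<close>.
\<close>

definition rho3b :: "'k ring \<Rightarrow> 'k \<times> 'k \<Rightarrow> (('k \<times> 'k) \<times> (sweedler_gen list \<Rightarrow> 'k) set \<Rightarrow> 'k) set"
  where "rho3b K p = (let T = tensor K (kxk K) (sweedler_hopf K); half = inv\<^bsub>K\<^esub> (\<one>\<^bsub>K\<^esub> \<oplus>\<^bsub>K\<^esub> \<one>\<^bsub>K\<^esub>) in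
    (half \<otimes>\<^bsub>K\<^esub> (fst p \<oplus>\<^bsub>K\<^esub> snd p)) \<odot>\<^bsub>T\<^esub> \<one>\<^bsub>T\<^esub>
      \<oplus>\<^bsub>T\<^esub> (half \<otimes>\<^bsub>K\<^esub> (fst p \<ominus>\<^bsub>K\<^esub> snd p)) \<odot>\<^bsub>T\<^esub> rho3b_f K)"

end

theory Submission
  imports Defs
begin

text \<open>
  The algebra \<open>A = k \<times> k\<close> has the basis \<open>1\<close>, \<open>e\<close> with \<open>e\<close> idempotent. A unital linear map
  \<open>\<rho>: A \<rightarrow> A \<otimes> H\<close> is therefore given by the two elements of \<open>H\<close> in \<open>\<rho> e = 1 \<otimes> h + e \<otimes> c\<close>. Comparing
  coefficients at \<open>1\<close> and \<open>e\<close>, one finds that \<open>\<rho>\<close> is a coaction iff \<open>h\<^sup>2 = h\<close>, \<open>hc + ch + c\<^sup>2 = c\<close>,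
  \<open>\<Delta>h = h \<otimes> c + 1 \<otimes> h\<close>, \<open>\<Delta>c = c \<otimes> c\<close>, \<open>\<epsilon>h = 0\<close> and \<open>\<epsilon>c = 1\<close> (\<open>coaction_pair_coaction\<close>,
  \<open>coaction_has_pair\<close>). So the whole theorem is about such pairs \<open>(h, c)\<close>. The group-like element \<open>c\<close>
  is invertible with inverse \<open>S c\<close>, and then these conditions are the relations and the structure maps of
  \<open>k\<langle>c,d,h\<rangle>/I\<close>, with \<open>d\<close> in the role of \<open>S c\<close>.

  A functional \<open>\<lambda>\<close> acts on \<open>A\<close> by \<open>1 \<mapsto> \<lambda>(1) 1\<close> and \<open>e \<mapsto> \<lambda>(h) 1 + \<lambda>(c) e\<close>. The cosupport thus consists of
  the triangular matrices with the entries \<open>\<lambda>(1)\<close>, \<open>\<lambda>(h)\<close>, \<open>\<lambda>(c)\<close> (\<open>cosupp_coaction\<close>), and what it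
  is depends only on the linear relations between \<open>1\<close>, \<open>h\<close> and \<open>c\<close>, because functionals separate the
  points of a vector space from subspaces (\<open>functional_separation\<close>). If \<open>1\<close>, \<open>h\<close>, \<open>c\<close> are independent, all
  triangular matrices occur. If \<open>h = 0\<close>, then \<open>c\<close> is an invertible idempotent, hence \<open>c = 1\<close>, and the
  cosupport consists of the scalars. In the remaining case \<open>c\<close> is a combination of \<open>1\<close> and \<open>h\<close>, and the
  counit, the relations and the invertibility of \<open>c\<close> leave only \<open>c = 1 - 2h\<close> (\<open>pair_dependent\<close>), which
  describes the symmetric operators. This is the classification (\<open>cosupp_trichotomy\<close>).

  The pairs of the listed coactions are \<open>(0, 1)\<close> in \<open>k\<close>, \<open>(\<delta>\<^sub>c, \<delta>\<^sub>1 - \<delta>\<^sub>c)\<close> in \<open>(kC\<^sub>2)\<^sup>*\<close>, the generators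
  of \<open>k\<langle>c,d,h\<rangle>/I\<close> and of its quotient, and \<open>(1/2 (1 - c + cv), c)\<close> in the Sweedler algebra. The algebras given
  by generators and relations are Hopf algebras because the elements at which the Hopf identities hold
  form a subalgebra (locale \<open>prehopf\<close>), so that only the generators need to be inspected. That
  \<open>1\<close>, \<open>h\<close>, \<open>c\<close> are independent in them is seen in a representation on \<open>A\<close> itself
  (\<open>cosupp_triangular_of_hom\<close>).

  For the universality, the equation \<open>\<rho> = (id \<otimes> \<phi>) \<rho>\<^sub>0\<close> says that \<open>\<phi>\<close> maps one pair to the other
  (\<open>coaction_transport_iff\<close>). An algebra homomorphism with this property respects \<open>\<Delta>\<close> and \<open>\<epsilon>\<close> at \<open>h\<close> and
  \<open>c\<close>, hence everywhere when homomorphisms are determined by these values, and it then respects the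
  antipode (\<open>bialgebra_hom_antipode\<close>). It remains to find the algebra homomorphism. For
  \<open>k\<langle>c,d,h\<rangle>/I\<close> it exists since every pair satisfies the relations; for the two smaller cosupports the
  inclusion of the cosupport forces \<open>(h, c) = (0, 1)\<close> or \<open>c = 1 - 2h\<close>, and there is a homomorphism
  because \<open>k\<close> is initial and \<open>(kC\<^sub>2)\<^sup>*\<close> is freely generated by an idempotent.
\<close>


section \<open>Linear maps and algebra homomorphisms\<close>

lemma unital_algebra_module: "unital_algebra K A \<Longrightarrow> module K A"
  by (simp add: unital_algebra_def)

lemma unital_algebra_ring: "unital_algebra K A \<Longrightarrow> ring A"
  by (simp add: unital_algebra_def)

lemma unital_algebra_cring: "unital_algebra K A \<Longrightarrow> cring K"
  by (simp add: unital_algebra_def module_def)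

lemma lin_homI:
  assumes "\<And>x. x \<in> carrier M \<Longrightarrow> f x \<in> carrier N"
    and "\<And>x y. \<lbrakk>x \<in> carrier M; y \<in> carrier M\<rbrakk> \<Longrightarrow> f (x \<oplus>\<^bsub>M\<^esub> y) = f x \<oplus>\<^bsub>N\<^esub> f y"
    and "\<And>a x. \<lbrakk>a \<in> carrier K; x \<in> carrier M\<rbrakk> \<Longrightarrow> f (a \<odot>\<^bsub>M\<^esub> x) = a \<odot>\<^bsub>N\<^esub> f x"
  shows "f \<in> lin_hom K M N"
  using assms by (auto simp: lin_hom_def)

lemma lin_hom_closed: "\<lbrakk>f \<in> lin_hom K M N; x \<in> carrier M\<rbrakk> \<Longrightarrow> f x \<in> carrier N"
  and lin_hom_add: "\<lbrakk>f \<in> lin_hom K M N; x \<in> carrier M; y \<in> carrier M\<rbrakk>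
    \<Longrightarrow> f (x \<oplus>\<^bsub>M\<^esub> y) = f x \<oplus>\<^bsub>N\<^esub> f y"
  and lin_hom_smult: "\<lbrakk>f \<in> lin_hom K M N; a \<in> carrier K; x \<in> carrier M\<rbrakk>
    \<Longrightarrow> f (a \<odot>\<^bsub>M\<^esub> x) = a \<odot>\<^bsub>N\<^esub> f x"
  by (auto simp: lin_hom_def)

lemma lin_hom_zero:
  assumes "module K M" "module K N" "f \<in> lin_hom K M N"
  shows "f \<zero>\<^bsub>M\<^esub> = \<zero>\<^bsub>N\<^esub>"
proof -
  interpret M: module K M by fact
  interpret N: module K N by fact
  have "f (\<zero>\<^bsub>K\<^esub> \<odot>\<^bsub>M\<^esub> \<zero>\<^bsub>M\<^esub>) = \<zero>\<^bsub>K\<^esub> \<odot>\<^bsub>N\<^esub> f \<zero>\<^bsub>M\<^esub>"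
    by (rule lin_hom_smult[OF assms(3)]) auto
  then show ?thesis using lin_hom_closed[OF assms(3)] by simp
qed

lemma lin_hom_neg:
  assumes "module K M" "module K N" "f \<in> lin_hom K M N" "x \<in> carrier M"
  shows "f (\<ominus>\<^bsub>M\<^esub> x) = \<ominus>\<^bsub>N\<^esub> f x"
proof -
  interpret M: module K M by fact
  interpret N: module K N by fact
  have "f ((\<ominus>\<^bsub>K\<^esub> \<one>\<^bsub>K\<^esub>) \<odot>\<^bsub>M\<^esub> x) = (\<ominus>\<^bsub>K\<^esub> \<one>\<^bsub>K\<^esub>) \<odot>\<^bsub>N\<^esub> f x"
    by (rule lin_hom_smult[OF assms(3)]) (use assms(4) in auto)
  then show ?thesis using lin_hom_closed[OF assms(3,4)] assms(4)
    by (simp add: M.smult_l_minus N.smult_l_minus)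
qed

lemma lin_hom_minus:
  assumes "module K M" "module K N" "f \<in> lin_hom K M N" "x \<in> carrier M" "y \<in> carrier M"
  shows "f (x \<ominus>\<^bsub>M\<^esub> y) = f x \<ominus>\<^bsub>N\<^esub> f y"
proof -
  interpret M: module K M by fact
  show ?thesis
    using assms by (simp add: a_minus_def lin_hom_add lin_hom_neg)
qed

lemma lin_hom_id: "(\<lambda>x. x) \<in> lin_hom K M M"
  by (rule lin_homI) auto

lemma lin_hom_comp:
  "\<lbrakk>g \<in> lin_hom K M N; f \<in> lin_hom K N L\<rbrakk> \<Longrightarrow> (\<lambda>x. f (g x)) \<in> lin_hom K M L"
  by (auto simp: lin_hom_def Pi_iff)

lemma lin_hom_const_zero:
  assumes "module K N" shows "(\<lambda>x. \<zero>\<^bsub>N\<^esub>) \<in> lin_hom K M N"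
proof -
  interpret N: module K N by fact
  show ?thesis by (rule lin_homI) auto
qed

lemma lin_hom_plus:
  assumes "module K N" "f \<in> lin_hom K M N" "g \<in> lin_hom K M N"
  shows "(\<lambda>x. f x \<oplus>\<^bsub>N\<^esub> g x) \<in> lin_hom K M N"
proof -
  interpret N: module K N by fact
  show ?thesis
    using assms(2,3)
    by (intro lin_homI)
       (auto simp: lin_hom_closed lin_hom_add lin_hom_smult N.M.a_ac N.smult_r_distr)
qed

lemma lin_hom_scale:
  assumes "module K N" "f \<in> lin_hom K M N" "a \<in> carrier K"
  shows "(\<lambda>x. a \<odot>\<^bsub>N\<^esub> f x) \<in> lin_hom K M N"
proof -
  interpret N: module K N by fact
  show ?thesis
    using assms(2,3)
    by (intro lin_homI)
       (auto simp: lin_hom_closed lin_hom_add lin_hom_smult N.smult_r_distr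
          N.smult_assoc1[symmetric] N.R.m_comm)
qed

lemma lin_hom_mult_left:
  assumes "unital_algebra K N" "f \<in> lin_hom K M N" "z \<in> carrier N"
  shows "(\<lambda>x. z \<otimes>\<^bsub>N\<^esub> f x) \<in> lin_hom K M N"
proof -
  interpret N: unital_algebra K N by fact
  show ?thesis
    using assms(2,3)
    by (intro lin_homI)
       (auto simp: lin_hom_closed lin_hom_add lin_hom_smult N.r_distr N.smult_mult_right)
qed

lemma lin_hom_mult_right:
  assumes "unital_algebra K N" "f \<in> lin_hom K M N" "z \<in> carrier N"
  shows "(\<lambda>x. f x \<otimes>\<^bsub>N\<^esub> z) \<in> lin_hom K M N"
proof -
  interpret N: unital_algebra K N by fact
  show ?thesis
    using assms(2,3)
    by (intro lin_homI)
       (auto simp: lin_hom_closed lin_hom_add lin_hom_smult N.l_distr N.smult_mult_left)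
qed

lemma alg_homI:
  assumes "f \<in> lin_hom K A B" "f \<one>\<^bsub>A\<^esub> = \<one>\<^bsub>B\<^esub>"
    and "\<And>x y. \<lbrakk>x \<in> carrier A; y \<in> carrier A\<rbrakk> \<Longrightarrow> f (x \<otimes>\<^bsub>A\<^esub> y) = f x \<otimes>\<^bsub>B\<^esub> f y"
  shows "f \<in> alg_hom K A B"
  using assms by (auto simp: alg_hom_def ring_hom_def lin_hom_def)

lemma alg_hom_lin: "f \<in> alg_hom K A B \<Longrightarrow> f \<in> lin_hom K A B"
  and alg_hom_one: "f \<in> alg_hom K A B \<Longrightarrow> f \<one>\<^bsub>A\<^esub> = \<one>\<^bsub>B\<^esub>"
  and alg_hom_mult: "\<lbrakk>f \<in> alg_hom K A B; x \<in> carrier A; y \<in> carrier A\<rbrakk>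
    \<Longrightarrow> f (x \<otimes>\<^bsub>A\<^esub> y) = f x \<otimes>\<^bsub>B\<^esub> f y"
  by (auto simp: alg_hom_def ring_hom_def)

lemma alg_hom_id: "(\<lambda>x. x) \<in> alg_hom K A A"
  by (rule alg_homI) (auto intro: lin_hom_id)

lemma alg_hom_comp:
  assumes "g \<in> alg_hom K A B" "f \<in> alg_hom K B C"
  shows "(\<lambda>x. f (g x)) \<in> alg_hom K A C"
  using assms
  by (intro alg_homI lin_hom_comp[of g K A B f C])
     (auto simp: alg_hom_lin alg_hom_one alg_hom_mult lin_hom_closed[OF alg_hom_lin])

lemma unital_algebraI:
  fixes A (structure)
  assumes "cring K"
    and add_closed: "\<And>x y. \<lbrakk>x \<in> carrier A; y \<in> carrier A\<rbrakk> \<Longrightarrow> x \<oplus> y \<in> carrier A"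
    and zero_closed: "\<zero> \<in> carrier A"
    and add_assoc: "\<And>x y z. \<lbrakk>x \<in> carrier A; y \<in> carrier A; z \<in> carrier A\<rbrakk>
      \<Longrightarrow> (x \<oplus> y) \<oplus> z = x \<oplus> (y \<oplus> z)"
    and add_comm: "\<And>x y. \<lbrakk>x \<in> carrier A; y \<in> carrier A\<rbrakk> \<Longrightarrow> x \<oplus> y = y \<oplus> x"
    and add_zero: "\<And>x. x \<in> carrier A \<Longrightarrow> \<zero> \<oplus> x = x"
    and add_inv: "\<And>x. x \<in> carrier A \<Longrightarrow> \<exists>y\<in>carrier A. y \<oplus> x = \<zero>"
    and mult_closed: "\<And>x y. \<lbrakk>x \<in> carrier A; y \<in> carrier A\<rbrakk> \<Longrightarrow> x \<otimes> y \<in> carrier A"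
    and one_closed: "\<one> \<in> carrier A"
    and mult_assoc: "\<And>x y z. \<lbrakk>x \<in> carrier A; y \<in> carrier A; z \<in> carrier A\<rbrakk>
      \<Longrightarrow> (x \<otimes> y) \<otimes> z = x \<otimes> (y \<otimes> z)"
    and one_left: "\<And>x. x \<in> carrier A \<Longrightarrow> \<one> \<otimes> x = x"
    and one_right: "\<And>x. x \<in> carrier A \<Longrightarrow> x \<otimes> \<one> = x"
    and distrib_right: "\<And>x y z. \<lbrakk>x \<in> carrier A; y \<in> carrier A; z \<in> carrier A\<rbrakk>
      \<Longrightarrow> (x \<oplus> y) \<otimes> z = x \<otimes> z \<oplus> y \<otimes> z"
    and distrib_left: "\<And>x y z. \<lbrakk>x \<in> carrier A; y \<in> carrier A; z \<in> carrier A\<rbrakk>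
      \<Longrightarrow> z \<otimes> (x \<oplus> y) = z \<otimes> x \<oplus> z \<otimes> y"
    and smult_closed: "\<And>a x. \<lbrakk>a \<in> carrier K; x \<in> carrier A\<rbrakk> \<Longrightarrow> a \<odot> x \<in> carrier A"
    and smult_l_distr: "\<And>a b x. \<lbrakk>a \<in> carrier K; b \<in> carrier K; x \<in> carrier A\<rbrakk>
      \<Longrightarrow> (a \<oplus>\<^bsub>K\<^esub> b) \<odot> x = a \<odot> x \<oplus> b \<odot> x"
    and smult_r_distr: "\<And>a x y. \<lbrakk>a \<in> carrier K; x \<in> carrier A; y \<in> carrier A\<rbrakk>
      \<Longrightarrow> a \<odot> (x \<oplus> y) = a \<odot> x \<oplus> a \<odot> y"
    and smult_assoc: "\<And>a b x. \<lbrakk>a \<in> carrier K; b \<in> carrier K; x \<in> carrier A\<rbrakk>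
      \<Longrightarrow> (a \<otimes>\<^bsub>K\<^esub> b) \<odot> x = a \<odot> (b \<odot> x)"
    and smult_one: "\<And>x. x \<in> carrier A \<Longrightarrow> \<one>\<^bsub>K\<^esub> \<odot> x = x"
    and smult_mult_left: "\<And>a x y. \<lbrakk>a \<in> carrier K; x \<in> carrier A; y \<in> carrier A\<rbrakk>
      \<Longrightarrow> (a \<odot> x) \<otimes> y = a \<odot> (x \<otimes> y)"
    and smult_mult_right: "\<And>a x y. \<lbrakk>a \<in> carrier K; x \<in> carrier A; y \<in> carrier A\<rbrakk>
      \<Longrightarrow> x \<otimes> (a \<odot> y) = a \<odot> (x \<otimes> y)"
  shows "unital_algebra K A"
proof -
  have grp: "abelian_group A"
    by (rule abelian_groupI) (fact add_closed zero_closed add_assoc add_comm add_zero add_inv)+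
  have mon: "monoid A"
    by (rule monoidI) (fact mult_closed one_closed mult_assoc one_left one_right)+
  have rng: "ring A"
    by (rule ringI[OF grp mon]) (fact distrib_right distrib_left)+
  have mod: "module K A"
    by (intro moduleI grp assms(1))
       (fact smult_closed smult_l_distr smult_r_distr smult_assoc smult_one)+
  show ?thesis
    by (intro unital_algebra.intro unital_algebra_axioms.intro mod rng)
       (fact smult_mult_left smult_mult_right)+
qed


section \<open>Monoid algebras\<close>

context
  fixes K :: "'k ring" (structure) and M :: "('m, 'x) monoid_scheme"
  assumes K: "cring K" and M: "monoid M"
begin

interpretation K: cring K by (rule K)
interpretation M: monoid M by (rule M)

lemma monoid_alg_carrier_iff:
  "f \<in> carrier (monoid_alg K M) \<longleftrightarrow>
    (\<forall>x. f x \<in> carrier K) \<and> finite (supp K f) \<and> supp K f \<subseteq> carrier M"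
  by (auto simp: monoid_alg_def)

lemma basis_elt_carrier:
  "m \<in> carrier M \<Longrightarrow> basis_elt K m \<in> carrier (monoid_alg K M)"
  unfolding monoid_alg_carrier_iff
  by (auto simp: basis_elt_def supp_def intro!: finite_subset[of _ "{m}"] split: if_splits)

text \<open>
  The summation may run over any finite sets that contain the supports; this brings products of
  different functions to a common index set.
\<close>

lemma monoid_alg_mult_eq:
  assumes f: "f \<in> carrier (monoid_alg K M)" and g: "g \<in> carrier (monoid_alg K M)"
    and S: "finite S" "supp K f \<subseteq> S" and T: "finite T" "supp K g \<subseteq> T"
  shows "(f \<otimes>\<^bsub>monoid_alg K M\<^esub> g) x =
    (\<Oplus>p\<in>{p \<in> S \<times> T. fst p \<otimes>\<^bsub>M\<^esub> snd p = x}. f (fst p) \<otimes> g (snd p))"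
proof -
  have fg: "f y \<in> carrier K" "g y \<in> carrier K" for y
    using f g by (auto simp: monoid_alg_carrier_iff)
  have "(\<Oplus>p\<in>{p \<in> supp K f \<times> supp K g. fst p \<otimes>\<^bsub>M\<^esub> snd p = x}. f (fst p) \<otimes> g (snd p)) =
    (\<Oplus>p\<in>{p \<in> S \<times> T. fst p \<otimes>\<^bsub>M\<^esub> snd p = x}. f (fst p) \<otimes> g (snd p))"
  proof (rule K.add.finprod_mono_neutral_cong_left)
    show "finite {p \<in> S \<times> T. fst p \<otimes>\<^bsub>M\<^esub> snd p = x}"
      using S T by (auto intro!: finite_subset[of _ "S \<times> T"])
  next
    fix p
    assume "p \<in> {p \<in> S \<times> T. fst p \<otimes>\<^bsub>M\<^esub> snd p = x} - {p \<in> supp K f \<times> supp K g. fst p \<otimes>\<^bsub>M\<^esub> snd p = x}"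
    then have "f (fst p) = \<zero> \<or> g (snd p) = \<zero>"
      by (auto simp: supp_def)
    then show "f (fst p) \<otimes> g (snd p) = \<zero>"
      using fg by auto
  qed (use S T fg in auto)
  then show ?thesis by (simp add: monoid_alg_def)
qed

lemma monoid_alg_mult_closed:
  assumes f: "f \<in> carrier (monoid_alg K M)" and g: "g \<in> carrier (monoid_alg K M)"
  shows "f \<otimes>\<^bsub>monoid_alg K M\<^esub> g \<in> carrier (monoid_alg K M)"
proof -
  let ?fg = "f \<otimes>\<^bsub>monoid_alg K M\<^esub> g" and ?S = "supp K f" and ?T = "supp K g"
  have fin: "finite ?S" "finite ?T" "?S \<subseteq> carrier M" "?T \<subseteq> carrier M"
    and fg: "\<And>y. f y \<in> carrier K" "\<And>y. g y \<in> carrier K"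
    using f g by (auto simp: monoid_alg_carrier_iff)
  have eq: "?fg x = (\<Oplus>p\<in>{p \<in> ?S \<times> ?T. fst p \<otimes>\<^bsub>M\<^esub> snd p = x}. f (fst p) \<otimes> g (snd p))" for x
    using f g fin by (intro monoid_alg_mult_eq) auto
  have "supp K ?fg \<subseteq> (\<lambda>p. fst p \<otimes>\<^bsub>M\<^esub> snd p) ` (?S \<times> ?T)"
  proof
    fix x assume "x \<in> supp K ?fg"
    then have nz: "?fg x \<noteq> \<zero>" by (simp add: supp_def)
    have "{p \<in> ?S \<times> ?T. fst p \<otimes>\<^bsub>M\<^esub> snd p = x} \<noteq> {}"
    proof
      assume "{p \<in> ?S \<times> ?T. fst p \<otimes>\<^bsub>M\<^esub> snd p = x} = {}"
      then have "?fg x = \<zero>" by (simp only: eq K.finsum_empty)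
      with nz show False by simp
    qed
    then show "x \<in> (\<lambda>p. fst p \<otimes>\<^bsub>M\<^esub> snd p) ` (?S \<times> ?T)" by blast
  qed
  moreover have "(\<lambda>p. fst p \<otimes>\<^bsub>M\<^esub> snd p) ` (?S \<times> ?T) \<subseteq> carrier M" using fin by (auto intro!: M.m_closed)
  moreover have "?fg x \<in> carrier K" for x
    unfolding eq using fg by (intro K.finsum_closed) auto
  moreover have "finite (supp K ?fg)"
    by (rule finite_subset[OF calculation(1)]) (use fin in auto)
  ultimately show ?thesis
    unfolding monoid_alg_carrier_iff by blast
qed

lemma monoid_alg_module: "module K (monoid_alg K M)"
proof (rule moduleI)
  have supp_add: "supp K (f \<oplus>\<^bsub>monoid_alg K M\<^esub> g) \<subseteq> supp K f \<union> supp K g"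
    if "f \<in> carrier (monoid_alg K M)" for f g
    using that by (auto simp: supp_def monoid_alg_def)
  have supp_neg: "supp K (\<lambda>x. \<ominus> f x) \<subseteq> supp K f" for f
    by (auto simp: supp_def)
  show "abelian_group (monoid_alg K M)"
  proof (rule abelian_groupI)
    fix f g assume fg: "f \<in> carrier (monoid_alg K M)" "g \<in> carrier (monoid_alg K M)"
    then show "f \<oplus>\<^bsub>monoid_alg K M\<^esub> g \<in> carrier (monoid_alg K M)"
      using supp_add[of f g] unfolding monoid_alg_carrier_iff
      by (auto simp: monoid_alg_def intro: finite_subset)
    show "f \<oplus>\<^bsub>monoid_alg K M\<^esub> g = g \<oplus>\<^bsub>monoid_alg K M\<^esub> f"
      using fg unfolding monoid_alg_carrier_iff by (auto simp: monoid_alg_def K.a_comm)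
  next
    fix f assume f: "f \<in> carrier (monoid_alg K M)"
    then have "(\<lambda>x. \<ominus> f x) \<in> carrier (monoid_alg K M)"
      using supp_neg[of f] finite_subset[OF supp_neg] unfolding monoid_alg_carrier_iff by auto
    moreover have "(\<lambda>x. \<ominus> f x) \<oplus>\<^bsub>monoid_alg K M\<^esub> f = \<zero>\<^bsub>monoid_alg K M\<^esub>"
      using f unfolding monoid_alg_carrier_iff by (simp add: monoid_alg_def K.l_neg)
    ultimately show "\<exists>g\<in>carrier (monoid_alg K M). g \<oplus>\<^bsub>monoid_alg K M\<^esub> f = \<zero>\<^bsub>monoid_alg K M\<^esub>"
      by blast
  next
    show "\<zero>\<^bsub>monoid_alg K M\<^esub> \<in> carrier (monoid_alg K M)"
      unfolding monoid_alg_carrier_iff by (simp add: monoid_alg_def supp_def)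
  qed (auto simp: monoid_alg_carrier_iff, auto simp: monoid_alg_def K.a_assoc)
next
  fix a f assume af: "a \<in> carrier K" "f \<in> carrier (monoid_alg K M)"
  then have "supp K (a \<odot>\<^bsub>monoid_alg K M\<^esub> f) \<subseteq> supp K f"
    by (auto simp: supp_def monoid_alg_def)
  with af show "a \<odot>\<^bsub>monoid_alg K M\<^esub> f \<in> carrier (monoid_alg K M)"
    unfolding monoid_alg_carrier_iff by (auto simp: monoid_alg_def intro: finite_subset)
qed (auto simp: K monoid_alg_carrier_iff, auto simp: monoid_alg_def K.l_distr K.r_distr K.m_assoc)

interpretation F: module K "monoid_alg K M" by (rule monoid_alg_module)

lemma monoid_alg_add_apply: "(f \<oplus>\<^bsub>monoid_alg K M\<^esub> g) x = f x \<oplus> g x"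
  and monoid_alg_smult_apply: "(a \<odot>\<^bsub>monoid_alg K M\<^esub> f) x = a \<otimes> f x"
  and monoid_alg_one: "\<one>\<^bsub>monoid_alg K M\<^esub> = basis_elt K \<one>\<^bsub>M\<^esub>"
  by (auto simp: monoid_alg_def basis_elt_def)

text \<open>
  Over an index set that contains all supports involved, additivity and homogeneity hold term by
  term.
\<close>

lemma monoid_alg_mult_lin:
  assumes g: "g \<in> carrier (monoid_alg K M)"
  shows "(\<lambda>f. f \<otimes>\<^bsub>monoid_alg K M\<^esub> g) \<in> lin_hom K (monoid_alg K M) (monoid_alg K M)"
    and "(\<lambda>f. g \<otimes>\<^bsub>monoid_alg K M\<^esub> f) \<in> lin_hom K (monoid_alg K M) (monoid_alg K M)"
proof -
  have c: "finite (supp K f)" "f y \<in> carrier K" if "f \<in> carrier (monoid_alg K M)" for f y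
    using that by (auto simp: monoid_alg_carrier_iff)
  let ?I = "\<lambda>S T x. {p \<in> S \<times> T. fst p \<otimes>\<^bsub>M\<^esub> snd p = x}" and ?T = "supp K g"
  have fin: "finite (?I S T x)" if "finite S" "finite T" for S T x
    using that by (auto intro!: finite_subset[of _ "S \<times> T"])
  show "(\<lambda>f. f \<otimes>\<^bsub>monoid_alg K M\<^esub> g) \<in> lin_hom K (monoid_alg K M) (monoid_alg K M)"
  proof (rule lin_homI)
    fix f f' assume f: "f \<in> carrier (monoid_alg K M)" and f': "f' \<in> carrier (monoid_alg K M)"
    let ?S = "supp K f \<union> supp K f'" and ?ff = "f \<oplus>\<^bsub>monoid_alg K M\<^esub> f'"
    have sub: "supp K ?ff \<subseteq> ?S" and ff: "?ff \<in> carrier (monoid_alg K M)"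
      using f f' by (auto simp: supp_def monoid_alg_add_apply)
    show "?ff \<otimes>\<^bsub>monoid_alg K M\<^esub> g = f \<otimes>\<^bsub>monoid_alg K M\<^esub> g \<oplus>\<^bsub>monoid_alg K M\<^esub> f' \<otimes>\<^bsub>monoid_alg K M\<^esub> g"
    proof
      fix x
      let ?J = "?I ?S ?T x"
      have "(?ff \<otimes>\<^bsub>monoid_alg K M\<^esub> g) x = (\<Oplus>p\<in>?J. ?ff (fst p) \<otimes> g (snd p))"
        using f f' g ff sub by (intro monoid_alg_mult_eq) (auto simp: c)
      also have "\<dots> = (\<Oplus>p\<in>?J. f (fst p) \<otimes> g (snd p) \<oplus> f' (fst p) \<otimes> g (snd p))"
        using f f' g by (intro K.finsum_cong') (auto simp: monoid_alg_add_apply c K.l_distr)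
      also have "\<dots> = (\<Oplus>p\<in>?J. f (fst p) \<otimes> g (snd p)) \<oplus> (\<Oplus>p\<in>?J. f' (fst p) \<otimes> g (snd p))"
        using f f' g by (intro K.finsum_addf) (auto simp: c)
      also have "(\<Oplus>p\<in>?J. f (fst p) \<otimes> g (snd p)) = (f \<otimes>\<^bsub>monoid_alg K M\<^esub> g) x"
        using f f' g by (intro monoid_alg_mult_eq[symmetric]) (auto simp: c)
      also have "(\<Oplus>p\<in>?J. f' (fst p) \<otimes> g (snd p)) = (f' \<otimes>\<^bsub>monoid_alg K M\<^esub> g) x"
        using f f' g by (intro monoid_alg_mult_eq[symmetric]) (auto simp: c)
      finally have sum: "(?ff \<otimes>\<^bsub>monoid_alg K M\<^esub> g) x = (f \<otimes>\<^bsub>monoid_alg K M\<^esub> g) x \<oplus> (f' \<otimes>\<^bsub>monoid_alg K M\<^esub> g) x" .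
      show "(?ff \<otimes>\<^bsub>monoid_alg K M\<^esub> g) x = (f \<otimes>\<^bsub>monoid_alg K M\<^esub> g \<oplus>\<^bsub>monoid_alg K M\<^esub> f' \<otimes>\<^bsub>monoid_alg K M\<^esub> g) x"
        by (subst monoid_alg_add_apply) (rule sum)
    qed
  next
    fix a f assume a: "a \<in> carrier K" and f: "f \<in> carrier (monoid_alg K M)"
    let ?af = "a \<odot>\<^bsub>monoid_alg K M\<^esub> f"
    have sub: "supp K ?af \<subseteq> supp K f" and af: "?af \<in> carrier (monoid_alg K M)"
      using a f by (auto simp: supp_def monoid_alg_smult_apply)
    show "?af \<otimes>\<^bsub>monoid_alg K M\<^esub> g = a \<odot>\<^bsub>monoid_alg K M\<^esub> (f \<otimes>\<^bsub>monoid_alg K M\<^esub> g)"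
    proof
      fix x
      let ?J = "?I (supp K f) ?T x"
      have "(?af \<otimes>\<^bsub>monoid_alg K M\<^esub> g) x = (\<Oplus>p\<in>?J. ?af (fst p) \<otimes> g (snd p))"
        using f g af sub by (intro monoid_alg_mult_eq) (auto simp: c)
      also have "\<dots> = (\<Oplus>p\<in>?J. a \<otimes> (f (fst p) \<otimes> g (snd p)))"
        using f g a by (intro K.finsum_cong') (auto simp: monoid_alg_smult_apply c K.m_assoc)
      also have "\<dots> = a \<otimes> (\<Oplus>p\<in>?J. f (fst p) \<otimes> g (snd p))"
        using f g a by (intro K.finsum_rdistr[symmetric] fin) (auto simp: c)
      also have "(\<Oplus>p\<in>?J. f (fst p) \<otimes> g (snd p)) = (f \<otimes>\<^bsub>monoid_alg K M\<^esub> g) x"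
        using f g by (intro monoid_alg_mult_eq[symmetric]) (auto simp: c)
      finally have scaled: "(?af \<otimes>\<^bsub>monoid_alg K M\<^esub> g) x = a \<otimes> (f \<otimes>\<^bsub>monoid_alg K M\<^esub> g) x" .
      show "(?af \<otimes>\<^bsub>monoid_alg K M\<^esub> g) x = (a \<odot>\<^bsub>monoid_alg K M\<^esub> (f \<otimes>\<^bsub>monoid_alg K M\<^esub> g)) x"
        by (subst monoid_alg_smult_apply) (rule scaled)
    qed
  qed (use g in \<open>auto intro: monoid_alg_mult_closed\<close>)
  show "(\<lambda>f. g \<otimes>\<^bsub>monoid_alg K M\<^esub> f) \<in> lin_hom K (monoid_alg K M) (monoid_alg K M)"
  proof (rule lin_homI)
    fix f f' assume f: "f \<in> carrier (monoid_alg K M)" and f': "f' \<in> carrier (monoid_alg K M)"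
    let ?S = "supp K f \<union> supp K f'" and ?ff = "f \<oplus>\<^bsub>monoid_alg K M\<^esub> f'"
    have sub: "supp K ?ff \<subseteq> ?S" and ff: "?ff \<in> carrier (monoid_alg K M)"
      using f f' by (auto simp: supp_def monoid_alg_add_apply)
    show "g \<otimes>\<^bsub>monoid_alg K M\<^esub> ?ff = g \<otimes>\<^bsub>monoid_alg K M\<^esub> f \<oplus>\<^bsub>monoid_alg K M\<^esub> g \<otimes>\<^bsub>monoid_alg K M\<^esub> f'"
    proof
      fix x
      let ?J = "?I ?T ?S x"
      have "(g \<otimes>\<^bsub>monoid_alg K M\<^esub> ?ff) x = (\<Oplus>p\<in>?J. g (fst p) \<otimes> ?ff (snd p))"
        using f f' g ff sub by (intro monoid_alg_mult_eq) (auto simp: c)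
      also have "\<dots> = (\<Oplus>p\<in>?J. g (fst p) \<otimes> f (snd p) \<oplus> g (fst p) \<otimes> f' (snd p))"
        using f f' g by (intro K.finsum_cong') (auto simp: monoid_alg_add_apply c K.r_distr)
      also have "\<dots> = (\<Oplus>p\<in>?J. g (fst p) \<otimes> f (snd p)) \<oplus> (\<Oplus>p\<in>?J. g (fst p) \<otimes> f' (snd p))"
        using f f' g by (intro K.finsum_addf) (auto simp: c)
      also have "(\<Oplus>p\<in>?J. g (fst p) \<otimes> f (snd p)) = (g \<otimes>\<^bsub>monoid_alg K M\<^esub> f) x"
        using f f' g by (intro monoid_alg_mult_eq[symmetric]) (auto simp: c)
      also have "(\<Oplus>p\<in>?J. g (fst p) \<otimes> f' (snd p)) = (g \<otimes>\<^bsub>monoid_alg K M\<^esub> f') x"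
        using f f' g by (intro monoid_alg_mult_eq[symmetric]) (auto simp: c)
      finally have sum: "(g \<otimes>\<^bsub>monoid_alg K M\<^esub> ?ff) x = (g \<otimes>\<^bsub>monoid_alg K M\<^esub> f) x \<oplus> (g \<otimes>\<^bsub>monoid_alg K M\<^esub> f') x" .
      show "(g \<otimes>\<^bsub>monoid_alg K M\<^esub> ?ff) x = (g \<otimes>\<^bsub>monoid_alg K M\<^esub> f \<oplus>\<^bsub>monoid_alg K M\<^esub> g \<otimes>\<^bsub>monoid_alg K M\<^esub> f') x"
        by (subst monoid_alg_add_apply) (rule sum)
    qed
  next
    fix a f assume a: "a \<in> carrier K" and f: "f \<in> carrier (monoid_alg K M)"
    let ?af = "a \<odot>\<^bsub>monoid_alg K M\<^esub> f"
    have sub: "supp K ?af \<subseteq> supp K f" and af: "?af \<in> carrier (monoid_alg K M)"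
      using a f by (auto simp: supp_def monoid_alg_smult_apply)
    show "g \<otimes>\<^bsub>monoid_alg K M\<^esub> ?af = a \<odot>\<^bsub>monoid_alg K M\<^esub> (g \<otimes>\<^bsub>monoid_alg K M\<^esub> f)"
    proof
      fix x
      let ?J = "?I ?T (supp K f) x"
      have "(g \<otimes>\<^bsub>monoid_alg K M\<^esub> ?af) x = (\<Oplus>p\<in>?J. g (fst p) \<otimes> ?af (snd p))"
        using f g af sub by (intro monoid_alg_mult_eq) (auto simp: c)
      also have "\<dots> = (\<Oplus>p\<in>?J. a \<otimes> (g (fst p) \<otimes> f (snd p)))"
        using f g a by (intro K.finsum_cong') (auto simp: monoid_alg_smult_apply c K.m_lcomm)
      also have "\<dots> = a \<otimes> (\<Oplus>p\<in>?J. g (fst p) \<otimes> f (snd p))"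
        using f g a by (intro K.finsum_rdistr[symmetric] fin) (auto simp: c)
      also have "(\<Oplus>p\<in>?J. g (fst p) \<otimes> f (snd p)) = (g \<otimes>\<^bsub>monoid_alg K M\<^esub> f) x"
        using f g by (intro monoid_alg_mult_eq[symmetric]) (auto simp: c)
      finally have scaled: "(g \<otimes>\<^bsub>monoid_alg K M\<^esub> ?af) x = a \<otimes> (g \<otimes>\<^bsub>monoid_alg K M\<^esub> f) x" .
      show "(g \<otimes>\<^bsub>monoid_alg K M\<^esub> ?af) x = (a \<odot>\<^bsub>monoid_alg K M\<^esub> (g \<otimes>\<^bsub>monoid_alg K M\<^esub> f)) x"
        by (subst monoid_alg_smult_apply) (rule scaled)
    qed
  qed (use g in \<open>auto intro: monoid_alg_mult_closed\<close>)
qed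

lemma basis_elt_mult:
  assumes "m \<in> carrier M" "n \<in> carrier M"
  shows "basis_elt K m \<otimes>\<^bsub>monoid_alg K M\<^esub> basis_elt K n = basis_elt K (m \<otimes>\<^bsub>M\<^esub> n)"
proof
  fix x
  have s: "supp K (basis_elt K m) \<subseteq> {m}" for m :: 'm by (auto simp: supp_def basis_elt_def)
  have "{p \<in> {m} \<times> {n}. fst p \<otimes>\<^bsub>M\<^esub> snd p = x} = (if x = m \<otimes>\<^bsub>M\<^esub> n then {(m, n)} else {})"
    by auto
  then show "(basis_elt K m \<otimes>\<^bsub>monoid_alg K M\<^esub> basis_elt K n) x = basis_elt K (m \<otimes>\<^bsub>M\<^esub> n) x"
    using assms s
    by (simp add: monoid_alg_mult_eq[where S="{m}" and T="{n}"] basis_elt_carrier)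
       (simp add: basis_elt_def)
qed

lemma monoid_alg_induct:
  assumes f: "f \<in> carrier (monoid_alg K M)"
    and zero: "P \<zero>\<^bsub>monoid_alg K M\<^esub>"
    and basis: "\<And>a m. \<lbrakk>a \<in> carrier K; m \<in> carrier M\<rbrakk> \<Longrightarrow> P (a \<odot>\<^bsub>monoid_alg K M\<^esub> basis_elt K m)"
    and add: "\<And>f g. \<lbrakk>f \<in> carrier (monoid_alg K M); g \<in> carrier (monoid_alg K M); P f; P g\<rbrakk>
      \<Longrightarrow> P (f \<oplus>\<^bsub>monoid_alg K M\<^esub> g)"
  shows "P f"
proof -
  have "\<lbrakk>f \<in> carrier (monoid_alg K M); supp K f \<subseteq> S\<rbrakk> \<Longrightarrow> P f" if "finite S" for S f
    using that
  proof (induction S arbitrary: f)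
    case empty
    then have "f = \<zero>\<^bsub>monoid_alg K M\<^esub>" by (auto simp: supp_def monoid_alg_def)
    then show ?case using zero by simp
  next
    case (insert s S)
    show ?case
    proof (cases "s \<in> supp K f")
      case False
      with insert show ?thesis by blast
    next
      case True
      have f: "\<And>x. f x \<in> carrier K" "finite (supp K f)" "supp K f \<subseteq> carrier M"
        using insert.prems by (auto simp: monoid_alg_carrier_iff)
      let ?g = "f(s := \<zero>)"
      have "supp K ?g \<subseteq> supp K f - {s}" by (auto simp: supp_def)
      with f have g: "?g \<in> carrier (monoid_alg K M)"
        by (auto simp: monoid_alg_carrier_iff intro: finite_subset)
      have "supp K ?g \<subseteq> S" using \<open>supp K ?g \<subseteq> supp K f - {s}\<close> insert.prems by auto
      then have "P ?g" using insert.IH g by blast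
      moreover have s: "s \<in> carrier M" using True f by auto
      moreover have "f = f s \<odot>\<^bsub>monoid_alg K M\<^esub> basis_elt K s \<oplus>\<^bsub>monoid_alg K M\<^esub> ?g"
        using f by (auto simp: monoid_alg_def basis_elt_def)
      ultimately show ?thesis
        using add[of "f s \<odot>\<^bsub>monoid_alg K M\<^esub> basis_elt K s" ?g] g basis[of "f s" s] f
        by (simp add: basis_elt_carrier)
    qed
  qed
  moreover have "finite (supp K f)" using f by (simp add: monoid_alg_carrier_iff)
  ultimately show ?thesis using f by blast
qed

lemma monoid_alg_lin_eq:
  assumes N: "module K N" and "g \<in> lin_hom K (monoid_alg K M) N" "h \<in> lin_hom K (monoid_alg K M) N"
    and "\<And>m. m \<in> carrier M \<Longrightarrow> g (basis_elt K m) = h (basis_elt K m)"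
    and "f \<in> carrier (monoid_alg K M)"
  shows "g f = h f"
  using assms(5)
  by (rule monoid_alg_induct)
     (use assms in \<open>auto simp: lin_hom_zero[OF monoid_alg_module N] lin_hom_add lin_hom_smult
        basis_elt_carrier\<close>)

text \<open>
  The product is bilinear, so the algebra laws follow from those for the basis elements, where they
  are the monoid laws.
\<close>

lemma monoid_alg_unital_algebra: "unital_algebra K (monoid_alg K M)"
proof -
  let ?F = "monoid_alg K M"
  note lin = monoid_alg_mult_lin
  note cl = monoid_alg_mult_closed
  note eq = monoid_alg_lin_eq[OF monoid_alg_module]
  note b = basis_elt_carrier
  have comp: "(\<lambda>x. g x \<otimes>\<^bsub>?F\<^esub> h) \<in> lin_hom K N ?F" "(\<lambda>x. h \<otimes>\<^bsub>?F\<^esub> g x) \<in> lin_hom K N ?F"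
    if "g \<in> lin_hom K N ?F" "h \<in> carrier ?F" for g h and N :: "('k, 'm \<Rightarrow> 'k) module"
    using lin_hom_comp[OF that(1) lin(1)[OF that(2)]] lin_hom_comp[OF that(1) lin(2)[OF that(2)]]
    by auto
  note intros = comp lin_hom_id b cl
  have assoc1: "(basis_elt K m \<otimes>\<^bsub>?F\<^esub> basis_elt K n) \<otimes>\<^bsub>?F\<^esub> h = basis_elt K m \<otimes>\<^bsub>?F\<^esub> (basis_elt K n \<otimes>\<^bsub>?F\<^esub> h)"
    if "m \<in> carrier M" "n \<in> carrier M" "h \<in> carrier ?F" for m n h
    by (rule eq[OF _ _ _ that(3)])
       (use that in \<open>auto intro!: intros simp: basis_elt_mult M.m_assoc\<close>)
  have assoc2: "(basis_elt K m \<otimes>\<^bsub>?F\<^esub> g) \<otimes>\<^bsub>?F\<^esub> h = basis_elt K m \<otimes>\<^bsub>?F\<^esub> (g \<otimes>\<^bsub>?F\<^esub> h)"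
    if "m \<in> carrier M" "g \<in> carrier ?F" "h \<in> carrier ?F" for m g h
    by (rule eq[OF _ _ _ that(2), where g="\<lambda>g. (basis_elt K m \<otimes>\<^bsub>?F\<^esub> g) \<otimes>\<^bsub>?F\<^esub> h"])
       (use that in \<open>auto intro!: intros simp: assoc1\<close>)
  have assoc: "(f \<otimes>\<^bsub>?F\<^esub> g) \<otimes>\<^bsub>?F\<^esub> h = f \<otimes>\<^bsub>?F\<^esub> (g \<otimes>\<^bsub>?F\<^esub> h)"
    if "f \<in> carrier ?F" "g \<in> carrier ?F" "h \<in> carrier ?F" for f g h
    by (rule eq[OF _ _ _ that(1), where g="\<lambda>f. (f \<otimes>\<^bsub>?F\<^esub> g) \<otimes>\<^bsub>?F\<^esub> h"])
       (use that in \<open>auto intro!: intros simp: assoc2\<close>)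
  have one: "\<one>\<^bsub>?F\<^esub> \<in> carrier ?F" by (simp add: monoid_alg_one b)
  have one_l: "\<one>\<^bsub>?F\<^esub> \<otimes>\<^bsub>?F\<^esub> f = f" if "f \<in> carrier ?F" for f
    by (rule eq[OF _ _ _ that]) (auto intro!: lin one lin_hom_id simp: monoid_alg_one basis_elt_mult b)
  have one_r: "f \<otimes>\<^bsub>?F\<^esub> \<one>\<^bsub>?F\<^esub> = f" if "f \<in> carrier ?F" for f
    by (rule eq[OF _ _ _ that]) (auto intro!: lin one lin_hom_id simp: monoid_alg_one basis_elt_mult b)
  have "monoid ?F" by (rule monoidI) (auto intro: cl one simp: one_l one_r assoc)
  then have "ring ?F"
    by (intro ringI F.M.abelian_group_axioms)
       (auto simp: lin_hom_add[OF lin(1)] lin_hom_add[OF lin(2)])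
  then show ?thesis
    by (intro unital_algebra.intro monoid_alg_module unital_algebra_axioms.intro)
       (auto simp: lin_hom_smult[OF lin(1)] lin_hom_smult[OF lin(2)])
qed

lemma lin_ext_eq:
  assumes N: "module K N" and \<phi>: "\<phi> \<in> carrier M \<rightarrow> carrier N"
    and f: "f \<in> carrier (monoid_alg K M)" and S: "finite S" "supp K f \<subseteq> S" "S \<subseteq> carrier M"
  shows "lin_ext K N \<phi> f = (\<Oplus>\<^bsub>N\<^esub>x\<in>S. f x \<odot>\<^bsub>N\<^esub> \<phi> x)"
proof -
  interpret N: module K N by fact
  show ?thesis
    unfolding lin_ext_def
    by (rule N.M.add.finprod_mono_neutral_cong_left)
       (use S f \<phi> in \<open>auto simp: supp_def monoid_alg_carrier_iff Pi_iff\<close>)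
qed

lemma lin_ext_lin:
  assumes N: "module K N" and \<phi>: "\<phi> \<in> carrier M \<rightarrow> carrier N"
  shows "lin_ext K N \<phi> \<in> lin_hom K (monoid_alg K M) N"
proof -
  interpret N: module K N by fact
  have c: "finite (supp K f)" "f y \<in> carrier K" "supp K f \<subseteq> carrier M"
    if "f \<in> carrier (monoid_alg K M)" for f y
    using that by (auto simp: monoid_alg_carrier_iff)
  note eq = lin_ext_eq[OF N \<phi>]
  show ?thesis
  proof (rule lin_homI)
    fix f assume f: "f \<in> carrier (monoid_alg K M)"
    then show "lin_ext K N \<phi> f \<in> carrier N"
      unfolding lin_ext_def using \<phi> c[OF f]
      by (intro N.M.finsum_closed) (auto simp: Pi_iff)
  next
    fix f g assume f: "f \<in> carrier (monoid_alg K M)" and g: "g \<in> carrier (monoid_alg K M)"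
    let ?S = "supp K f \<union> supp K g"
    have S: "finite ?S" "?S \<subseteq> carrier M" using c f g by auto
    have \<phi>': "\<phi> x \<in> carrier N" if "x \<in> ?S" for x using S \<phi> that by auto
    have "lin_ext K N \<phi> (f \<oplus>\<^bsub>monoid_alg K M\<^esub> g)
        = (\<Oplus>\<^bsub>N\<^esub>x\<in>?S. (f \<oplus>\<^bsub>monoid_alg K M\<^esub> g) x \<odot>\<^bsub>N\<^esub> \<phi> x)"
      using f g S by (intro eq) (auto simp: supp_def monoid_alg_add_apply)
    also have "\<dots> = (\<Oplus>\<^bsub>N\<^esub>x\<in>?S. f x \<odot>\<^bsub>N\<^esub> \<phi> x \<oplus>\<^bsub>N\<^esub> g x \<odot>\<^bsub>N\<^esub> \<phi> x)"
      using \<phi>' c(2)[OF f] c(2)[OF g]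
      by (intro N.M.finsum_cong') (auto simp: monoid_alg_add_apply N.smult_l_distr)
    also have "\<dots> = (\<Oplus>\<^bsub>N\<^esub>x\<in>?S. f x \<odot>\<^bsub>N\<^esub> \<phi> x) \<oplus>\<^bsub>N\<^esub> (\<Oplus>\<^bsub>N\<^esub>x\<in>?S. g x \<odot>\<^bsub>N\<^esub> \<phi> x)"
      using \<phi>' c(2)[OF f] c(2)[OF g] by (intro N.M.finsum_addf) auto
    finally show "lin_ext K N \<phi> (f \<oplus>\<^bsub>monoid_alg K M\<^esub> g) = lin_ext K N \<phi> f \<oplus>\<^bsub>N\<^esub> lin_ext K N \<phi> g"
      using eq[OF f S(1) _ S(2)] eq[OF g S(1) _ S(2)] by simp
  next
    fix a f assume a: "a \<in> carrier K" and f: "f \<in> carrier (monoid_alg K M)"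
    have \<phi>': "\<phi> x \<in> carrier N" if "x \<in> supp K f" for x using c[OF f] \<phi> that by auto
    have "lin_ext K N \<phi> (a \<odot>\<^bsub>monoid_alg K M\<^esub> f)
        = (\<Oplus>\<^bsub>N\<^esub>x\<in>supp K f. (a \<odot>\<^bsub>monoid_alg K M\<^esub> f) x \<odot>\<^bsub>N\<^esub> \<phi> x)"
      using f c[OF f] a by (intro eq) (auto simp: supp_def monoid_alg_smult_apply)
    also have "\<dots> = (\<Oplus>\<^bsub>N\<^esub>x\<in>supp K f. a \<odot>\<^bsub>N\<^esub> (f x \<odot>\<^bsub>N\<^esub> \<phi> x))"
      using \<phi>' c[OF f] a
      by (intro N.M.finsum_cong') (auto simp: monoid_alg_smult_apply N.smult_assoc1)
    also have "\<dots> = a \<odot>\<^bsub>N\<^esub> (\<Oplus>\<^bsub>N\<^esub>x\<in>supp K f. f x \<odot>\<^bsub>N\<^esub> \<phi> x)"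
      using \<phi>' c[OF f] a by (intro N.finsum_smult_ldistr[symmetric]) auto
    finally show "lin_ext K N \<phi> (a \<odot>\<^bsub>monoid_alg K M\<^esub> f) = a \<odot>\<^bsub>N\<^esub> lin_ext K N \<phi> f"
      by (simp add: lin_ext_def)
  qed
qed

lemma lin_ext_basis:
  assumes N: "module K N" and \<phi>: "\<phi> \<in> carrier M \<rightarrow> carrier N" and m: "m \<in> carrier M"
  shows "lin_ext K N \<phi> (basis_elt K m) = \<phi> m"
proof -
  interpret N: module K N by fact
  have "lin_ext K N \<phi> (basis_elt K m) = (\<Oplus>\<^bsub>N\<^esub>x\<in>{m}. basis_elt K m x \<odot>\<^bsub>N\<^esub> \<phi> x)"
    by (rule lin_ext_eq[OF N \<phi> basis_elt_carrier[OF m]])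
       (use m in \<open>auto simp: supp_def basis_elt_def\<close>)
  also have "\<dots> = \<phi> m"
    using \<phi> m by (simp add: basis_elt_def Pi_iff)
  finally show ?thesis .
qed

lemma lin_ext_alg_hom:
  assumes B: "unital_algebra K B" and \<phi>: "\<phi> \<in> carrier M \<rightarrow> carrier B"
    and one: "\<phi> \<one>\<^bsub>M\<^esub> = \<one>\<^bsub>B\<^esub>"
    and mult: "\<And>m n. \<lbrakk>m \<in> carrier M; n \<in> carrier M\<rbrakk> \<Longrightarrow> \<phi> (m \<otimes>\<^bsub>M\<^esub> n) = \<phi> m \<otimes>\<^bsub>B\<^esub> \<phi> n"
  shows "lin_ext K B \<phi> \<in> alg_hom K (monoid_alg K M) B"
proof -
  note B' = unital_algebra_module[OF B]
  note lin = lin_ext_lin[OF B' \<phi>] and bas = lin_ext_basis[OF B' \<phi>]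
  let ?F = "monoid_alg K M"
  show ?thesis
  proof (rule alg_homI[OF lin])
    show "lin_ext K B \<phi> \<one>\<^bsub>?F\<^esub> = \<one>\<^bsub>B\<^esub>"
      by (simp add: monoid_alg_one bas one)
  next
    fix f g assume f: "f \<in> carrier ?F" and g: "g \<in> carrier ?F"
    have 1: "lin_ext K B \<phi> (basis_elt K m \<otimes>\<^bsub>?F\<^esub> g) = lin_ext K B \<phi> (basis_elt K m) \<otimes>\<^bsub>B\<^esub> lin_ext K B \<phi> g"
      if m: "m \<in> carrier M" for m
      by (rule monoid_alg_lin_eq[OF B' _ _ _ g])
         (use m \<phi> in \<open>auto intro!: lin lin_hom_comp[OF monoid_alg_mult_lin(2) lin] lin_hom_mult_left[OF B]
            simp: basis_elt_carrier basis_elt_mult bas mult lin_hom_closed[OF lin]\<close>)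
    show "lin_ext K B \<phi> (f \<otimes>\<^bsub>?F\<^esub> g) = lin_ext K B \<phi> f \<otimes>\<^bsub>B\<^esub> lin_ext K B \<phi> g"
      by (rule monoid_alg_lin_eq[OF B' _ _ _ f])
         (use g in \<open>auto intro!: lin lin_hom_comp[OF monoid_alg_mult_lin(1) lin] lin_hom_mult_right[OF B]
            simp: 1 lin_hom_closed[OF lin]\<close>)
  qed
qed

end


section \<open>Quotient algebras\<close>

lemma quot_alg_sel:
  "carrier (quot_alg A N) = a_rcosets\<^bsub>A\<^esub> N"
  "Z \<otimes>\<^bsub>quot_alg A N\<^esub> Y = rcoset_mult A N Z Y"
  "Z \<oplus>\<^bsub>quot_alg A N\<^esub> Y = Z <+>\<^bsub>A\<^esub> Y"
  "\<one>\<^bsub>quot_alg A N\<^esub> = N +>\<^bsub>A\<^esub> \<one>\<^bsub>A\<^esub>"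
  "\<zero>\<^bsub>quot_alg A N\<^esub> = N"
  "a \<odot>\<^bsub>quot_alg A N\<^esub> Z = (\<Union>x\<in>Z. N +>\<^bsub>A\<^esub> (a \<odot>\<^bsub>A\<^esub> x))"
  by (simp_all add: quot_alg_def ring.defs module.defs FactRing_def)

context
  fixes K :: "'k ring" and A :: "('k, 'a, 'x) module_scheme" (structure) and N
  assumes A: "unital_algebra K A" and N: "ideal N A"
begin

interpretation A: unital_algebra K A by (rule A)
interpretation N: ideal N A by (rule N)

text \<open>Because \<open>a x = (a 1) x\<close>, a ring ideal of an algebra is a subspace.\<close>

lemma ideal_smult_closed:
  assumes "a \<in> carrier K" "n \<in> N" shows "a \<odot> n \<in> N"
proof -
  have "(a \<odot> \<one>) \<otimes> n \<in> N" using assms by (intro N.I_l_closed) auto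
  then show ?thesis using assms by (simp add: A.smult_mult_left)
qed

lemma quot_map_closed: "x \<in> carrier A \<Longrightarrow> N +> x \<in> carrier (quot_alg A N)"
  by (simp add: quot_alg_sel A.a_rcosetsI N.a_subset)

lemma quot_alg_cases:
  assumes "Y \<in> carrier (quot_alg A N)" obtains x where "x \<in> carrier A" "Y = N +> x"
  using assms by (auto simp: quot_alg_sel A_RCOSETS_defs a_r_coset_def)

lemma quot_map_add:
  "\<lbrakk>x \<in> carrier A; y \<in> carrier A\<rbrakk> \<Longrightarrow> N +> (x \<oplus> y) = (N +> x) \<oplus>\<^bsub>quot_alg A N\<^esub> (N +> y)"
  by (simp add: quot_alg_sel N.a_rcos_sum)

lemma quot_map_mult:
  "\<lbrakk>x \<in> carrier A; y \<in> carrier A\<rbrakk> \<Longrightarrow> N +> (x \<otimes> y) = (N +> x) \<otimes>\<^bsub>quot_alg A N\<^esub> (N +> y)"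
  by (simp add: quot_alg_sel N.rcoset_mult_add)

lemma quot_map_eq_iff:
  assumes "x \<in> carrier A" "y \<in> carrier A"
  shows "N +> x = N +> y \<longleftrightarrow> x \<ominus> y \<in> N"
  using A.quotient_eq_iff_same_a_r_cos[OF N assms] by simp

text \<open>
  All representatives of a coset give the same coset after scaling, so the union in the definition
  is over equal sets.
\<close>

lemma quot_map_smult:
  assumes a: "a \<in> carrier K" and x: "x \<in> carrier A"
  shows "N +> (a \<odot> x) = a \<odot>\<^bsub>quot_alg A N\<^esub> (N +> x)"
proof -
  have eq: "N +> (a \<odot> z) = N +> (a \<odot> x)" if z: "z \<in> N +> x" for z
  proof -
    obtain n where n: "n \<in> N" "z = n \<oplus> x"
      using z by (auto simp: a_r_coset_def')
    have nA: "n \<in> carrier A" using n N.a_subset by auto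
    have "a \<odot> z \<ominus> a \<odot> x = a \<odot> n"
      using n nA a x by (simp add: A.smult_r_distr a_minus_def A.M.a_assoc A.M.r_neg)
    then show ?thesis
      using ideal_smult_closed[OF a n(1)] n nA a x by (simp add: quot_map_eq_iff)
  qed
  have "(\<Union>z\<in>N +> x. N +> (a \<odot> z)) = (\<Union>z\<in>N +> x. N +> (a \<odot> x))"
    by (rule SUP_cong[OF refl eq])
  also have "\<dots> = N +> (a \<odot> x)"
    using N.a_rcos_self[OF x] by auto
  finally show ?thesis by (simp add: quot_alg_sel)
qed

lemma quot_alg_unital_algebra: "unital_algebra K (quot_alg A N)"
proof -
  note hom = quot_map_add[symmetric] quot_map_mult[symmetric] quot_map_smult[symmetric] quot_map_closed
  have one: "\<one>\<^bsub>quot_alg A N\<^esub> = N +> \<one>" by (simp add: quot_alg_sel)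
  have zero: "\<zero>\<^bsub>quot_alg A N\<^esub> = N +> \<zero>" by (simp add: quot_alg_sel N.a_subset)
  have neg: "(N +> (\<ominus> x)) \<oplus>\<^bsub>quot_alg A N\<^esub> (N +> x) = \<zero>\<^bsub>quot_alg A N\<^esub>" if "x \<in> carrier A" for x
    unfolding zero using that by (subst quot_map_add[symmetric]) (simp_all add: A.M.l_neg)
  have zero_add: "\<zero>\<^bsub>quot_alg A N\<^esub> \<oplus>\<^bsub>quot_alg A N\<^esub> (N +> x) = N +> x" if "x \<in> carrier A" for x
    unfolding zero using that by (subst quot_map_add[symmetric]) simp_all
  have zero_closed: "\<zero>\<^bsub>quot_alg A N\<^esub> \<in> carrier (quot_alg A N)"
    unfolding zero by (rule quot_map_closed) simp
  show ?thesis
  proof (rule unital_algebraI)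
    show "cring K" by (rule unital_algebra_cring[OF A])
    show "\<exists>Y\<in>carrier (quot_alg A N). Y \<oplus>\<^bsub>quot_alg A N\<^esub> Z = \<zero>\<^bsub>quot_alg A N\<^esub>"
      if Z: "Z \<in> carrier (quot_alg A N)" for Z
    proof -
      obtain x where x: "x \<in> carrier A" "Z = N +> x" by (rule quot_alg_cases[OF Z])
      then show ?thesis
        by (intro bexI[OF _ quot_map_closed[of "\<ominus> x"]]) (simp_all add: neg)
    qed
  qed ((elim quot_alg_cases)?; (hypsubst)?; simp add: hom one zero_add zero_closed A.M.a_ac A.m_assoc
        A.l_distr A.r_distr A.smult_l_distr A.smult_r_distr A.smult_assoc1
        A.smult_mult_left A.smult_mult_right)+
qed

lemma quot_map_alg_hom: "(\<lambda>x. N +> x) \<in> alg_hom K A (quot_alg A N)"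
  by (intro alg_homI lin_homI)
     (simp_all add: quot_map_closed quot_map_add quot_map_mult quot_map_smult quot_alg_sel(4))

lemma quot_map_zero_iff: "x \<in> carrier A \<Longrightarrow> N +> x = \<zero>\<^bsub>quot_alg A N\<^esub> \<longleftrightarrow> x \<in> N"
  using quot_map_eq_iff[of x "\<zero>"] by (simp add: quot_alg_sel N.a_subset a_minus_def)

context
  fixes B :: "('k, 'b, 'y) module_scheme" and f
  assumes B: "module K B" and f: "f \<in> lin_hom K A B" and vanish: "\<And>n. n \<in> N \<Longrightarrow> f n = \<zero>\<^bsub>B\<^esub>"
begin

text \<open>
  A map that vanishes on the ideal is constant on a coset, so its image of the coset is a singleton.
\<close>

lemma quot_induced_apply:
  assumes x: "x \<in> carrier A" shows "the_elem (f ` (N +> x)) = f x"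
proof -
  interpret B: module K B by (rule B)
  have const: "f z = f x" if z: "z \<in> N +> x" for z
  proof -
    obtain n where n: "n \<in> N" "z = n \<oplus> x"
      using z by (auto simp: a_r_coset_def')
    then have "n \<in> carrier A" using N.a_subset by auto
    then show ?thesis
      using x n lin_hom_closed[OF f x] by (simp add: lin_hom_add[OF f] vanish)
  qed
  have "f ` (N +> x) = (\<lambda>_. f x) ` (N +> x)"
    by (rule image_cong[OF refl const])
  also have "\<dots> = {f x}" using N.a_rcos_self[OF x] by auto
  finally show ?thesis by simp
qed

lemma quot_induced_lin: "(\<lambda>Y. the_elem (f ` Y)) \<in> lin_hom K (quot_alg A N) B"
  by (rule lin_homI; (elim quot_alg_cases)?; hypsubst?;
      simp add: quot_map_add[symmetric] quot_map_smult[symmetric] quot_induced_apply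
        lin_hom_closed[OF f] lin_hom_add[OF f] lin_hom_smult[OF f])

end

lemma quot_induced_alg_hom:
  assumes B: "unital_algebra K B" and f: "f \<in> alg_hom K A B" and v: "\<And>n. n \<in> N \<Longrightarrow> f n = \<zero>\<^bsub>B\<^esub>"
  shows "(\<lambda>Y. the_elem (f ` Y)) \<in> alg_hom K (quot_alg A N) B"
proof -
  note fl = unital_algebra_module[OF B] alg_hom_lin[OF f] v
  show ?thesis
    by (rule alg_homI[OF quot_induced_lin[OF fl]]; (elim quot_alg_cases)?; hypsubst?;
      simp add: quot_map_mult[symmetric] quot_alg_sel(4) quot_induced_apply[OF fl] alg_hom_one[OF f]
        alg_hom_mult[OF f])
qed

end


section \<open>Tensor products\<close>

definition bilin ::
    "'k ring \<Rightarrow> ('k, 'a, 'x) module_scheme \<Rightarrow> ('k, 'b, 'y) module_scheme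
      \<Rightarrow> ('k, 'm, 'z) module_scheme \<Rightarrow> ('a \<Rightarrow> 'b \<Rightarrow> 'm) set"
  where "bilin K A B M = {\<beta>. (\<forall>b\<in>carrier B. (\<lambda>a. \<beta> a b) \<in> lin_hom K A M) \<and>
    (\<forall>a\<in>carrier A. (\<lambda>b. \<beta> a b) \<in> lin_hom K B M)}"

lemma bilinI:
  assumes "\<And>b. b \<in> carrier B \<Longrightarrow> (\<lambda>a. \<beta> a b) \<in> lin_hom K A M"
    and "\<And>a. a \<in> carrier A \<Longrightarrow> (\<lambda>b. \<beta> a b) \<in> lin_hom K B M"
  shows "\<beta> \<in> bilin K A B M"
  using assms by (simp add: bilin_def)

lemma bilinD:
  assumes "\<beta> \<in> bilin K A B M"
  shows "b \<in> carrier B \<Longrightarrow> (\<lambda>a. \<beta> a b) \<in> lin_hom K A M"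
    and "a \<in> carrier A \<Longrightarrow> (\<lambda>b. \<beta> a b) \<in> lin_hom K B M"
  using assms by (simp_all add: bilin_def)

context
  fixes K :: "'k ring" and A :: "('k, 'a, 'x) module_scheme" and B :: "('k, 'b, 'y) module_scheme"
  assumes A: "unital_algebra K A" and B: "unital_algebra K B"
begin

interpretation A: unital_algebra K A by (rule A)
interpretation B: unital_algebra K B by (rule B)

abbreviation (input) "kAB \<equiv> monoid_alg K (A \<times>\<times> B)"

lemma DirProd_monoid': "monoid (A \<times>\<times> B)"
  by (intro DirProd_monoid A.monoid_axioms B.monoid_axioms)

lemma DirProd_carrier: "carrier (A \<times>\<times> B) = carrier A \<times> carrier B"
  by (simp add: DirProd_def)

lemma kAB_alg: "unital_algebra K kAB"
  by (rule monoid_alg_unital_algebra[OF unital_algebra_cring[OF A] DirProd_monoid'])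

interpretation F: unital_algebra K kAB by (rule kAB_alg)

lemma basis_pair_closed:
  "\<lbrakk>a \<in> carrier A; b \<in> carrier B\<rbrakk> \<Longrightarrow> basis_elt K (a, b) \<in> carrier kAB"
  by (rule basis_elt_carrier[OF unital_algebra_cring[OF A] DirProd_monoid']) (simp add: DirProd_def)

lemma basis_pair_mult:
  "\<lbrakk>a \<in> carrier A; b \<in> carrier B; a' \<in> carrier A; b' \<in> carrier B\<rbrakk> \<Longrightarrow>
    basis_elt K (a, b) \<otimes>\<^bsub>kAB\<^esub> basis_elt K (a', b') = basis_elt K (a \<otimes>\<^bsub>A\<^esub> a', b \<otimes>\<^bsub>B\<^esub> b')"
  by (subst basis_elt_mult[OF unital_algebra_cring[OF A] DirProd_monoid']) (simp_all add: DirProd_def)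

lemma bilin_rels_cases:
  assumes "r \<in> bilin_rels K A B"
  obtains (add_left) a a' b where "a \<in> carrier A" "a' \<in> carrier A" "b \<in> carrier B"
      "r = basis_elt K (a \<oplus>\<^bsub>A\<^esub> a', b) \<ominus>\<^bsub>kAB\<^esub> (basis_elt K (a, b) \<oplus>\<^bsub>kAB\<^esub> basis_elt K (a', b))"
    | (add_right) a b b' where "a \<in> carrier A" "b \<in> carrier B" "b' \<in> carrier B"
      "r = basis_elt K (a, b \<oplus>\<^bsub>B\<^esub> b') \<ominus>\<^bsub>kAB\<^esub> (basis_elt K (a, b) \<oplus>\<^bsub>kAB\<^esub> basis_elt K (a, b'))"
    | (smult_left) s a b where "s \<in> carrier K" "a \<in> carrier A" "b \<in> carrier B"
      "r = basis_elt K (s \<odot>\<^bsub>A\<^esub> a, b) \<ominus>\<^bsub>kAB\<^esub> s \<odot>\<^bsub>kAB\<^esub> basis_elt K (a, b)"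
    | (smult_right) s a b where "s \<in> carrier K" "a \<in> carrier A" "b \<in> carrier B"
      "r = basis_elt K (a, s \<odot>\<^bsub>B\<^esub> b) \<ominus>\<^bsub>kAB\<^esub> s \<odot>\<^bsub>kAB\<^esub> basis_elt K (a, b)"
  using assms unfolding bilin_rels_def Let_def
  apply (elim UnE CollectE exE conjE)
  subgoal by (rule add_left)
  subgoal by (rule add_right)
  subgoal by (rule smult_left)
  subgoal by (rule smult_right)
  done

lemma bilin_rels_add_left:
  "\<lbrakk>a \<in> carrier A; a' \<in> carrier A; b \<in> carrier B\<rbrakk> \<Longrightarrow>
    basis_elt K (a \<oplus>\<^bsub>A\<^esub> a', b) \<ominus>\<^bsub>kAB\<^esub> (basis_elt K (a, b) \<oplus>\<^bsub>kAB\<^esub> basis_elt K (a', b)) \<in> bilin_rels K A B"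
  unfolding bilin_rels_def Let_def
  by (rule UnI1[OF UnI1[OF UnI1]], rule CollectI, rule exI, rule exI, rule exI, rule conjI, rule refl, intro conjI)

lemma bilin_rels_add_right:
  "\<lbrakk>a \<in> carrier A; b \<in> carrier B; b' \<in> carrier B\<rbrakk> \<Longrightarrow>
    basis_elt K (a, b \<oplus>\<^bsub>B\<^esub> b') \<ominus>\<^bsub>kAB\<^esub> (basis_elt K (a, b) \<oplus>\<^bsub>kAB\<^esub> basis_elt K (a, b')) \<in> bilin_rels K A B"
  unfolding bilin_rels_def Let_def
  by (rule UnI1[OF UnI1[OF UnI2]], rule CollectI, rule exI, rule exI, rule exI, rule conjI, rule refl, intro conjI)

lemma bilin_rels_smult_left:
  "\<lbrakk>s \<in> carrier K; a \<in> carrier A; b \<in> carrier B\<rbrakk> \<Longrightarrow>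
    basis_elt K (s \<odot>\<^bsub>A\<^esub> a, b) \<ominus>\<^bsub>kAB\<^esub> s \<odot>\<^bsub>kAB\<^esub> basis_elt K (a, b) \<in> bilin_rels K A B"
  unfolding bilin_rels_def Let_def
  by (rule UnI1[OF UnI2], rule CollectI, rule exI, rule exI, rule exI, rule conjI, rule refl, intro conjI)

lemma bilin_rels_smult_right:
  "\<lbrakk>s \<in> carrier K; a \<in> carrier A; b \<in> carrier B\<rbrakk> \<Longrightarrow>
    basis_elt K (a, s \<odot>\<^bsub>B\<^esub> b) \<ominus>\<^bsub>kAB\<^esub> s \<odot>\<^bsub>kAB\<^esub> basis_elt K (a, b) \<in> bilin_rels K A B"
  unfolding bilin_rels_def Let_def
  by (rule UnI2, rule CollectI, rule exI, rule exI, rule exI, rule conjI, rule refl, intro conjI)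

lemmas bilin_rels_intros =
  bilin_rels_add_left bilin_rels_add_right bilin_rels_smult_left bilin_rels_smult_right

lemma bilin_rels_subset: "bilin_rels K A B \<subseteq> carrier kAB"
proof
  fix r assume "r \<in> bilin_rels K A B"
  then show "r \<in> carrier kAB"
    by (cases rule: bilin_rels_cases) (simp_all add: basis_pair_closed F.minus_closed)
qed

lemma submodule_zero: "submodule N K kAB \<Longrightarrow> \<zero>\<^bsub>kAB\<^esub> \<in> N"
  using subgroup.one_closed[OF submodule.axioms(1)] by fastforce

lemma bilin_sub_submodule: "submodule (bilin_sub K A B) K kAB"
proof -
  let ?S = "{N. submodule N K kAB \<and> bilin_rels K A B \<subseteq> N}"
  have ne: "carrier kAB \<in> ?S"
    using F.carrier_is_submodule bilin_rels_subset by simp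
  have eq: "bilin_sub K A B = \<Inter>?S" by (simp add: bilin_sub_def hull_def)
  show ?thesis
    unfolding eq
  proof (rule F.submoduleI)
    show "\<Inter>?S \<subseteq> carrier kAB" using ne by blast
    show "\<zero>\<^bsub>kAB\<^esub> \<in> \<Inter>?S" using submodule_zero by blast
    show "\<ominus>\<^bsub>kAB\<^esub> n \<in> \<Inter>?S" if "n \<in> \<Inter>?S" for n using that F.submoduleE(3) by blast
    show "m \<oplus>\<^bsub>kAB\<^esub> n \<in> \<Inter>?S" if "m \<in> \<Inter>?S" "n \<in> \<Inter>?S" for m n using that F.submoduleE(5) by blast
    show "s \<odot>\<^bsub>kAB\<^esub> n \<in> \<Inter>?S" if "s \<in> carrier K" "n \<in> \<Inter>?S" for s n using that F.submoduleE(4) by blast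
  qed
qed

lemma bilin_sub_minimal:
  "\<lbrakk>submodule N K kAB; bilin_rels K A B \<subseteq> N\<rbrakk> \<Longrightarrow> bilin_sub K A B \<subseteq> N"
  unfolding bilin_sub_def by (rule hull_minimal)

lemma bilin_rels_in_sub: "bilin_rels K A B \<subseteq> bilin_sub K A B"
  unfolding bilin_sub_def by (rule hull_subset)

lemma bilin_sub_subset: "bilin_sub K A B \<subseteq> carrier kAB"
  by (rule bilin_sub_minimal[OF F.carrier_is_submodule bilin_rels_subset])

text \<open>
  Left or right multiplication by a basis element of \<open>A \<times> B\<close> sends each bilinearity relation to a
  relation of the same kind, and the preimage of the subspace under this linear map is again a
  subspace.
\<close>

lemma bilin_sub_ideal: "ideal (bilin_sub K A B) kAB"
proof -
  let ?N = "bilin_sub K A B"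
  note sm = bilin_sub_submodule
  have pre: "submodule {n \<in> carrier kAB. f n \<in> ?N} K kAB" if f: "f \<in> lin_hom K kAB kAB" for f
    by (rule F.submoduleI)
       (auto simp: lin_hom_add[OF f] lin_hom_smult[OF f] lin_hom_zero[OF F.module_axioms F.module_axioms f]
          lin_hom_neg[OF F.module_axioms F.module_axioms f] F.submoduleE(3-5)[OF sm]
          submodule_zero[OF sm])
  have l: "basis_elt K (p, q) \<otimes>\<^bsub>kAB\<^esub> r \<in> ?N" if pq: "p \<in> carrier A" "q \<in> carrier B" and r: "r \<in> ?N" for p q r
  proof -
    have f: "(\<lambda>n. basis_elt K (p, q) \<otimes>\<^bsub>kAB\<^esub> n) \<in> lin_hom K kAB kAB"
      by (intro lin_hom_mult_left kAB_alg lin_hom_id basis_pair_closed pq)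
    have "basis_elt K (p, q) \<otimes>\<^bsub>kAB\<^esub> r \<in> bilin_rels K A B" if "r \<in> bilin_rels K A B" for r
      using that
      by (cases rule: bilin_rels_cases)
         (auto simp: lin_hom_minus[OF F.module_axioms F.module_axioms f] lin_hom_add[OF f] lin_hom_smult[OF f]
            basis_pair_closed basis_pair_mult pq A.r_distr B.r_distr A.smult_mult_right B.smult_mult_right
            intro!: bilin_rels_intros)
    then have "?N \<subseteq> {n \<in> carrier kAB. basis_elt K (p, q) \<otimes>\<^bsub>kAB\<^esub> n \<in> ?N}"
      using bilin_rels_in_sub bilin_rels_subset by (intro bilin_sub_minimal pre f) auto
    then show ?thesis using r by auto
  qed
  have r: "r \<otimes>\<^bsub>kAB\<^esub> basis_elt K (p, q) \<in> ?N" if pq: "p \<in> carrier A" "q \<in> carrier B" and r: "r \<in> ?N" for p q r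
  proof -
    have f: "(\<lambda>n. n \<otimes>\<^bsub>kAB\<^esub> basis_elt K (p, q)) \<in> lin_hom K kAB kAB"
      by (intro lin_hom_mult_right kAB_alg lin_hom_id basis_pair_closed pq)
    have "r \<otimes>\<^bsub>kAB\<^esub> basis_elt K (p, q) \<in> bilin_rels K A B" if "r \<in> bilin_rels K A B" for r
      using that
      by (cases rule: bilin_rels_cases)
         (auto simp: lin_hom_minus[OF F.module_axioms F.module_axioms f] lin_hom_add[OF f] lin_hom_smult[OF f]
            basis_pair_closed basis_pair_mult pq A.l_distr B.l_distr A.smult_mult_left B.smult_mult_left
            intro!: bilin_rels_intros)
    then have "?N \<subseteq> {n \<in> carrier kAB. n \<otimes>\<^bsub>kAB\<^esub> basis_elt K (p, q) \<in> ?N}"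
      using bilin_rels_in_sub bilin_rels_subset by (intro bilin_sub_minimal pre f) auto
    then show ?thesis using r by auto
  qed
  note ind = monoid_alg_induct[OF unital_algebra_cring[OF A] DirProd_monoid']
  note N0 = submodule_zero[OF sm]
  have sub: "n \<in> carrier kAB" if "n \<in> ?N" for n using that bilin_sub_subset by auto
  show ?thesis
  proof (rule idealI)
    show "ring kAB" by (rule F.ring_axioms)
    show "subgroup ?N (add_monoid kAB)" by (rule submodule.axioms(1)[OF sm])
  next
    fix n f assume n: "n \<in> ?N" and f: "f \<in> carrier kAB"
    show "f \<otimes>\<^bsub>kAB\<^esub> n \<in> ?N"
      using f(1)
      by (rule ind) (use n N0 in \<open>auto simp: sub basis_pair_closed F.smult_mult_left F.l_distr
          F.submoduleE(4,5)[OF sm] l DirProd_carrier\<close>)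
    show "n \<otimes>\<^bsub>kAB\<^esub> f \<in> ?N"
      using f
      by (rule ind) (use n N0 in \<open>auto simp: sub basis_pair_closed F.smult_mult_right F.r_distr
          F.submoduleE(4,5)[OF sm] r DirProd_carrier\<close>)
  qed
qed

lemma tensor_unital_algebra: "unital_algebra K (tensor K A B)"
  unfolding tensor_def by (rule quot_alg_unital_algebra[OF kAB_alg bilin_sub_ideal])

interpretation T: unital_algebra K "tensor K A B" by (rule tensor_unital_algebra)

lemma tens_closed: "\<lbrakk>a \<in> carrier A; b \<in> carrier B\<rbrakk> \<Longrightarrow> tens K A B a b \<in> carrier (tensor K A B)"
  unfolding tensor_def tens_def
  by (intro quot_map_closed[OF kAB_alg bilin_sub_ideal] basis_pair_closed)

lemma tens_mult:
  "\<lbrakk>a \<in> carrier A; b \<in> carrier B; a' \<in> carrier A; b' \<in> carrier B\<rbrakk> \<Longrightarrow>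
    tens K A B a b \<otimes>\<^bsub>tensor K A B\<^esub> tens K A B a' b' = tens K A B (a \<otimes>\<^bsub>A\<^esub> a') (b \<otimes>\<^bsub>B\<^esub> b')"
  unfolding tensor_def tens_def
  by (simp add: quot_map_mult[OF kAB_alg bilin_sub_ideal, symmetric] basis_pair_closed basis_pair_mult)

lemma tensor_one: "\<one>\<^bsub>tensor K A B\<^esub> = tens K A B \<one>\<^bsub>A\<^esub> \<one>\<^bsub>B\<^esub>"
  unfolding tensor_def tens_def quot_alg_sel(4)
  by (simp add: monoid_alg_one[OF unital_algebra_cring[OF A] DirProd_monoid'])

lemma tens_bilin: "tens K A B \<in> bilin K A B (tensor K A B)"
proof -
  note h = quot_map_add[OF kAB_alg bilin_sub_ideal, symmetric]
    quot_map_smult[OF kAB_alg bilin_sub_ideal, symmetric]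
  note e = iffD2[OF quot_map_eq_iff[OF kAB_alg bilin_sub_ideal]]
  note i = bilin_rels_intros[THEN subsetD[OF bilin_rels_in_sub]]
  show ?thesis
    by (intro bilinI lin_homI tens_closed)
       (unfold tensor_def tens_def, simp_all add: h basis_pair_closed,
         (rule e; simp add: basis_pair_closed i)+)
qed

lemmas tens_lin_left = bilinD(1)[OF tens_bilin] and tens_lin_right = bilinD(2)[OF tens_bilin]

text \<open>
  Scalars are absorbed into the left factor, hence sums of pure tensors exhaust the tensor product.
\<close>

lemma tensor_induct:
  assumes t: "t \<in> carrier (tensor K A B)"
    and pure: "\<And>a b. \<lbrakk>a \<in> carrier A; b \<in> carrier B\<rbrakk> \<Longrightarrow> P (tens K A B a b)"
    and add: "\<And>s t. \<lbrakk>s \<in> carrier (tensor K A B); t \<in> carrier (tensor K A B); P s; P t\<rbrakk>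
      \<Longrightarrow> P (s \<oplus>\<^bsub>tensor K A B\<^esub> t)"
  shows "P t"
proof -
  let ?q = "\<lambda>f. bilin_sub K A B +>\<^bsub>kAB\<^esub> f"
  have q: "?q \<in> alg_hom K kAB (tensor K A B)"
    unfolding tensor_def by (rule quot_map_alg_hom[OF kAB_alg bilin_sub_ideal])
  note ql = alg_hom_lin[OF q]
  obtain f where f: "f \<in> carrier kAB" "t = ?q f"
    using t unfolding tensor_def by (rule quot_alg_cases[OF kAB_alg bilin_sub_ideal])
  have "P (?q f)"
    using f(1)
  proof (rule monoid_alg_induct[OF unital_algebra_cring[OF A] DirProd_monoid'])
    have "\<zero>\<^bsub>tensor K A B\<^esub> = tens K A B \<zero>\<^bsub>A\<^esub> \<zero>\<^bsub>B\<^esub>"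
      by (rule lin_hom_zero[OF A.module_axioms T.module_axioms tens_lin_left, symmetric]) simp
    then show "P (?q \<zero>\<^bsub>kAB\<^esub>)"
      using lin_hom_zero[OF F.module_axioms T.module_axioms ql] pure[of "\<zero>\<^bsub>A\<^esub>" "\<zero>\<^bsub>B\<^esub>"] by simp
  next
    fix s m assume s: "s \<in> carrier K" and m: "m \<in> carrier (A \<times>\<times> B)"
    define a b where "a = fst m" and "b = snd m"
    with m have ab: "m = (a, b)" "a \<in> carrier A" "b \<in> carrier B"
      by (simp_all add: DirProd_carrier mem_Times_iff)
    have "?q (s \<odot>\<^bsub>kAB\<^esub> basis_elt K (a, b)) = tens K A B (s \<odot>\<^bsub>A\<^esub> a) b"
      using ab s by (simp add: lin_hom_smult[OF ql] basis_pair_closed tens_def[symmetric]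
          lin_hom_smult[OF tens_lin_left])
    then show "P (?q (s \<odot>\<^bsub>kAB\<^esub> basis_elt K m))"
      using ab s pure[of "s \<odot>\<^bsub>A\<^esub> a" b] by simp
  next
    fix f g assume "f \<in> carrier kAB" "g \<in> carrier kAB" "P (?q f)" "P (?q g)"
    then show "P (?q (f \<oplus>\<^bsub>kAB\<^esub> g))"
      using add[of "?q f" "?q g"] by (simp add: lin_hom_add[OF ql] lin_hom_closed[OF ql])
  qed
  then show ?thesis using f by simp
qed

lemma tensor_lin_eq:
  assumes "f \<in> lin_hom K (tensor K A B) M" "g \<in> lin_hom K (tensor K A B) M"
    and "\<And>a b. \<lbrakk>a \<in> carrier A; b \<in> carrier B\<rbrakk> \<Longrightarrow> f (tens K A B a b) = g (tens K A B a b)"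
    and "t \<in> carrier (tensor K A B)"
  shows "f t = g t"
  using assms(4) by (rule tensor_induct) (simp_all add: assms(3) lin_hom_add[OF assms(1)] lin_hom_add[OF assms(2)])

context
  fixes M :: "('k, 'm, 'z) module_scheme" and \<beta>
  assumes M: "module K M" and \<beta>: "\<beta> \<in> bilin K A B M"
begin

interpretation M: module K M by (rule M)

text \<open>
  The elements at which the linear extension vanishes form a subspace, and bilinearity says that it
  contains the relations.
\<close>

lemma bilin_vanish:
  assumes n: "n \<in> bilin_sub K A B"
  shows "lin_ext K M (\<lambda>(a, b). \<beta> a b) n = \<zero>\<^bsub>M\<^esub>"
proof -
  let ?\<phi> = "\<lambda>(a, b). \<beta> a b"
  have \<phi>: "?\<phi> \<in> carrier (A \<times>\<times> B) \<rightarrow> carrier M"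
    using lin_hom_closed[OF bilinD(1)[OF \<beta>]] by (auto simp: DirProd_carrier)
  note l = lin_ext_lin[OF unital_algebra_cring[OF A] DirProd_monoid' M \<phi>]
  have b: "lin_ext K M ?\<phi> (basis_elt K (a, b)) = \<beta> a b" if "a \<in> carrier A" "b \<in> carrier B" for a b
    using lin_ext_basis[OF unital_algebra_cring[OF A] DirProd_monoid' M \<phi>, of "(a, b)"] that
    by (simp add: DirProd_def)
  have cl: "\<beta> a b \<in> carrier M" if "a \<in> carrier A" "b \<in> carrier B" for a b
    using lin_hom_closed[OF bilinD(1)[OF \<beta>]] that by auto
  have "submodule {n \<in> carrier kAB. lin_ext K M ?\<phi> n = \<zero>\<^bsub>M\<^esub>} K kAB"
    by (rule F.submoduleI)
       (auto simp: lin_hom_add[OF l] lin_hom_smult[OF l] lin_hom_zero[OF F.module_axioms M l]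
          lin_hom_neg[OF F.module_axioms M l])
  moreover have "lin_ext K M ?\<phi> r = \<zero>\<^bsub>M\<^esub>" if "r \<in> bilin_rels K A B" for r
    using that
    by (cases rule: bilin_rels_cases)
       (simp_all add: lin_hom_neg[OF F.module_axioms M l] lin_hom_add[OF l] lin_hom_smult[OF l]
          basis_pair_closed b cl lin_hom_add[OF bilinD(1)[OF \<beta>]] lin_hom_smult[OF bilinD(1)[OF \<beta>]]
          lin_hom_add[OF bilinD(2)[OF \<beta>]] lin_hom_smult[OF bilinD(2)[OF \<beta>]] a_minus_def M.M.r_neg)
  ultimately have "bilin_sub K A B \<subseteq> {n \<in> carrier kAB. lin_ext K M ?\<phi> n = \<zero>\<^bsub>M\<^esub>}"
    using bilin_rels_subset by (intro bilin_sub_minimal) auto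
  then show ?thesis using n by auto
qed

lemma bilin_lin_ext: "lin_ext K M (\<lambda>(a, b). \<beta> a b) \<in> lin_hom K kAB M"
  using lin_hom_closed[OF bilinD(1)[OF \<beta>]]
  by (intro lin_ext_lin[OF unital_algebra_cring[OF A] DirProd_monoid' M]) (auto simp: DirProd_carrier)

lemma tlift_lin: "tlift K M \<beta> \<in> lin_hom K (tensor K A B) M"
  unfolding tlift_def[abs_def] tensor_def
  by (rule quot_induced_lin[OF kAB_alg bilin_sub_ideal M bilin_lin_ext bilin_vanish])

lemma tlift_tens: "\<lbrakk>a \<in> carrier A; b \<in> carrier B\<rbrakk> \<Longrightarrow> tlift K M \<beta> (tens K A B a b) = \<beta> a b"
  unfolding tlift_def tens_def
  apply (subst quot_induced_apply[OF kAB_alg bilin_sub_ideal M bilin_lin_ext bilin_vanish])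
    apply (simp_all add: basis_pair_closed)
  apply (subst lin_ext_basis[OF unital_algebra_cring[OF A] DirProd_monoid' M])
  using lin_hom_closed[OF bilinD(1)[OF \<beta>]] by (auto simp: DirProd_carrier)

end

lemma tlift_alg_hom:
  assumes C: "unital_algebra K C" and \<beta>: "\<beta> \<in> bilin K A B C"
    and one: "\<beta> \<one>\<^bsub>A\<^esub> \<one>\<^bsub>B\<^esub> = \<one>\<^bsub>C\<^esub>"
    and mult: "\<And>a b a' b'. \<lbrakk>a \<in> carrier A; b \<in> carrier B; a' \<in> carrier A; b' \<in> carrier B\<rbrakk>
      \<Longrightarrow> \<beta> (a \<otimes>\<^bsub>A\<^esub> a') (b \<otimes>\<^bsub>B\<^esub> b') = \<beta> a b \<otimes>\<^bsub>C\<^esub> \<beta> a' b'"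
  shows "tlift K C \<beta> \<in> alg_hom K (tensor K A B) C"
proof -
  note C' = unital_algebra_module[OF C]
  note l = tlift_lin[OF C' \<beta>] and v = tlift_tens[OF C' \<beta>]
  show ?thesis
  proof (rule alg_homI[OF l])
    show "tlift K C \<beta> \<one>\<^bsub>tensor K A B\<^esub> = \<one>\<^bsub>C\<^esub>" by (simp add: tensor_one v one)
  next
    fix s t assume s: "s \<in> carrier (tensor K A B)" and t: "t \<in> carrier (tensor K A B)"
    have 1: "tlift K C \<beta> (tens K A B a b \<otimes>\<^bsub>tensor K A B\<^esub> t) = tlift K C \<beta> (tens K A B a b) \<otimes>\<^bsub>C\<^esub> tlift K C \<beta> t"
      if ab: "a \<in> carrier A" "b \<in> carrier B" for a b
      by (rule tensor_lin_eq[OF _ _ _ t])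
         (use ab in \<open>auto intro!: lin_hom_mult_left[OF C] l lin_hom_comp[OF lin_hom_mult_left[OF tensor_unital_algebra lin_hom_id] l]
            simp: tens_closed lin_hom_closed[OF l] tens_mult v mult lin_hom_closed[OF bilinD(1)[OF \<beta>]]\<close>)
    show "tlift K C \<beta> (s \<otimes>\<^bsub>tensor K A B\<^esub> t) = tlift K C \<beta> s \<otimes>\<^bsub>C\<^esub> tlift K C \<beta> t"
      by (rule tensor_lin_eq[OF _ _ _ s])
         (use t in \<open>auto intro!: lin_hom_mult_right[OF C] l lin_hom_comp[OF lin_hom_mult_right[OF tensor_unital_algebra lin_hom_id] l]
            simp: 1 tens_closed lin_hom_closed[OF l]\<close>)
  qed
qed

end


lemma lin_hom_cong:
  assumes M: "module K M" and f: "f \<in> lin_hom K M N" and eq: "\<And>x. x \<in> carrier M \<Longrightarrow> f x = g x"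
  shows "g \<in> lin_hom K M N"
proof -
  interpret M: module K M by fact
  show ?thesis
    by (rule lin_homI)
       (simp_all add: eq[symmetric] lin_hom_closed[OF f] lin_hom_add[OF f] lin_hom_smult[OF f])
qed

lemma alg_hom_cong:
  assumes A: "unital_algebra K A" and f: "f \<in> alg_hom K A B" and eq: "\<And>x. x \<in> carrier A \<Longrightarrow> f x = g x"
  shows "g \<in> alg_hom K A B"
proof -
  interpret A: unital_algebra K A by fact
  show ?thesis
    by (rule alg_homI[OF lin_hom_cong[OF A.module_axioms alg_hom_lin[OF f] eq]])
       (simp_all add: eq[symmetric] alg_hom_one[OF f] alg_hom_mult[OF f])
qed

text \<open>Both sides of the equation are linear in each of the two arguments.\<close>

lemma lin_hom_mult_ext:
  assumes T: "unital_algebra K T" and C: "unital_algebra K C" and f: "f \<in> lin_hom K T C"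
    and S: "S \<subseteq> carrier T"
    and gen: "\<And>g h t. \<lbrakk>g \<in> lin_hom K T C; h \<in> lin_hom K T C; \<And>s. s \<in> S \<Longrightarrow> g s = h s; t \<in> carrier T\<rbrakk>
      \<Longrightarrow> g t = h t"
    and mult: "\<And>s t. \<lbrakk>s \<in> S; t \<in> S\<rbrakk> \<Longrightarrow> f (s \<otimes>\<^bsub>T\<^esub> t) = f s \<otimes>\<^bsub>C\<^esub> f t"
    and s: "s \<in> carrier T" and t: "t \<in> carrier T"
  shows "f (s \<otimes>\<^bsub>T\<^esub> t) = f s \<otimes>\<^bsub>C\<^esub> f t"
proof -
  have 1: "f (s \<otimes>\<^bsub>T\<^esub> t) = f s \<otimes>\<^bsub>C\<^esub> f t" if s: "s \<in> S" for s
  proof (rule gen[OF _ _ _ t, where g="\<lambda>t. f (s \<otimes>\<^bsub>T\<^esub> t)"])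
    have sT: "s \<in> carrier T" using s S by auto
    show "(\<lambda>t. f (s \<otimes>\<^bsub>T\<^esub> t)) \<in> lin_hom K T C"
      by (rule lin_hom_comp[OF lin_hom_mult_left[OF T lin_hom_id sT] f])
    show "(\<lambda>t. f s \<otimes>\<^bsub>C\<^esub> f t) \<in> lin_hom K T C"
      by (rule lin_hom_mult_left[OF C f lin_hom_closed[OF f sT]])
  qed (rule mult[OF s])
  show ?thesis
  proof (rule gen[OF _ _ _ s, where g="\<lambda>s. f (s \<otimes>\<^bsub>T\<^esub> t)"])
    show "(\<lambda>s. f (s \<otimes>\<^bsub>T\<^esub> t)) \<in> lin_hom K T C"
      by (rule lin_hom_comp[OF lin_hom_mult_right[OF T lin_hom_id t] f])
    show "(\<lambda>s. f s \<otimes>\<^bsub>C\<^esub> f t) \<in> lin_hom K T C"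
      by (rule lin_hom_mult_right[OF C f lin_hom_closed[OF f t]])
  qed (rule 1)
qed

lemma tens_bilin':
  assumes "unital_algebra K A" "unital_algebra K B" "f \<in> lin_hom K C A" "g \<in> lin_hom K D B"
  shows "(\<lambda>x y. tens K A B (f x) (g y)) \<in> bilin K C D (tensor K A B)"
  using assms
  by (intro bilinI lin_hom_comp[OF _ tens_lin_left] lin_hom_comp[OF _ tens_lin_right])
     (auto intro: lin_hom_closed)

context
  fixes K :: "'k ring" and A :: "('k, 'a, 'x) module_scheme" and B :: "('k, 'b, 'y) module_scheme"
    and C :: "('k, 'c, 'z) module_scheme" and D :: "('k, 'd, 'w) module_scheme"
  assumes A: "unital_algebra K A" and B: "unital_algebra K B"
    and C: "unital_algebra K C" and D: "unital_algebra K D"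
begin

lemma tmap_lin:
  "\<lbrakk>f \<in> lin_hom K C A; g \<in> lin_hom K D B\<rbrakk>
    \<Longrightarrow> tmap K A B f g \<in> lin_hom K (tensor K C D) (tensor K A B)"
  unfolding tmap_def
  by (intro tlift_lin[OF C D] unital_algebra_module[OF tensor_unital_algebra[OF A B]] tens_bilin' A B)

lemma tmap_tens:
  "\<lbrakk>f \<in> lin_hom K C A; g \<in> lin_hom K D B; x \<in> carrier C; y \<in> carrier D\<rbrakk>
    \<Longrightarrow> tmap K A B f g (tens K C D x y) = tens K A B (f x) (g y)"
  unfolding tmap_def
  by (intro tlift_tens[OF C D] unital_algebra_module[OF tensor_unital_algebra[OF A B]] tens_bilin' A B)

lemma tmap_alg_hom:
  assumes f: "f \<in> alg_hom K C A" and g: "g \<in> alg_hom K D B"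
  shows "tmap K A B f g \<in> alg_hom K (tensor K C D) (tensor K A B)"
  unfolding tmap_def
  by (rule tlift_alg_hom[OF C D tensor_unital_algebra[OF A B]])
     (auto intro!: tens_bilin' A B simp: alg_hom_lin f g alg_hom_one[OF f] alg_hom_one[OF g]
        tensor_one[OF A B] tens_mult[OF A B] alg_hom_mult[OF f] alg_hom_mult[OF g]
        lin_hom_closed[OF alg_hom_lin[OF f]] lin_hom_closed[OF alg_hom_lin[OF g]])

end

text \<open>
  The associator is a lift whose values are lifts themselves; this gives the linearity of the inner
  lift in the outer variable.
\<close>

lemma tlift_param_lin:
  assumes A: "unital_algebra K A" and B: "unital_algebra K B" and C: "module K C" and M: "module K M"
    and \<beta>: "\<And>c. c \<in> carrier C \<Longrightarrow> \<beta> c \<in> bilin K A B M"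
    and lin: "\<And>a b. \<lbrakk>a \<in> carrier A; b \<in> carrier B\<rbrakk> \<Longrightarrow> (\<lambda>c. \<beta> c a b) \<in> lin_hom K C M"
    and t: "t \<in> carrier (tensor K A B)"
  shows "(\<lambda>c. tlift K M (\<beta> c) t) \<in> lin_hom K C M"
  using t
proof (rule tensor_induct[OF A B])
  fix a b assume ab: "a \<in> carrier A" "b \<in> carrier B"
  show "(\<lambda>c. tlift K M (\<beta> c) (tens K A B a b)) \<in> lin_hom K C M"
    by (rule lin_hom_cong[OF C lin[OF ab]]) (simp add: tlift_tens[OF A B M \<beta>] ab)
next
  fix s t assume st: "s \<in> carrier (tensor K A B)" "t \<in> carrier (tensor K A B)"
    and lin: "(\<lambda>c. tlift K M (\<beta> c) s) \<in> lin_hom K C M" "(\<lambda>c. tlift K M (\<beta> c) t) \<in> lin_hom K C M"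
  show "(\<lambda>c. tlift K M (\<beta> c) (s \<oplus>\<^bsub>tensor K A B\<^esub> t)) \<in> lin_hom K C M"
    by (rule lin_hom_cong[OF C lin_hom_plus[OF M lin]])
       (simp add: lin_hom_add[OF tlift_lin[OF A B M \<beta>]] st)
qed

context
  fixes K :: "'k ring" and A :: "('k, 'a, 'x) module_scheme" and B :: "('k, 'b, 'y) module_scheme"
    and C :: "('k, 'c, 'z) module_scheme"
  assumes A: "unital_algebra K A" and B: "unital_algebra K B" and C: "unital_algebra K C"
begin

lemma tensor3_lin_eq:
  assumes f: "f \<in> lin_hom K (tensor K (tensor K A B) C) M"
    and g: "g \<in> lin_hom K (tensor K (tensor K A B) C) M"
    and eq: "\<And>a b c. \<lbrakk>a \<in> carrier A; b \<in> carrier B; c \<in> carrier C\<rbrakk> \<Longrightarrow>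
      f (tens K (tensor K A B) C (tens K A B a b) c) = g (tens K (tensor K A B) C (tens K A B a b) c)"
    and t: "t \<in> carrier (tensor K (tensor K A B) C)"
  shows "f t = g t"
proof (rule tensor_lin_eq[OF tensor_unital_algebra[OF A B] C f g _ t])
  fix s c assume s: "s \<in> carrier (tensor K A B)" and c: "c \<in> carrier C"
  note l = tens_lin_left[OF tensor_unital_algebra[OF A B] C c]
  show "f (tens K (tensor K A B) C s c) = g (tens K (tensor K A B) C s c)"
    by (rule tensor_lin_eq[OF A B lin_hom_comp[OF l f] lin_hom_comp[OF l g] _ s]) (simp add: eq c)
qed

lemma tassoc_bilin:
  shows "c \<in> carrier C \<Longrightarrow> (\<lambda>a b. tens K A (tensor K B C) a (tens K B C b c))
      \<in> bilin K A B (tensor K A (tensor K B C))"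
    and "(\<lambda>Y c. tlift K (tensor K A (tensor K B C))
        (\<lambda>a b. tens K A (tensor K B C) a (tens K B C b c)) Y)
      \<in> bilin K (tensor K A B) C (tensor K A (tensor K B C))"
proof -
  note BC = tensor_unital_algebra[OF B C]
  note T = unital_algebra_module[OF tensor_unital_algebra[OF A BC]]
  show 1: "(\<lambda>a b. tens K A (tensor K B C) a (tens K B C b c))
      \<in> bilin K A B (tensor K A (tensor K B C))" if c: "c \<in> carrier C" for c
    by (rule tens_bilin'[OF A BC lin_hom_id tens_lin_left[OF B C c]])
  show "(\<lambda>Y c. tlift K (tensor K A (tensor K B C))
        (\<lambda>a b. tens K A (tensor K B C) a (tens K B C b c)) Y)
      \<in> bilin K (tensor K A B) C (tensor K A (tensor K B C))"
  proof (rule bilinI)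
    fix c assume "c \<in> carrier C"
    then show "(\<lambda>Y. tlift K (tensor K A (tensor K B C))
        (\<lambda>a b. tens K A (tensor K B C) a (tens K B C b c)) Y)
      \<in> lin_hom K (tensor K A B) (tensor K A (tensor K B C))"
      by (intro tlift_lin[OF A B T] 1)
  next
    fix Y assume Y: "Y \<in> carrier (tensor K A B)"
    show "(\<lambda>c. tlift K (tensor K A (tensor K B C))
        (\<lambda>a b. tens K A (tensor K B C) a (tens K B C b c)) Y)
      \<in> lin_hom K C (tensor K A (tensor K B C))"
      by (rule tlift_param_lin[OF A B unital_algebra_module[OF C] T 1 _ Y])
         (auto intro!: lin_hom_comp[OF tens_lin_right[OF B C] tens_lin_right[OF A BC]])
  qed
qed

lemma tassoc_lin:
  "tassoc K A B C \<in> lin_hom K (tensor K (tensor K A B) C) (tensor K A (tensor K B C))"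
  unfolding tassoc_def Let_def
  by (rule tlift_lin[OF tensor_unital_algebra[OF A B] C
        unital_algebra_module[OF tensor_unital_algebra[OF A tensor_unital_algebra[OF B C]]] tassoc_bilin(2)])

lemma tassoc_tens:
  assumes "a \<in> carrier A" "b \<in> carrier B" "c \<in> carrier C"
  shows "tassoc K A B C (tens K (tensor K A B) C (tens K A B a b) c)
    = tens K A (tensor K B C) a (tens K B C b c)"
  unfolding tassoc_def Let_def
  using assms
  by (simp add: tassoc_bilin tens_closed[OF A B]
      tlift_tens[OF tensor_unital_algebra[OF A B] C
        unital_algebra_module[OF tensor_unital_algebra[OF A tensor_unital_algebra[OF B C]]]]
      tlift_tens[OF A B
        unital_algebra_module[OF tensor_unital_algebra[OF A tensor_unital_algebra[OF B C]]]])

lemma tassoc_alg_hom: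
  "tassoc K A B C \<in> alg_hom K (tensor K (tensor K A B) C) (tensor K A (tensor K B C))"
proof (rule alg_homI[OF tassoc_lin])
  note AB = tensor_unital_algebra[OF A B] and BC = tensor_unital_algebra[OF B C]
  interpret A: unital_algebra K A by (rule A)
  interpret B: unital_algebra K B by (rule B)
  interpret C: unital_algebra K C by (rule C)
  show "tassoc K A B C \<one>\<^bsub>tensor K (tensor K A B) C\<^esub> = \<one>\<^bsub>tensor K A (tensor K B C)\<^esub>"
    by (simp add: tensor_one AB BC A B C tassoc_tens)
  fix s t assume s: "s \<in> carrier (tensor K (tensor K A B) C)" and t: "t \<in> carrier (tensor K (tensor K A B) C)"
  let ?S = "{tens K (tensor K A B) C (tens K A B a b) c | a b c. a \<in> carrier A \<and> b \<in> carrier B \<and> c \<in> carrier C}"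
  show "tassoc K A B C (s \<otimes>\<^bsub>tensor K (tensor K A B) C\<^esub> t)
      = tassoc K A B C s \<otimes>\<^bsub>tensor K A (tensor K B C)\<^esub> tassoc K A B C t"
  proof (rule lin_hom_mult_ext[OF tensor_unital_algebra[OF AB C] tensor_unital_algebra[OF A BC] tassoc_lin, where S="?S"])
    show "?S \<subseteq> carrier (tensor K (tensor K A B) C)"
      by (auto intro!: tens_closed AB C A B)
  next
    fix g h u
    assume g: "g \<in> lin_hom K (tensor K (tensor K A B) C) (tensor K A (tensor K B C))"
      and h: "h \<in> lin_hom K (tensor K (tensor K A B) C) (tensor K A (tensor K B C))"
      and eq: "\<And>s. s \<in> ?S \<Longrightarrow> g s = h s" and u: "u \<in> carrier (tensor K (tensor K A B) C)"
    show "g u = h u"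
      by (rule tensor3_lin_eq[OF g h eq u]) (rule CollectI, intro exI conjI, rule refl)
  next
    fix s t assume "s \<in> ?S" "t \<in> ?S"
    then show "tassoc K A B C (s \<otimes>\<^bsub>tensor K (tensor K A B) C\<^esub> t)
        = tassoc K A B C s \<otimes>\<^bsub>tensor K A (tensor K B C)\<^esub> tassoc K A B C t"
      by (auto simp: tens_mult AB BC A B C tassoc_tens tens_closed)
  qed (fact s t)+
qed

end

text \<open>
  The constructions depend on the module part of a record only, so they do not distinguish a Hopf
  algebra from its underlying algebra.
\<close>

lemma truncate_eq_iff:
  "module.truncate A = module.truncate A' \<longleftrightarrow> carrier A = carrier A' \<and> monoid.mult A = monoid.mult A' \<and>
    one A = one A' \<and> ring.zero A = ring.zero A' \<and> ring.add A = ring.add A' \<and> smult A = smult A'"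
  by (auto simp: module.defs)

lemma tens_cong:
  assumes "module.truncate A = module.truncate A'" "module.truncate B = module.truncate B'"
  shows "tensor K A B = tensor K A' B'" "tens K A B = tens K A' B'"
  using assms unfolding truncate_eq_iff
  by (simp_all add: tensor_def tens_def[abs_def] bilin_sub_def bilin_rels_def DirProd_def)

lemma lin_hom_truncate:
  assumes "module.truncate A = module.truncate A'" "module.truncate B = module.truncate B'"
  shows "lin_hom K A B = lin_hom K A' B'" "alg_hom K A B = alg_hom K A' B'"
  using assms unfolding truncate_eq_iff
  by (simp_all add: lin_hom_def alg_hom_def ring_hom_def)

lemma unital_algebra_truncate:
  assumes A: "unital_algebra K A" and eq: "module.truncate A = module.truncate A'"
  shows "unital_algebra K A'"
proof -
  interpret A: unital_algebra K A by (rule A)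
  have e: "carrier A' = carrier A" "monoid.mult A' = monoid.mult A" "one A' = one A"
    "ring.zero A' = ring.zero A" "ring.add A' = ring.add A" "smult A' = smult A"
    using eq unfolding truncate_eq_iff by simp_all
  have neg: "\<exists>y\<in>carrier A. y \<oplus>\<^bsub>A\<^esub> x = \<zero>\<^bsub>A\<^esub>" if "x \<in> carrier A" for x
    using that by (intro bexI[of _ "\<ominus>\<^bsub>A\<^esub> x"]) (simp_all add: A.M.l_neg)
  show ?thesis
    by (rule unital_algebraI[OF unital_algebra_cring[OF A]])
       (simp_all add: e A.M.a_ac A.m_assoc A.l_distr A.r_distr A.smult_l_distr
          A.smult_r_distr A.smult_assoc1 A.smult_mult_left A.smult_mult_right neg)
qed

lemma base_alg_sel:
  "carrier (base_alg K) = carrier K" "monoid.mult (base_alg K) = monoid.mult K"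
  "one (base_alg K) = one K" "ring.zero (base_alg K) = ring.zero K"
  "ring.add (base_alg K) = ring.add K" "smult (base_alg K) = monoid.mult K"
  by (simp_all add: base_alg_def ring.defs module.defs fun_eq_iff)

lemma base_alg_unital_algebra:
  assumes "cring K" shows "unital_algebra K (base_alg K)"
proof -
  interpret K: cring K by fact
  have neg: "\<exists>y\<in>carrier K. y \<oplus>\<^bsub>K\<^esub> x = \<zero>\<^bsub>K\<^esub>" if "x \<in> carrier K" for x
    using that by (intro bexI[of _ "\<ominus>\<^bsub>K\<^esub> x"]) (simp_all add: K.l_neg)
  show ?thesis
    by (rule unital_algebraI[OF assms])
       (simp_all add: base_alg_sel K.a_ac K.m_assoc K.l_distr K.r_distr K.m_lcomm neg)
qed

lemma opp_alg_sel:
  "carrier (opp_alg A) = carrier A" "x \<otimes>\<^bsub>opp_alg A\<^esub> y = y \<otimes>\<^bsub>A\<^esub> x"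
  "one (opp_alg A) = one A" "ring.zero (opp_alg A) = ring.zero A"
  "ring.add (opp_alg A) = ring.add A" "smult (opp_alg A) = smult A"
  by (simp_all add: opp_alg_def)

lemma opp_alg_unital_algebra:
  assumes A: "unital_algebra K A" shows "unital_algebra K (opp_alg A)"
proof -
  interpret A: unital_algebra K A by (rule A)
  have neg: "\<exists>y\<in>carrier A. y \<oplus>\<^bsub>A\<^esub> x = \<zero>\<^bsub>A\<^esub>" if "x \<in> carrier A" for x
    using that by (intro bexI[of _ "\<ominus>\<^bsub>A\<^esub> x"]) (simp_all add: A.M.l_neg)
  show ?thesis
    by (rule unital_algebraI[OF unital_algebra_cring[OF A]])
       (simp_all add: opp_alg_sel A.M.a_ac A.m_assoc A.l_distr A.r_distr A.smult_l_distr
          A.smult_r_distr A.smult_assoc1 A.smult_mult_left A.smult_mult_right neg)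
qed

lemma lin_hom_opp: "lin_hom K M (opp_alg A) = lin_hom K M A"
  by (simp add: lin_hom_def opp_alg_sel)


section \<open>Free algebras\<close>

lemma word_monoid: "monoid word_monoid"
  by (rule monoidI) (simp_all add: word_monoid_def)

context
  fixes K :: "'k ring" assumes K: "cring K"
begin

lemma free_alg_unital_algebra: "unital_algebra K (free_alg K)"
  unfolding free_alg_def by (rule monoid_alg_unital_algebra[OF K word_monoid])

lemma free_gen_closed: "free_gen K x \<in> carrier (free_alg K)"
  unfolding free_alg_def free_gen_def
  by (rule basis_elt_carrier[OF K word_monoid]) (simp add: word_monoid_def)

lemma free_alg_word:
  fixes x :: 'g
  shows "basis_elt K ([] :: 'g list) = \<one>\<^bsub>free_alg K\<^esub>"
    and "basis_elt K (x # w) = free_gen K x \<otimes>\<^bsub>free_alg K\<^esub> basis_elt K w"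
proof -
  have word: "\<one>\<^bsub>word_monoid\<^esub> = []" "v \<otimes>\<^bsub>word_monoid\<^esub> w = v @ w" "carrier word_monoid = UNIV"
    for v w :: "'g list"
    by (simp_all add: word_monoid_def)
  show "basis_elt K ([] :: 'g list) = \<one>\<^bsub>free_alg K\<^esub>"
    by (simp add: free_alg_def monoid_alg_one[OF K word_monoid] word)
  show "basis_elt K (x # w) = free_gen K x \<otimes>\<^bsub>free_alg K\<^esub> basis_elt K w"
    using basis_elt_mult[OF K word_monoid, of "[x]" w] by (simp add: free_alg_def free_gen_def word)
qed

text \<open>
  A word is a product of generators bracketed to the right, hence one-sided multiplication by
  generators reaches all words.
\<close>

lemma free_alg_induct:
  fixes f :: "'g list \<Rightarrow> 'k"
  assumes f: "f \<in> carrier (free_alg K)"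
    and one: "P \<one>\<^bsub>free_alg K\<^esub>"
    and gen: "\<And>x f. \<lbrakk>f \<in> carrier (free_alg K); P f\<rbrakk> \<Longrightarrow> P (free_gen K x \<otimes>\<^bsub>free_alg K\<^esub> f)"
    and add: "\<And>f g. \<lbrakk>f \<in> carrier (free_alg K); g \<in> carrier (free_alg K); P f; P g\<rbrakk>
      \<Longrightarrow> P (f \<oplus>\<^bsub>free_alg K\<^esub> g)"
    and smult: "\<And>a f. \<lbrakk>a \<in> carrier K; f \<in> carrier (free_alg K); P f\<rbrakk> \<Longrightarrow> P (a \<odot>\<^bsub>free_alg K\<^esub> f)"
  shows "P f"
proof -
  interpret F: unital_algebra K "free_alg K :: ('k, 'g list \<Rightarrow> 'k) module" by (rule free_alg_unital_algebra)
  have word: "basis_elt K w \<in> carrier (free_alg K) \<and> P (basis_elt K w)" for w :: "'g list"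
    by (induction w) (simp_all add: free_alg_word one gen free_gen_closed)
  show ?thesis
  proof (rule monoid_alg_induct[OF K word_monoid f[unfolded free_alg_def]])
    have "P (\<zero>\<^bsub>K\<^esub> \<odot>\<^bsub>free_alg K\<^esub> \<one>\<^bsub>free_alg K\<^esub>)" by (intro smult one) auto
    then show "P \<zero>\<^bsub>monoid_alg K word_monoid\<^esub>" by (simp add: free_alg_def[symmetric])
  qed (use word smult add in \<open>auto simp: free_alg_def[symmetric]\<close>)
qed

context
  fixes B :: "('k, 'b, 'y) module_scheme" and g :: "'g \<Rightarrow> 'b"
  assumes B: "unital_algebra K B" and g: "\<And>x. g x \<in> carrier B"
begin

interpretation B: unital_algebra K B by (rule B)

lemma word_prod_closed: "foldr (\<lambda>x y. g x \<otimes>\<^bsub>B\<^esub> y) w \<one>\<^bsub>B\<^esub> \<in> carrier B"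
  by (induction w) (simp_all add: g)

lemma word_prod_append:
  "foldr (\<lambda>x y. g x \<otimes>\<^bsub>B\<^esub> y) (v @ w) \<one>\<^bsub>B\<^esub> = foldr (\<lambda>x y. g x \<otimes>\<^bsub>B\<^esub> y) v \<one>\<^bsub>B\<^esub> \<otimes>\<^bsub>B\<^esub> foldr (\<lambda>x y. g x \<otimes>\<^bsub>B\<^esub> y) w \<one>\<^bsub>B\<^esub>"
  using word_prod_closed
  by (induction v) (simp_all add: g B.m_assoc word_prod_closed del: foldr_append)

lemma free_eval_alg_hom: "free_eval K B g \<in> alg_hom K (free_alg K) B"
  unfolding free_eval_def free_alg_def
  by (rule lin_ext_alg_hom[OF K word_monoid B])
     (auto simp: word_monoid_def word_prod_closed word_prod_append simp del: foldr_append)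

lemma free_eval_gen: "free_eval K B g (free_gen K x) = g x"
  unfolding free_eval_def free_gen_def
  by (subst lin_ext_basis[OF K word_monoid unital_algebra_module[OF B]])
     (auto simp: word_monoid_def word_prod_closed g)

end

text \<open>The kernel is an ideal that contains the generators.\<close>

lemma alg_hom_vanish_genideal:
  assumes A: "unital_algebra K A" and B: "unital_algebra K B" and f: "f \<in> alg_hom K A B"
    and S: "S \<subseteq> carrier A" "\<And>s. s \<in> S \<Longrightarrow> f s = \<zero>\<^bsub>B\<^esub>" and n: "n \<in> Idl\<^bsub>A\<^esub> S"
  shows "f n = \<zero>\<^bsub>B\<^esub>"
proof -
  have fr: "f \<in> ring_hom A B" using f by (simp only: alg_hom_def Int_iff)
  have h: "ring_hom_ring A B f"
    by (rule ring_hom_ringI2[OF unital_algebra_ring[OF A] unital_algebra_ring[OF B] fr])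
  have "Idl\<^bsub>A\<^esub> S \<subseteq> a_kernel A B f"
    by (rule ring.genideal_minimal[OF unital_algebra_ring[OF A] ring_hom_ring.kernel_is_ideal[OF h]])
       (use S in \<open>auto simp: a_kernel_def'\<close>)
  then have "n \<in> a_kernel A B f" using n by (rule subsetD)
  then show ?thesis by (simp add: a_kernel_def')
qed

context
  fixes J :: "('g list \<Rightarrow> 'k) set"
  assumes J: "ideal J (free_alg K)"
begin

lemma quot_free_unital_algebra: "unital_algebra K (quot_alg (free_alg K) J)"
  by (rule quot_alg_unital_algebra[OF free_alg_unital_algebra J])

lemma quot_gen_closed: "quot_gen K J x \<in> carrier (quot_alg (free_alg K) J)"
  unfolding quot_gen_def by (intro quot_map_closed[OF free_alg_unital_algebra J] free_gen_closed)

lemma quot_free_induct: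
  assumes y: "y \<in> carrier (quot_alg (free_alg K) J)"
    and one: "P \<one>\<^bsub>quot_alg (free_alg K) J\<^esub>"
    and gen: "\<And>x y. \<lbrakk>y \<in> carrier (quot_alg (free_alg K) J); P y\<rbrakk>
      \<Longrightarrow> P (quot_gen K J x \<otimes>\<^bsub>quot_alg (free_alg K) J\<^esub> y)"
    and add: "\<And>y z. \<lbrakk>y \<in> carrier (quot_alg (free_alg K) J); z \<in> carrier (quot_alg (free_alg K) J); P y; P z\<rbrakk>
      \<Longrightarrow> P (y \<oplus>\<^bsub>quot_alg (free_alg K) J\<^esub> z)"
    and smult: "\<And>a y. \<lbrakk>a \<in> carrier K; y \<in> carrier (quot_alg (free_alg K) J); P y\<rbrakk>
      \<Longrightarrow> P (a \<odot>\<^bsub>quot_alg (free_alg K) J\<^esub> y)"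
  shows "P y"
proof -
  note q = quot_map_alg_hom[OF free_alg_unital_algebra J]
  note ql = alg_hom_lin[OF q]
  obtain f where f: "f \<in> carrier (free_alg K)" "y = J +>\<^bsub>free_alg K\<^esub> f"
    using y by (rule quot_alg_cases[OF free_alg_unital_algebra J])
  have "P (J +>\<^bsub>free_alg K\<^esub> f)"
    using f(1)
    by (rule free_alg_induct)
       (use one gen add smult in \<open>simp_all add: alg_hom_one[OF q] alg_hom_mult[OF q] free_gen_closed
         lin_hom_add[OF ql] lin_hom_smult[OF ql] lin_hom_closed[OF ql] quot_gen_def[symmetric]\<close>)
  then show ?thesis using f by simp
qed

lemma quot_free_hom_eq:
  assumes "f \<in> alg_hom K (quot_alg (free_alg K) J) B" "g \<in> alg_hom K (quot_alg (free_alg K) J) B"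
    and "\<And>x. f (quot_gen K J x) = g (quot_gen K J x)" and "u \<in> carrier (quot_alg (free_alg K) J)"
  shows "f u = g u"
  using assms(4)
  by (rule quot_free_induct)
     (simp_all add: assms(3) alg_hom_one[OF assms(1)] alg_hom_one[OF assms(2)]
        alg_hom_mult[OF assms(1)] alg_hom_mult[OF assms(2)] quot_gen_closed
        lin_hom_add[OF alg_hom_lin[OF assms(1)]] lin_hom_add[OF alg_hom_lin[OF assms(2)]]
        lin_hom_smult[OF alg_hom_lin[OF assms(1)]] lin_hom_smult[OF alg_hom_lin[OF assms(2)]])

lemma quot_free_eval:
  assumes B: "unital_algebra K B" and g: "\<And>x. g x \<in> carrier B"
    and v: "\<And>n. n \<in> J \<Longrightarrow> free_eval K B g n = \<zero>\<^bsub>B\<^esub>"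
  shows "(\<lambda>Y. the_elem (free_eval K B g ` Y)) \<in> alg_hom K (quot_alg (free_alg K) J) B"
    and "the_elem (free_eval K B g ` quot_gen K J x) = g x"
proof -
  note h = free_eval_alg_hom[of B g, OF B g]
  show "(\<lambda>Y. the_elem (free_eval K B g ` Y)) \<in> alg_hom K (quot_alg (free_alg K) J) B"
    by (rule quot_induced_alg_hom[OF free_alg_unital_algebra J B h v])
  show "the_elem (free_eval K B g ` quot_gen K J x) = g x"
    unfolding quot_gen_def
    by (subst quot_induced_apply[OF free_alg_unital_algebra J unital_algebra_module[OF B] alg_hom_lin[OF h] v])
       (simp_all add: free_gen_closed free_eval_gen B g)
qed

end

end


section \<open>Linear functionals\<close>

lemma lin_hom_scalar:
  assumes N: "module K N" and l: "l \<in> lin_hom K M (base_alg K)" and z: "z \<in> carrier N"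
  shows "(\<lambda>y. l y \<odot>\<^bsub>N\<^esub> z) \<in> lin_hom K M N"
proof -
  interpret N: module K N by fact
  have "l y \<in> carrier K" if "y \<in> carrier M" for y
    using lin_hom_closed[OF l that] by (simp add: base_alg_sel)
  then show ?thesis
    by (intro lin_homI)
       (simp_all add: z lin_hom_add[OF l] lin_hom_smult[OF l] base_alg_sel N.smult_l_distr N.smult_assoc1)
qed

text \<open>
  A subspace that is maximal among those containing \<open>U\<close> but not \<open>v\<close> is a complement of the line
  spanned by \<open>v\<close>, and the coordinate along this line is the functional.
\<close>

lemma functional_separation:
  fixes M (structure)
  assumes K: "field K" and M: "module K M" and U: "submodule U K M"
    and v: "v \<in> carrier M" "v \<notin> U"
  obtains l where "l \<in> lin_hom K M (base_alg K)" "l v = \<one>\<^bsub>K\<^esub>" "\<And>u. u \<in> U \<Longrightarrow> l u = \<zero>\<^bsub>K\<^esub>"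
proof -
  interpret K: field K by (rule K)
  interpret M: module K M by (rule M)
  (* Any two elements of a chain are comparable, so the union of a chain is a subspace and Zorn's
     lemma applies. *)
  let ?A = "{W. submodule W K M \<and> U \<subseteq> W \<and> v \<notin> W}"
  have zero: "\<zero> \<in> W" if "submodule W K M" for W
    using subgroup.one_closed[OF submodule.axioms(1)[OF that]] by simp
  have "\<exists>W\<in>?A. \<forall>V\<in>?A. W \<subseteq> V \<longrightarrow> V = W"
  proof (rule subset_Zorn_nonempty)
    show "?A \<noteq> {}" using U v by blast
  next
    fix C assume ne: "C \<noteq> {}" and chain: "subset.chain ?A C"
    have sub: "submodule W K M" "U \<subseteq> W" "v \<notin> W" if "W \<in> C" for W
      using chain that unfolding subset.chain_def by auto
    have lin: "V \<subseteq> W \<or> W \<subseteq> V" if "V \<in> C" "W \<in> C" for V W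
      using chain that unfolding subset_chain_def by blast
    have "submodule (\<Union>C) K M"
    proof (rule M.submoduleI)
      show "\<Union>C \<subseteq> carrier M" using sub(1) M.submoduleE(1) by blast
      show "\<zero> \<in> \<Union>C" using ne sub(1) zero by blast
      show "\<ominus> x \<in> \<Union>C" if "x \<in> \<Union>C" for x using that sub(1) M.submoduleE(3) by blast
      show "a \<odot> x \<in> \<Union>C" if "a \<in> carrier K" "x \<in> \<Union>C" for a x
        using that sub(1) M.submoduleE(4) by blast
    next
      fix x y assume "x \<in> \<Union>C" "y \<in> \<Union>C"
      then obtain V W where VW: "V \<in> C" "x \<in> V" "W \<in> C" "y \<in> W" by blast
      then have "x \<oplus> y \<in> V \<or> x \<oplus> y \<in> W"
        using lin[OF VW(1,3)] M.submoduleE(5)[OF sub(1)] by blast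
      then show "x \<oplus> y \<in> \<Union>C" using VW by blast
    qed
    then show "\<Union>C \<in> ?A" using ne sub by blast
  qed
  then obtain W where W: "submodule W K M" "U \<subseteq> W" "v \<notin> W"
    and max: "\<And>V. \<lbrakk>submodule V K M; U \<subseteq> V; v \<notin> V; W \<subseteq> V\<rbrakk> \<Longrightarrow> V = W"
    by auto
  note WE = M.submoduleE[OF W(1)]
  have Wc: "w \<in> carrier M" if "w \<in> W" for w using WE(1) that by auto
  have Wminus: "x \<ominus> y \<in> W" if "x \<in> W" "y \<in> W" for x y
    using that by (simp add: a_minus_def WE)
  have neg_zero: "\<ominus> \<zero> = \<zero>" using M.M.r_neg[of "\<zero>"] by simp
  have ex: "\<exists>a\<in>carrier K. x \<ominus> a \<odot> v \<in> W" if x: "x \<in> carrier M" for x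
  proof (cases "x \<in> W")
    case True
    then show ?thesis using v x by (intro bexI[of _ "\<zero>\<^bsub>K\<^esub>"]) (simp_all add: a_minus_def neg_zero)
  next
    case False
    let ?V = "{w \<oplus> b \<odot> x | w b. w \<in> W \<and> b \<in> carrier K}"
    have V: "w \<oplus> b \<odot> x \<in> ?V" if "w \<in> W" "b \<in> carrier K" for w b using that by blast
    have sm: "submodule ?V K M"
    proof (rule M.submoduleI)
      show "?V \<subseteq> carrier M" using x Wc by auto
      show "\<zero> \<in> ?V" using V[OF zero[OF W(1)] K.zero_closed] x by simp
    next
      fix y assume "y \<in> ?V"
      then obtain w b where y: "y = w \<oplus> b \<odot> x" "w \<in> W" "b \<in> carrier K" by blast
      then have "\<ominus> y = \<ominus> w \<oplus> (\<ominus>\<^bsub>K\<^esub> b) \<odot> x"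
        using x Wc by (simp add: M.M.minus_add M.smult_l_minus)
      then show "\<ominus> y \<in> ?V" using V[of "\<ominus> w" "\<ominus>\<^bsub>K\<^esub> b"] y WE by simp
    next
      fix y z assume "y \<in> ?V" "z \<in> ?V"
      then obtain w b w' b' where y: "y = w \<oplus> b \<odot> x" "w \<in> W" "b \<in> carrier K"
        and z: "z = w' \<oplus> b' \<odot> x" "w' \<in> W" "b' \<in> carrier K" by blast
      then have "y \<oplus> z = (w \<oplus> w') \<oplus> (b \<oplus>\<^bsub>K\<^esub> b') \<odot> x"
        using x Wc by (simp add: M.M.a_ac M.smult_l_distr)
      then show "y \<oplus> z \<in> ?V" using V[of "w \<oplus> w'" "b \<oplus>\<^bsub>K\<^esub> b'"] y z WE by simp
    next
      fix a y assume a: "a \<in> carrier K" and "y \<in> ?V"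
      then obtain w b where y: "y = w \<oplus> b \<odot> x" "w \<in> W" "b \<in> carrier K" by blast
      then have "a \<odot> y = a \<odot> w \<oplus> (a \<otimes>\<^bsub>K\<^esub> b) \<odot> x"
        using x Wc a by (simp add: M.smult_r_distr M.smult_assoc1)
      then show "a \<odot> y \<in> ?V" using V[of "a \<odot> w" "a \<otimes>\<^bsub>K\<^esub> b"] y a WE by simp
    qed
    have WV: "W \<subseteq> ?V"
    proof
      fix w assume "w \<in> W"
      then show "w \<in> ?V" using V[of w "\<zero>\<^bsub>K\<^esub>"] Wc x by simp
    qed
    have "x \<in> ?V" using V[OF zero[OF W(1)] K.one_closed] x by simp
    then have "?V \<noteq> W" using False by blast
    then have "v \<in> ?V" using max[OF sm _ _ WV] W(2) WV by blast
    then obtain w b where vb: "v = w \<oplus> b \<odot> x" "w \<in> W" "b \<in> carrier K" by blast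
    then have b0: "b \<noteq> \<zero>\<^bsub>K\<^esub>" using W(3) Wc x by auto
    let ?a = "inv\<^bsub>K\<^esub> b"
    have a: "?a \<in> carrier K" "?a \<otimes>\<^bsub>K\<^esub> b = \<one>\<^bsub>K\<^esub>"
      using vb(3) b0 by (auto simp: K.field_Units K.Units_l_inv)
    have "?a \<odot> v = ?a \<odot> w \<oplus> x"
      using vb a x Wc by (simp add: M.smult_r_distr M.smult_assoc1[symmetric])
    moreover have "x \<oplus> (p \<oplus> \<ominus> x) = p" if "p \<in> carrier M" for p
      using x that by (metis M.M.a_lcomm M.M.r_neg M.M.a_inv_closed M.M.r_zero)
    ultimately have "x \<ominus> ?a \<odot> v = \<ominus> (?a \<odot> w)"
      using x Wc vb(2) a by (simp add: a_minus_def M.M.minus_add)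
    then show ?thesis using a WE vb(2) by (intro bexI[of _ ?a]) simp_all
  qed
  have uniq: "a = b" if ab: "a \<in> carrier K" "b \<in> carrier K"
    and x: "x \<in> carrier M" "x \<ominus> a \<odot> v \<in> W" "x \<ominus> b \<odot> v \<in> W" for a b x
  proof (rule ccontr)
    assume "a \<noteq> b"
    then have ne: "a \<ominus>\<^bsub>K\<^esub> b \<noteq> \<zero>\<^bsub>K\<^esub>" using ab by simp
    have "(x \<ominus> b \<odot> v) \<ominus> (x \<ominus> a \<odot> v) = (a \<ominus>\<^bsub>K\<^esub> b) \<odot> v"
      using ab x(1) v
      by (simp add: a_minus_def M.M.minus_add M.M.a_ac M.smult_l_distr M.smult_l_minus
          M.M.r_neg M.M.r_neg1 M.M.r_neg2)
    then have "(a \<ominus>\<^bsub>K\<^esub> b) \<odot> v \<in> W" using Wminus[OF x(3,2)] by simp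
    moreover have "inv\<^bsub>K\<^esub> (a \<ominus>\<^bsub>K\<^esub> b) \<in> carrier K"
      using ab ne by (auto simp: K.field_Units)
    ultimately have "inv\<^bsub>K\<^esub> (a \<ominus>\<^bsub>K\<^esub> b) \<odot> ((a \<ominus>\<^bsub>K\<^esub> b) \<odot> v) \<in> W"
      by (metis WE(4))
    moreover have "inv\<^bsub>K\<^esub> (a \<ominus>\<^bsub>K\<^esub> b) \<otimes>\<^bsub>K\<^esub> (a \<ominus>\<^bsub>K\<^esub> b) = \<one>\<^bsub>K\<^esub>" "inv\<^bsub>K\<^esub> (a \<ominus>\<^bsub>K\<^esub> b) \<in> carrier K"
      using ab ne by (auto simp: K.field_Units K.Units_l_inv)
    ultimately show False using v W(3) ab by (simp add: M.smult_assoc1[symmetric])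
  qed
  (* The coordinate along the line of \<open>v\<close> in the decomposition of \<open>M\<close> into \<open>W\<close> and this line. *)
  define l where "l x = (THE a. a \<in> carrier K \<and> x \<ominus> a \<odot> v \<in> W)" for x
  have l: "l x = a" if "x \<in> carrier M" "a \<in> carrier K" "x \<ominus> a \<odot> v \<in> W" for x a
    unfolding l_def using that uniq by (intro the_equality) blast+
  have lc: "l x \<in> carrier K" "x \<ominus> l x \<odot> v \<in> W" if x: "x \<in> carrier M" for x
    using ex[OF x] l[OF x] by auto
  have "l \<in> lin_hom K M (base_alg K)"
  proof (rule lin_homI)
    fix x y assume x: "x \<in> carrier M" and y: "y \<in> carrier M"
    have "(x \<oplus> y) \<ominus> (l x \<oplus>\<^bsub>K\<^esub> l y) \<odot> v = (x \<ominus> l x \<odot> v) \<oplus> (y \<ominus> l y \<odot> v)"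
      using x y v lc by (simp add: a_minus_def M.smult_l_distr M.M.minus_add M.M.a_ac)
    also have "\<dots> \<in> W" using lc x y WE by simp
    finally show "l (x \<oplus> y) = l x \<oplus>\<^bsub>base_alg K\<^esub> l y"
      using x y lc by (intro l) (simp_all add: base_alg_sel)
  next
    fix a x assume a: "a \<in> carrier K" and x: "x \<in> carrier M"
    have "a \<odot> x \<ominus> (a \<otimes>\<^bsub>K\<^esub> l x) \<odot> v = a \<odot> (x \<ominus> l x \<odot> v)"
      using a x v lc by (simp add: a_minus_def M.smult_r_distr M.smult_assoc1 M.smult_r_minus)
    also have "\<dots> \<in> W" using lc x a WE by simp
    finally show "l (a \<odot> x) = a \<odot>\<^bsub>base_alg K\<^esub> l x"
      using a x lc by (intro l) (simp_all add: base_alg_sel)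
  qed (simp add: lc base_alg_sel)
  moreover have "l v = \<one>\<^bsub>K\<^esub>"
    using v by (intro l) (simp_all add: a_minus_def M.M.r_neg zero W(1))
  moreover have "l u = \<zero>\<^bsub>K\<^esub>" if "u \<in> U" for u
    using that W(2) Wc v by (intro l) (auto simp: a_minus_def neg_zero)
  ultimately show ?thesis by (rule that)
qed


section \<open>Hopf algebras from generators\<close>

lemma bilin_mult:
  assumes "unital_algebra K M" "f \<in> lin_hom K A M" "g \<in> lin_hom K B M"
  shows "(\<lambda>x y. f x \<otimes>\<^bsub>M\<^esub> g y) \<in> bilin K A B M"
  using assms by (intro bilinI lin_hom_mult_left lin_hom_mult_right) (auto intro: lin_hom_closed)

lemma bilin_scale_left:
  assumes M: "module K M" and l: "l \<in> lin_hom K A (base_alg K)" and g: "g \<in> lin_hom K B M"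
  shows "(\<lambda>x y. l x \<odot>\<^bsub>M\<^esub> g y) \<in> bilin K A B M"
proof -
  have "l x \<in> carrier K" if "x \<in> carrier A" for x
    using lin_hom_closed[OF l that] by (simp add: base_alg_sel)
  then show ?thesis
    by (intro bilinI lin_hom_scalar lin_hom_scale M l g lin_hom_closed[OF g])
qed

lemma bilin_scale_right:
  assumes M: "module K M" and l: "l \<in> lin_hom K B (base_alg K)" and g: "g \<in> lin_hom K A M"
  shows "(\<lambda>x y. l y \<odot>\<^bsub>M\<^esub> g x) \<in> bilin K A B M"
proof -
  have "l x \<in> carrier K" if "x \<in> carrier B" for x
    using lin_hom_closed[OF l that] by (simp add: base_alg_sel)
  then show ?thesis
    by (intro bilinI lin_hom_scalar lin_hom_scale M l g lin_hom_closed[OF g])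
qed

text \<open>
  The axioms that involve the comultiplication, at a single element, so that they can be propagated
  from generators to the whole algebra.
\<close>

definition hopf_identities :: "'k ring \<Rightarrow> ('k, 'h) hopf \<Rightarrow> 'h \<Rightarrow> bool"
  where "hopf_identities K H x \<longleftrightarrow>
    tassoc K H H H (tmap K (tensor K H H) H (comult H) (\<lambda>y. y) (comult H x))
      = tmap K H (tensor K H H) (\<lambda>y. y) (comult H) (comult H x) \<and>
    tlift K H (\<lambda>y z. counit H y \<odot>\<^bsub>H\<^esub> z) (comult H x) = x \<and>
    tlift K H (\<lambda>y z. counit H z \<odot>\<^bsub>H\<^esub> y) (comult H x) = x \<and>
    tlift K H (\<lambda>y z. antipode H y \<otimes>\<^bsub>H\<^esub> z) (comult H x) = counit H x \<odot>\<^bsub>H\<^esub> \<one>\<^bsub>H\<^esub> \<and>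
    tlift K H (\<lambda>y z. y \<otimes>\<^bsub>H\<^esub> antipode H z) (comult H x) = counit H x \<odot>\<^bsub>H\<^esub> \<one>\<^bsub>H\<^esub>"

text \<open>
  A Hopf algebra except that the identities of comultiplication, counit and antipode are still to be
  verified; by the lemmas below it suffices to verify them on algebra generators.
\<close>

locale prehopf = unital_algebra K H for K :: "'k ring" and H :: "('k, 'h) hopf" (structure) +
  assumes comult_hom: "comult H \<in> alg_hom K H (tensor K H H)"
    and counit_hom: "counit H \<in> alg_hom K H (base_alg K)"
    and antipode_lin: "antipode H \<in> lin_hom K H H"
    and antipode_one: "antipode H \<one> = \<one>"
    and antipode_mult: "\<lbrakk>x \<in> carrier H; y \<in> carrier H\<rbrakk>
      \<Longrightarrow> antipode H (x \<otimes> y) = antipode H y \<otimes> antipode H x"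
begin

lemma H_alg: "unital_algebra K H" by (rule unital_algebra_axioms)

lemma H_mod: "module K H" by (rule module_axioms)

lemma K_cring: "cring K" by (rule R.cring_axioms)

lemma HH_alg: "unital_algebra K (tensor K H H)" by (intro tensor_unital_algebra H_alg)

lemmas comult_lin = alg_hom_lin[OF comult_hom] and counit_lin = alg_hom_lin[OF counit_hom]
lemmas comult_closed = lin_hom_closed[OF comult_lin] and antipode_closed = lin_hom_closed[OF antipode_lin]

lemma counit_closed: "x \<in> carrier H \<Longrightarrow> counit H x \<in> carrier K"
  using lin_hom_closed[OF counit_lin] by (simp add: base_alg_sel)

lemma counit_mult: "\<lbrakk>x \<in> carrier H; y \<in> carrier H\<rbrakk> \<Longrightarrow> counit H (x \<otimes> y) = counit H x \<otimes>\<^bsub>K\<^esub> counit H y"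
  using alg_hom_mult[OF counit_hom] by (simp add: base_alg_sel)

lemma counit_one: "counit H \<one> = \<one>\<^bsub>K\<^esub>"
  using alg_hom_one[OF counit_hom] by (simp add: base_alg_sel)

lemma left_coassoc_hom:
  "(\<lambda>x. tassoc K H H H (tmap K (tensor K H H) H (comult H) (\<lambda>y. y) (comult H x)))
    \<in> alg_hom K H (tensor K H (tensor K H H))"
  by (rule alg_hom_comp[OF alg_hom_comp[OF comult_hom
        tmap_alg_hom[OF HH_alg H_alg H_alg H_alg comult_hom alg_hom_id]] tassoc_alg_hom[OF H_alg H_alg H_alg]])

lemma right_coassoc_hom:
  "(\<lambda>x. tmap K H (tensor K H H) (\<lambda>y. y) (comult H) (comult H x))
    \<in> alg_hom K H (tensor K H (tensor K H H))"
  by (rule alg_hom_comp[OF comult_hom tmap_alg_hom[OF H_alg HH_alg H_alg H_alg alg_hom_id comult_hom]])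

lemmas counit_bilin = bilin_scale_left[OF H_mod counit_lin lin_hom_id]
  bilin_scale_right[OF H_mod counit_lin lin_hom_id]

lemmas antipode_bilin = bilin_mult[OF H_alg antipode_lin lin_hom_id]
  bilin_mult[OF H_alg lin_hom_id antipode_lin]

lemma counit_homs:
  "(\<lambda>x. tlift K H (\<lambda>y z. counit H y \<odot> z) (comult H x)) \<in> alg_hom K H H"
  "(\<lambda>x. tlift K H (\<lambda>y z. counit H z \<odot> y) (comult H x)) \<in> alg_hom K H H"
  by (rule alg_hom_comp[OF comult_hom tlift_alg_hom[OF H_alg H_alg H_alg]];
      simp add: counit_bilin counit_one counit_mult counit_closed smult_mult_left smult_mult_right
        smult_assoc1[symmetric] R.m_comm)+

lemmas antipode_lins =
  lin_hom_comp[OF comult_lin tlift_lin[OF H_alg H_alg H_mod antipode_bilin(1)]]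
  lin_hom_comp[OF comult_lin tlift_lin[OF H_alg H_alg H_mod antipode_bilin(2)]]

lemmas antipode_tens = tlift_tens[OF H_alg H_alg H_mod antipode_bilin(1)]
  tlift_tens[OF H_alg H_alg H_mod antipode_bilin(2)]

lemmas counit_tens = tlift_tens[OF H_alg H_alg H_mod counit_bilin(1)]
  tlift_tens[OF H_alg H_alg H_mod counit_bilin(2)]

text \<open>
  In \<open>S(x\<^sub>1y\<^sub>1)x\<^sub>2y\<^sub>2 = S(y\<^sub>1)S(x\<^sub>1)x\<^sub>2y\<^sub>2\<close> the inner factor is a scalar; this is why the antipode
  identities for \<open>x\<close> and \<open>y\<close> give that for \<open>xy\<close>.
\<close>

lemma antipode_left_tensor_mult:
  assumes s: "s \<in> carrier (tensor K H H)" and r: "r \<in> carrier K"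
    and eq: "tlift K H (\<lambda>y z. antipode H y \<otimes> z) s = r \<odot> \<one>"
    and t: "t \<in> carrier (tensor K H H)"
  shows "tlift K H (\<lambda>y z. antipode H y \<otimes> z) (s \<otimes>\<^bsub>tensor K H H\<^esub> t)
    = r \<odot> tlift K H (\<lambda>y z. antipode H y \<otimes> z) t"
proof (rule tensor_lin_eq[OF H_alg H_alg _ _ _ t])
  note l = tlift_lin[OF H_alg H_alg H_mod antipode_bilin(1)]
  show "(\<lambda>t. tlift K H (\<lambda>y z. antipode H y \<otimes> z) (s \<otimes>\<^bsub>tensor K H H\<^esub> t)) \<in> lin_hom K (tensor K H H) H"
    by (rule lin_hom_comp[OF lin_hom_mult_left[OF HH_alg lin_hom_id s] l])
  show "(\<lambda>t. r \<odot> tlift K H (\<lambda>y z. antipode H y \<otimes> z) t) \<in> lin_hom K (tensor K H H) H"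
    by (rule lin_hom_scale[OF H_mod l r])
  fix a b assume ab: "a \<in> carrier H" "b \<in> carrier H"
  have "tlift K H (\<lambda>y z. antipode H y \<otimes> z) (s \<otimes>\<^bsub>tensor K H H\<^esub> tens K H H a b)
      = antipode H a \<otimes> tlift K H (\<lambda>y z. antipode H y \<otimes> z) s \<otimes> b"
  proof (rule tensor_lin_eq[OF H_alg H_alg _ _ _ s])
    show "(\<lambda>s. tlift K H (\<lambda>y z. antipode H y \<otimes> z) (s \<otimes>\<^bsub>tensor K H H\<^esub> tens K H H a b)) \<in> lin_hom K (tensor K H H) H"
      by (rule lin_hom_comp[OF lin_hom_mult_right[OF HH_alg lin_hom_id tens_closed[OF H_alg H_alg ab]] l])
    show "(\<lambda>s. antipode H a \<otimes> tlift K H (\<lambda>y z. antipode H y \<otimes> z) s \<otimes> b) \<in> lin_hom K (tensor K H H) H"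
      by (intro lin_hom_mult_left lin_hom_mult_right H_alg l antipode_closed ab)
  qed (simp add: tens_mult[OF H_alg H_alg] antipode_tens ab antipode_mult antipode_closed m_assoc)
  also have "\<dots> = r \<odot> (antipode H a \<otimes> b)"
    using ab r by (simp add: eq antipode_closed smult_mult_left smult_mult_right)
  finally show "tlift K H (\<lambda>y z. antipode H y \<otimes> z) (s \<otimes>\<^bsub>tensor K H H\<^esub> tens K H H a b)
      = r \<odot> tlift K H (\<lambda>y z. antipode H y \<otimes> z) (tens K H H a b)"
    by (simp add: antipode_tens ab)
qed

lemma antipode_right_tensor_mult:
  assumes t: "t \<in> carrier (tensor K H H)" and r: "r \<in> carrier K"
    and eq: "tlift K H (\<lambda>y z. y \<otimes> antipode H z) t = r \<odot> \<one>"
    and s: "s \<in> carrier (tensor K H H)"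
  shows "tlift K H (\<lambda>y z. y \<otimes> antipode H z) (s \<otimes>\<^bsub>tensor K H H\<^esub> t)
    = r \<odot> tlift K H (\<lambda>y z. y \<otimes> antipode H z) s"
proof (rule tensor_lin_eq[OF H_alg H_alg _ _ _ s])
  note l = tlift_lin[OF H_alg H_alg H_mod antipode_bilin(2)]
  show "(\<lambda>s. tlift K H (\<lambda>y z. y \<otimes> antipode H z) (s \<otimes>\<^bsub>tensor K H H\<^esub> t)) \<in> lin_hom K (tensor K H H) H"
    by (rule lin_hom_comp[OF lin_hom_mult_right[OF HH_alg lin_hom_id t] l])
  show "(\<lambda>s. r \<odot> tlift K H (\<lambda>y z. y \<otimes> antipode H z) s) \<in> lin_hom K (tensor K H H) H"
    by (rule lin_hom_scale[OF H_mod l r])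
  fix a b assume ab: "a \<in> carrier H" "b \<in> carrier H"
  have "tlift K H (\<lambda>y z. y \<otimes> antipode H z) (tens K H H a b \<otimes>\<^bsub>tensor K H H\<^esub> t)
      = a \<otimes> tlift K H (\<lambda>y z. y \<otimes> antipode H z) t \<otimes> antipode H b"
  proof (rule tensor_lin_eq[OF H_alg H_alg _ _ _ t])
    show "(\<lambda>t. tlift K H (\<lambda>y z. y \<otimes> antipode H z) (tens K H H a b \<otimes>\<^bsub>tensor K H H\<^esub> t)) \<in> lin_hom K (tensor K H H) H"
      by (rule lin_hom_comp[OF lin_hom_mult_left[OF HH_alg lin_hom_id tens_closed[OF H_alg H_alg ab]] l])
    show "(\<lambda>t. a \<otimes> tlift K H (\<lambda>y z. y \<otimes> antipode H z) t \<otimes> antipode H b) \<in> lin_hom K (tensor K H H) H"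
      by (intro lin_hom_mult_left lin_hom_mult_right H_alg l antipode_closed ab)
  qed (simp add: tens_mult[OF H_alg H_alg] antipode_tens ab antipode_mult antipode_closed m_assoc)
  also have "\<dots> = r \<odot> (a \<otimes> antipode H b)"
    using ab r by (simp add: eq antipode_closed smult_mult_left smult_mult_right)
  finally show "tlift K H (\<lambda>y z. y \<otimes> antipode H z) (tens K H H a b \<otimes>\<^bsub>tensor K H H\<^esub> t)
      = r \<odot> tlift K H (\<lambda>y z. y \<otimes> antipode H z) (tens K H H a b)"
    by (simp add: antipode_tens ab)
qed

lemma hopf_identities_one: "hopf_identities K H \<one>"
proof -
  have D: "comult H \<one> = tens K H H \<one> \<one>"
    by (simp add: alg_hom_one[OF comult_hom] tensor_one[OF H_alg H_alg])
  show ?thesis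
    unfolding hopf_identities_def
    using alg_hom_one[OF left_coassoc_hom] alg_hom_one[OF right_coassoc_hom]
      alg_hom_one[OF counit_homs(1)] alg_hom_one[OF counit_homs(2)]
    by (simp add: D antipode_tens antipode_one counit_one)
qed

lemma hopf_identities_add:
  assumes x: "x \<in> carrier H" "hopf_identities K H x" and y: "y \<in> carrier H" "hopf_identities K H y"
  shows "hopf_identities K H (x \<oplus> y)"
  using x(2) y(2) unfolding hopf_identities_def
  by (simp only: x(1) y(1) lin_hom_add[OF alg_hom_lin[OF left_coassoc_hom]]
      lin_hom_add[OF alg_hom_lin[OF right_coassoc_hom]] lin_hom_add[OF alg_hom_lin[OF counit_homs(1)]]
      lin_hom_add[OF alg_hom_lin[OF counit_homs(2)]] lin_hom_add[OF antipode_lins(1)]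
      lin_hom_add[OF antipode_lins(2)] lin_hom_add[OF counit_lin] base_alg_sel
      smult_l_distr counit_closed one_closed simp_thms)

lemma hopf_identities_smult:
  assumes a: "a \<in> carrier K" and x: "x \<in> carrier H" "hopf_identities K H x"
  shows "hopf_identities K H (a \<odot> x)"
  using x(2) unfolding hopf_identities_def
  by (simp only: x(1) a lin_hom_smult[OF alg_hom_lin[OF left_coassoc_hom]]
      lin_hom_smult[OF alg_hom_lin[OF right_coassoc_hom]] lin_hom_smult[OF alg_hom_lin[OF counit_homs(1)]]
      lin_hom_smult[OF alg_hom_lin[OF counit_homs(2)]] lin_hom_smult[OF antipode_lins(1)]
      lin_hom_smult[OF antipode_lins(2)] lin_hom_smult[OF counit_lin] base_alg_sel
      smult_assoc1 counit_closed one_closed simp_thms)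

lemma hopf_identities_mult:
  assumes x: "x \<in> carrier H" "hopf_identities K H x" and y: "y \<in> carrier H" "hopf_identities K H y"
  shows "hopf_identities K H (x \<otimes> y)"
proof -
  have 1: "tlift K H (\<lambda>y z. antipode H y \<otimes> z) (comult H (x \<otimes> y)) = counit H (x \<otimes> y) \<odot> \<one>"
    using antipode_left_tensor_mult[OF comult_closed[OF x(1)] counit_closed[OF x(1)] _ comult_closed[OF y(1)]]
      x y unfolding hopf_identities_def
    by (simp add: alg_hom_mult[OF comult_hom] counit_mult smult_assoc1 counit_closed)
  have 2: "tlift K H (\<lambda>y z. y \<otimes> antipode H z) (comult H (x \<otimes> y)) = counit H (x \<otimes> y) \<odot> \<one>"
    using antipode_right_tensor_mult[OF comult_closed[OF y(1)] counit_closed[OF y(1)] _ comult_closed[OF x(1)]]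
      x y unfolding hopf_identities_def
    by (simp add: alg_hom_mult[OF comult_hom] counit_mult smult_assoc1[symmetric] counit_closed R.m_comm)
  show ?thesis
    using x(2) y(2) 1 2 unfolding hopf_identities_def
    by (simp only: x(1) y(1) alg_hom_mult[OF left_coassoc_hom] alg_hom_mult[OF right_coassoc_hom]
        alg_hom_mult[OF counit_homs(1)] alg_hom_mult[OF counit_homs(2)] simp_thms)
qed

lemmas coassoc_simps =
  tmap_tens[OF HH_alg H_alg H_alg H_alg comult_lin lin_hom_id]
  tmap_tens[OF H_alg HH_alg H_alg H_alg lin_hom_id comult_lin]
  tassoc_tens[OF H_alg H_alg H_alg]

lemma hopf_identities_grouplike:
  assumes g: "g \<in> carrier H" "comult H g = tens K H H g g" "counit H g = \<one>\<^bsub>K\<^esub>"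
    and S: "antipode H g \<otimes> g = \<one>" "g \<otimes> antipode H g = \<one>"
  shows "hopf_identities K H g"
  unfolding hopf_identities_def
  using g S by (simp add: coassoc_simps counit_tens antipode_tens)

text \<open>
  This form covers both \<open>\<Delta>h = h \<otimes> c + 1 \<otimes> h\<close> and \<open>\<Delta>v = v \<otimes> 1 + c \<otimes> v\<close>. The two conditions on the
  antipode are the antipode identities written out for \<open>x\<close>.
\<close>

lemma hopf_identities_skew_primitive:
  assumes g: "g \<in> carrier H" "comult H g = tens K H H g g" "counit H g = \<one>\<^bsub>K\<^esub>"
    and g': "g' \<in> carrier H" "comult H g' = tens K H H g' g'" "counit H g' = \<one>\<^bsub>K\<^esub>"
    and x: "x \<in> carrier H" "comult H x = tens K H H x g \<oplus>\<^bsub>tensor K H H\<^esub> tens K H H g' x" "counit H x = \<zero>\<^bsub>K\<^esub>"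
    and S: "antipode H x \<otimes> g \<oplus> antipode H g' \<otimes> x = \<zero>" "x \<otimes> antipode H g \<oplus> g' \<otimes> antipode H x = \<zero>"
  shows "hopf_identities K H x"
proof -
  note tc = tens_closed[OF H_alg H_alg] tens_closed[OF HH_alg H_alg] tens_closed[OF H_alg HH_alg]
  interpret T: unital_algebra K "tensor K H (tensor K H H)"
    by (rule tensor_unital_algebra[OF H_alg HH_alg])
  interpret TL: unital_algebra K "tensor K (tensor K H H) H"
    by (rule tensor_unital_algebra[OF HH_alg H_alg])
  interpret HH: unital_algebra K "tensor K H H" by (rule HH_alg)
  have inner_left: "tmap K (tensor K H H) H (comult H) (\<lambda>y. y) (comult H x) =
      tens K (tensor K H H) H (tens K H H x g \<oplus>\<^bsub>tensor K H H\<^esub> tens K H H g' x) g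
      \<oplus>\<^bsub>tensor K (tensor K H H) H\<^esub> tens K (tensor K H H) H (tens K H H g' g') x"
    using g g' x
    by (simp add: lin_hom_add[OF tmap_lin[OF HH_alg H_alg H_alg H_alg comult_lin lin_hom_id]] tc coassoc_simps)
  have left: "tassoc K H H H (tmap K (tensor K H H) H (comult H) (\<lambda>y. y) (comult H x))
      = (tens K H (tensor K H H) x (tens K H H g g)
      \<oplus>\<^bsub>tensor K H (tensor K H H)\<^esub> tens K H (tensor K H H) g' (tens K H H x g))
      \<oplus>\<^bsub>tensor K H (tensor K H H)\<^esub> tens K H (tensor K H H) g' (tens K H H g' x)"
    unfolding inner_left using g(1) g'(1) x(1)
    by (simp only: lin_hom_add[OF tens_lin_left[OF HH_alg H_alg]] lin_hom_add[OF tassoc_lin[OF H_alg H_alg H_alg]]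
        coassoc_simps tc TL.M.a_closed)
  have right: "tmap K H (tensor K H H) (\<lambda>y. y) (comult H) (comult H x)
      = tens K H (tensor K H H) x (tens K H H g g)
      \<oplus>\<^bsub>tensor K H (tensor K H H)\<^esub> tens K H (tensor K H H) g' (tens K H H x g \<oplus>\<^bsub>tensor K H H\<^esub> tens K H H g' x)"
    using g g' x
    by (simp add: lin_hom_add[OF tmap_lin[OF H_alg HH_alg H_alg H_alg lin_hom_id comult_lin]] tc coassoc_simps)
  have coassoc: "tassoc K H H H (tmap K (tensor K H H) H (comult H) (\<lambda>y. y) (comult H x))
      = tmap K H (tensor K H H) (\<lambda>y. y) (comult H) (comult H x)"
    unfolding left right using g(1) g'(1) x(1)
    by (simp only: lin_hom_add[OF tens_lin_right[OF H_alg HH_alg]] tc T.M.a_assoc)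
  show ?thesis
    unfolding hopf_identities_def
  proof (intro conjI coassoc)
  qed (use g g' x S in \<open>simp_all add: tc counit_tens antipode_tens
      lin_hom_add[OF tlift_lin[OF H_alg H_alg H_mod counit_bilin(1)]]
      lin_hom_add[OF tlift_lin[OF H_alg H_alg H_mod counit_bilin(2)]]
      lin_hom_add[OF tlift_lin[OF H_alg H_alg H_mod antipode_bilin(1)]]
      lin_hom_add[OF tlift_lin[OF H_alg H_alg H_mod antipode_bilin(2)]]\<close>)
qed

lemma hopf_algebraI:
  assumes "\<And>x. x \<in> carrier H \<Longrightarrow> hopf_identities K H x"
  shows "hopf_algebra K H"
  by (intro hopf_algebra.intro H_alg hopf_algebra_axioms.intro comult_hom counit_hom antipode_lin)
     (use assms in \<open>auto simp: hopf_identities_def\<close>)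

end

lemma presented_hopf_sel:
  "module.truncate (presented_hopf K J D E S) = module.truncate (quot_alg (free_alg K) J)"
  "comult (presented_hopf K J D E S) =
    (\<lambda>Y. the_elem (free_eval K (tensor K (quot_alg (free_alg K) J) (quot_alg (free_alg K) J)) D ` Y))"
  "counit (presented_hopf K J D E S) = (\<lambda>Y. the_elem (free_eval K (base_alg K) E ` Y))"
  "antipode (presented_hopf K J D E S) =
    (\<lambda>Y. the_elem (free_eval K (opp_alg (quot_alg (free_alg K) J)) S ` Y))"
  by (simp_all add: presented_hopf_def Let_def module.defs hopf.defs)

context
  fixes K :: "'k ring" and J :: "('g list \<Rightarrow> 'k) set" and D E S Q H
  defines "Q \<equiv> quot_alg (free_alg K) J" and "H \<equiv> presented_hopf K J D E S"
  assumes K: "cring K" and J: "ideal J (free_alg K)"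
    and D: "\<And>x. D x \<in> carrier (tensor K Q Q)" "\<And>n. n \<in> J \<Longrightarrow> free_eval K (tensor K Q Q) D n = \<zero>\<^bsub>tensor K Q Q\<^esub>"
    and E: "\<And>x. E x \<in> carrier K" "\<And>n. n \<in> J \<Longrightarrow> free_eval K (base_alg K) E n = \<zero>\<^bsub>K\<^esub>"
    and S: "\<And>x. S x \<in> carrier Q" "\<And>n. n \<in> J \<Longrightarrow> free_eval K (opp_alg Q) S n = \<zero>\<^bsub>Q\<^esub>"
begin

lemma presented_tens: "tensor K H H = tensor K Q Q" "tens K H H = tens K Q Q"
  unfolding H_def Q_def by (rule tens_cong[OF presented_hopf_sel(1) presented_hopf_sel(1)])+

lemma presented_sel: "carrier H = carrier Q" "monoid.mult H = monoid.mult Q" "one H = one Q"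
  "ring.zero H = ring.zero Q" "ring.add H = ring.add Q" "smult H = smult Q"
  using presented_hopf_sel(1)[of K J D E S]
  unfolding truncate_eq_iff H_def[symmetric] Q_def[symmetric] by simp_all

text \<open>
  That \<open>D\<close>, \<open>E\<close> and \<open>S\<close> satisfy the relations is the content of the hypotheses about \<open>J\<close>; for \<open>S\<close>
  they refer to the opposite algebra, which turns an anti-homomorphism into a homomorphism.
\<close>

lemma presented_homs:
  "comult H \<in> alg_hom K Q (tensor K Q Q)" "counit H \<in> alg_hom K Q (base_alg K)"
  "antipode H \<in> alg_hom K Q (opp_alg Q)"
  "comult H (quot_gen K J x) = D x" "counit H (quot_gen K J x) = E x" "antipode H (quot_gen K J x) = S x"
proof -
  note Q = quot_free_unital_algebra[OF K J, folded Q_def]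
  note QQ = tensor_unital_algebra[OF Q Q] and B = base_alg_unital_algebra[OF K]
    and O = opp_alg_unital_algebra[OF Q]
  note 1 = quot_free_eval[OF K J QQ D, folded Q_def]
  note 2 = quot_free_eval[OF K J B, of E, unfolded base_alg_sel, OF E, folded Q_def]
  note 3 = quot_free_eval[OF K J O, of S, unfolded opp_alg_sel, OF S, folded Q_def]
  show "comult H \<in> alg_hom K Q (tensor K Q Q)" "counit H \<in> alg_hom K Q (base_alg K)"
    "antipode H \<in> alg_hom K Q (opp_alg Q)"
    "comult H (quot_gen K J x) = D x" "counit H (quot_gen K J x) = E x" "antipode H (quot_gen K J x) = S x"
    using 1 2 3 unfolding H_def presented_hopf_sel Q_def[symmetric] by simp_all
qed

lemma presented_prehopf: "prehopf K H"
proof -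
  have t: "module.truncate Q = module.truncate H"
    unfolding H_def Q_def by (rule presented_hopf_sel(1)[symmetric])
  note Q = quot_free_unital_algebra[OF K J, folded Q_def]
  show ?thesis
  proof (intro prehopf.intro prehopf_axioms.intro unital_algebra_truncate[OF Q t])
    show "comult H \<in> alg_hom K H (tensor K H H)"
      unfolding presented_tens lin_hom_truncate(2)[OF t refl, symmetric] by (rule presented_homs)
    show "counit H \<in> alg_hom K H (base_alg K)"
      unfolding lin_hom_truncate(2)[OF t refl, symmetric] by (rule presented_homs)
    show "antipode H \<in> lin_hom K H H"
      unfolding lin_hom_truncate(1)[OF t t, symmetric]
      using alg_hom_lin[OF presented_homs(3)] by (simp add: lin_hom_opp)
    show "antipode H \<one>\<^bsub>H\<^esub> = \<one>\<^bsub>H\<^esub>"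
      using alg_hom_one[OF presented_homs(3)] by (simp add: presented_sel opp_alg_sel)
    show "antipode H (x \<otimes>\<^bsub>H\<^esub> y) = antipode H y \<otimes>\<^bsub>H\<^esub> antipode H x"
      if "x \<in> carrier H" "y \<in> carrier H" for x y
      using alg_hom_mult[OF presented_homs(3)] that by (simp add: presented_sel opp_alg_sel)
  qed
qed

text \<open>
  The elements that satisfy the identities are closed under sums, scalar multiples and products.
\<close>

lemma presented_hopf_algebra:
  assumes gen: "\<And>x. hopf_identities K H (quot_gen K J x)"
  shows "hopf_algebra K H"
proof -
  interpret H: prehopf K H by (rule presented_prehopf)
  note gc = quot_gen_closed[OF K J, folded Q_def]
  show ?thesis
  proof (rule H.hopf_algebraI)
    fix y assume "y \<in> carrier H"
    then have "y \<in> carrier (quot_alg (free_alg K) J)" by (simp add: presented_sel Q_def)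
    then show "hopf_identities K H y"
    proof (rule quot_free_induct[OF K J])
    qed (fold Q_def, use H.hopf_identities_one H.hopf_identities_mult[OF _ gen] H.hopf_identities_add
        H.hopf_identities_smult in \<open>simp_all add: presented_sel gc\<close>)
  qed
qed

end


section \<open>Bialgebra homomorphisms preserve the antipode\<close>

lemma lin_hom_tlift:
  assumes A: "unital_algebra K A" and B: "unital_algebra K B" and M: "module K M" and N: "module K N"
    and \<beta>: "\<beta> \<in> bilin K A B M" and h: "h \<in> lin_hom K M N" and t: "t \<in> carrier (tensor K A B)"
  shows "h (tlift K M \<beta> t) = tlift K N (\<lambda>a b. h (\<beta> a b)) t"
proof -
  have \<beta>': "(\<lambda>a b. h (\<beta> a b)) \<in> bilin K A B N"
    by (intro bilinI lin_hom_comp[OF bilinD(1)[OF \<beta>] h] lin_hom_comp[OF bilinD(2)[OF \<beta>] h])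
  show ?thesis
    by (rule tensor_lin_eq[OF A B lin_hom_comp[OF tlift_lin[OF A B M \<beta>] h] tlift_lin[OF A B N \<beta>'] _ t])
       (simp add: tlift_tens[OF A B M \<beta>] tlift_tens[OF A B N \<beta>'])
qed

lemma tlift_tmap:
  assumes A: "unital_algebra K A" and B: "unital_algebra K B"
    and C: "unital_algebra K C" and D: "unital_algebra K D" and M: "module K M"
    and \<beta>: "\<beta> \<in> bilin K A B M" and f: "f \<in> lin_hom K C A" and g: "g \<in> lin_hom K D B"
    and t: "t \<in> carrier (tensor K C D)"
  shows "tlift K M \<beta> (tmap K A B f g t) = tlift K M (\<lambda>x y. \<beta> (f x) (g y)) t"
proof -
  have \<beta>': "(\<lambda>x y. \<beta> (f x) (g y)) \<in> bilin K C D M"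
    by (intro bilinI lin_hom_comp[OF f bilinD(1)[OF \<beta>]] lin_hom_comp[OF g bilinD(2)[OF \<beta>]]
        lin_hom_closed[OF f] lin_hom_closed[OF g])
  show ?thesis
    by (rule tensor_lin_eq[OF C D lin_hom_comp[OF tmap_lin[OF A B C D f g] tlift_lin[OF A B M \<beta>]]
          tlift_lin[OF C D M \<beta>'] _ t])
       (simp add: tmap_tens[OF A B C D f g] tlift_tens[OF A B M \<beta>] tlift_tens[OF C D M \<beta>']
          lin_hom_closed[OF f] lin_hom_closed[OF g])
qed

lemma tlift_cong:
  assumes A: "unital_algebra K A" and B: "unital_algebra K B" and M: "module K M"
    and \<beta>: "\<beta> \<in> bilin K A B M" and \<beta>': "\<beta>' \<in> bilin K A B M"
    and eq: "\<And>a b. \<lbrakk>a \<in> carrier A; b \<in> carrier B\<rbrakk> \<Longrightarrow> \<beta> a b = \<beta>' a b"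
    and t: "t \<in> carrier (tensor K A B)"
  shows "tlift K M \<beta> t = tlift K M \<beta>' t"
  by (rule tensor_lin_eq[OF A B tlift_lin[OF A B M \<beta>] tlift_lin[OF A B M \<beta>'] _ t])
     (simp add: tlift_tens[OF A B M \<beta>] tlift_tens[OF A B M \<beta>'] eq)

text \<open>
  The product \<open>f * g = m (f \<otimes> g) \<Delta>\<close> on the linear maps from a coalgebra to an algebra, with unit
  \<open>\<epsilon>(\<sqdot>) 1\<close>.
\<close>

definition convolution :: "'k ring \<Rightarrow> ('k, 'g) hopf \<Rightarrow> ('k, 'h, 'x) module_scheme
    \<Rightarrow> ('g \<Rightarrow> 'h) \<Rightarrow> ('g \<Rightarrow> 'h) \<Rightarrow> 'g \<Rightarrow> 'h"
  where "convolution K G H f g x = tlift K H (\<lambda>y z. f y \<otimes>\<^bsub>H\<^esub> g z) (comult G x)"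

context
  fixes K :: "'k ring" and G :: "('k, 'g) hopf" and H :: "('k, 'h, 'x) module_scheme" (structure)
  assumes G: "hopf_algebra K G" and H: "unital_algebra K H"
begin

interpretation G: hopf_algebra K G by (rule G)
interpretation H: unital_algebra K H by (rule H)

lemma G_alg: "unital_algebra K G" by (rule G.unital_algebra_axioms)

lemma GG_alg: "unital_algebra K (tensor K G G)" by (intro tensor_unital_algebra G_alg)

lemmas G_comult_lin = alg_hom_lin[OF G.comult_hom]

lemma convolution_lin:
  assumes "f \<in> lin_hom K G H" "g \<in> lin_hom K G H"
  shows "convolution K G H f g \<in> lin_hom K G H"
  unfolding convolution_def[abs_def]
  by (rule lin_hom_comp[OF G_comult_lin tlift_lin[OF G_alg G_alg H.module_axioms bilin_mult[OF H assms]]])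

lemma convolution_assoc:
  assumes f: "f \<in> lin_hom K G H" and g: "g \<in> lin_hom K G H" and l: "l \<in> lin_hom K G H"
    and x: "x \<in> carrier G"
  shows "convolution K G H (convolution K G H f g) l x = convolution K G H f (convolution K G H g l) x"
proof -
  note Hm = H.module_axioms
  let ?fg = "tlift K H (\<lambda>a b. f a \<otimes> g b)" and ?gl = "tlift K H (\<lambda>a b. g a \<otimes> l b)"
  note fg = tlift_lin[OF G_alg G_alg Hm bilin_mult[OF H f g]]
  note gl = tlift_lin[OF G_alg G_alg Hm bilin_mult[OF H g l]]
  note b1 = bilin_mult[OF H fg l] and b2 = bilin_mult[OF H f gl]
  let ?\<Theta> = "tlift K H (\<lambda>Y z. ?fg Y \<otimes> l z)" and ?\<Theta>' = "tlift K H (\<lambda>y Z. f y \<otimes> ?gl Z)"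
  note \<Theta> = tlift_lin[OF GG_alg G_alg Hm b1] and \<Theta>' = tlift_lin[OF G_alg GG_alg Hm b2]
  have dx: "comult G x \<in> carrier (tensor K G G)" by (rule lin_hom_closed[OF G_comult_lin x])
  have eq: "?\<Theta> u = ?\<Theta>' (tassoc K G G G u)" if "u \<in> carrier (tensor K (tensor K G G) G)" for u
    by (rule tensor3_lin_eq[OF G_alg G_alg G_alg \<Theta> lin_hom_comp[OF tassoc_lin[OF G_alg G_alg G_alg] \<Theta>'] _ that])
       (simp add: tassoc_tens[OF G_alg G_alg G_alg] tens_closed[OF G_alg G_alg]
          tlift_tens[OF GG_alg G_alg Hm b1] tlift_tens[OF G_alg GG_alg Hm b2]
          tlift_tens[OF G_alg G_alg Hm bilin_mult[OF H f g]] tlift_tens[OF G_alg G_alg Hm bilin_mult[OF H g l]]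
          lin_hom_closed[OF f] lin_hom_closed[OF g] lin_hom_closed[OF l] H.m_assoc)
  have left: "convolution K G H (convolution K G H f g) l x
      = ?\<Theta> (tmap K (tensor K G G) G (comult G) (\<lambda>y. y) (comult G x))"
    by (simp add: convolution_def
        tlift_tmap[OF GG_alg G_alg G_alg G_alg Hm b1 G_comult_lin lin_hom_id dx])
  have right: "convolution K G H f (convolution K G H g l) x
      = ?\<Theta>' (tmap K G (tensor K G G) (\<lambda>y. y) (comult G) (comult G x))"
    by (simp add: convolution_def
        tlift_tmap[OF G_alg GG_alg G_alg G_alg Hm b2 lin_hom_id G_comult_lin dx])
  have "tmap K (tensor K G G) G (comult G) (\<lambda>y. y) (comult G x) \<in> carrier (tensor K (tensor K G G) G)"
    by (rule lin_hom_closed[OF tmap_lin[OF GG_alg G_alg G_alg G_alg G_comult_lin lin_hom_id] dx])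
  then show ?thesis
    unfolding left right by (simp only: eq G.coassoc[OF x])
qed

lemma convolution_unit:
  assumes f: "f \<in> lin_hom K G H" and x: "x \<in> carrier G"
  shows "convolution K G H (\<lambda>y. counit G y \<odot> \<one>) f x = f x"
    and "convolution K G H f (\<lambda>y. counit G y \<odot> \<one>) x = f x"
proof -
  note Hm = H.module_axioms and el = alg_hom_lin[OF G.counit_hom]
  have u: "(\<lambda>y. counit G y \<odot> \<one>) \<in> lin_hom K G H"
    by (rule lin_hom_scalar[OF Hm el]) simp
  have ec: "counit G y \<in> carrier K" if "y \<in> carrier G" for y
    using lin_hom_closed[OF el that] by (simp add: base_alg_sel)
  have dx: "comult G x \<in> carrier (tensor K G G)" by (rule lin_hom_closed[OF G_comult_lin x])
  note b1 = bilin_scale_left[OF G.module_axioms el lin_hom_id]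
  note b2 = bilin_scale_right[OF G.module_axioms el lin_hom_id]
  have b1': "(\<lambda>a b. f (counit G a \<odot>\<^bsub>G\<^esub> b)) \<in> bilin K G G H"
    by (intro bilinI lin_hom_comp[OF bilinD(1)[OF b1] f] lin_hom_comp[OF bilinD(2)[OF b1] f])
  have b2': "(\<lambda>a b. f (counit G b \<odot>\<^bsub>G\<^esub> a)) \<in> bilin K G G H"
    by (intro bilinI lin_hom_comp[OF bilinD(1)[OF b2] f] lin_hom_comp[OF bilinD(2)[OF b2] f])
  have "convolution K G H (\<lambda>y. counit G y \<odot> \<one>) f x
      = tlift K H (\<lambda>a b. f (counit G a \<odot>\<^bsub>G\<^esub> b)) (comult G x)"
    unfolding convolution_def
    by (rule tlift_cong[OF G_alg G_alg Hm bilin_mult[OF H u f] b1' _ dx])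
       (simp add: lin_hom_smult[OF f] lin_hom_closed[OF f] ec H.smult_mult_left)
  then show "convolution K G H (\<lambda>y. counit G y \<odot> \<one>) f x = f x"
    by (simp only: lin_hom_tlift[OF G_alg G_alg G.module_axioms Hm b1 f dx, symmetric] G.counit_left[OF x])
  have "convolution K G H f (\<lambda>y. counit G y \<odot> \<one>) x
      = tlift K H (\<lambda>a b. f (counit G b \<odot>\<^bsub>G\<^esub> a)) (comult G x)"
    unfolding convolution_def
    by (rule tlift_cong[OF G_alg G_alg Hm bilin_mult[OF H f u] b2' _ dx])
       (simp add: lin_hom_smult[OF f] lin_hom_closed[OF f] ec H.smult_mult_right)
  then show "convolution K G H f (\<lambda>y. counit G y \<odot> \<one>) x = f x"
    by (simp only: lin_hom_tlift[OF G_alg G_alg G.module_axioms Hm b2 f dx, symmetric] G.counit_right[OF x])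
qed

end

lemma convolution_cong:
  assumes G: "hopf_algebra K G" and H: "unital_algebra K H"
    and f: "f \<in> lin_hom K G H" and f': "f' \<in> lin_hom K G H"
    and g: "g \<in> lin_hom K G H" and g': "g' \<in> lin_hom K G H"
    and eq: "\<And>y. y \<in> carrier G \<Longrightarrow> f y = f' y" "\<And>y. y \<in> carrier G \<Longrightarrow> g y = g' y"
    and x: "x \<in> carrier G"
  shows "convolution K G H f g x = convolution K G H f' g' x"
proof -
  interpret G: hopf_algebra K G by (rule G)
  note Ga = G.unital_algebra_axioms
  show ?thesis
    unfolding convolution_def
    by (rule tlift_cong[OF Ga Ga unital_algebra_module[OF H] bilin_mult[OF H f g] bilin_mult[OF H f' g']])
       (simp_all add: eq lin_hom_closed[OF alg_hom_lin[OF G.comult_hom] x])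
qed

text \<open>
  Both \<open>S \<phi>\<close> and \<open>\<phi> S\<close> are inverse to \<open>\<phi>\<close> with respect to convolution, the former on the right and
  the latter on the left, and such inverses agree.
\<close>

lemma bialgebra_hom_antipode:
  assumes G: "hopf_algebra K G" and H: "hopf_algebra K H" and \<phi>: "\<phi> \<in> alg_hom K G H"
    and \<Delta>: "\<And>x. x \<in> carrier G \<Longrightarrow> comult H (\<phi> x) = tmap K H H \<phi> \<phi> (comult G x)"
    and \<epsilon>: "\<And>x. x \<in> carrier G \<Longrightarrow> counit H (\<phi> x) = counit G x"
    and x: "x \<in> carrier G"
  shows "antipode H (\<phi> x) = \<phi> (antipode G x)"
proof -
  interpret G: hopf_algebra K G by (rule G)
  interpret H: hopf_algebra K H by (rule H)
  note Ga = G.unital_algebra_axioms and Ha = H.unital_algebra_axioms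
  note Gm = G.module_axioms and Hm = H.module_axioms
  note \<phi>l = alg_hom_lin[OF \<phi>]
  let ?u = "\<lambda>y. counit G y \<odot>\<^bsub>H\<^esub> \<one>\<^bsub>H\<^esub>" and ?S\<phi> = "\<lambda>y. antipode H (\<phi> y)" and ?\<phi>S = "\<lambda>y. \<phi> (antipode G y)"
  let ?c = "convolution K G H"
  have u: "?u \<in> lin_hom K G H"
    by (rule lin_hom_scalar[OF Hm alg_hom_lin[OF G.counit_hom]]) simp
  note S\<phi> = lin_hom_comp[OF \<phi>l H.antipode_lin] and \<phi>S = lin_hom_comp[OF G.antipode_lin \<phi>l]
  have dy: "comult G y \<in> carrier (tensor K G G)" if "y \<in> carrier G" for y
    by (rule lin_hom_closed[OF alg_hom_lin[OF G.comult_hom] that])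
  have ec: "counit G y \<in> carrier K" if "y \<in> carrier G" for y
    using lin_hom_closed[OF alg_hom_lin[OF G.counit_hom] that] by (simp add: base_alg_sel)
  have left: "?c ?\<phi>S \<phi> y = ?u y" if y: "y \<in> carrier G" for y
  proof -
    note b = bilin_mult[OF Ga G.antipode_lin lin_hom_id]
    have b': "(\<lambda>a b. \<phi> (antipode G a \<otimes>\<^bsub>G\<^esub> b)) \<in> bilin K G G H"
      by (intro bilinI lin_hom_comp[OF bilinD(1)[OF b] \<phi>l] lin_hom_comp[OF bilinD(2)[OF b] \<phi>l])
    have "?c ?\<phi>S \<phi> y = tlift K H (\<lambda>a b. \<phi> (antipode G a \<otimes>\<^bsub>G\<^esub> b)) (comult G y)"
      unfolding convolution_def
      by (rule tlift_cong[OF Ga Ga Hm bilin_mult[OF Ha \<phi>S \<phi>l] b' _ dy[OF y]])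
         (simp add: alg_hom_mult[OF \<phi>] lin_hom_closed[OF G.antipode_lin])
    then have "?c ?\<phi>S \<phi> y = \<phi> (counit G y \<odot>\<^bsub>G\<^esub> \<one>\<^bsub>G\<^esub>)"
      by (simp only: lin_hom_tlift[OF Ga Ga Gm Hm b \<phi>l dy[OF y], symmetric] G.antipode_left[OF y])
    then show ?thesis using y by (simp add: lin_hom_smult[OF \<phi>l] alg_hom_one[OF \<phi>] ec)
  qed
  have right: "?c \<phi> ?S\<phi> y = ?u y" if y: "y \<in> carrier G" for y
  proof -
    note b = bilin_mult[OF Ha lin_hom_id H.antipode_lin]
    have "?c \<phi> ?S\<phi> y = tlift K H (\<lambda>a b. a \<otimes>\<^bsub>H\<^esub> antipode H b) (tmap K H H \<phi> \<phi> (comult G y))"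
      unfolding convolution_def by (rule tlift_tmap[OF Ha Ha Ga Ga Hm b \<phi>l \<phi>l dy[OF y], symmetric])
    then show ?thesis
      using y lin_hom_closed[OF \<phi>l y] by (simp only: \<Delta>[OF y, symmetric] H.antipode_right \<epsilon>)
  qed
  have "?c ?u ?S\<phi> x = ?c (?c ?\<phi>S \<phi>) ?S\<phi> x"
    by (rule convolution_cong[OF G Ha u convolution_lin[OF G Ha \<phi>S \<phi>l] S\<phi> S\<phi> _ _ x]) (simp_all add: left)
  also have "\<dots> = ?c ?\<phi>S (?c \<phi> ?S\<phi>) x"
    by (rule convolution_assoc[OF G Ha \<phi>S \<phi>l S\<phi> x])
  also have "\<dots> = ?c ?\<phi>S ?u x"
    by (rule convolution_cong[OF G Ha \<phi>S \<phi>S convolution_lin[OF G Ha \<phi>l S\<phi>] u _ _ x]) (simp_all add: right)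
  finally show ?thesis
    by (simp only: convolution_unit[OF G Ha S\<phi> x] convolution_unit[OF G Ha \<phi>S x])
qed

lemma hopf_homI:
  assumes "hopf_algebra K G" "hopf_algebra K H" "\<phi> \<in> alg_hom K G H"
    and "\<And>x. x \<in> carrier G \<Longrightarrow> comult H (\<phi> x) = tmap K H H \<phi> \<phi> (comult G x)"
    and "\<And>x. x \<in> carrier G \<Longrightarrow> counit H (\<phi> x) = counit G x"
  shows "\<phi> \<in> hopf_hom K G H"
  using assms bialgebra_hom_antipode[OF assms] by (simp add: hopf_hom_def)


section \<open>The algebra of linear operators\<close>

lemma End_alg_sel:
  "carrier (End_alg K A) = lin_hom K A A \<inter> extensional (carrier A)"
  "f \<otimes>\<^bsub>End_alg K A\<^esub> g = compose (carrier A) f g"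
  "\<one>\<^bsub>End_alg K A\<^esub> = (\<lambda>x\<in>carrier A. x)"
  "\<zero>\<^bsub>End_alg K A\<^esub> = (\<lambda>x\<in>carrier A. \<zero>\<^bsub>A\<^esub>)"
  "f \<oplus>\<^bsub>End_alg K A\<^esub> g = (\<lambda>x\<in>carrier A. f x \<oplus>\<^bsub>A\<^esub> g x)"
  "a \<odot>\<^bsub>End_alg K A\<^esub> f = (\<lambda>x\<in>carrier A. a \<odot>\<^bsub>A\<^esub> f x)"
  by (simp_all add: End_alg_def)

lemma End_alg_unital_algebra:
  assumes M: "module K A" shows "unital_algebra K (End_alg K A)"
proof -
  interpret A: module K A by (rule M)
  have restr: "(\<lambda>x\<in>carrier A. f x) \<in> carrier (End_alg K A)" if "f \<in> lin_hom K A A" for f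
    using that by (auto simp: End_alg_sel intro: lin_hom_cong[OF M that])
  have cl: "f x \<in> carrier A" if "f \<in> carrier (End_alg K A)" "x \<in> carrier A" for f x
    using that by (auto simp: End_alg_sel lin_hom_closed)
  have lin: "f \<in> lin_hom K A A" if "f \<in> carrier (End_alg K A)" for f
    using that by (simp add: End_alg_sel)
  have add: "f (x \<oplus>\<^bsub>A\<^esub> y) = f x \<oplus>\<^bsub>A\<^esub> f y" and sm: "a \<in> carrier K \<Longrightarrow> f (a \<odot>\<^bsub>A\<^esub> x) = a \<odot>\<^bsub>A\<^esub> f x"
    if "f \<in> carrier (End_alg K A)" "x \<in> carrier A" "y \<in> carrier A" for f x y a
    using that by (simp_all add: lin_hom_add[OF lin] lin_hom_smult[OF lin])
  have ext: "f = g" if "f \<in> carrier (End_alg K A)" "g \<in> carrier (End_alg K A)"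
    "\<And>x. x \<in> carrier A \<Longrightarrow> f x = g x" for f g
    using that by (auto simp: End_alg_sel intro: extensionalityI)
  have add_closed: "f \<oplus>\<^bsub>End_alg K A\<^esub> g \<in> carrier (End_alg K A)"
    if "f \<in> carrier (End_alg K A)" "g \<in> carrier (End_alg K A)" for f g
    unfolding End_alg_sel(5) by (intro restr lin_hom_plus[OF M] lin that)
  have smult_closed: "a \<odot>\<^bsub>End_alg K A\<^esub> f \<in> carrier (End_alg K A)"
    if "a \<in> carrier K" "f \<in> carrier (End_alg K A)" for a f
    unfolding End_alg_sel(6) by (intro restr lin_hom_scale[OF M] lin that)
  have mult_closed: "f \<otimes>\<^bsub>End_alg K A\<^esub> g \<in> carrier (End_alg K A)"
    if "f \<in> carrier (End_alg K A)" "g \<in> carrier (End_alg K A)" for f g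
    unfolding End_alg_sel(2) compose_def by (rule restr[OF lin_hom_comp[OF lin[OF that(2)] lin[OF that(1)]]])
  have one: "\<one>\<^bsub>End_alg K A\<^esub> \<in> carrier (End_alg K A)"
    unfolding End_alg_sel(3) by (rule restr[OF lin_hom_id])
  have zero: "\<zero>\<^bsub>End_alg K A\<^esub> \<in> carrier (End_alg K A)"
    unfolding End_alg_sel(4) by (rule restr[OF lin_hom_const_zero[OF M]])
  note closed = add_closed smult_closed mult_closed one zero
  have app: "x \<in> carrier A \<Longrightarrow> (f \<oplus>\<^bsub>End_alg K A\<^esub> g) x = f x \<oplus>\<^bsub>A\<^esub> g x"
    "x \<in> carrier A \<Longrightarrow> (f \<otimes>\<^bsub>End_alg K A\<^esub> g) x = f (g x)"
    "x \<in> carrier A \<Longrightarrow> \<one>\<^bsub>End_alg K A\<^esub> x = x" "x \<in> carrier A \<Longrightarrow> \<zero>\<^bsub>End_alg K A\<^esub> x = \<zero>\<^bsub>A\<^esub>"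
    "x \<in> carrier A \<Longrightarrow> (a \<odot>\<^bsub>End_alg K A\<^esub> f) x = a \<odot>\<^bsub>A\<^esub> f x" for f g x a
    by (simp_all add: End_alg_sel compose_def)
  show ?thesis
  proof (rule unital_algebraI)
    show "cring K" by (rule A.R.cring_axioms)
    fix f assume f: "f \<in> carrier (End_alg K A)"
    have neg: "(\<ominus>\<^bsub>K\<^esub> \<one>\<^bsub>K\<^esub>) \<odot>\<^bsub>End_alg K A\<^esub> f \<oplus>\<^bsub>End_alg K A\<^esub> f = \<zero>\<^bsub>End_alg K A\<^esub>"
      using f by (intro ext closed) (simp_all add: app cl A.smult_l_minus A.M.l_neg)
    show "\<exists>g\<in>carrier (End_alg K A). g \<oplus>\<^bsub>End_alg K A\<^esub> f = \<zero>\<^bsub>End_alg K A\<^esub>"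
      by (rule bexI[where P="\<lambda>g. g \<oplus>\<^bsub>End_alg K A\<^esub> f = \<zero>\<^bsub>End_alg K A\<^esub>", OF neg]) (use f in \<open>simp add: closed\<close>)
  qed (fact closed | (rule ext; simp add: closed app cl add sm A.M.a_ac A.smult_l_distr A.smult_r_distr
        A.smult_assoc1))+
qed


section \<open>The algebra \<open>k \<times> k\<close>\<close>

lemma kxk_sel:
  "carrier (kxk K) = carrier K \<times> carrier K"
  "p \<otimes>\<^bsub>kxk K\<^esub> q = (fst p \<otimes>\<^bsub>K\<^esub> fst q, snd p \<otimes>\<^bsub>K\<^esub> snd q)"
  "p \<oplus>\<^bsub>kxk K\<^esub> q = (fst p \<oplus>\<^bsub>K\<^esub> fst q, snd p \<oplus>\<^bsub>K\<^esub> snd q)"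
  "\<one>\<^bsub>kxk K\<^esub> = (\<one>\<^bsub>K\<^esub>, \<one>\<^bsub>K\<^esub>)" "\<zero>\<^bsub>kxk K\<^esub> = (\<zero>\<^bsub>K\<^esub>, \<zero>\<^bsub>K\<^esub>)"
  "a \<odot>\<^bsub>kxk K\<^esub> p = (a \<otimes>\<^bsub>K\<^esub> fst p, a \<otimes>\<^bsub>K\<^esub> snd p)"
  by (simp_all add: kxk_def RDirProd_def DirProd_def ring.defs module.defs monoid.defs split_def)

text \<open>
  As \<open>1\<close>, \<open>e\<close> is a basis of \<open>k \<times> k\<close>, every element of \<open>(k \<times> k) \<otimes> B\<close> is \<open>1 \<otimes> x + e \<otimes> y\<close> for unique
  \<open>x\<close> and \<open>y\<close>.
\<close>

definition kxk_tens ::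
    "'k ring \<Rightarrow> ('k, 'h, 'x) module_scheme \<Rightarrow> 'h \<Rightarrow> 'h \<Rightarrow> (('k \<times> 'k) \<times> 'h \<Rightarrow> 'k) set"
  where "kxk_tens K B x y = tens K (kxk K) B \<one>\<^bsub>kxk K\<^esub> x \<oplus>\<^bsub>tensor K (kxk K) B\<^esub> tens K (kxk K) B (elt_e K) y"

text \<open>
  The operator with \<open>1 \<mapsto> \<alpha> 1\<close> and \<open>e \<mapsto> \<beta> 1 + \<gamma> e\<close>, that is, with the general upper triangular matrix
  in the basis \<open>1\<close>, \<open>e\<close>.
\<close>

definition kxk_op :: "'k ring \<Rightarrow> 'k \<Rightarrow> 'k \<Rightarrow> 'k \<Rightarrow> 'k \<times> 'k \<Rightarrow> 'k \<times> 'k"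
  where "kxk_op K \<alpha> \<beta> \<gamma> = (\<lambda>p\<in>carrier (kxk K). snd p \<odot>\<^bsub>kxk K\<^esub> (\<alpha> \<odot>\<^bsub>kxk K\<^esub> \<one>\<^bsub>kxk K\<^esub>) \<oplus>\<^bsub>kxk K\<^esub>
    (fst p \<ominus>\<^bsub>K\<^esub> snd p) \<odot>\<^bsub>kxk K\<^esub> (\<beta> \<odot>\<^bsub>kxk K\<^esub> \<one>\<^bsub>kxk K\<^esub> \<oplus>\<^bsub>kxk K\<^esub> \<gamma> \<odot>\<^bsub>kxk K\<^esub> elt_e K))"

context
  fixes K :: "'k ring" (structure) assumes K: "cring K"
begin

interpretation K: cring K by (rule K)

lemma kxk_unital_algebra: "unital_algebra K (kxk K)"
proof (rule unital_algebraI[OF K])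
  fix p assume "p \<in> carrier (kxk K)"
  then show "\<exists>q\<in>carrier (kxk K). q \<oplus>\<^bsub>kxk K\<^esub> p = \<zero>\<^bsub>kxk K\<^esub>"
    by (intro bexI[of _ "(\<ominus> fst p, \<ominus> snd p)"]) (auto simp: kxk_sel K.l_neg)
qed (auto simp: kxk_sel K.a_ac K.m_ac K.l_distr K.r_distr)

interpretation A: unital_algebra K "kxk K" by (rule kxk_unital_algebra)

lemma elt_e_closed: "elt_e K \<in> carrier (kxk K)"
  by (simp add: elt_e_def kxk_sel)

lemma elt_e_idem: "elt_e K \<otimes>\<^bsub>kxk K\<^esub> elt_e K = elt_e K"
  by (simp add: elt_e_def kxk_sel)

lemma kxk_coord_lin:
  "fst \<in> lin_hom K (kxk K) (base_alg K)" "snd \<in> lin_hom K (kxk K) (base_alg K)"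
  "(\<lambda>p. fst p \<ominus> snd p) \<in> lin_hom K (kxk K) (base_alg K)"
proof -
  have *: "fst \<in> lin_hom K (kxk K) (base_alg K)" "snd \<in> lin_hom K (kxk K) (base_alg K)"
    by (auto intro!: lin_homI simp: kxk_sel base_alg_sel)
  then show "fst \<in> lin_hom K (kxk K) (base_alg K)" "snd \<in> lin_hom K (kxk K) (base_alg K)" .
  show "(\<lambda>p. fst p \<ominus> snd p) \<in> lin_hom K (kxk K) (base_alg K)"
    by (rule lin_homI)
       (auto simp: kxk_sel base_alg_sel a_minus_def K.minus_add K.r_distr K.r_minus K.a_ac)
qed

lemma kxk_expand:
  assumes p: "p \<in> carrier (kxk K)"
  shows "p = snd p \<odot>\<^bsub>kxk K\<^esub> \<one>\<^bsub>kxk K\<^esub> \<oplus>\<^bsub>kxk K\<^esub> (fst p \<ominus> snd p) \<odot>\<^bsub>kxk K\<^esub> elt_e K"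
proof -
  obtain x y where xy: "p = (x, y)" "x \<in> carrier K" "y \<in> carrier K"
    using p by (auto simp: kxk_sel)
  then have "y \<oplus> (x \<ominus> y) = x"
    by (simp add: a_minus_def K.a_lcomm[of y x] K.r_neg)
  then show ?thesis using xy by (simp add: kxk_sel elt_e_def)
qed

lemma kxk_lin_eq:
  assumes M: "module K M" and f: "f \<in> lin_hom K (kxk K) M" and g: "g \<in> lin_hom K (kxk K) M"
    and eq: "f \<one>\<^bsub>kxk K\<^esub> = g \<one>\<^bsub>kxk K\<^esub>" "f (elt_e K) = g (elt_e K)" and p: "p \<in> carrier (kxk K)"
  shows "f p = g p"
proof -
  have c: "snd p \<in> carrier K" "fst p \<ominus> snd p \<in> carrier K" using p by (auto simp: kxk_sel)
  have expand: "h p = snd p \<odot>\<^bsub>M\<^esub> h \<one>\<^bsub>kxk K\<^esub> \<oplus>\<^bsub>M\<^esub> (fst p \<ominus> snd p) \<odot>\<^bsub>M\<^esub> h (elt_e K)"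
    if h: "h \<in> lin_hom K (kxk K) M" for h
    by (subst kxk_expand[OF p])
       (use c in \<open>simp only: lin_hom_add[OF h] lin_hom_smult[OF h] A.smult_closed A.one_closed elt_e_closed\<close>)
  show ?thesis using expand[OF f] expand[OF g] eq by simp
qed

subsection \<open>Tensor products with \<open>k \<times> k\<close>\<close>

context
  fixes B :: "('k, 'h, 'x) module_scheme"
  assumes B: "unital_algebra K B"
begin

interpretation B: unital_algebra K B by (rule B)
interpretation T: unital_algebra K "tensor K (kxk K) B"
  by (rule tensor_unital_algebra[OF kxk_unital_algebra B])

lemmas kxk_tc = tens_closed[OF kxk_unital_algebra B]
lemmas kxk_tl = tens_lin_left[OF kxk_unital_algebra B] and kxk_tr = tens_lin_right[OF kxk_unital_algebra B]

lemma kxk_tens_closed: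
  "\<lbrakk>x \<in> carrier B; y \<in> carrier B\<rbrakk> \<Longrightarrow> kxk_tens K B x y \<in> carrier (tensor K (kxk K) B)"
  unfolding kxk_tens_def by (intro T.M.a_closed kxk_tc A.one_closed elt_e_closed)

lemma kxk_tens_add:
  "\<lbrakk>x \<in> carrier B; y \<in> carrier B; x' \<in> carrier B; y' \<in> carrier B\<rbrakk> \<Longrightarrow>
    kxk_tens K B x y \<oplus>\<^bsub>tensor K (kxk K) B\<^esub> kxk_tens K B x' y' = kxk_tens K B (x \<oplus>\<^bsub>B\<^esub> x') (y \<oplus>\<^bsub>B\<^esub> y')"
  unfolding kxk_tens_def
  by (simp only: lin_hom_add[OF kxk_tr[OF A.one_closed]] lin_hom_add[OF kxk_tr[OF elt_e_closed]]
      kxk_tc A.one_closed elt_e_closed T.M.a_ac T.M.a_closed)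

lemma kxk_tens_smult:
  "\<lbrakk>a \<in> carrier K; x \<in> carrier B; y \<in> carrier B\<rbrakk> \<Longrightarrow>
    a \<odot>\<^bsub>tensor K (kxk K) B\<^esub> kxk_tens K B x y = kxk_tens K B (a \<odot>\<^bsub>B\<^esub> x) (a \<odot>\<^bsub>B\<^esub> y)"
  unfolding kxk_tens_def
  by (simp only: lin_hom_smult[OF kxk_tr[OF A.one_closed]] lin_hom_smult[OF kxk_tr[OF elt_e_closed]]
      kxk_tc A.one_closed elt_e_closed T.smult_r_distr)

lemma tens_kxk:
  assumes p: "p \<in> carrier (kxk K)" and b: "b \<in> carrier B"
  shows "tens K (kxk K) B p b = kxk_tens K B (snd p \<odot>\<^bsub>B\<^esub> b) ((fst p \<ominus> snd p) \<odot>\<^bsub>B\<^esub> b)"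
proof -
  have c: "snd p \<in> carrier K" "fst p \<ominus> snd p \<in> carrier K" using p by (auto simp: kxk_sel)
  show ?thesis
    unfolding kxk_tens_def
    by (subst kxk_expand[OF p])
       (use c b in \<open>simp only: lin_hom_add[OF kxk_tl[OF b]] lin_hom_smult[OF kxk_tl[OF b]]
          lin_hom_smult[OF kxk_tr[OF A.one_closed]] lin_hom_smult[OF kxk_tr[OF elt_e_closed]]
          A.smult_closed A.one_closed elt_e_closed\<close>)
qed

lemma kxk_tensor_cases:
  assumes "t \<in> carrier (tensor K (kxk K) B)"
  obtains x y where "x \<in> carrier B" "y \<in> carrier B" "t = kxk_tens K B x y"
proof -
  have "\<exists>x y. x \<in> carrier B \<and> y \<in> carrier B \<and> t = kxk_tens K B x y"
    using assms
  proof (rule tensor_induct[OF kxk_unital_algebra B])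
    fix p b assume p: "p \<in> carrier (kxk K)" and b: "b \<in> carrier B"
    have "snd p \<in> carrier K" "fst p \<ominus> snd p \<in> carrier K" using p by (auto simp: kxk_sel)
    then show "\<exists>x y. x \<in> carrier B \<and> y \<in> carrier B \<and> tens K (kxk K) B p b = kxk_tens K B x y"
      using tens_kxk[OF p b] b B.smult_closed by metis
  next
    fix s t assume "\<exists>x y. x \<in> carrier B \<and> y \<in> carrier B \<and> s = kxk_tens K B x y"
      "\<exists>x y. x \<in> carrier B \<and> y \<in> carrier B \<and> t = kxk_tens K B x y"
    then show "\<exists>x y. x \<in> carrier B \<and> y \<in> carrier B \<and> s \<oplus>\<^bsub>tensor K (kxk K) B\<^esub> t = kxk_tens K B x y"
      using kxk_tens_add B.M.a_closed by metis
  qed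
  then show ?thesis using that by blast
qed

lemma tlift_kxk_tens:
  assumes M: "module K M" and \<beta>: "\<beta> \<in> bilin K (kxk K) B M" and xy: "x \<in> carrier B" "y \<in> carrier B"
  shows "tlift K M \<beta> (kxk_tens K B x y) = \<beta> \<one>\<^bsub>kxk K\<^esub> x \<oplus>\<^bsub>M\<^esub> \<beta> (elt_e K) y"
  unfolding kxk_tens_def using xy
  by (simp only: lin_hom_add[OF tlift_lin[OF kxk_unital_algebra B M \<beta>]] kxk_tc A.one_closed elt_e_closed
      tlift_tens[OF kxk_unital_algebra B M \<beta>])

lemma kxk_tens_inject:
  assumes xy: "x \<in> carrier B" "y \<in> carrier B" "x' \<in> carrier B" "y' \<in> carrier B"
    and eq: "kxk_tens K B x y = kxk_tens K B x' y'"
  shows "x = x'" "y = y'"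
proof -
  note b1 = bilin_scale_left[OF B.module_axioms kxk_coord_lin(2) lin_hom_id]
  note b2 = bilin_scale_left[OF B.module_axioms kxk_coord_lin(3) lin_hom_id]
  have minus: "\<one> \<ominus> \<one> = \<zero>" "\<one> \<ominus> \<zero> = \<one>"
    by (simp_all add: a_minus_def K.r_neg K.minus_zero)
  have *: "tlift K B (\<lambda>p b. snd p \<odot>\<^bsub>B\<^esub> b) (kxk_tens K B x y) = x"
    "tlift K B (\<lambda>p b. (fst p \<ominus> snd p) \<odot>\<^bsub>B\<^esub> b) (kxk_tens K B x y) = y"
    if "x \<in> carrier B" "y \<in> carrier B" for x y
    using that by (simp_all add: tlift_kxk_tens[OF B.module_axioms b1] tlift_kxk_tens[OF B.module_axioms b2]
        kxk_sel elt_e_def minus)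
  show "x = x'" using *(1)[OF xy(1,2)] *(1)[OF xy(3,4)] eq by simp
  show "y = y'" using *(2)[OF xy(1,2)] *(2)[OF xy(3,4)] eq by simp
qed

lemma kxk_tens_one: "\<one>\<^bsub>tensor K (kxk K) B\<^esub> = kxk_tens K B \<one>\<^bsub>B\<^esub> \<zero>\<^bsub>B\<^esub>"
proof -
  have "tens K (kxk K) B (elt_e K) \<zero>\<^bsub>B\<^esub> = \<zero>\<^bsub>tensor K (kxk K) B\<^esub>"
    by (rule lin_hom_zero[OF B.module_axioms T.module_axioms kxk_tr[OF elt_e_closed]])
  then show ?thesis
    by (simp add: kxk_tens_def tensor_one[OF kxk_unital_algebra B] kxk_tc)
qed

lemma kxk_tens_mult:
  assumes xy: "x \<in> carrier B" "y \<in> carrier B" "x' \<in> carrier B" "y' \<in> carrier B"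
  shows "kxk_tens K B x y \<otimes>\<^bsub>tensor K (kxk K) B\<^esub> kxk_tens K B x' y'
    = kxk_tens K B (x \<otimes>\<^bsub>B\<^esub> x') (x \<otimes>\<^bsub>B\<^esub> y' \<oplus>\<^bsub>B\<^esub> y \<otimes>\<^bsub>B\<^esub> x' \<oplus>\<^bsub>B\<^esub> y \<otimes>\<^bsub>B\<^esub> y')"
proof -
  let ?t = "tens K (kxk K) B" and ?e = "elt_e K" and ?u = "\<one>\<^bsub>kxk K\<^esub>"
  have c: "?t ?u b \<in> carrier (tensor K (kxk K) B)" "?t ?e b \<in> carrier (tensor K (kxk K) B)"
    if "b \<in> carrier B" for b using that by (simp_all add: kxk_tc elt_e_closed)
  have e1: "?e \<otimes>\<^bsub>kxk K\<^esub> ?u = ?e" "?u \<otimes>\<^bsub>kxk K\<^esub> ?e = ?e" "?u \<otimes>\<^bsub>kxk K\<^esub> ?u = ?u"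
    by (simp_all add: elt_e_closed)
  have "kxk_tens K B x y \<otimes>\<^bsub>tensor K (kxk K) B\<^esub> kxk_tens K B x' y'
    = (?t ?u (x \<otimes>\<^bsub>B\<^esub> x') \<oplus>\<^bsub>tensor K (kxk K) B\<^esub> ?t ?e (y \<otimes>\<^bsub>B\<^esub> x'))
      \<oplus>\<^bsub>tensor K (kxk K) B\<^esub> (?t ?e (x \<otimes>\<^bsub>B\<^esub> y') \<oplus>\<^bsub>tensor K (kxk K) B\<^esub> ?t ?e (y \<otimes>\<^bsub>B\<^esub> y'))"
    unfolding kxk_tens_def using xy
    by (simp only: T.l_distr T.r_distr c T.M.a_closed tens_mult[OF kxk_unital_algebra B] A.one_closed
        elt_e_closed elt_e_idem e1)
  moreover have "?t ?e (x \<otimes>\<^bsub>B\<^esub> y' \<oplus>\<^bsub>B\<^esub> y \<otimes>\<^bsub>B\<^esub> x' \<oplus>\<^bsub>B\<^esub> y \<otimes>\<^bsub>B\<^esub> y') =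
      (?t ?e (x \<otimes>\<^bsub>B\<^esub> y') \<oplus>\<^bsub>tensor K (kxk K) B\<^esub> ?t ?e (y \<otimes>\<^bsub>B\<^esub> x')) \<oplus>\<^bsub>tensor K (kxk K) B\<^esub> ?t ?e (y \<otimes>\<^bsub>B\<^esub> y')"
    using xy by (simp only: lin_hom_add[OF kxk_tr[OF elt_e_closed]] B.m_closed B.M.a_closed)
  ultimately show ?thesis
    unfolding kxk_tens_def using xy by (simp only: T.M.a_ac c B.m_closed T.M.a_closed)
qed

end

lemma unital_ext_lin:
  assumes H: "unital_algebra K H" and w: "w \<in> carrier (tensor K (kxk K) H)"
  shows "unital_ext K H w \<in> lin_hom K (kxk K) (tensor K (kxk K) H)"
    and "unital_ext K H w \<one>\<^bsub>kxk K\<^esub> = \<one>\<^bsub>tensor K (kxk K) H\<^esub>"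
    and "unital_ext K H w (elt_e K) = w"
proof -
  interpret T: unital_algebra K "tensor K (kxk K) H"
    by (rule tensor_unital_algebra[OF kxk_unital_algebra H])
  show "unital_ext K H w \<in> lin_hom K (kxk K) (tensor K (kxk K) H)"
    unfolding unital_ext_def[abs_def] Let_def
    by (intro lin_hom_plus lin_hom_scalar T.module_axioms kxk_coord_lin w T.one_closed)
  show "unital_ext K H w \<one>\<^bsub>kxk K\<^esub> = \<one>\<^bsub>tensor K (kxk K) H\<^esub>"
    "unital_ext K H w (elt_e K) = w"
    using w by (simp_all add: unital_ext_def Let_def kxk_sel elt_e_def a_minus_def K.r_neg K.minus_zero)
qed

text \<open>Only \<open>\<rho>(e) \<rho>(e) = \<rho>(e)\<close> has to be verified, and its two coordinates are the two relations.\<close>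

lemma unital_ext_alg_hom:
  assumes H: "unital_algebra K H" and hc: "h \<in> carrier H" "c \<in> carrier H"
    and rel: "h \<otimes>\<^bsub>H\<^esub> h = h" "h \<otimes>\<^bsub>H\<^esub> c \<oplus>\<^bsub>H\<^esub> c \<otimes>\<^bsub>H\<^esub> h \<oplus>\<^bsub>H\<^esub> c \<otimes>\<^bsub>H\<^esub> c = c"
  shows "unital_ext K H (kxk_tens K H h c) \<in> alg_hom K (kxk K) (tensor K (kxk K) H)"
proof -
  note w = kxk_tens_closed[OF H hc]
  note u = unital_ext_lin[OF H w]
  note T = tensor_unital_algebra[OF kxk_unital_algebra H]
  interpret T: unital_algebra K "tensor K (kxk K) H" by (rule T)
  have idem: "kxk_tens K H h c \<otimes>\<^bsub>tensor K (kxk K) H\<^esub> kxk_tens K H h c = kxk_tens K H h c"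
    using hc by (simp add: kxk_tens_mult[OF H] rel)
  show ?thesis
  proof (rule alg_homI[OF u(1,2)])
    fix p q assume pq: "p \<in> carrier (kxk K)" "q \<in> carrier (kxk K)"
    show "unital_ext K H (kxk_tens K H h c) (p \<otimes>\<^bsub>kxk K\<^esub> q)
        = unital_ext K H (kxk_tens K H h c) p \<otimes>\<^bsub>tensor K (kxk K) H\<^esub> unital_ext K H (kxk_tens K H h c) q"
    proof (rule lin_hom_mult_ext[OF kxk_unital_algebra T u(1), where S="{\<one>\<^bsub>kxk K\<^esub>, elt_e K}"])
      fix f g t assume f: "f \<in> lin_hom K (kxk K) (tensor K (kxk K) H)"
        and g: "g \<in> lin_hom K (kxk K) (tensor K (kxk K) H)"
        and eq: "\<And>s. s \<in> {\<one>\<^bsub>kxk K\<^esub>, elt_e K} \<Longrightarrow> f s = g s" and t: "t \<in> carrier (kxk K)"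
      show "f t = g t" by (rule kxk_lin_eq[OF T.module_axioms f g eq eq t]) simp_all
    qed (auto simp: elt_e_closed elt_e_idem u w idem pq)
  qed
qed

subsection \<open>Coactions on \<open>k \<times> k\<close> as pairs of elements\<close>

text \<open>
  For the map with \<open>\<rho>(e) = 1 \<otimes> h + e \<otimes> c\<close> the second line says that \<open>\<rho>(e)\<close> is idempotent, the third
  expresses coassociativity, and the fourth the counit axiom.
\<close>

definition coaction_pair :: "('k, 'h) hopf \<Rightarrow> 'h \<Rightarrow> 'h \<Rightarrow> bool"
  where "coaction_pair H h c \<longleftrightarrow> h \<in> carrier H \<and> c \<in> carrier H \<and>
    h \<otimes>\<^bsub>H\<^esub> h = h \<and> h \<otimes>\<^bsub>H\<^esub> c \<oplus>\<^bsub>H\<^esub> c \<otimes>\<^bsub>H\<^esub> h \<oplus>\<^bsub>H\<^esub> c \<otimes>\<^bsub>H\<^esub> c = c \<and>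
    comult H h = tens K H H h c \<oplus>\<^bsub>tensor K H H\<^esub> tens K H H \<one>\<^bsub>H\<^esub> h \<and> comult H c = tens K H H c c \<and>
    counit H h = \<zero> \<and> counit H c = \<one>"

context
  fixes H :: "('k, 'h) hopf" and h c
  assumes H: "hopf_algebra K H" and hc: "h \<in> carrier H" "c \<in> carrier H"
begin

interpretation H: hopf_algebra K H by (rule H)

lemma H_alg': "unital_algebra K H" by (rule H.unital_algebra_axioms)

lemma HH_alg': "unital_algebra K (tensor K H H)" by (intro tensor_unital_algebra H_alg')

lemma coaction_coassoc_left:
  assumes \<rho>: "\<rho> \<in> alg_hom K (kxk K) (tensor K (kxk K) H)" and e: "\<rho> (elt_e K) = kxk_tens K H h c"
  shows "tassoc K (kxk K) H H (tmap K (tensor K (kxk K) H) H \<rho> (\<lambda>y. y) (kxk_tens K H h c))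
    = kxk_tens K (tensor K H H) (tens K H H h c \<oplus>\<^bsub>tensor K H H\<^esub> tens K H H \<one>\<^bsub>H\<^esub> h) (tens K H H c c)"
proof -
  note A = kxk_unital_algebra and Ha = H_alg' and HH = HH_alg'
  note AH = tensor_unital_algebra[OF A Ha]
  interpret TL: unital_algebra K "tensor K (tensor K (kxk K) H) H" by (rule tensor_unital_algebra[OF AH Ha])
  interpret TR: unital_algebra K "tensor K (kxk K) (tensor K H H)" by (rule tensor_unital_algebra[OF A HH])
  note tc = tens_closed[OF A Ha] tens_closed[OF AH Ha] tens_closed[OF A HH] tens_closed[OF Ha Ha]
    elt_e_closed A.one_closed H.one_closed hc
  note \<rho>l = alg_hom_lin[OF \<rho>]
  have 1: "tmap K (tensor K (kxk K) H) H \<rho> (\<lambda>y. y) (kxk_tens K H h c)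
      = tens K (tensor K (kxk K) H) H (tens K (kxk K) H \<one>\<^bsub>kxk K\<^esub> \<one>\<^bsub>H\<^esub>) h
        \<oplus>\<^bsub>tensor K (tensor K (kxk K) H) H\<^esub>
        tens K (tensor K (kxk K) H) H (tens K (kxk K) H \<one>\<^bsub>kxk K\<^esub> h \<oplus>\<^bsub>tensor K (kxk K) H\<^esub> tens K (kxk K) H (elt_e K) c) c"
    unfolding kxk_tens_def
    by (simp only: lin_hom_add[OF tmap_lin[OF AH Ha A Ha \<rho>l lin_hom_id]] tc
        tmap_tens[OF AH Ha A Ha \<rho>l lin_hom_id] alg_hom_one[OF \<rho>] e kxk_tens_def tensor_one[OF A Ha])
  have 2: "tassoc K (kxk K) H H (tmap K (tensor K (kxk K) H) H \<rho> (\<lambda>y. y) (kxk_tens K H h c))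
      = tens K (kxk K) (tensor K H H) \<one>\<^bsub>kxk K\<^esub> (tens K H H \<one>\<^bsub>H\<^esub> h) \<oplus>\<^bsub>tensor K (kxk K) (tensor K H H)\<^esub>
       (tens K (kxk K) (tensor K H H) \<one>\<^bsub>kxk K\<^esub> (tens K H H h c) \<oplus>\<^bsub>tensor K (kxk K) (tensor K H H)\<^esub>
        tens K (kxk K) (tensor K H H) (elt_e K) (tens K H H c c))"
    unfolding 1
    by (simp only: lin_hom_add[OF tens_lin_left[OF AH Ha]] lin_hom_add[OF tassoc_lin[OF A Ha Ha]]
        tassoc_tens[OF A Ha Ha] tc TL.M.a_closed)
  show ?thesis
    unfolding 2 unfolding kxk_tens_def
    by (simp only: lin_hom_add[OF tens_lin_right[OF A HH]] tc TR.M.a_ac TR.M.a_closed)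
qed

lemma coaction_coassoc_right:
  "tmap K (kxk K) (tensor K H H) (\<lambda>y. y) (comult H) (kxk_tens K H h c)
    = kxk_tens K (tensor K H H) (comult H h) (comult H c)"
  unfolding kxk_tens_def
  by (simp only: lin_hom_add[OF tmap_lin[OF kxk_unital_algebra HH_alg' kxk_unital_algebra H_alg' lin_hom_id
          alg_hom_lin[OF H.comult_hom]]]
      tmap_tens[OF kxk_unital_algebra HH_alg' kxk_unital_algebra H_alg' lin_hom_id alg_hom_lin[OF H.comult_hom]]
      tens_closed[OF kxk_unital_algebra H_alg'] elt_e_closed A.one_closed hc)

lemma coaction_functional:
  assumes l: "l \<in> lin_hom K H (base_alg K)"
  shows "tlift K (kxk K) (\<lambda>x h. l h \<odot>\<^bsub>kxk K\<^esub> x) (kxk_tens K H h c)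
      = l h \<odot>\<^bsub>kxk K\<^esub> \<one>\<^bsub>kxk K\<^esub> \<oplus>\<^bsub>kxk K\<^esub> l c \<odot>\<^bsub>kxk K\<^esub> elt_e K"
    and "tlift K (kxk K) (\<lambda>x h. l h \<odot>\<^bsub>kxk K\<^esub> x) \<one>\<^bsub>tensor K (kxk K) H\<^esub> = l \<one>\<^bsub>H\<^esub> \<odot>\<^bsub>kxk K\<^esub> \<one>\<^bsub>kxk K\<^esub>"
proof -
  note b = bilin_scale_right[OF A.module_axioms l lin_hom_id]
  show "tlift K (kxk K) (\<lambda>x h. l h \<odot>\<^bsub>kxk K\<^esub> x) (kxk_tens K H h c)
      = l h \<odot>\<^bsub>kxk K\<^esub> \<one>\<^bsub>kxk K\<^esub> \<oplus>\<^bsub>kxk K\<^esub> l c \<odot>\<^bsub>kxk K\<^esub> elt_e K"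
    by (rule tlift_kxk_tens[OF H_alg' A.module_axioms b hc])
  show "tlift K (kxk K) (\<lambda>x h. l h \<odot>\<^bsub>kxk K\<^esub> x) \<one>\<^bsub>tensor K (kxk K) H\<^esub> = l \<one>\<^bsub>H\<^esub> \<odot>\<^bsub>kxk K\<^esub> \<one>\<^bsub>kxk K\<^esub>"
    unfolding tensor_one[OF kxk_unital_algebra H_alg']
    by (rule tlift_tens[OF kxk_unital_algebra H_alg' A.module_axioms b]) simp_all
qed

end

lemma kxk_coords_inject:
  assumes "a \<in> carrier K" "b \<in> carrier K" "a' \<in> carrier K" "b' \<in> carrier K"
    and "a \<odot>\<^bsub>kxk K\<^esub> \<one>\<^bsub>kxk K\<^esub> \<oplus>\<^bsub>kxk K\<^esub> b \<odot>\<^bsub>kxk K\<^esub> elt_e K = a' \<odot>\<^bsub>kxk K\<^esub> \<one>\<^bsub>kxk K\<^esub> \<oplus>\<^bsub>kxk K\<^esub> b' \<odot>\<^bsub>kxk K\<^esub> elt_e K"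
  shows "a = a'" "b = b'"
proof -
  have pair: "(a \<oplus> b, a) = (a' \<oplus> b', a')"
    using assms by (simp add: kxk_sel elt_e_def del: prod.inject)
  then show a: "a = a'" by blast
  have "a \<oplus> b = a' \<oplus> b'" using pair by blast
  then have "a' \<oplus> b = a' \<oplus> b'" unfolding a .
  then show "b = b'" using assms(1-4) K.add.l_cancel[of a' b b'] by simp
qed

text \<open>
  All maps in the axioms of a coaction are linear, so the axioms need to be checked at \<open>1\<close> and at
  \<open>e\<close> only.
\<close>

lemma coaction_pair_coaction:
  assumes H: "hopf_algebra K H" and p: "coaction_pair H h c"
  shows "hopf_coaction K (kxk K) H (unital_ext K H (kxk_tens K H h c))"
proof -
  interpret H: hopf_algebra K H by (rule H)
  note Ha = H.unital_algebra_axioms and A = kxk_unital_algebra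
  note HH = tensor_unital_algebra[OF Ha Ha] and AH = tensor_unital_algebra[OF A Ha]
  note AHH = tensor_unital_algebra[OF A HH]
  have hc: "h \<in> carrier H" "c \<in> carrier H" using p by (auto simp: coaction_pair_def)
  let ?\<rho> = "unital_ext K H (kxk_tens K H h c)"
  have \<rho>: "?\<rho> \<in> alg_hom K (kxk K) (tensor K (kxk K) H)"
    using p by (intro unital_ext_alg_hom[OF Ha]) (auto simp: coaction_pair_def)
  note e = unital_ext_lin(3)[OF Ha kxk_tens_closed[OF Ha hc]]
  have L: "(\<lambda>a. tassoc K (kxk K) H H (tmap K (tensor K (kxk K) H) H ?\<rho> (\<lambda>y. y) (?\<rho> a)))
      \<in> alg_hom K (kxk K) (tensor K (kxk K) (tensor K H H))"
    by (rule alg_hom_comp[OF alg_hom_comp[OF \<rho> tmap_alg_hom[OF AH Ha A Ha \<rho> alg_hom_id]] tassoc_alg_hom[OF A Ha Ha]])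
  have R: "(\<lambda>a. tmap K (kxk K) (tensor K H H) (\<lambda>y. y) (comult H) (?\<rho> a))
      \<in> alg_hom K (kxk K) (tensor K (kxk K) (tensor K H H))"
    by (rule alg_hom_comp[OF \<rho> tmap_alg_hom[OF A HH A Ha alg_hom_id H.comult_hom]])
  have C: "(\<lambda>a. tlift K (kxk K) (\<lambda>x h. counit H h \<odot>\<^bsub>kxk K\<^esub> x) (?\<rho> a)) \<in> lin_hom K (kxk K) (kxk K)"
    by (rule lin_hom_comp[OF alg_hom_lin[OF \<rho>] tlift_lin[OF A Ha A.module_axioms
          bilin_scale_right[OF A.module_axioms alg_hom_lin[OF H.counit_hom] lin_hom_id]]])
  note cf = coaction_functional[OF H hc alg_hom_lin[OF H.counit_hom]]
  show ?thesis
    unfolding hopf_coaction_def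
  proof (intro conjI ballI A H \<rho>)
    fix a assume a: "a \<in> carrier (kxk K)"
    show "tassoc K (kxk K) H H (tmap K (tensor K (kxk K) H) H ?\<rho> (\<lambda>y. y) (?\<rho> a))
        = tmap K (kxk K) (tensor K H H) (\<lambda>y. y) (comult H) (?\<rho> a)"
    proof (rule kxk_lin_eq[OF unital_algebra_module[OF AHH] alg_hom_lin[OF L] alg_hom_lin[OF R] _ _ a])
      show "tassoc K (kxk K) H H (tmap K (tensor K (kxk K) H) H ?\<rho> (\<lambda>y. y) (?\<rho> \<one>\<^bsub>kxk K\<^esub>))
        = tmap K (kxk K) (tensor K H H) (\<lambda>y. y) (comult H) (?\<rho> \<one>\<^bsub>kxk K\<^esub>)"
        using alg_hom_one[OF L] alg_hom_one[OF R] by simp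
      show "tassoc K (kxk K) H H (tmap K (tensor K (kxk K) H) H ?\<rho> (\<lambda>y. y) (?\<rho> (elt_e K)))
        = tmap K (kxk K) (tensor K H H) (\<lambda>y. y) (comult H) (?\<rho> (elt_e K))"
        unfolding e coaction_coassoc_left[OF H hc \<rho> e] coaction_coassoc_right[OF H hc]
        using p by (simp add: coaction_pair_def)
    qed
    show "tlift K (kxk K) (\<lambda>x h. counit H h \<odot>\<^bsub>kxk K\<^esub> x) (?\<rho> a) = a"
    proof (rule kxk_lin_eq[OF A.module_axioms C lin_hom_id _ _ a])
      show "tlift K (kxk K) (\<lambda>x h. counit H h \<odot>\<^bsub>kxk K\<^esub> x) (?\<rho> \<one>\<^bsub>kxk K\<^esub>) = \<one>\<^bsub>kxk K\<^esub>"
        using alg_hom_one[OF H.counit_hom] by (simp add: alg_hom_one[OF \<rho>] cf base_alg_sel)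
      show "tlift K (kxk K) (\<lambda>x h. counit H h \<odot>\<^bsub>kxk K\<^esub> x) (?\<rho> (elt_e K)) = elt_e K"
        using p by (simp add: e cf coaction_pair_def elt_e_closed)
    qed
  qed
qed

text \<open>
  The equations for \<open>h\<close> and \<open>c\<close> are obtained by comparing the coordinates of both sides of each
  axiom at \<open>e\<close>.
\<close>

lemma coaction_has_pair:
  assumes co: "hopf_coaction K (kxk K) H \<rho>"
  obtains h c where "coaction_pair H h c" "\<rho> (elt_e K) = kxk_tens K H h c"
    "\<forall>a\<in>carrier (kxk K). \<rho> a = unital_ext K H (kxk_tens K H h c) a"
proof -
  have H: "hopf_algebra K H" and \<rho>: "\<rho> \<in> alg_hom K (kxk K) (tensor K (kxk K) H)"
    using co by (simp_all add: hopf_coaction_def)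
  interpret H: hopf_algebra K H by (rule H)
  note Ha = H.unital_algebra_axioms and A = kxk_unital_algebra
  note HH = tensor_unital_algebra[OF Ha Ha] and AH = tensor_unital_algebra[OF A Ha]
  interpret HH: unital_algebra K "tensor K H H" by (rule HH)
  note \<rho>l = alg_hom_lin[OF \<rho>]
  obtain h c where hc: "h \<in> carrier H" "c \<in> carrier H" and e: "\<rho> (elt_e K) = kxk_tens K H h c"
    using kxk_tensor_cases[OF Ha lin_hom_closed[OF \<rho>l elt_e_closed]] by blast
  note w = kxk_tens_closed[OF Ha hc]
  have "\<rho> (elt_e K \<otimes>\<^bsub>kxk K\<^esub> elt_e K) = \<rho> (elt_e K) \<otimes>\<^bsub>tensor K (kxk K) H\<^esub> \<rho> (elt_e K)"
    by (intro alg_hom_mult[OF \<rho>] elt_e_closed)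
  then have "kxk_tens K H (h \<otimes>\<^bsub>H\<^esub> h) (h \<otimes>\<^bsub>H\<^esub> c \<oplus>\<^bsub>H\<^esub> c \<otimes>\<^bsub>H\<^esub> h \<oplus>\<^bsub>H\<^esub> c \<otimes>\<^bsub>H\<^esub> c) = kxk_tens K H h c"
    using hc by (simp add: elt_e_idem e kxk_tens_mult[OF Ha])
  note i = kxk_tens_inject[OF Ha _ _ _ _ this]
  have rel: "h \<otimes>\<^bsub>H\<^esub> h = h" "h \<otimes>\<^bsub>H\<^esub> c \<oplus>\<^bsub>H\<^esub> c \<otimes>\<^bsub>H\<^esub> h \<oplus>\<^bsub>H\<^esub> c \<otimes>\<^bsub>H\<^esub> c = c"
    using hc by (auto intro!: i)
  have coassoc: "tassoc K (kxk K) H H (tmap K (tensor K (kxk K) H) H \<rho> (\<lambda>y. y) (\<rho> (elt_e K)))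
        = tmap K (kxk K) (tensor K H H) (\<lambda>y. y) (comult H) (\<rho> (elt_e K))"
    and counit: "tlift K (kxk K) (\<lambda>x h. counit H h \<odot>\<^bsub>kxk K\<^esub> x) (\<rho> (elt_e K)) = elt_e K"
    using co elt_e_closed unfolding hopf_coaction_def by blast+
  have dc: "comult H h \<in> carrier (tensor K H H)" "comult H c \<in> carrier (tensor K H H)"
    by (intro lin_hom_closed[OF alg_hom_lin[OF H.comult_hom]] hc)+
  have ec: "counit H h \<in> carrier K" "counit H c \<in> carrier K"
    using lin_hom_closed[OF alg_hom_lin[OF H.counit_hom]] hc by (simp_all add: base_alg_sel)
  note tc = tens_closed[OF Ha Ha]
  have "kxk_tens K (tensor K H H) (comult H h) (comult H c)
      = kxk_tens K (tensor K H H) (tens K H H h c \<oplus>\<^bsub>tensor K H H\<^esub> tens K H H \<one>\<^bsub>H\<^esub> h) (tens K H H c c)"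
    using coassoc unfolding e coaction_coassoc_left[OF H hc \<rho> e] coaction_coassoc_right[OF H hc] by simp
  note i = kxk_tens_inject[OF HH _ _ _ _ this]
  have cm: "comult H h = tens K H H h c \<oplus>\<^bsub>tensor K H H\<^esub> tens K H H \<one>\<^bsub>H\<^esub> h"
    by (rule i(1)) (use hc in \<open>simp_all add: dc tc\<close>)
  have cm': "comult H c = tens K H H c c"
    by (rule i(2)) (use hc in \<open>simp_all add: dc tc\<close>)
  have "counit H h \<odot>\<^bsub>kxk K\<^esub> \<one>\<^bsub>kxk K\<^esub> \<oplus>\<^bsub>kxk K\<^esub> counit H c \<odot>\<^bsub>kxk K\<^esub> elt_e K
      = \<zero> \<odot>\<^bsub>kxk K\<^esub> \<one>\<^bsub>kxk K\<^esub> \<oplus>\<^bsub>kxk K\<^esub> \<one> \<odot>\<^bsub>kxk K\<^esub> elt_e K"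
    using counit unfolding e coaction_functional[OF H hc alg_hom_lin[OF H.counit_hom]]
    by (simp add: elt_e_closed)
  note cu = kxk_coords_inject[OF ec K.zero_closed K.one_closed this]
  have "coaction_pair H h c"
    unfolding coaction_pair_def by (intro conjI hc rel cm cm' cu)
  moreover have "\<rho> a = unital_ext K H (kxk_tens K H h c) a" if a: "a \<in> carrier (kxk K)" for a
    using unital_algebra_module[OF AH] \<rho>l unital_ext_lin(1)[OF Ha w]
    by (rule kxk_lin_eq[OF _ _ _ _ _ a])
       (simp_all add: alg_hom_one[OF \<rho>] unital_ext_lin[OF Ha w] e)
  ultimately show ?thesis using e that by blast
qed

end


section \<open>Operators on \<open>k \<times> k\<close> and cosupports\<close>

definition scalar_ops :: "'k ring \<Rightarrow> ('k \<times> 'k \<Rightarrow> 'k \<times> 'k) set"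
  where "scalar_ops K = {kxk_op K a \<zero>\<^bsub>K\<^esub> a | a. a \<in> carrier K}"

text \<open>
  In the basis \<open>e\<close>, \<open>1 - e\<close> these are the matrices with the diagonal entries \<open>b + c\<close> and the other
  entries \<open>b\<close>; in particular \<open>1\<close> is an eigenvector, for the eigenvalue \<open>2b + c\<close>.
\<close>

definition symmetric_ops :: "'k ring \<Rightarrow> ('k \<times> 'k \<Rightarrow> 'k \<times> 'k) set"
  where "symmetric_ops K = {kxk_op K (c \<oplus>\<^bsub>K\<^esub> (b \<oplus>\<^bsub>K\<^esub> b)) b c | b c. b \<in> carrier K \<and> c \<in> carrier K}"

definition triangular_ops :: "'k ring \<Rightarrow> ('k \<times> 'k \<Rightarrow> 'k \<times> 'k) set"
  where "triangular_ops K = {kxk_op K a b c | a b c. a \<in> carrier K \<and> b \<in> carrier K \<and> c \<in> carrier K}"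

context
  fixes K :: "'k ring" (structure) assumes K: "field K"
begin

interpretation K: field K by (rule K)

lemma K_cring: "cring K" by (rule K.cring_axioms)

interpretation A: unital_algebra K "kxk K" by (rule kxk_unital_algebra[OF K_cring])
interpretation E: unital_algebra K "End_alg K (kxk K)" by (rule End_alg_unital_algebra[OF A.module_axioms])

lemmas e_closed = elt_e_closed[OF K_cring]

lemma kxk_op_closed:
  assumes "a \<in> carrier K" "b \<in> carrier K" "c \<in> carrier K"
  shows "kxk_op K a b c \<in> carrier (End_alg K (kxk K))"
proof -
  have "(\<lambda>p. snd p \<odot>\<^bsub>kxk K\<^esub> (a \<odot>\<^bsub>kxk K\<^esub> \<one>\<^bsub>kxk K\<^esub>) \<oplus>\<^bsub>kxk K\<^esub>
    (fst p \<ominus> snd p) \<odot>\<^bsub>kxk K\<^esub> (b \<odot>\<^bsub>kxk K\<^esub> \<one>\<^bsub>kxk K\<^esub> \<oplus>\<^bsub>kxk K\<^esub> c \<odot>\<^bsub>kxk K\<^esub> elt_e K)) \<in> lin_hom K (kxk K) (kxk K)"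
    by (intro lin_hom_plus lin_hom_scalar A.module_axioms kxk_coord_lin K_cring A.smult_closed A.M.a_closed
        A.one_closed e_closed assms)
  then have "kxk_op K a b c \<in> lin_hom K (kxk K) (kxk K)"
    by (rule lin_hom_cong[OF A.module_axioms]) (simp add: kxk_op_def)
  then show ?thesis by (simp add: End_alg_sel kxk_op_def)
qed

lemma kxk_op_values:
  assumes "a \<in> carrier K" "b \<in> carrier K" "c \<in> carrier K"
  shows "kxk_op K a b c \<one>\<^bsub>kxk K\<^esub> = a \<odot>\<^bsub>kxk K\<^esub> \<one>\<^bsub>kxk K\<^esub>"
    and "kxk_op K a b c (elt_e K) = b \<odot>\<^bsub>kxk K\<^esub> \<one>\<^bsub>kxk K\<^esub> \<oplus>\<^bsub>kxk K\<^esub> c \<odot>\<^bsub>kxk K\<^esub> elt_e K"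
  using assms by (simp_all add: kxk_op_def kxk_sel elt_e_def a_minus_def K.r_neg K.minus_zero)

lemma kxk_op_unique:
  assumes f: "f \<in> carrier (End_alg K (kxk K))" and abc: "a \<in> carrier K" "b \<in> carrier K" "c \<in> carrier K"
    and "f \<one>\<^bsub>kxk K\<^esub> = a \<odot>\<^bsub>kxk K\<^esub> \<one>\<^bsub>kxk K\<^esub>" "f (elt_e K) = b \<odot>\<^bsub>kxk K\<^esub> \<one>\<^bsub>kxk K\<^esub> \<oplus>\<^bsub>kxk K\<^esub> c \<odot>\<^bsub>kxk K\<^esub> elt_e K"
  shows "f = kxk_op K a b c"
proof (rule extensionalityI[of _ "carrier (kxk K)"])
  show "f \<in> extensional (carrier (kxk K))" "kxk_op K a b c \<in> extensional (carrier (kxk K))"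
    using f kxk_op_closed[OF abc] by (simp_all add: End_alg_sel)
  have lin: "f \<in> lin_hom K (kxk K) (kxk K)" "kxk_op K a b c \<in> lin_hom K (kxk K) (kxk K)"
    using f kxk_op_closed[OF abc] by (simp_all add: End_alg_sel)
  show "f p = kxk_op K a b c p" if p: "p \<in> carrier (kxk K)" for p
    by (rule kxk_lin_eq[OF K_cring A.module_axioms lin _ _ p]) (simp_all add: assms kxk_op_values)
qed

lemma kxk_op_inject:
  assumes "a \<in> carrier K" "b \<in> carrier K" "c \<in> carrier K" "a' \<in> carrier K" "b' \<in> carrier K" "c' \<in> carrier K"
    and eq: "kxk_op K a b c = kxk_op K a' b' c'"
  shows "a = a'" "b = b'" "c = c'"
proof -
  have "kxk_op K a b c \<one>\<^bsub>kxk K\<^esub> = kxk_op K a' b' c' \<one>\<^bsub>kxk K\<^esub>" by (simp only: eq)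
  then show "a = a'" using assms(1-6) by (simp add: kxk_op_values) (simp add: kxk_sel)
  have "kxk_op K a b c (elt_e K) = kxk_op K a' b' c' (elt_e K)" by (simp only: eq)
  then have "b \<odot>\<^bsub>kxk K\<^esub> \<one>\<^bsub>kxk K\<^esub> \<oplus>\<^bsub>kxk K\<^esub> c \<odot>\<^bsub>kxk K\<^esub> elt_e K
      = b' \<odot>\<^bsub>kxk K\<^esub> \<one>\<^bsub>kxk K\<^esub> \<oplus>\<^bsub>kxk K\<^esub> c' \<odot>\<^bsub>kxk K\<^esub> elt_e K"
    unfolding kxk_op_values(2)[OF assms(1-3)] kxk_op_values(2)[OF assms(4-6)] .
  note i = kxk_coords_inject[OF K_cring assms(2,3,5,6) this]
  show "b = b'" "c = c'" by (rule i)+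
qed

lemma kxk_op_add:
  assumes abc: "a \<in> carrier K" "b \<in> carrier K" "c \<in> carrier K"
    and abc': "a' \<in> carrier K" "b' \<in> carrier K" "c' \<in> carrier K"
  shows "kxk_op K a b c \<oplus>\<^bsub>End_alg K (kxk K)\<^esub> kxk_op K a' b' c' = kxk_op K (a \<oplus> a') (b \<oplus> b') (c \<oplus> c')"
proof (rule kxk_op_unique)
  show "kxk_op K a b c \<oplus>\<^bsub>End_alg K (kxk K)\<^esub> kxk_op K a' b' c' \<in> carrier (End_alg K (kxk K))"
    by (intro E.M.a_closed kxk_op_closed assms)
  show "(kxk_op K a b c \<oplus>\<^bsub>End_alg K (kxk K)\<^esub> kxk_op K a' b' c') \<one>\<^bsub>kxk K\<^esub> = (a \<oplus> a') \<odot>\<^bsub>kxk K\<^esub> \<one>\<^bsub>kxk K\<^esub>"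
    using abc abc' by (simp add: End_alg_sel kxk_op_values A.smult_l_distr)
  have "(kxk_op K a b c \<oplus>\<^bsub>End_alg K (kxk K)\<^esub> kxk_op K a' b' c') (elt_e K) =
      (b \<odot>\<^bsub>kxk K\<^esub> \<one>\<^bsub>kxk K\<^esub> \<oplus>\<^bsub>kxk K\<^esub> c \<odot>\<^bsub>kxk K\<^esub> elt_e K) \<oplus>\<^bsub>kxk K\<^esub> (b' \<odot>\<^bsub>kxk K\<^esub> \<one>\<^bsub>kxk K\<^esub> \<oplus>\<^bsub>kxk K\<^esub> c' \<odot>\<^bsub>kxk K\<^esub> elt_e K)"
    using abc abc' by (simp add: End_alg_sel kxk_op_values e_closed)
  then show "(kxk_op K a b c \<oplus>\<^bsub>End_alg K (kxk K)\<^esub> kxk_op K a' b' c') (elt_e K) =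
      (b \<oplus> b') \<odot>\<^bsub>kxk K\<^esub> \<one>\<^bsub>kxk K\<^esub> \<oplus>\<^bsub>kxk K\<^esub> (c \<oplus> c') \<odot>\<^bsub>kxk K\<^esub> elt_e K"
    using abc abc' by (simp add: kxk_sel elt_e_def K.a_ac)
qed (use assms in auto)

lemma kxk_op_smult:
  assumes s: "s \<in> carrier K" and abc: "a \<in> carrier K" "b \<in> carrier K" "c \<in> carrier K"
  shows "s \<odot>\<^bsub>End_alg K (kxk K)\<^esub> kxk_op K a b c = kxk_op K (s \<otimes> a) (s \<otimes> b) (s \<otimes> c)"
proof (rule kxk_op_unique)
  show "s \<odot>\<^bsub>End_alg K (kxk K)\<^esub> kxk_op K a b c \<in> carrier (End_alg K (kxk K))"
    by (intro E.smult_closed kxk_op_closed assms)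
  show "(s \<odot>\<^bsub>End_alg K (kxk K)\<^esub> kxk_op K a b c) \<one>\<^bsub>kxk K\<^esub> = (s \<otimes> a) \<odot>\<^bsub>kxk K\<^esub> \<one>\<^bsub>kxk K\<^esub>"
    using s abc by (simp add: End_alg_sel kxk_op_values A.smult_assoc1)
  show "(s \<odot>\<^bsub>End_alg K (kxk K)\<^esub> kxk_op K a b c) (elt_e K)
      = (s \<otimes> b) \<odot>\<^bsub>kxk K\<^esub> \<one>\<^bsub>kxk K\<^esub> \<oplus>\<^bsub>kxk K\<^esub> (s \<otimes> c) \<odot>\<^bsub>kxk K\<^esub> elt_e K"
    using s abc by (simp add: End_alg_sel kxk_op_values e_closed A.smult_assoc1 A.smult_r_distr)
qed (use assms in auto)

lemma kxk_op_mult: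
  assumes abc: "a \<in> carrier K" "b \<in> carrier K" "c \<in> carrier K"
    and abc': "a' \<in> carrier K" "b' \<in> carrier K" "c' \<in> carrier K"
  shows "kxk_op K a b c \<otimes>\<^bsub>End_alg K (kxk K)\<^esub> kxk_op K a' b' c'
    = kxk_op K (a \<otimes> a') (a \<otimes> b' \<oplus> b \<otimes> c') (c \<otimes> c')"
proof (rule kxk_op_unique)
  have lin: "kxk_op K a b c \<in> lin_hom K (kxk K) (kxk K)"
    using kxk_op_closed[OF abc] by (simp add: End_alg_sel)
  note l = lin_hom_add[OF lin] lin_hom_smult[OF lin]
  show "kxk_op K a b c \<otimes>\<^bsub>End_alg K (kxk K)\<^esub> kxk_op K a' b' c' \<in> carrier (End_alg K (kxk K))"
    by (intro E.m_closed kxk_op_closed assms)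
  show "(kxk_op K a b c \<otimes>\<^bsub>End_alg K (kxk K)\<^esub> kxk_op K a' b' c') \<one>\<^bsub>kxk K\<^esub> = (a \<otimes> a') \<odot>\<^bsub>kxk K\<^esub> \<one>\<^bsub>kxk K\<^esub>"
    using abc abc' by (simp add: End_alg_sel compose_eq kxk_op_values l A.smult_assoc1[symmetric] K.m_comm)
  have "(kxk_op K a b c \<otimes>\<^bsub>End_alg K (kxk K)\<^esub> kxk_op K a' b' c') (elt_e K)
      = b' \<odot>\<^bsub>kxk K\<^esub> (a \<odot>\<^bsub>kxk K\<^esub> \<one>\<^bsub>kxk K\<^esub>) \<oplus>\<^bsub>kxk K\<^esub> c' \<odot>\<^bsub>kxk K\<^esub> (b \<odot>\<^bsub>kxk K\<^esub> \<one>\<^bsub>kxk K\<^esub> \<oplus>\<^bsub>kxk K\<^esub> c \<odot>\<^bsub>kxk K\<^esub> elt_e K)"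
    using abc abc' by (simp add: End_alg_sel compose_eq kxk_op_values l e_closed)
  then show "(kxk_op K a b c \<otimes>\<^bsub>End_alg K (kxk K)\<^esub> kxk_op K a' b' c') (elt_e K)
      = (a \<otimes> b' \<oplus> b \<otimes> c') \<odot>\<^bsub>kxk K\<^esub> \<one>\<^bsub>kxk K\<^esub> \<oplus>\<^bsub>kxk K\<^esub> (c \<otimes> c') \<odot>\<^bsub>kxk K\<^esub> elt_e K"
    using abc abc' by (simp add: kxk_sel elt_e_def K.r_distr K.m_ac K.a_ac)
qed (use assms in auto)

lemma kxk_op_one: "\<one>\<^bsub>End_alg K (kxk K)\<^esub> = kxk_op K \<one> \<zero> \<one>"
  by (rule kxk_op_unique) (simp_all add: e_closed, simp_all add: End_alg_sel e_closed)

lemma kxk_op_zero: "\<zero>\<^bsub>End_alg K (kxk K)\<^esub> = kxk_op K \<zero> \<zero> \<zero>"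
  by (rule kxk_op_unique) (simp_all add: e_closed, simp_all add: End_alg_sel e_closed)

text \<open>
  The entries of sums, scalar multiples and products of triangular matrices are explicit, so that a
  subalgebra is given by a condition on the entries that is stable under these formulas.
\<close>

lemma op_subalgebra:
  assumes V: "V = {kxk_op K a b c | a b c. a \<in> carrier K \<and> b \<in> carrier K \<and> c \<in> carrier K \<and> Q a b c}"
    and one: "Q \<one> \<zero> \<one>"
    and add: "\<And>a b c a' b' c'. \<lbrakk>a \<in> carrier K; b \<in> carrier K; c \<in> carrier K; a' \<in> carrier K; b' \<in> carrier K;
      c' \<in> carrier K; Q a b c; Q a' b' c'\<rbrakk> \<Longrightarrow> Q (a \<oplus> a') (b \<oplus> b') (c \<oplus> c')"
    and smult: "\<And>s a b c. \<lbrakk>s \<in> carrier K; a \<in> carrier K; b \<in> carrier K; c \<in> carrier K; Q a b c\<rbrakk>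
      \<Longrightarrow> Q (s \<otimes> a) (s \<otimes> b) (s \<otimes> c)"
    and mult: "\<And>a b c a' b' c'. \<lbrakk>a \<in> carrier K; b \<in> carrier K; c \<in> carrier K; a' \<in> carrier K; b' \<in> carrier K;
      c' \<in> carrier K; Q a b c; Q a' b' c'\<rbrakk> \<Longrightarrow> Q (a \<otimes> a') (a \<otimes> b' \<oplus> b \<otimes> c') (c \<otimes> c')"
  shows "unital_subalgebra K (End_alg K (kxk K)) V"
proof -
  have I: "kxk_op K a b c \<in> V" if "a \<in> carrier K" "b \<in> carrier K" "c \<in> carrier K" "Q a b c" for a b c
    unfolding V using that by blast
  have C: "\<exists>a b c. f = kxk_op K a b c \<and> a \<in> carrier K \<and> b \<in> carrier K \<and> c \<in> carrier K \<and> Q a b c" if "f \<in> V" for f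
    using that unfolding V by blast
  have sub: "V \<subseteq> carrier (End_alg K (kxk K))" unfolding V using kxk_op_closed by blast
  have 1: "\<one>\<^bsub>End_alg K (kxk K)\<^esub> \<in> V" unfolding kxk_op_one by (rule I) (simp_all add: one)
  have sm: "s \<odot>\<^bsub>End_alg K (kxk K)\<^esub> f \<in> V" if s: "s \<in> carrier K" and f: "f \<in> V" for s f
    using C[OF f] s by (auto simp: kxk_op_smult intro!: I smult)
  have ad: "f \<oplus>\<^bsub>End_alg K (kxk K)\<^esub> g \<in> V" if f: "f \<in> V" and g: "g \<in> V" for f g
    using C[OF f] C[OF g] by (auto simp: kxk_op_add intro!: I add)
  have mu: "f \<otimes>\<^bsub>End_alg K (kxk K)\<^esub> g \<in> V" if f: "f \<in> V" and g: "g \<in> V" for f g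
    using C[OF f] C[OF g] by (auto simp: kxk_op_mult intro!: I mult)
  have neg: "\<ominus>\<^bsub>End_alg K (kxk K)\<^esub> f \<in> V" if f: "f \<in> V" for f
  proof -
    have fc: "f \<in> carrier (End_alg K (kxk K))" using f sub by blast
    have "(\<ominus> \<one>) \<odot>\<^bsub>End_alg K (kxk K)\<^esub> f \<in> V" by (rule sm[OF _ f]) simp
    then show ?thesis using fc by (simp add: E.smult_l_minus)
  qed
  have zero: "\<zero>\<^bsub>End_alg K (kxk K)\<^esub> \<in> V"
  proof -
    have "\<zero> \<odot>\<^bsub>End_alg K (kxk K)\<^esub> \<one>\<^bsub>End_alg K (kxk K)\<^esub> \<in> V" by (rule sm[OF _ 1]) simp
    then show ?thesis by simp
  qed
  show ?thesis
    unfolding unital_subalgebra_def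
    by (intro conjI E.subringI E.submoduleI sub 1 neg mu ad zero sm)
qed

lemma scalar_ops_subalgebra: "unital_subalgebra K (End_alg K (kxk K)) (scalar_ops K)"
  by (rule op_subalgebra[where Q="\<lambda>a b c. b = \<zero> \<and> c = a"]) (auto simp: scalar_ops_def)

lemma triangular_ops_subalgebra: "unital_subalgebra K (End_alg K (kxk K)) (triangular_ops K)"
  by (rule op_subalgebra[where Q="\<lambda>a b c. True"]) (auto simp: triangular_ops_def)

lemma symmetric_ops_subalgebra: "unital_subalgebra K (End_alg K (kxk K)) (symmetric_ops K)"
proof (rule op_subalgebra[where Q="\<lambda>a b c. a = c \<oplus> (b \<oplus> b)"])
  show "symmetric_ops K = {kxk_op K a b c |a b c.
      a \<in> carrier K \<and> b \<in> carrier K \<and> c \<in> carrier K \<and> a = c \<oplus> (b \<oplus> b)}"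
    by (auto simp: symmetric_ops_def)
qed (simp_all add: K.a_ac K.r_distr K.l_distr K.m_ac)

lemma scalars_End: "scalars K (End_alg K (kxk K)) = scalar_ops K"
  unfolding scalars_def scalar_ops_def by (auto simp: kxk_op_one kxk_op_smult)

text \<open>
  The dimensions are computed along the chain of the scalar, the symmetric and the triangular
  operators, each of which extends the previous one by one line.
\<close>

lemma line_extension_ops:
  assumes abc: "a \<in> carrier K" "b \<in> carrier K" "c \<in> carrier K"
  shows "ring.line_extension (End_alg K (kxk K)) (scalar_ops K) (kxk_op K a b c) W
    = {kxk_op K (s \<otimes> a) (s \<otimes> b) (s \<otimes> c) \<oplus>\<^bsub>End_alg K (kxk K)\<^esub> w | s w. s \<in> carrier K \<and> w \<in> W}"
proof -
  have prod: "kxk_op K s \<zero> s \<otimes>\<^bsub>End_alg K (kxk K)\<^esub> kxk_op K a b c = kxk_op K (s \<otimes> a) (s \<otimes> b) (s \<otimes> c)"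
    if "s \<in> carrier K" for s
    using that abc by (simp add: kxk_op_mult)
  have mem: "f \<in> ring.line_extension (End_alg K (kxk K)) (scalar_ops K) (kxk_op K a b c) W \<longleftrightarrow>
      (\<exists>k\<in>scalar_ops K. \<exists>w\<in>W. f = k \<otimes>\<^bsub>End_alg K (kxk K)\<^esub> kxk_op K a b c \<oplus>\<^bsub>End_alg K (kxk K)\<^esub> w)" for f
    by (auto simp: E.line_extension_def set_add_def' r_coset_def)
  have scalars: "(\<exists>k\<in>scalar_ops K. \<exists>w\<in>W. f = k \<otimes>\<^bsub>End_alg K (kxk K)\<^esub> kxk_op K a b c \<oplus>\<^bsub>End_alg K (kxk K)\<^esub> w) \<longleftrightarrow>
      (\<exists>s\<in>carrier K. \<exists>w\<in>W. f = kxk_op K s \<zero> s \<otimes>\<^bsub>End_alg K (kxk K)\<^esub> kxk_op K a b c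
      \<oplus>\<^bsub>End_alg K (kxk K)\<^esub> w)" for f
    unfolding scalar_ops_def by auto
  have "(\<exists>s\<in>carrier K. \<exists>w\<in>W. f = kxk_op K s \<zero> s \<otimes>\<^bsub>End_alg K (kxk K)\<^esub> kxk_op K a b c \<oplus>\<^bsub>End_alg K (kxk K)\<^esub> w)
      \<longleftrightarrow> (\<exists>s\<in>carrier K. \<exists>w\<in>W. f = kxk_op K (s \<otimes> a) (s \<otimes> b) (s \<otimes> c)
      \<oplus>\<^bsub>End_alg K (kxk K)\<^esub> w)" for f
    by (intro bex_cong refl) (simp add: prod)
  then show ?thesis unfolding set_eq_iff mem scalars by auto
qed

lemma has_dim_scalar_ops: "has_dim K (End_alg K (kxk K)) (scalar_ops K) 1"
proof -
  have "kxk_op K \<one> \<zero> \<one> \<noteq> kxk_op K \<zero> \<zero> \<zero>"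
    using kxk_op_inject(1)[of "\<one>" "\<zero>" "\<one>" "\<zero>" "\<zero>" "\<zero>"] by auto
  then have "E.dimension (Suc 0) (scalar_ops K)
      (ring.line_extension (End_alg K (kxk K)) (scalar_ops K) (kxk_op K \<one> \<zero> \<one>) {\<zero>\<^bsub>End_alg K (kxk K)\<^esub>})"
    by (intro E.Suc_dim E.zero_dim) (simp_all add: kxk_op_closed kxk_op_zero)
  moreover have "ring.line_extension (End_alg K (kxk K)) (scalar_ops K) (kxk_op K \<one> \<zero> \<one>)
      {\<zero>\<^bsub>End_alg K (kxk K)\<^esub>} = scalar_ops K"
    unfolding line_extension_ops[OF K.one_closed K.zero_closed K.one_closed]
    unfolding scalar_ops_def by (auto simp: kxk_op_zero kxk_op_add cong: rev_conj_cong)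
  ultimately show ?thesis by (simp add: has_dim_def scalars_End)
qed

lemma has_dim_symmetric_ops: "has_dim K (End_alg K (kxk K)) (symmetric_ops K) 2"
proof -
  let ?v = "kxk_op K (\<one> \<oplus> \<one>) \<one> \<zero>"
  have "?v \<notin> scalar_ops K"
  proof
    assume "?v \<in> scalar_ops K"
    then obtain a where a: "a \<in> carrier K" "?v = kxk_op K a \<zero> a" by (auto simp: scalar_ops_def)
    show False using kxk_op_inject(2)[OF _ _ _ _ _ _ a(2)] a(1) by simp
  qed
  then have "E.dimension (Suc 1) (scalar_ops K)
      (ring.line_extension (End_alg K (kxk K)) (scalar_ops K) ?v (scalar_ops K))"
    using has_dim_scalar_ops by (intro E.Suc_dim) (simp_all add: kxk_op_closed has_dim_def scalars_End)
  moreover have "ring.line_extension (End_alg K (kxk K)) (scalar_ops K) ?v (scalar_ops K) = symmetric_ops K"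
  proof -
    have 1: "kxk_op K (s \<otimes> (\<one> \<oplus> \<one>)) (s \<otimes> \<one>) (s \<otimes> \<zero>) \<oplus>\<^bsub>End_alg K (kxk K)\<^esub> kxk_op K a \<zero> a
        = kxk_op K (a \<oplus> (s \<oplus> s)) s a" if "s \<in> carrier K" "a \<in> carrier K" for s a
      using that by (simp add: kxk_op_add K.r_distr K.a_ac)
    have "ring.line_extension (End_alg K (kxk K)) (scalar_ops K) ?v (scalar_ops K)
        = {kxk_op K (a \<oplus> (s \<oplus> s)) s a | s a. s \<in> carrier K \<and> a \<in> carrier K}"
      unfolding line_extension_ops[OF K.a_closed[OF K.one_closed K.one_closed] K.one_closed K.zero_closed]
    proof (intro equalityI subsetI; elim CollectE exE conjE)
      fix f s w
      assume f: "f = kxk_op K (s \<otimes> (\<one> \<oplus> \<one>)) (s \<otimes> \<one>) (s \<otimes> \<zero>) \<oplus>\<^bsub>End_alg K (kxk K)\<^esub> w"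
        and s: "s \<in> carrier K" and "w \<in> scalar_ops K"
      then obtain a where a: "w = kxk_op K a \<zero> a" "a \<in> carrier K" by (auto simp: scalar_ops_def)
      have "f = kxk_op K (a \<oplus> (s \<oplus> s)) s a" unfolding f a(1) by (rule 1[OF s a(2)])
      then show "f \<in> {kxk_op K (a \<oplus> (s \<oplus> s)) s a | s a. s \<in> carrier K \<and> a \<in> carrier K}"
        using s a(2) by blast
    next
      fix f s a
      assume f: "f = kxk_op K (a \<oplus> (s \<oplus> s)) s a" and sa: "s \<in> carrier K" "a \<in> carrier K"
      have "kxk_op K a \<zero> a \<in> scalar_ops K" using sa by (auto simp: scalar_ops_def)
      then show "f \<in> {kxk_op K (s \<otimes> (\<one> \<oplus> \<one>)) (s \<otimes> \<one>) (s \<otimes> \<zero>) \<oplus>\<^bsub>End_alg K (kxk K)\<^esub> w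
          | s w. s \<in> carrier K \<and> w \<in> scalar_ops K}"
        unfolding f 1[OF sa, symmetric] using sa(1) by blast
    qed
    then show ?thesis by (simp add: symmetric_ops_def)
  qed
  ultimately show ?thesis by (simp add: has_dim_def scalars_End numeral_2_eq_2)
qed

lemma has_dim_triangular_ops: "has_dim K (End_alg K (kxk K)) (triangular_ops K) 3"
proof -
  let ?v = "kxk_op K \<one> \<zero> \<zero>"
  have "?v \<notin> symmetric_ops K"
  proof
    assume "?v \<in> symmetric_ops K"
    then obtain b c where bc: "b \<in> carrier K" "c \<in> carrier K" "?v = kxk_op K (c \<oplus> (b \<oplus> b)) b c"
      by (auto simp: symmetric_ops_def)
    have "b = \<zero>" "c = \<zero>" "\<one> = c \<oplus> (b \<oplus> b)"
      using kxk_op_inject[OF _ _ _ _ _ _ bc(3)] bc(1,2) by auto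
    then have "\<one> = \<zero> \<oplus> (\<zero> \<oplus> \<zero>)" by metis
    then show False by simp
  qed
  then have "E.dimension (Suc 2) (scalar_ops K)
      (ring.line_extension (End_alg K (kxk K)) (scalar_ops K) ?v (symmetric_ops K))"
    using has_dim_symmetric_ops by (intro E.Suc_dim) (simp_all add: kxk_op_closed has_dim_def scalars_End)
  moreover have "ring.line_extension (End_alg K (kxk K)) (scalar_ops K) ?v (symmetric_ops K) = triangular_ops K"
  proof -
    have 1: "kxk_op K (s \<otimes> \<one>) (s \<otimes> \<zero>) (s \<otimes> \<zero>) \<oplus>\<^bsub>End_alg K (kxk K)\<^esub> kxk_op K (c \<oplus> (b \<oplus> b)) b c
        = kxk_op K (s \<oplus> (c \<oplus> (b \<oplus> b))) b c" if "s \<in> carrier K" "b \<in> carrier K" "c \<in> carrier K" for s b c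
      using that by (simp add: kxk_op_add)
    have 2: "a = (a \<ominus> (c \<oplus> (b \<oplus> b))) \<oplus> (c \<oplus> (b \<oplus> b))"
      if "a \<in> carrier K" "b \<in> carrier K" "c \<in> carrier K" for a b c
      using that by (simp add: a_minus_def K.a_assoc K.l_neg)
    have line: "ring.line_extension (End_alg K (kxk K)) (scalar_ops K) ?v (symmetric_ops K)
        = {kxk_op K (s \<oplus> (c \<oplus> (b \<oplus> b))) b c | s b c. s \<in> carrier K \<and> b \<in> carrier K \<and> c \<in> carrier K}"
      unfolding line_extension_ops[OF K.one_closed K.zero_closed K.zero_closed]
    proof (intro equalityI subsetI; elim CollectE exE conjE)
      fix f s w
      assume f: "f = kxk_op K (s \<otimes> \<one>) (s \<otimes> \<zero>) (s \<otimes> \<zero>) \<oplus>\<^bsub>End_alg K (kxk K)\<^esub> w"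
        and s: "s \<in> carrier K" and "w \<in> symmetric_ops K"
      then obtain b c where bc: "w = kxk_op K (c \<oplus> (b \<oplus> b)) b c" "b \<in> carrier K" "c \<in> carrier K"
        by (auto simp: symmetric_ops_def)
      have "f = kxk_op K (s \<oplus> (c \<oplus> (b \<oplus> b))) b c" unfolding f bc(1) by (rule 1[OF s bc(2,3)])
      then show "f \<in> {kxk_op K (s \<oplus> (c \<oplus> (b \<oplus> b))) b c | s b c.
          s \<in> carrier K \<and> b \<in> carrier K \<and> c \<in> carrier K}"
        using s bc(2,3) by blast
    next
      fix f s b c
      assume f: "f = kxk_op K (s \<oplus> (c \<oplus> (b \<oplus> b))) b c"
        and sbc: "s \<in> carrier K" "b \<in> carrier K" "c \<in> carrier K"
      have "kxk_op K (c \<oplus> (b \<oplus> b)) b c \<in> symmetric_ops K" using sbc by (auto simp: symmetric_ops_def)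
      then show "f \<in> {kxk_op K (s \<otimes> \<one>) (s \<otimes> \<zero>) (s \<otimes> \<zero>) \<oplus>\<^bsub>End_alg K (kxk K)\<^esub> w
          | s w. s \<in> carrier K \<and> w \<in> symmetric_ops K}"
        unfolding f 1[OF sbc, symmetric] using sbc(1) by blast
    qed
    show ?thesis
      unfolding line triangular_ops_def
    proof (intro equalityI subsetI; elim CollectE exE conjE)
      fix f a b c assume abc: "a \<in> carrier K" "b \<in> carrier K" "c \<in> carrier K" and f: "f = kxk_op K a b c"
      have "f = kxk_op K ((a \<ominus> (c \<oplus> (b \<oplus> b))) \<oplus> (c \<oplus> (b \<oplus> b))) b c"
        unfolding f using 2[OF abc] by simp
      moreover have "a \<ominus> (c \<oplus> (b \<oplus> b)) \<in> carrier K" using abc by simp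
      ultimately show "f \<in> {kxk_op K (s \<oplus> (c \<oplus> (b \<oplus> b))) b c | s b c.
          s \<in> carrier K \<and> b \<in> carrier K \<and> c \<in> carrier K}"
        using abc by blast
    next
      fix f s b c assume "f = kxk_op K (s \<oplus> (c \<oplus> (b \<oplus> b))) b c" "s \<in> carrier K" "b \<in> carrier K" "c \<in> carrier K"
      moreover from this have "s \<oplus> (c \<oplus> (b \<oplus> b)) \<in> carrier K" by simp
      ultimately show "f \<in> {kxk_op K a b c | a b c. a \<in> carrier K \<and> b \<in> carrier K \<and> c \<in> carrier K}"
        by blast
    qed
  qed
  ultimately show ?thesis by (simp add: has_dim_def scalars_End numeral_3_eq_3 numeral_2_eq_2)
qed

subsection \<open>Matrices\<close>

lemma scalar_ops_eq: "scalar_ops K = {\<lambda>x\<in>carrier (kxk K). \<alpha> \<odot>\<^bsub>kxk K\<^esub> x | \<alpha>. \<alpha> \<in> carrier K}"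
proof -
  have "(\<lambda>x\<in>carrier (kxk K). \<alpha> \<odot>\<^bsub>kxk K\<^esub> x) = kxk_op K \<alpha> \<zero> \<alpha>" if \<alpha>: "\<alpha> \<in> carrier K" for \<alpha>
  proof (rule kxk_op_unique)
    have "\<alpha> \<odot>\<^bsub>End_alg K (kxk K)\<^esub> \<one>\<^bsub>End_alg K (kxk K)\<^esub> = (\<lambda>x\<in>carrier (kxk K). \<alpha> \<odot>\<^bsub>kxk K\<^esub> x)"
      by (auto simp: End_alg_sel)
    then show "(\<lambda>x\<in>carrier (kxk K). \<alpha> \<odot>\<^bsub>kxk K\<^esub> x) \<in> carrier (End_alg K (kxk K))"
      using E.smult_closed[OF \<alpha> E.one_closed] by simp
  qed (simp_all add: \<alpha> e_closed)
  then show ?thesis unfolding scalar_ops_def by (metis (no_types, opaque_lifting))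
qed

lemma has_matrix_two:
  assumes uv: "u \<in> carrier (kxk K)" "v \<in> carrier (kxk K)"
  shows "has_matrix K (kxk K) [u, v] f M \<longleftrightarrow>
    M 0 0 \<in> carrier K \<and> M 0 1 \<in> carrier K \<and> M 1 0 \<in> carrier K \<and> M 1 1 \<in> carrier K \<and>
    f u = M 0 0 \<odot>\<^bsub>kxk K\<^esub> u \<oplus>\<^bsub>kxk K\<^esub> M 1 0 \<odot>\<^bsub>kxk K\<^esub> v \<and> f v = M 0 1 \<odot>\<^bsub>kxk K\<^esub> u \<oplus>\<^bsub>kxk K\<^esub> M 1 1 \<odot>\<^bsub>kxk K\<^esub> v"
proof -
  have sum: "(\<Oplus>\<^bsub>kxk K\<^esub>i\<in>{..<Suc (Suc 0)}. M i j \<odot>\<^bsub>kxk K\<^esub> ([u, v] ! i)) =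
      M 0 j \<odot>\<^bsub>kxk K\<^esub> u \<oplus>\<^bsub>kxk K\<^esub> M 1 j \<odot>\<^bsub>kxk K\<^esub> v" if "M 0 j \<in> carrier K" "M 1 j \<in> carrier K" for j
    using that uv by (simp add: lessThan_Suc A.M.a_comm)
  show ?thesis
    unfolding has_matrix_def
    by (auto simp: sum less_Suc_eq)
qed

lemma triangular_ops_eq:
  "triangular_ops K = {f \<in> carrier (End_alg K (kxk K)). \<exists>M.
      has_matrix K (kxk K) [\<one>\<^bsub>kxk K\<^esub>, elt_e K] f M \<and> (\<forall>i<2. \<forall>j<i. M i j = \<zero>)}"
proof (intro equalityI subsetI)
  fix f assume "f \<in> triangular_ops K"
  then obtain a b c where abc: "a \<in> carrier K" "b \<in> carrier K" "c \<in> carrier K" and f: "f = kxk_op K a b c"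
    by (auto simp: triangular_ops_def)
  let ?M = "\<lambda>i j :: nat. if j = 0 then (if i = 0 then a else \<zero>) else (if i = 0 then b else c)"
  have "has_matrix K (kxk K) [\<one>\<^bsub>kxk K\<^esub>, elt_e K] f ?M"
    using abc by (simp add: has_matrix_two e_closed f kxk_op_values)
  moreover have "\<forall>i<2. \<forall>j<i. ?M i j = \<zero>" by auto
  ultimately show "f \<in> {f \<in> carrier (End_alg K (kxk K)). \<exists>M.
      has_matrix K (kxk K) [\<one>\<^bsub>kxk K\<^esub>, elt_e K] f M \<and> (\<forall>i<2. \<forall>j<i. M i j = \<zero>)}"
    using kxk_op_closed[OF abc] f by blast
next
  fix f assume "f \<in> {f \<in> carrier (End_alg K (kxk K)). \<exists>M.
      has_matrix K (kxk K) [\<one>\<^bsub>kxk K\<^esub>, elt_e K] f M \<and> (\<forall>i<2. \<forall>j<i. M i j = \<zero>)}"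
  then obtain M where f: "f \<in> carrier (End_alg K (kxk K))" and M: "has_matrix K (kxk K) [\<one>\<^bsub>kxk K\<^esub>, elt_e K] f M"
    and M10: "M 1 0 = \<zero>" by auto
  have "f = kxk_op K (M 0 0) (M 0 1) (M 1 1)"
    using M M10 by (intro kxk_op_unique[OF f]) (simp_all add: has_matrix_two e_closed)
  then show "f \<in> triangular_ops K"
    using M unfolding triangular_ops_def has_matrix_two[OF A.one_closed e_closed] by blast
qed

lemma symmetric_ops_eq:
  "symmetric_ops K = {f \<in> carrier (End_alg K (kxk K)). \<exists>\<alpha>\<in>carrier K. \<exists>\<beta>\<in>carrier K.
      has_matrix K (kxk K) [(\<one>, \<zero>), (\<zero>, \<one>)] f (\<lambda>i j. if i = j then \<alpha> else \<beta>)}"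
proof -
  have u: "(\<one>, \<zero>) \<in> carrier (kxk K)" "(\<zero>, \<one>) \<in> carrier (kxk K)" by (simp_all add: kxk_sel)
  have one: "\<one>\<^bsub>kxk K\<^esub> = (\<one>, \<zero>) \<oplus>\<^bsub>kxk K\<^esub> (\<zero>, \<one>)" by (simp add: kxk_sel)
  have main: "has_matrix K (kxk K) [(\<one>, \<zero>), (\<zero>, \<one>)] f (\<lambda>i j. if i = j then \<alpha> else \<beta>)
      \<longleftrightarrow> f = kxk_op K (\<alpha> \<oplus> \<beta>) \<beta> (\<alpha> \<ominus> \<beta>)"
    if f: "f \<in> carrier (End_alg K (kxk K))" and ab: "\<alpha> \<in> carrier K" "\<beta> \<in> carrier K" for f \<alpha> \<beta>
  proof
    have lin: "f \<in> lin_hom K (kxk K) (kxk K)" using f by (simp add: End_alg_sel)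
    have minus: "\<beta> \<oplus> (\<alpha> \<ominus> \<beta>) = \<alpha>" using ab by (simp add: a_minus_def K.a_lcomm[of \<beta> \<alpha>] K.r_neg)
    {
      assume "has_matrix K (kxk K) [(\<one>, \<zero>), (\<zero>, \<one>)] f (\<lambda>i j. if i = j then \<alpha> else \<beta>)"
      then have v: "f (\<one>, \<zero>) = (\<alpha>, \<beta>)" "f (\<zero>, \<one>) = (\<beta>, \<alpha>)"
        using ab by (simp_all add: has_matrix_two u) (simp_all add: kxk_sel)
      show "f = kxk_op K (\<alpha> \<oplus> \<beta>) \<beta> (\<alpha> \<ominus> \<beta>)"
      proof (rule kxk_op_unique[OF f])
        show "f \<one>\<^bsub>kxk K\<^esub> = (\<alpha> \<oplus> \<beta>) \<odot>\<^bsub>kxk K\<^esub> \<one>\<^bsub>kxk K\<^esub>"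
          unfolding one lin_hom_add[OF lin u] v using ab by (simp add: kxk_sel K.a_comm)
        show "f (elt_e K) = \<beta> \<odot>\<^bsub>kxk K\<^esub> \<one>\<^bsub>kxk K\<^esub> \<oplus>\<^bsub>kxk K\<^esub> (\<alpha> \<ominus> \<beta>) \<odot>\<^bsub>kxk K\<^esub> elt_e K"
          unfolding elt_e_def v using ab by (simp add: kxk_sel minus)
      qed (use ab in auto)
    }
    assume f_eq: "f = kxk_op K (\<alpha> \<oplus> \<beta>) \<beta> (\<alpha> \<ominus> \<beta>)"
    have z: "(\<zero>, \<one>) = \<one>\<^bsub>kxk K\<^esub> \<oplus>\<^bsub>kxk K\<^esub> (\<ominus> \<one>) \<odot>\<^bsub>kxk K\<^esub> elt_e K"
      by (simp add: kxk_sel elt_e_def K.r_neg)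
    have fe: "f (elt_e K) = (\<alpha>, \<beta>)"
      unfolding f_eq using ab by (simp add: kxk_op_values) (simp add: kxk_sel elt_e_def minus)
    have f1: "f \<one>\<^bsub>kxk K\<^esub> = (\<alpha> \<oplus> \<beta>, \<alpha> \<oplus> \<beta>)"
      unfolding f_eq using ab by (simp add: kxk_op_values) (simp add: kxk_sel)
    have "f (\<zero>, \<one>) = f \<one>\<^bsub>kxk K\<^esub> \<oplus>\<^bsub>kxk K\<^esub> (\<ominus> \<one>) \<odot>\<^bsub>kxk K\<^esub> f (elt_e K)"
      unfolding z by (simp add: lin_hom_add[OF lin] lin_hom_smult[OF lin] e_closed)
    also have "\<dots> = (\<beta>, \<alpha>)"
      unfolding fe f1 using ab
      by (simp add: kxk_sel K.l_minus K.a_assoc K.r_neg) (simp add: K.a_lcomm[of \<alpha> \<beta>] K.r_neg)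
    finally have f2: "f (\<zero>, \<one>) = (\<beta>, \<alpha>)" .
    show "has_matrix K (kxk K) [(\<one>, \<zero>), (\<zero>, \<one>)] f (\<lambda>i j. if i = j then \<alpha> else \<beta>)"
      unfolding has_matrix_two[OF u] using ab fe[unfolded elt_e_def] f2 by (simp add: kxk_sel)
  qed
  have cl: "kxk_op K (\<alpha> \<oplus> \<beta>) \<beta> (\<alpha> \<ominus> \<beta>) \<in> carrier (End_alg K (kxk K))"
    if "\<alpha> \<in> carrier K" "\<beta> \<in> carrier K" for \<alpha> \<beta> using that by (intro kxk_op_closed) auto
  have "{f \<in> carrier (End_alg K (kxk K)). \<exists>\<alpha>\<in>carrier K. \<exists>\<beta>\<in>carrier K.
      has_matrix K (kxk K) [(\<one>, \<zero>), (\<zero>, \<one>)] f (\<lambda>i j. if i = j then \<alpha> else \<beta>)}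
    = {kxk_op K (\<alpha> \<oplus> \<beta>) \<beta> (\<alpha> \<ominus> \<beta>) | \<alpha> \<beta>. \<alpha> \<in> carrier K \<and> \<beta> \<in> carrier K}"
    using main cl by blast
  also have "\<dots> = symmetric_ops K"
    unfolding symmetric_ops_def
  proof (intro equalityI subsetI; elim CollectE exE conjE)
    fix f \<alpha> \<beta> assume ab: "\<alpha> \<in> carrier K" "\<beta> \<in> carrier K" and f: "f = kxk_op K (\<alpha> \<oplus> \<beta>) \<beta> (\<alpha> \<ominus> \<beta>)"
    have "(\<alpha> \<ominus> \<beta>) \<oplus> (\<beta> \<oplus> \<beta>) = \<alpha> \<oplus> \<beta>" "\<alpha> \<ominus> \<beta> \<in> carrier K"
      using ab by (simp_all add: a_minus_def K.a_assoc K.r_neg1)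
    then show "f \<in> {kxk_op K (c \<oplus> (b \<oplus> b)) b c | b c. b \<in> carrier K \<and> c \<in> carrier K}"
      using f ab by (metis (mono_tags, lifting) mem_Collect_eq)
  next
    fix f b c assume bc: "b \<in> carrier K" "c \<in> carrier K" and f: "f = kxk_op K (c \<oplus> (b \<oplus> b)) b c"
    have "(c \<oplus> b) \<oplus> b = c \<oplus> (b \<oplus> b)" "(c \<oplus> b) \<ominus> b = c" "c \<oplus> b \<in> carrier K"
      using bc by (simp_all add: a_minus_def K.a_assoc K.r_neg)
    then show "f \<in> {kxk_op K (\<alpha> \<oplus> \<beta>) \<beta> (\<alpha> \<ominus> \<beta>) | \<alpha> \<beta>. \<alpha> \<in> carrier K \<and> \<beta> \<in> carrier K}"
      using f bc by (metis (mono_tags, lifting) mem_Collect_eq)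
  qed
  finally show ?thesis by simp
qed

end


section \<open>Classification and universality\<close>

lemma tmap_cong:
  assumes A: "unital_algebra K A" and B: "unital_algebra K B" and C: "unital_algebra K C" and D: "unital_algebra K D"
    and f: "f \<in> lin_hom K C A" "f' \<in> lin_hom K C A" and g: "g \<in> lin_hom K D B" "g' \<in> lin_hom K D B"
    and eq: "\<And>x. x \<in> carrier C \<Longrightarrow> f x = f' x" "\<And>y. y \<in> carrier D \<Longrightarrow> g y = g' y"
    and t: "t \<in> carrier (tensor K C D)"
  shows "tmap K A B f g t = tmap K A B f' g' t"
  by (rule tensor_lin_eq[OF C D tmap_lin[OF A B C D f(1) g(1)] tmap_lin[OF A B C D f(2) g(2)] _ t])
     (simp add: tmap_tens[OF A B C D f(1) g(1)] tmap_tens[OF A B C D f(2) g(2)] eq)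

text \<open>
  The homomorphism in a universal property is unique among extensional functions, hence the one that
  is constructed has to be cut down to the carrier.
\<close>

lemma hopf_hom_restrict:
  assumes G: "hopf_algebra K G" and H: "hopf_algebra K H" and \<phi>: "\<phi> \<in> hopf_hom K G H"
  shows "restrict \<phi> (carrier G) \<in> hopf_hom K G H"
proof -
  interpret G: hopf_algebra K G by (rule G)
  interpret H: hopf_algebra K H by (rule H)
  note Ga = G.unital_algebra_axioms and Ha = H.unital_algebra_axioms
  have a: "\<phi> \<in> alg_hom K G H" using \<phi> by (simp add: hopf_hom_def)
  have a': "restrict \<phi> (carrier G) \<in> alg_hom K G H"
    by (rule alg_hom_cong[OF Ga a]) simp
  have "tmap K H H (restrict \<phi> (carrier G)) (restrict \<phi> (carrier G)) (comult G x) = tmap K H H \<phi> \<phi> (comult G x)"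
    if "x \<in> carrier G" for x
    by (rule tmap_cong[OF Ha Ha Ga Ga])
       (simp_all add: alg_hom_lin a a' lin_hom_closed[OF alg_hom_lin[OF G.comult_hom] that])
  then show ?thesis
    using \<phi> a' by (simp add: hopf_hom_def lin_hom_closed[OF G.antipode_lin])
qed

text \<open>Inverses are preserved and unique.\<close>

lemma alg_hom_inverse_eq:
  assumes B: "unital_algebra K B" and f: "f \<in> alg_hom K A B" and g: "g \<in> alg_hom K A B"
    and xy: "x \<in> carrier A" "y \<in> carrier A" "x \<otimes>\<^bsub>A\<^esub> y = \<one>\<^bsub>A\<^esub>" "y \<otimes>\<^bsub>A\<^esub> x = \<one>\<^bsub>A\<^esub>" and eq: "f x = g x"
  shows "f y = g y"
proof -
  interpret B: unital_algebra K B by (rule B)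
  have c: "f y \<in> carrier B" "g y \<in> carrier B" "f x \<in> carrier B"
    using lin_hom_closed[OF alg_hom_lin[OF f]] lin_hom_closed[OF alg_hom_lin[OF g]] xy by auto
  have "f y \<otimes>\<^bsub>B\<^esub> f x = \<one>\<^bsub>B\<^esub>" "f x \<otimes>\<^bsub>B\<^esub> g y = \<one>\<^bsub>B\<^esub>"
    using alg_hom_mult[OF f xy(2,1)] alg_hom_mult[OF g xy(1,2)] xy eq
    by (simp_all add: alg_hom_one[OF f] alg_hom_one[OF g])
  then show ?thesis using c by (metis B.m_assoc B.l_one B.r_one)
qed

context
  fixes K :: "'k ring" assumes K: "field K"
begin

interpretation K: field K by (rule K)
interpretation A: unital_algebra K "kxk K" by (rule kxk_unital_algebra[OF K_cring[OF K]])

text \<open>For a group-like element the antipode axiom reads \<open>S(c) c = 1 = c S(c)\<close>.\<close>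

lemma coaction_pair_c_inverse:
  assumes H: "hopf_algebra K H" and p: "coaction_pair K H h c"
  shows "antipode H c \<otimes>\<^bsub>H\<^esub> c = \<one>\<^bsub>H\<^esub>" "c \<otimes>\<^bsub>H\<^esub> antipode H c = \<one>\<^bsub>H\<^esub>" "antipode H c \<in> carrier H"
proof -
  interpret H: hopf_algebra K H by (rule H)
  note Ha = H.unital_algebra_axioms
  have c: "c \<in> carrier H" "comult H c = tens K H H c c" "counit H c = \<one>\<^bsub>K\<^esub>"
    using p by (simp_all add: coaction_pair_def[OF K_cring[OF K]])
  note t = tlift_tens[OF Ha Ha H.module_axioms bilin_mult[OF Ha H.antipode_lin lin_hom_id]]
    tlift_tens[OF Ha Ha H.module_axioms bilin_mult[OF Ha lin_hom_id H.antipode_lin]]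
  show "antipode H c \<otimes>\<^bsub>H\<^esub> c = \<one>\<^bsub>H\<^esub>" "c \<otimes>\<^bsub>H\<^esub> antipode H c = \<one>\<^bsub>H\<^esub>"
    using H.antipode_left[OF c(1)] H.antipode_right[OF c(1)] c by (simp_all add: t)
  show "antipode H c \<in> carrier H" using lin_hom_closed[OF H.antipode_lin c(1)] .
qed

text \<open>The functional \<open>\<lambda>\<close> sends \<open>1 \<otimes> 1\<close> to \<open>\<lambda>(1) 1\<close> and \<open>1 \<otimes> h + e \<otimes> c\<close> to \<open>\<lambda>(h) 1 + \<lambda>(c) e\<close>.\<close>

lemma cosupp_coaction:
  assumes H: "hopf_algebra K H" and p: "coaction_pair K H h c"
    and \<rho>: "\<And>a. a \<in> carrier (kxk K) \<Longrightarrow> \<rho> a = unital_ext K H (kxk_tens K H h c) a"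
  shows "cosupp K (kxk K) H \<rho> = {kxk_op K (l \<one>\<^bsub>H\<^esub>) (l h) (l c) | l. l \<in> lin_hom K H (base_alg K)}"
proof -
  interpret H: hopf_algebra K H by (rule H)
  note Kc = K_cring[OF K] and Ha = H.unital_algebra_axioms
  have hc: "h \<in> carrier H" "c \<in> carrier H" using p by (simp_all add: coaction_pair_def[OF Kc])
  note u = unital_ext_lin[OF Kc Ha kxk_tens_closed[OF Kc Ha hc]]
  have "(\<lambda>a\<in>carrier (kxk K). rho_vee K (kxk K) \<rho> l a) = kxk_op K (l \<one>\<^bsub>H\<^esub>) (l h) (l c)"
    if l: "l \<in> lin_hom K H (base_alg K)" for l
  proof -
    let ?f = "\<lambda>a. tlift K (kxk K) (\<lambda>x h. l h \<odot>\<^bsub>kxk K\<^esub> x) (unital_ext K H (kxk_tens K H h c) a)"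
    have lc: "l x \<in> carrier K" if "x \<in> carrier H" for x
      using lin_hom_closed[OF l that] by (simp add: base_alg_sel)
    have f: "?f \<in> lin_hom K (kxk K) (kxk K)"
      by (rule lin_hom_comp[OF u(1) tlift_lin[OF kxk_unital_algebra[OF Kc] Ha A.module_axioms
            bilin_scale_right[OF A.module_axioms l lin_hom_id]]])
    have "(\<lambda>a\<in>carrier (kxk K). rho_vee K (kxk K) \<rho> l a) = (\<lambda>a\<in>carrier (kxk K). ?f a)"
      by (rule restrict_ext) (simp add: rho_vee_def \<rho>)
    also have "\<dots> = kxk_op K (l \<one>\<^bsub>H\<^esub>) (l h) (l c)"
    proof (rule kxk_op_unique[OF K])
      show "(\<lambda>a\<in>carrier (kxk K). ?f a) \<in> carrier (End_alg K (kxk K))"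
        using lin_hom_cong[OF A.module_axioms f, of "restrict ?f (carrier (kxk K))"]
        by (simp add: End_alg_sel)
    qed (simp_all add: lc hc elt_e_closed[OF Kc] u coaction_functional[OF Kc H hc l])
    finally show ?thesis .
  qed
  then show ?thesis unfolding cosupp_def by (metis (no_types, lifting))
qed

context
  fixes H :: "('k, 'h) hopf" (structure) and h c
  assumes H: "hopf_algebra K H" and p: "coaction_pair K H h c"
begin

interpretation H: hopf_algebra K H by (rule H)

lemma pair_facts: "h \<in> carrier H" "c \<in> carrier H" "h \<otimes> h = h"
  "h \<otimes> c \<oplus> c \<otimes> h \<oplus> c \<otimes> c = c" "counit H h = \<zero>\<^bsub>K\<^esub>" "counit H c = \<one>\<^bsub>K\<^esub>" "counit H \<one> = \<one>\<^bsub>K\<^esub>"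
  using p alg_hom_one[OF H.counit_hom] by (simp_all add: coaction_pair_def[OF K_cring[OF K]] base_alg_sel)

lemmas counit_lin' = alg_hom_lin[OF H.counit_hom]

lemma functional_closed: "\<lbrakk>l \<in> lin_hom K H (base_alg K); x \<in> carrier H\<rbrakk> \<Longrightarrow> l x \<in> carrier K"
  using lin_hom_closed by (force simp: base_alg_sel)

text \<open>For \<open>h = 0\<close> the second relation becomes \<open>c\<^sup>2 = c\<close>, and \<open>c\<close> is invertible.\<close>

lemma pair_h_zero: "h = \<zero> \<Longrightarrow> c = \<one>"
proof -
  assume "h = \<zero>"
  then have cc: "c \<otimes> c = c" using pair_facts by simp
  note i = coaction_pair_c_inverse[OF H p]
  have "c = (antipode H c \<otimes> c) \<otimes> c" using i pair_facts by simp
  also have "\<dots> = \<one>" unfolding H.m_assoc[OF i(3) pair_facts(2,2)] cc by (rule i(1))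
  finally show ?thesis .
qed

lemma smult_cancel:
  assumes "s \<in> carrier K" "x \<in> carrier H" "s \<odot> x = \<zero>" "x \<noteq> \<zero>" shows "s = \<zero>\<^bsub>K\<^esub>"
proof (rule ccontr)
  assume "s \<noteq> \<zero>\<^bsub>K\<^esub>"
  then have s: "inv\<^bsub>K\<^esub> s \<in> carrier K" "inv\<^bsub>K\<^esub> s \<otimes>\<^bsub>K\<^esub> s = \<one>\<^bsub>K\<^esub>"
    using assms(1) by (auto simp: K.field_Units K.Units_l_inv)
  have "inv\<^bsub>K\<^esub> s \<odot> (s \<odot> x) = x"
    using H.smult_assoc1[OF s(1) assms(1,2)] s(2) assms(2) by simp
  then show False using assms s by simp
qed

text \<open>
  If \<open>c\<close> is a linear combination of \<open>1\<close> and \<open>h \<noteq> 0\<close>, then the counit gives \<open>c = 1 + bh\<close>, the relation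
  between \<open>h\<close> and \<open>c\<close> becomes \<open>(b + 1)(b + 2)h = 0\<close>, and \<open>b = -1\<close> is excluded because then \<open>hc = 0\<close>
  although \<open>c\<close> is invertible.
\<close>

lemma pair_dependent:
  assumes ab: "a \<in> carrier K" "b \<in> carrier K" and c: "c = a \<odot> \<one> \<oplus> b \<odot> h" and h: "h \<noteq> \<zero>"
  shows "c = \<one> \<ominus> (h \<oplus> h)"
proof -
  note pf = pair_facts and i = coaction_pair_c_inverse[OF H p]
  have "counit H c = a"
    unfolding c using pf ab
    by (simp add: lin_hom_add[OF counit_lin'] lin_hom_smult[OF counit_lin'] base_alg_sel)
  then have a: "a = \<one>\<^bsub>K\<^esub>" using pf by simp
  have c': "c = \<one> \<oplus> b \<odot> h" unfolding c a by simp
  (* The idempotent \<open>h\<close> is an eigenvector: \<open>hc = ch = t h\<close>. *)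
  define t where "t = \<one>\<^bsub>K\<^esub> \<oplus>\<^bsub>K\<^esub> b"
  have t: "t \<in> carrier K" using ab by (simp add: t_def)
  have hc: "h \<otimes> c = t \<odot> h" "c \<otimes> h = t \<odot> h"
    unfolding c' t_def using pf ab
    by (simp_all add: H.r_distr H.l_distr H.smult_mult_left H.smult_mult_right H.smult_l_distr)
  have cc: "c \<otimes> c = c \<oplus> (b \<otimes>\<^bsub>K\<^esub> t) \<odot> h"
  proof -
    have "c \<otimes> c = c \<otimes> \<one> \<oplus> c \<otimes> (b \<odot> h)"
      by (subst (2) c') (use pf ab in \<open>simp add: H.r_distr\<close>)
    then show ?thesis using pf ab t by (simp add: H.smult_mult_right hc H.smult_assoc1)
  qed
  have "(t \<oplus>\<^bsub>K\<^esub> t \<oplus>\<^bsub>K\<^esub> b \<otimes>\<^bsub>K\<^esub> t) \<odot> h \<oplus> c = c"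
    using pf(4) pf(1,2) ab t unfolding hc cc by (simp add: H.smult_l_distr H.M.a_ac)
  then have "(t \<oplus>\<^bsub>K\<^esub> t \<oplus>\<^bsub>K\<^esub> b \<otimes>\<^bsub>K\<^esub> t) \<odot> h = \<zero>"
    using pf ab t by simp
  then have "t \<oplus>\<^bsub>K\<^esub> t \<oplus>\<^bsub>K\<^esub> b \<otimes>\<^bsub>K\<^esub> t = \<zero>\<^bsub>K\<^esub>"
    using smult_cancel[OF _ _ _ h] pf ab t by simp
  moreover have "t \<oplus>\<^bsub>K\<^esub> t \<oplus>\<^bsub>K\<^esub> b \<otimes>\<^bsub>K\<^esub> t = (\<one>\<^bsub>K\<^esub> \<oplus>\<^bsub>K\<^esub> t) \<otimes>\<^bsub>K\<^esub> t"
    unfolding t_def using ab by algebra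
  ultimately have "(\<one>\<^bsub>K\<^esub> \<oplus>\<^bsub>K\<^esub> t) \<otimes>\<^bsub>K\<^esub> t = \<zero>\<^bsub>K\<^esub>" by simp
  then have "\<one>\<^bsub>K\<^esub> \<oplus>\<^bsub>K\<^esub> t = \<zero>\<^bsub>K\<^esub> \<or> t = \<zero>\<^bsub>K\<^esub>" using t by (simp add: K.integral_iff)
  (* For \<open>t = 0\<close> one gets \<open>h = (h c) S(c) = 0\<close>. *)
  moreover have "t \<noteq> \<zero>\<^bsub>K\<^esub>"
  proof
    assume "t = \<zero>\<^bsub>K\<^esub>"
    then have "h \<otimes> c = \<zero>" using hc pf by simp
    then have "(h \<otimes> c) \<otimes> antipode H c = \<zero>" using i by simp
    then show False using h i pf by (simp add: H.m_assoc)
  qed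
  ultimately have "\<one>\<^bsub>K\<^esub> \<oplus>\<^bsub>K\<^esub> (\<one>\<^bsub>K\<^esub> \<oplus>\<^bsub>K\<^esub> b) = \<zero>\<^bsub>K\<^esub>" by (simp add: t_def)
  then have "b = \<ominus>\<^bsub>K\<^esub> (\<one>\<^bsub>K\<^esub> \<oplus>\<^bsub>K\<^esub> \<one>\<^bsub>K\<^esub>)"
    using ab by (metis K.a_assoc K.a_closed K.one_closed K.minus_equality K.a_comm)
  then show ?thesis
    unfolding c' using pf by (simp add: H.smult_l_minus H.smult_l_distr a_minus_def)
qed

lemma span_submodule:
  assumes xy: "x \<in> carrier H" "y \<in> carrier H"
  shows "submodule {a \<odot> x \<oplus> b \<odot> y | a b. a \<in> carrier K \<and> b \<in> carrier K} K H" (is "submodule ?U K H")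
proof (rule H.submoduleI)
  have I: "a \<odot> x \<oplus> b \<odot> y \<in> ?U" if "a \<in> carrier K" "b \<in> carrier K" for a b using that by blast
  show "?U \<subseteq> carrier H" using xy by auto
  show "\<zero> \<in> ?U" using I[of "\<zero>\<^bsub>K\<^esub>" "\<zero>\<^bsub>K\<^esub>"] xy by simp
  show "\<ominus> u \<in> ?U" if u: "u \<in> ?U" for u
  proof -
    obtain a b where ab: "u = a \<odot> x \<oplus> b \<odot> y" "a \<in> carrier K" "b \<in> carrier K" using u by blast
    then have "\<ominus> u = (\<ominus>\<^bsub>K\<^esub> a) \<odot> x \<oplus> (\<ominus>\<^bsub>K\<^esub> b) \<odot> y"
      using xy by (simp add: H.M.minus_add H.smult_l_minus)
    then show ?thesis using I[of "\<ominus>\<^bsub>K\<^esub> a" "\<ominus>\<^bsub>K\<^esub> b"] ab by simp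
  qed
  show "u \<oplus> v \<in> ?U" if u: "u \<in> ?U" and v: "v \<in> ?U" for u v
  proof -
    obtain a b where ab: "u = a \<odot> x \<oplus> b \<odot> y" "a \<in> carrier K" "b \<in> carrier K" using u by blast
    obtain a' b' where ab': "v = a' \<odot> x \<oplus> b' \<odot> y" "a' \<in> carrier K" "b' \<in> carrier K" using v by blast
    have "u \<oplus> v = (a \<oplus>\<^bsub>K\<^esub> a') \<odot> x \<oplus> (b \<oplus>\<^bsub>K\<^esub> b') \<odot> y"
      using ab ab' xy by (simp add: H.smult_l_distr H.M.a_ac)
    then show ?thesis using I[of "a \<oplus>\<^bsub>K\<^esub> a'" "b \<oplus>\<^bsub>K\<^esub> b'"] ab ab' by simp
  qed
  show "s \<odot> u \<in> ?U" if s: "s \<in> carrier K" and u: "u \<in> ?U" for s u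
  proof -
    obtain a b where ab: "u = a \<odot> x \<oplus> b \<odot> y" "a \<in> carrier K" "b \<in> carrier K" using u by blast
    then have "s \<odot> u = (s \<otimes>\<^bsub>K\<^esub> a) \<odot> x \<oplus> (s \<otimes>\<^bsub>K\<^esub> b) \<odot> y"
      using xy s by (simp add: H.smult_r_distr H.smult_assoc1)
    then show ?thesis using I[of "s \<otimes>\<^bsub>K\<^esub> a" "s \<otimes>\<^bsub>K\<^esub> b"] ab s by simp
  qed
qed

lemma functional_dual:
  assumes xy: "x \<in> carrier H" "y \<in> carrier H" and v: "v \<in> carrier H"
    and indep: "\<And>a b. \<lbrakk>a \<in> carrier K; b \<in> carrier K\<rbrakk> \<Longrightarrow> v \<noteq> a \<odot> x \<oplus> b \<odot> y"
  obtains l where "l \<in> lin_hom K H (base_alg K)" "l v = \<one>\<^bsub>K\<^esub>" "l x = \<zero>\<^bsub>K\<^esub>" "l y = \<zero>\<^bsub>K\<^esub>"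
proof -
  let ?U = "{a \<odot> x \<oplus> b \<odot> y | a b. a \<in> carrier K \<and> b \<in> carrier K}"
  have I: "a \<odot> x \<oplus> b \<odot> y \<in> ?U" if "a \<in> carrier K" "b \<in> carrier K" for a b using that by blast
  have nv: "v \<notin> ?U" using indep by blast
  show ?thesis
  proof (rule functional_separation[OF K H.module_axioms span_submodule[OF xy] v nv])
    fix l assume l: "l \<in> lin_hom K H (base_alg K)" "l v = \<one>\<^bsub>K\<^esub>" "\<And>u. u \<in> ?U \<Longrightarrow> l u = \<zero>\<^bsub>K\<^esub>"
    have "l x = \<zero>\<^bsub>K\<^esub>" using l(3)[OF I[of "\<one>\<^bsub>K\<^esub>" "\<zero>\<^bsub>K\<^esub>"]] xy by simp
    moreover have "l y = \<zero>\<^bsub>K\<^esub>" using l(3)[OF I[of "\<zero>\<^bsub>K\<^esub>" "\<one>\<^bsub>K\<^esub>"]] xy by simp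
    ultimately show ?thesis by (rule that[OF l(1,2)])
  qed
qed

lemma functional_combination:
  assumes "l \<in> lin_hom K H (base_alg K)" "l' \<in> lin_hom K H (base_alg K)" "a \<in> carrier K" "b \<in> carrier K"
  shows "(\<lambda>x. a \<otimes>\<^bsub>K\<^esub> l x \<oplus>\<^bsub>K\<^esub> b \<otimes>\<^bsub>K\<^esub> l' x) \<in> lin_hom K H (base_alg K)"
  using lin_hom_plus[OF unital_algebra_module[OF base_alg_unital_algebra[OF K_cring[OF K]]]
      lin_hom_scale[OF unital_algebra_module[OF base_alg_unital_algebra[OF K_cring[OF K]]] assms(1,3)]
      lin_hom_scale[OF unital_algebra_module[OF base_alg_unital_algebra[OF K_cring[OF K]]] assms(2,4)]]
  by (simp add: base_alg_sel)

lemma functional_zero_iff: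
  assumes x: "x \<in> carrier H" and "\<And>l. l \<in> lin_hom K H (base_alg K) \<Longrightarrow> l x = \<zero>\<^bsub>K\<^esub>"
  shows "x = \<zero>"
proof (rule ccontr)
  assume "x \<noteq> \<zero>"
  then obtain l where "l \<in> lin_hom K H (base_alg K)" "l x = \<one>\<^bsub>K\<^esub>"
    using functional_dual[of "\<zero>" "\<zero>" x] x by auto
  then show False using assms(2) by force
qed

text \<open>A multiple of \<open>1\<close> on which the counit vanishes is \<open>0\<close>, so \<open>h \<noteq> 0\<close> is not in the line of \<open>1\<close>.\<close>

lemma functional_h:
  assumes h: "h \<noteq> \<zero>"
  obtains l where "l \<in> lin_hom K H (base_alg K)" "l h = \<one>\<^bsub>K\<^esub>" "l \<one> = \<zero>\<^bsub>K\<^esub>"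
proof -
  have "h \<noteq> a \<odot> \<one> \<oplus> b \<odot> \<zero>" if ab: "a \<in> carrier K" "b \<in> carrier K" for a b
  proof
    assume eq: "h = a \<odot> \<one> \<oplus> b \<odot> \<zero>"
    then have eq: "h = a \<odot> \<one>" using ab by simp
    have "counit H h = a" unfolding eq using ab pair_facts by (simp add: lin_hom_smult[OF counit_lin'] base_alg_sel)
    then show False using h eq pair_facts by simp
  qed
  then show ?thesis using functional_dual[of "\<one>" "\<zero>" h] pair_facts that by auto
qed

context
  fixes \<rho>
  assumes \<rho>: "\<And>a. a \<in> carrier (kxk K) \<Longrightarrow> \<rho> a = unital_ext K H (kxk_tens K H h c) a"
begin

lemma cosupp_eq: "cosupp K (kxk K) H \<rho> = {kxk_op K (l \<one>) (l h) (l c) | l. l \<in> lin_hom K H (base_alg K)}"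
  by (rule cosupp_coaction[OF H p \<rho>])

lemma cosupp_mem: "l \<in> lin_hom K H (base_alg K) \<Longrightarrow> kxk_op K (l \<one>) (l h) (l c) \<in> cosupp K (kxk K) H \<rho>"
  unfolding cosupp_eq by blast

lemma cosupp_subset_triangular: "cosupp K (kxk K) H \<rho> \<subseteq> triangular_ops K"
  unfolding cosupp_eq triangular_ops_def using functional_closed pair_facts(1,2) H.one_closed by blast

lemma cosupp_scalar:
  assumes h: "h = \<zero>" shows "cosupp K (kxk K) H \<rho> = scalar_ops K"
proof -
  have l0: "l \<zero> = \<zero>\<^bsub>K\<^esub>" if "l \<in> lin_hom K H (base_alg K)" for l
    using lin_hom_zero[OF H.module_axioms unital_algebra_module[OF base_alg_unital_algebra[OF K_cring[OF K]]] that]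
    by (simp add: base_alg_sel)
  note c = pair_h_zero[OF h]
  show ?thesis
  proof
    show "cosupp K (kxk K) H \<rho> \<subseteq> scalar_ops K"
    proof
      fix f assume "f \<in> cosupp K (kxk K) H \<rho>"
      then obtain l where l: "l \<in> lin_hom K H (base_alg K)" and f: "f = kxk_op K (l \<one>) (l h) (l c)"
        unfolding cosupp_eq by blast
      have "f = kxk_op K (l \<one>) \<zero>\<^bsub>K\<^esub> (l \<one>)" unfolding f h c l0[OF l] by (rule refl)
      then show "f \<in> scalar_ops K"
        unfolding scalar_ops_def using functional_closed[OF l H.one_closed] by blast
    qed
    show "scalar_ops K \<subseteq> cosupp K (kxk K) H \<rho>"
    proof
      fix f assume "f \<in> scalar_ops K"
      then obtain a where a: "a \<in> carrier K" and f: "f = kxk_op K a \<zero>\<^bsub>K\<^esub> a" by (auto simp: scalar_ops_def)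
      let ?l = "\<lambda>x. a \<otimes>\<^bsub>K\<^esub> counit H x \<oplus>\<^bsub>K\<^esub> \<zero>\<^bsub>K\<^esub> \<otimes>\<^bsub>K\<^esub> counit H x"
      have l: "?l \<in> lin_hom K H (base_alg K)"
        by (intro functional_combination counit_lin' a K.zero_closed)
      have "f = kxk_op K (?l \<one>) (?l h) (?l c)" using a pair_facts by (simp add: f)
      then show "f \<in> cosupp K (kxk K) H \<rho>" using cosupp_mem[OF l] by (simp only:)
    qed
  qed
qed

text \<open>
  The relation \<open>1 = c + 2h\<close> turns into the relation between the entries that defines the symmetric
  operators. Conversely, since \<open>1\<close> and \<open>h\<close> are independent, a functional may be prescribed at \<open>1\<close>
  and \<open>h\<close>.
\<close>

lemma cosupp_symmetric:
  assumes h: "h \<noteq> \<zero>" and c: "c = \<one> \<ominus> (h \<oplus> h)"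
  shows "cosupp K (kxk K) H \<rho> = symmetric_ops K"
proof -
  note pf = pair_facts
  have lc: "l \<one> = l c \<oplus>\<^bsub>K\<^esub> (l h \<oplus>\<^bsub>K\<^esub> l h)" if l: "l \<in> lin_hom K H (base_alg K)" for l
  proof -
    have "\<one> = c \<oplus> (h \<oplus> h)" unfolding c using pf by (simp add: a_minus_def H.M.a_assoc H.M.l_neg)
    then have "l \<one> = l (c \<oplus> (h \<oplus> h))" by simp
    then show ?thesis using pf by (simp add: lin_hom_add[OF l] base_alg_sel)
  qed
  show ?thesis
  proof
    show "cosupp K (kxk K) H \<rho> \<subseteq> symmetric_ops K"
    proof
      fix f assume "f \<in> cosupp K (kxk K) H \<rho>"
      then obtain l where l: "l \<in> lin_hom K H (base_alg K)" and f: "f = kxk_op K (l \<one>) (l h) (l c)"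
        unfolding cosupp_eq by blast
      show "f \<in> symmetric_ops K"
        unfolding f lc[OF l] symmetric_ops_def using functional_closed[OF l pf(1)] functional_closed[OF l pf(2)]
        by blast
    qed
    show "symmetric_ops K \<subseteq> cosupp K (kxk K) H \<rho>"
    proof
      fix f assume "f \<in> symmetric_ops K"
      then obtain b d where bd: "b \<in> carrier K" "d \<in> carrier K" and f: "f = kxk_op K (d \<oplus>\<^bsub>K\<^esub> (b \<oplus>\<^bsub>K\<^esub> b)) b d"
        by (auto simp: symmetric_ops_def)
      obtain k where k: "k \<in> lin_hom K H (base_alg K)" "k h = \<one>\<^bsub>K\<^esub>" "k \<one> = \<zero>\<^bsub>K\<^esub>" by (rule functional_h[OF h])
      (* The functional is prescribed at \<open>1\<close> and \<open>h\<close>; its value at \<open>c\<close> follows from \<open>1 = c + 2h\<close>. *)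
      let ?a = "d \<oplus>\<^bsub>K\<^esub> (b \<oplus>\<^bsub>K\<^esub> b)"
      let ?l = "\<lambda>x. ?a \<otimes>\<^bsub>K\<^esub> counit H x \<oplus>\<^bsub>K\<^esub> b \<otimes>\<^bsub>K\<^esub> k x"
      have l: "?l \<in> lin_hom K H (base_alg K)"
        using bd by (intro functional_combination counit_lin' k) auto
      have v: "?l \<one> = ?a" "?l h = b" using bd pf k by simp_all
      have "?a = ?l c \<oplus>\<^bsub>K\<^esub> (b \<oplus>\<^bsub>K\<^esub> b)" using lc[OF l] unfolding v .
      moreover have lcc: "?l c \<in> carrier K" using functional_closed[OF l pf(2)] .
      ultimately have "?l c = d" using bd K.add.r_cancel[of "b \<oplus>\<^bsub>K\<^esub> b" d "?l c"] by simp
      then have "f = kxk_op K (?l \<one>) (?l h) (?l c)" unfolding v f by simp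
      then show "f \<in> cosupp K (kxk K) H \<rho>" using cosupp_mem[OF l] by (simp only:)
    qed
  qed
qed

text \<open>
  If neither \<open>h = 0\<close> nor \<open>c = 1 - 2h\<close>, then \<open>1\<close>, \<open>h\<close>, \<open>c\<close> are independent, and a functional may be
  prescribed at all three.
\<close>

lemma cosupp_triangular:
  assumes h: "h \<noteq> \<zero>" and c: "c \<noteq> \<one> \<ominus> (h \<oplus> h)"
  shows "cosupp K (kxk K) H \<rho> = triangular_ops K"
proof
  show "cosupp K (kxk K) H \<rho> \<subseteq> triangular_ops K" by (rule cosupp_subset_triangular)
  note pf = pair_facts
  have c_indep: "c \<noteq> a \<odot> \<one> \<oplus> b \<odot> h" if "a \<in> carrier K" "b \<in> carrier K" for a b
    using pair_dependent[OF that _ h] c by blast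
  obtain k where k: "k \<in> lin_hom K H (base_alg K)" "k c = \<one>\<^bsub>K\<^esub>" "k \<one> = \<zero>\<^bsub>K\<^esub>" "k h = \<zero>\<^bsub>K\<^esub>"
    by (rule functional_dual[OF H.one_closed pf(1,2) c_indep])
  obtain m where m: "m \<in> lin_hom K H (base_alg K)" "m h = \<one>\<^bsub>K\<^esub>" "m \<one> = \<zero>\<^bsub>K\<^esub>" by (rule functional_h[OF h])
  have mc: "m c \<in> carrier K" by (rule functional_closed[OF m(1) pf(2)])
  show "triangular_ops K \<subseteq> cosupp K (kxk K) H \<rho>"
  proof
    fix f assume "f \<in> triangular_ops K"
    then obtain a b d where abd: "a \<in> carrier K" "b \<in> carrier K" "d \<in> carrier K" and f: "f = kxk_op K a b d"
      by (auto simp: triangular_ops_def)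
    (* This functional is right at \<open>1\<close> and \<open>h\<close>; a multiple of \<open>k\<close>, which vanishes there, corrects
       the value at \<open>c\<close>. *)
    let ?l' = "\<lambda>x. a \<otimes>\<^bsub>K\<^esub> counit H x \<oplus>\<^bsub>K\<^esub> b \<otimes>\<^bsub>K\<^esub> m x"
    let ?s = "d \<ominus>\<^bsub>K\<^esub> (a \<oplus>\<^bsub>K\<^esub> b \<otimes>\<^bsub>K\<^esub> m c)"
    let ?l = "\<lambda>x. \<one>\<^bsub>K\<^esub> \<otimes>\<^bsub>K\<^esub> ?l' x \<oplus>\<^bsub>K\<^esub> ?s \<otimes>\<^bsub>K\<^esub> k x"
    have l: "?l \<in> lin_hom K H (base_alg K)"
      using abd mc by (intro functional_combination counit_lin' m k) auto
    have "?l \<one> = a" "?l h = b" using abd pf k m mc by simp_all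
    moreover have "?l c = d"
      using abd pf k m mc
      by (simp add: a_minus_def K.a_lcomm[of "a \<oplus>\<^bsub>K\<^esub> b \<otimes>\<^bsub>K\<^esub> m c" d] K.r_neg)
    ultimately have "f = kxk_op K (?l \<one>) (?l h) (?l c)" by (simp add: f)
    then show "f \<in> cosupp K (kxk K) H \<rho>" using cosupp_mem[OF l] by (simp only:)
  qed
qed

lemma cosupp_trichotomy:
  "cosupp K (kxk K) H \<rho> = scalar_ops K \<or> cosupp K (kxk K) H \<rho> = symmetric_ops K
    \<or> cosupp K (kxk K) H \<rho> = triangular_ops K"
  by (cases "h = \<zero>"; cases "c = \<one> \<ominus> (h \<oplus> h)")
     (simp_all only: cosupp_scalar cosupp_symmetric cosupp_triangular simp_thms)

text \<open>
  A linear relation between the entries that holds for all functionals is a relation between the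
  elements themselves.
\<close>

lemma cosupp_subset_scalar:
  assumes "cosupp K (kxk K) H \<rho> \<subseteq> scalar_ops K" shows "h = \<zero>" "c = \<one>"
proof -
  have "l h = \<zero>\<^bsub>K\<^esub>" if l: "l \<in> lin_hom K H (base_alg K)" for l
  proof -
    note lc = functional_closed[OF l]
    have "kxk_op K (l \<one>) (l h) (l c) \<in> scalar_ops K"
      using assms l unfolding cosupp_eq by blast
    then obtain a where a: "a \<in> carrier K" "kxk_op K (l \<one>) (l h) (l c) = kxk_op K a \<zero>\<^bsub>K\<^esub> a"
      by (auto simp: scalar_ops_def)
    show ?thesis by (rule kxk_op_inject(2)[OF K _ _ _ _ _ _ a(2)]) (simp_all add: lc pair_facts a)
  qed
  then show h: "h = \<zero>" by (rule functional_zero_iff[OF pair_facts(1)])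
  show "c = \<one>" by (rule pair_h_zero[OF h])
qed

lemma cosupp_subset_symmetric:
  assumes "cosupp K (kxk K) H \<rho> \<subseteq> symmetric_ops K" shows "c = \<one> \<ominus> (h \<oplus> h)"
proof -
  note pf = pair_facts
  have "l (c \<oplus> (h \<oplus> h) \<ominus> \<one>) = \<zero>\<^bsub>K\<^esub>" if l: "l \<in> lin_hom K H (base_alg K)" for l
  proof -
    note lc = functional_closed[OF l]
    have "kxk_op K (l \<one>) (l h) (l c) \<in> symmetric_ops K"
      using assms l unfolding cosupp_eq by blast
    then obtain b d where bd: "b \<in> carrier K" "d \<in> carrier K"
      and eq: "kxk_op K (l \<one>) (l h) (l c) = kxk_op K (d \<oplus>\<^bsub>K\<^esub> (b \<oplus>\<^bsub>K\<^esub> b)) b d"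
      by (auto simp: symmetric_ops_def)
    note i = kxk_op_inject[OF K _ _ _ _ _ _ eq]
    have "l \<one> = d \<oplus>\<^bsub>K\<^esub> (b \<oplus>\<^bsub>K\<^esub> b)" "l h = b" "l c = d"
      by (rule i; simp add: lc pf bd)+
    then have eq: "l (c \<oplus> (h \<oplus> h)) = l \<one>"
      using pf by (simp add: lin_hom_add[OF l] base_alg_sel)
    interpret B: unital_algebra K "base_alg K" by (rule base_alg_unital_algebra[OF K_cring[OF K]])
    have "l (c \<oplus> (h \<oplus> h) \<ominus> \<one>) = l \<one> \<ominus>\<^bsub>base_alg K\<^esub> l \<one>"
      using pf by (simp add: lin_hom_minus[OF H.module_axioms B.module_axioms l] eq)
    also have "\<dots> = \<zero>\<^bsub>base_alg K\<^esub>"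
      using lin_hom_closed[OF l H.one_closed] by simp
    finally show ?thesis by (simp only: base_alg_sel)
  qed
  then have z: "c \<oplus> (h \<oplus> h) \<ominus> \<one> = \<zero>"
    using pf by (intro functional_zero_iff) auto
  then have one: "c \<oplus> (h \<oplus> h) = \<one>" using pf by simp
  have "c = (c \<oplus> (h \<oplus> h)) \<ominus> (h \<oplus> h)"
    using pf by (simp add: a_minus_def H.M.a_assoc H.M.r_neg)
  then show ?thesis unfolding one .
qed

end

end

text \<open>
  The map \<open>id \<otimes> \<phi>\<close> sends \<open>1 \<otimes> h\<^sub>0 + e \<otimes> c\<^sub>0\<close> to \<open>1 \<otimes> \<phi>(h\<^sub>0) + e \<otimes> \<phi>(c\<^sub>0)\<close>, and the coordinates are
  unique.
\<close>

lemma coaction_transport_iff: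
  assumes G: "hopf_algebra K G" and H: "hopf_algebra K H"
    and pG: "coaction_pair K G h\<^sub>0 c\<^sub>0" and pH: "coaction_pair K H h c"
    and \<rho>\<^sub>0: "\<And>a. a \<in> carrier (kxk K) \<Longrightarrow> \<rho>\<^sub>0 a = unital_ext K G (kxk_tens K G h\<^sub>0 c\<^sub>0) a"
    and \<rho>: "\<And>a. a \<in> carrier (kxk K) \<Longrightarrow> \<rho> a = unital_ext K H (kxk_tens K H h c) a"
    and \<phi>: "\<phi> \<in> alg_hom K G H"
  shows "(\<forall>a\<in>carrier (kxk K). \<rho> a = tmap K (kxk K) H (\<lambda>x. x) \<phi> (\<rho>\<^sub>0 a)) \<longleftrightarrow> \<phi> h\<^sub>0 = h \<and> \<phi> c\<^sub>0 = c"
proof -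
  interpret G: hopf_algebra K G by (rule G)
  interpret H: hopf_algebra K H by (rule H)
  note Kc = K_cring[OF K]
  note Aa = kxk_unital_algebra[OF Kc] and Ga = G.unital_algebra_axioms and Ha = H.unital_algebra_axioms
  note \<phi>l = alg_hom_lin[OF \<phi>]
  have g: "h\<^sub>0 \<in> carrier G" "c\<^sub>0 \<in> carrier G" using pG by (simp_all add: coaction_pair_def[OF Kc])
  have h: "h \<in> carrier H" "c \<in> carrier H" using pH by (simp_all add: coaction_pair_def[OF Kc])
  have \<phi>g: "\<phi> h\<^sub>0 \<in> carrier H" "\<phi> c\<^sub>0 \<in> carrier H" using g lin_hom_closed[OF \<phi>l] by auto
  note e = elt_e_closed[OF Kc]
  note u0 = unital_ext_lin[OF Kc Ga kxk_tens_closed[OF Kc Ga g]]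
  note u = unital_ext_lin[OF Kc Ha kxk_tens_closed[OF Kc Ha h]]
  let ?t = "tmap K (kxk K) H (\<lambda>x. x) \<phi>"
  note tl = tmap_lin[OF Aa Ha Aa Ga lin_hom_id \<phi>l]
  have te: "?t (kxk_tens K G h\<^sub>0 c\<^sub>0) = kxk_tens K H (\<phi> h\<^sub>0) (\<phi> c\<^sub>0)"
    unfolding kxk_tens_def using g
    by (simp only: lin_hom_add[OF tl] tens_closed[OF Aa Ga] A.one_closed e tmap_tens[OF Aa Ha Aa Ga lin_hom_id \<phi>l])
  have t1: "?t \<one>\<^bsub>tensor K (kxk K) G\<^esub> = \<one>\<^bsub>tensor K (kxk K) H\<^esub>"
    by (rule alg_hom_one[OF tmap_alg_hom[OF Aa Ha Aa Ga alg_hom_id \<phi>]])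
  show ?thesis
  proof
    assume "\<forall>a\<in>carrier (kxk K). \<rho> a = ?t (\<rho>\<^sub>0 a)"
    then have "kxk_tens K H h c = kxk_tens K H (\<phi> h\<^sub>0) (\<phi> c\<^sub>0)"
      using e \<rho>[OF e] \<rho>\<^sub>0[OF e] te by (simp add: u u0)
    then show "\<phi> h\<^sub>0 = h \<and> \<phi> c\<^sub>0 = c"
      using kxk_tens_inject[OF Kc Ha h \<phi>g] by simp
  next
    assume eq: "\<phi> h\<^sub>0 = h \<and> \<phi> c\<^sub>0 = c"
    show "\<forall>a\<in>carrier (kxk K). \<rho> a = ?t (\<rho>\<^sub>0 a)"
    proof
      fix a assume a: "a \<in> carrier (kxk K)"
      have "unital_ext K H (kxk_tens K H h c) a = ?t (unital_ext K G (kxk_tens K G h\<^sub>0 c\<^sub>0) a)"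
        by (rule kxk_lin_eq[OF Kc unital_algebra_module[OF tensor_unital_algebra[OF Aa Ha]] u(1)
              lin_hom_comp[OF u0(1) tl] _ _ a]) (simp_all add: u u0 t1 te eq)
      then show "\<rho> a = ?t (\<rho>\<^sub>0 a)" by (simp add: \<rho>[OF a] \<rho>\<^sub>0[OF a])
    qed
  qed
qed

text \<open>
  If homomorphisms on \<open>G\<close> are determined by their values at \<open>h\<^sub>0\<close> and \<open>c\<^sub>0\<close>, then an algebra
  homomorphism that maps this pair to the pair of another coaction respects the comultiplication and
  the counit, because the two pairs satisfy the same formulas. The determination is assumed
  separately for the three kinds of target algebras, which have different element types.
\<close>

lemma V_universalI:
  fixes G :: "('k, 'g) hopf"
  assumes G: "hopf_algebra K G" and pG: "coaction_pair K G h\<^sub>0 c\<^sub>0"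
    and \<rho>\<^sub>0: "\<And>a. a \<in> carrier (kxk K) \<Longrightarrow> \<rho>\<^sub>0 a = unital_ext K G (kxk_tens K G h\<^sub>0 c\<^sub>0) a"
    and co: "hopf_coaction K (kxk K) G \<rho>\<^sub>0"
    and V: "unital_subalgebra K (End_alg K (kxk K)) (cosupp K (kxk K) G \<rho>\<^sub>0)"
    and gen_T: "\<And>(H :: ('k, 'h) hopf) f g x. \<lbrakk>hopf_algebra K H; f \<in> alg_hom K G (tensor K H H);
      g \<in> alg_hom K G (tensor K H H); f h\<^sub>0 = g h\<^sub>0; f c\<^sub>0 = g c\<^sub>0; x \<in> carrier G\<rbrakk> \<Longrightarrow> f x = g x"
    and gen_K: "\<And>f g x. \<lbrakk>f \<in> alg_hom K G (base_alg K); g \<in> alg_hom K G (base_alg K);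
      f h\<^sub>0 = g h\<^sub>0; f c\<^sub>0 = g c\<^sub>0; x \<in> carrier G\<rbrakk> \<Longrightarrow> f x = g x"
    and gen_H: "\<And>(H :: ('k, 'h) hopf) f g x. \<lbrakk>hopf_algebra K H; f \<in> alg_hom K G H; g \<in> alg_hom K G H;
      f h\<^sub>0 = g h\<^sub>0; f c\<^sub>0 = g c\<^sub>0; x \<in> carrier G\<rbrakk> \<Longrightarrow> f x = g x"
    and ex: "\<And>(H :: ('k, 'h) hopf) h c \<rho>. \<lbrakk>hopf_algebra K H; coaction_pair K H h c;
      \<And>a. a \<in> carrier (kxk K) \<Longrightarrow> \<rho> a = unital_ext K H (kxk_tens K H h c) a;
      cosupp K (kxk K) H \<rho> \<subseteq> cosupp K (kxk K) G \<rho>\<^sub>0\<rbrakk> \<Longrightarrow> \<exists>\<phi>\<in>alg_hom K G H. \<phi> h\<^sub>0 = h \<and> \<phi> c\<^sub>0 = c"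
  shows "V_universal TYPE('h) K (kxk K) (cosupp K (kxk K) G \<rho>\<^sub>0) G \<rho>\<^sub>0"
  unfolding V_universal_def
proof (intro conjI allI impI V co subset_refl; elim conjE)
  note Kc = K_cring[OF K]
  fix H :: "('k, 'h) hopf" and \<rho>
  assume coH: "hopf_coaction K (kxk K) H \<rho>" and sub: "cosupp K (kxk K) H \<rho> \<subseteq> cosupp K (kxk K) G \<rho>\<^sub>0"
  have H: "hopf_algebra K H" using coH by (simp add: hopf_coaction_def)
  interpret G: hopf_algebra K G by (rule G)
  interpret H: hopf_algebra K H by (rule H)
  note Ga = G.unital_algebra_axioms and Ha = H.unital_algebra_axioms
  obtain h c where p: "coaction_pair K H h c"
    and "\<forall>a\<in>carrier (kxk K). \<rho> a = unital_ext K H (kxk_tens K H h c) a"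
    by (rule coaction_has_pair[OF Kc coH])
  then have \<rho>: "\<rho> a = unital_ext K H (kxk_tens K H h c) a" if "a \<in> carrier (kxk K)" for a
    using that by blast
  have iff: "(\<forall>a\<in>carrier (kxk K). \<rho> a = tmap K (kxk K) H (\<lambda>x. x) \<phi> (\<rho>\<^sub>0 a)) \<longleftrightarrow> \<phi> h\<^sub>0 = h \<and> \<phi> c\<^sub>0 = c"
    if "\<phi> \<in> alg_hom K G H" for \<phi>
    by (rule coaction_transport_iff[OF G H pG p \<rho>\<^sub>0 \<rho> that])
  obtain \<phi> where \<phi>: "\<phi> \<in> alg_hom K G H" "\<phi> h\<^sub>0 = h" "\<phi> c\<^sub>0 = c" using ex[OF H p \<rho> sub] by blast
  note \<phi>l = alg_hom_lin[OF \<phi>(1)]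
  have g: "h\<^sub>0 \<in> carrier G" "c\<^sub>0 \<in> carrier G" using pG by (simp_all add: coaction_pair_def[OF Kc])
  have L: "(\<lambda>x. comult H (\<phi> x)) \<in> alg_hom K G (tensor K H H)"
    by (rule alg_hom_comp[OF \<phi>(1) H.comult_hom])
  have R: "(\<lambda>x. tmap K H H \<phi> \<phi> (comult G x)) \<in> alg_hom K G (tensor K H H)"
    by (rule alg_hom_comp[OF G.comult_hom tmap_alg_hom[OF Ha Ha Ga Ga \<phi>(1) \<phi>(1)]])
  note tl = tmap_lin[OF Ha Ha Ga Ga \<phi>l \<phi>l] and tt = tmap_tens[OF Ha Ha Ga Ga \<phi>l \<phi>l]
  have \<Delta>: "comult H (\<phi> x) = tmap K H H \<phi> \<phi> (comult G x)" if x: "x \<in> carrier G" for x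
  proof (rule gen_T[OF H L R _ _ x])
    have "comult H h = tens K H H h c \<oplus>\<^bsub>tensor K H H\<^esub> tens K H H \<one>\<^bsub>H\<^esub> h"
      "comult G h\<^sub>0 = tens K G G h\<^sub>0 c\<^sub>0 \<oplus>\<^bsub>tensor K G G\<^esub> tens K G G \<one>\<^bsub>G\<^esub> h\<^sub>0"
      using p pG by (simp_all add: coaction_pair_def[OF Kc])
    then show "comult H (\<phi> h\<^sub>0) = tmap K H H \<phi> \<phi> (comult G h\<^sub>0)"
      using g by (simp only: \<phi>(2,3) lin_hom_add[OF tl] tens_closed[OF Ga Ga] G.one_closed tt alg_hom_one[OF \<phi>(1)])
    have "comult H c = tens K H H c c" "comult G c\<^sub>0 = tens K G G c\<^sub>0 c\<^sub>0"
      using p pG by (simp_all add: coaction_pair_def[OF Kc])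
    then show "comult H (\<phi> c\<^sub>0) = tmap K H H \<phi> \<phi> (comult G c\<^sub>0)"
      using g by (simp only: \<phi>(2,3) tt)
  qed
  have \<epsilon>: "counit H (\<phi> x) = counit G x" if x: "x \<in> carrier G" for x
  proof (rule gen_K[OF alg_hom_comp[OF \<phi>(1) H.counit_hom] G.counit_hom _ _ x])
    show "counit H (\<phi> h\<^sub>0) = counit G h\<^sub>0" "counit H (\<phi> c\<^sub>0) = counit G c\<^sub>0"
      using p pG unfolding \<phi>(2,3) by (simp_all add: coaction_pair_def[OF Kc])
  qed
  let ?\<phi> = "restrict \<phi> (carrier G)"
  have hom: "?\<phi> \<in> hopf_hom K G H"
    by (rule hopf_hom_restrict[OF G H hopf_homI[OF G H \<phi>(1) \<Delta> \<epsilon>]])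
  then have hom_a: "?\<phi> \<in> alg_hom K G H" by (simp add: hopf_hom_def)
  show "\<exists>!\<phi>. \<phi> \<in> hopf_hom K G H \<and> \<phi> \<in> extensional (carrier G) \<and>
      (\<forall>a\<in>carrier (kxk K). \<rho> a = tmap K (kxk K) H (\<lambda>x. x) \<phi> (\<rho>\<^sub>0 a))"
  proof (rule ex1I[of _ ?\<phi>])
    show "?\<phi> \<in> hopf_hom K G H \<and> ?\<phi> \<in> extensional (carrier G) \<and>
      (\<forall>a\<in>carrier (kxk K). \<rho> a = tmap K (kxk K) H (\<lambda>x. x) ?\<phi> (\<rho>\<^sub>0 a))"
      unfolding iff[OF hom_a] using hom \<phi> g by simp
  next
    fix \<psi> assume \<psi>: "\<psi> \<in> hopf_hom K G H \<and> \<psi> \<in> extensional (carrier G) \<and>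
      (\<forall>a\<in>carrier (kxk K). \<rho> a = tmap K (kxk K) H (\<lambda>x. x) \<psi> (\<rho>\<^sub>0 a))"
    then have \<psi>a: "\<psi> \<in> alg_hom K G H" by (simp add: hopf_hom_def)
    have v: "\<psi> h\<^sub>0 = h" "\<psi> c\<^sub>0 = c" using \<psi> iff[OF \<psi>a] by auto
    show "\<psi> = ?\<phi>"
    proof (rule extensionalityI)
      show "\<psi> \<in> extensional (carrier G)" "?\<phi> \<in> extensional (carrier G)" using \<psi> by auto
      show "\<psi> x = ?\<phi> x" if x: "x \<in> carrier G" for x
        by (rule gen_H[OF H \<psi>a hom_a _ _ x]) (simp_all add: v \<phi> g)
    qed
  qed
qed

end

lemma coaction_equiv_id_iff:
  assumes A: "unital_algebra K A"
  shows "coaction_equiv_via K (\<lambda>a. a) A H \<rho> A H' \<rho>' \<longleftrightarrow> cosupp K A H \<rho> = cosupp K A H' \<rho>'"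
proof -
  have "(\<lambda>a. a) \<in> alg_iso K A A"
    by (simp add: alg_iso_def alg_hom_id bij_betw_def)
  moreover have "(\<lambda>f. \<lambda>x\<in>carrier A. f (inv_into (carrier A) (\<lambda>a. a) x)) ` cosupp K A H \<rho> = cosupp K A H \<rho>"
  proof -
    have inv: "inv_into (carrier A) (\<lambda>a. a) x = x" if "x \<in> carrier A" for x
      using inv_into_f_f[of "\<lambda>a. a" "carrier A" x] that by (simp add: inj_on_def)
    have "(\<lambda>x\<in>carrier A. f (inv_into (carrier A) (\<lambda>a. a) x)) = f" if "f \<in> cosupp K A H \<rho>" for f
      using that by (auto simp: cosupp_def inv intro!: restrict_ext)
    then show ?thesis by simp
  qed
  ultimately show ?thesis by (simp add: coaction_equiv_via_def)
qed


section \<open>The trivial coaction\<close>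

lemma hopf_coaction_cong:
  assumes co: "hopf_coaction K A H \<rho>" and eq: "\<And>a. a \<in> carrier A \<Longrightarrow> \<rho> a = \<rho>' a"
  shows "hopf_coaction K A H \<rho>'"
proof -
  have A: "unital_algebra K A" and H: "hopf_algebra K H" and \<rho>: "\<rho> \<in> alg_hom K A (tensor K A H)"
    using co by (simp_all add: hopf_coaction_def)
  interpret H: hopf_algebra K H by (rule H)
  note Ha = H.unital_algebra_axioms
  note AH = tensor_unital_algebra[OF A Ha]
  have \<rho>': "\<rho>' \<in> alg_hom K A (tensor K A H)" by (rule alg_hom_cong[OF A \<rho> eq])
  have "tmap K (tensor K A H) H \<rho> (\<lambda>y. y) t = tmap K (tensor K A H) H \<rho>' (\<lambda>y. y) t"
    if "t \<in> carrier (tensor K A H)" for t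
    by (rule tmap_cong[OF AH Ha A Ha alg_hom_lin[OF \<rho>] alg_hom_lin[OF \<rho>'] lin_hom_id lin_hom_id eq refl that])
  then show ?thesis
    using co \<rho>' unfolding hopf_coaction_def
    by (simp add: eq[symmetric] lin_hom_closed[OF alg_hom_lin[OF \<rho>]])
qed

lemma base_hopf_sel:
  "module.truncate (base_hopf K) = module.truncate (base_alg K)"
  "comult (base_hopf K) = (\<lambda>x. tens K (base_alg K) (base_alg K) x \<one>\<^bsub>K\<^esub>)"
  "counit (base_hopf K) = (\<lambda>x. x)" "antipode (base_hopf K) = (\<lambda>x. x)"
  by (simp_all add: base_hopf_def module.defs hopf.defs)

lemma base_hopf_mod_sel:
  "carrier (base_hopf K) = carrier K" "monoid.mult (base_hopf K) = monoid.mult K"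
  "one (base_hopf K) = one K" "ring.zero (base_hopf K) = ring.zero K"
  "ring.add (base_hopf K) = ring.add K" "smult (base_hopf K) = monoid.mult K"
  using base_hopf_sel(1)[of K] unfolding truncate_eq_iff by (simp_all add: base_alg_sel)

context
  fixes K :: "'k ring" assumes K: "field K"
begin

interpretation K: field K by (rule K)

lemma base_hopf_algebra: "hopf_algebra K (base_hopf K)"
proof -
  note Kc = K_cring[OF K]
  note B = base_alg_unital_algebra[OF Kc]
  note t = base_hopf_sel(1)[symmetric]
  note tens_eq = tens_cong[OF base_hopf_sel(1) base_hopf_sel(1)]
  have l: "(\<lambda>x. tens K (base_alg K) (base_alg K) x \<one>\<^bsub>K\<^esub>)
      \<in> lin_hom K (base_alg K) (tensor K (base_alg K) (base_alg K))"
    by (rule tens_lin_left[OF B B]) (simp add: base_alg_sel)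
  have "prehopf K (base_hopf K)"
  proof (intro prehopf.intro prehopf_axioms.intro unital_algebra_truncate[OF B t])
    show "comult (base_hopf K) \<in> alg_hom K (base_hopf K) (tensor K (base_hopf K) (base_hopf K))"
      unfolding tens_eq lin_hom_truncate(2)[OF t refl, symmetric] base_hopf_sel
      by (rule alg_homI[OF l]) (simp_all add: tensor_one[OF B B] tens_mult[OF B B] base_alg_sel)
    show "counit (base_hopf K) \<in> alg_hom K (base_hopf K) (base_alg K)"
      unfolding lin_hom_truncate(2)[OF t refl, symmetric] base_hopf_sel by (rule alg_hom_id)
    show "antipode (base_hopf K) \<in> lin_hom K (base_hopf K) (base_hopf K)"
      unfolding base_hopf_sel by (rule lin_hom_id)
  qed (auto simp: base_hopf_sel base_hopf_mod_sel K.m_comm)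
  then interpret H: prehopf K "base_hopf K" .
  show ?thesis
  proof (rule H.hopf_algebraI)
    fix x assume x: "x \<in> carrier (base_hopf K)"
    then have "hopf_identities K (base_hopf K) (x \<odot>\<^bsub>base_hopf K\<^esub> \<one>\<^bsub>base_hopf K\<^esub>)"
      by (intro H.hopf_identities_smult H.hopf_identities_one H.one_closed) (simp add: base_hopf_mod_sel)
    then show "hopf_identities K (base_hopf K) x" using x by (simp add: base_hopf_mod_sel)
  qed
qed

text \<open>The trivial coaction sends \<open>e\<close> to \<open>1 \<otimes> 0 + e \<otimes> 1\<close>.\<close>

lemma trivial_coaction_pair:
  assumes H: "hopf_algebra K H" shows "coaction_pair K H \<zero>\<^bsub>H\<^esub> \<one>\<^bsub>H\<^esub>"
proof -
  interpret H: hopf_algebra K H by (rule H)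
  note Ha = H.unital_algebra_axioms
  interpret T: unital_algebra K "tensor K H H" by (rule tensor_unital_algebra[OF Ha Ha])
  have z: "tens K H H \<zero>\<^bsub>H\<^esub> \<one>\<^bsub>H\<^esub> = \<zero>\<^bsub>tensor K H H\<^esub>" "tens K H H \<one>\<^bsub>H\<^esub> \<zero>\<^bsub>H\<^esub> = \<zero>\<^bsub>tensor K H H\<^esub>"
    using lin_hom_zero[OF H.module_axioms T.module_axioms tens_lin_left[OF Ha Ha]]
      lin_hom_zero[OF H.module_axioms T.module_axioms tens_lin_right[OF Ha Ha]] by auto
  have d: "comult H \<zero>\<^bsub>H\<^esub> = \<zero>\<^bsub>tensor K H H\<^esub>" "comult H \<one>\<^bsub>H\<^esub> = tens K H H \<one>\<^bsub>H\<^esub> \<one>\<^bsub>H\<^esub>"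
    using lin_hom_zero[OF H.module_axioms T.module_axioms alg_hom_lin[OF H.comult_hom]]
      alg_hom_one[OF H.comult_hom] by (simp_all add: tensor_one[OF Ha Ha])
  have e: "counit H \<zero>\<^bsub>H\<^esub> = \<zero>\<^bsub>K\<^esub>" "counit H \<one>\<^bsub>H\<^esub> = \<one>\<^bsub>K\<^esub>"
    using lin_hom_zero[OF H.module_axioms unital_algebra_module[OF base_alg_unital_algebra[OF K_cring[OF K]]]
        alg_hom_lin[OF H.counit_hom]] alg_hom_one[OF H.counit_hom] by (simp_all add: base_alg_sel)
  show ?thesis by (simp add: coaction_pair_def[OF K_cring[OF K]] z d e)
qed

lemma trivial_coaction_ext:
  assumes H: "unital_algebra K H" and a: "a \<in> carrier (kxk K)"
  shows "tens K (kxk K) H a \<one>\<^bsub>H\<^esub> = unital_ext K H (kxk_tens K H \<zero>\<^bsub>H\<^esub> \<one>\<^bsub>H\<^esub>) a"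
proof -
  note Kc = K_cring[OF K]
  note A = kxk_unital_algebra[OF Kc]
  interpret H: unital_algebra K H by (rule H)
  interpret A: unital_algebra K "kxk K" by (rule A)
  interpret T: unital_algebra K "tensor K (kxk K) H" by (rule tensor_unital_algebra[OF A H])
  note u = unital_ext_lin[OF Kc H kxk_tens_closed[OF Kc H H.zero_closed H.one_closed]]
  have z: "tens K (kxk K) H \<one>\<^bsub>kxk K\<^esub> \<zero>\<^bsub>H\<^esub> = \<zero>\<^bsub>tensor K (kxk K) H\<^esub>"
    using lin_hom_zero[OF H.module_axioms T.module_axioms tens_lin_right[OF A H]] by auto
  have e: "kxk_tens K H \<zero>\<^bsub>H\<^esub> \<one>\<^bsub>H\<^esub> = tens K (kxk K) H (elt_e K) \<one>\<^bsub>H\<^esub>"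
    by (simp add: kxk_tens_def z tens_closed[OF A H] elt_e_closed[OF Kc])
  show ?thesis
    by (rule kxk_lin_eq[OF Kc T.module_axioms tens_lin_left[OF A H H.one_closed] u(1) _ _ a])
       (simp only: u(2) tensor_one[OF A H], simp only: u(3) e[symmetric])
qed

lemma rho1_ext:
  "a \<in> carrier (kxk K) \<Longrightarrow>
    rho1 K a = unital_ext K (base_hopf K) (kxk_tens K (base_hopf K) \<zero>\<^bsub>base_hopf K\<^esub> \<one>\<^bsub>base_hopf K\<^esub>) a"
  using trivial_coaction_ext[OF hopf_algebra.axioms(1)[OF base_hopf_algebra]]
  by (simp add: rho1_def base_hopf_mod_sel)

lemma rho1_coaction: "hopf_coaction K (kxk K) (base_hopf K) (rho1 K)"
  by (rule hopf_coaction_cong[OF coaction_pair_coaction[OF K_cring[OF K] base_hopf_algebra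
        trivial_coaction_pair[OF base_hopf_algebra]]]) (rule rho1_ext[symmetric])

lemma cosupp_rho1: "cosupp K (kxk K) (base_hopf K) (rho1 K) = scalar_ops K"
  by (rule cosupp_scalar[OF K base_hopf_algebra trivial_coaction_pair[OF base_hopf_algebra] rho1_ext refl])

text \<open>Every element of \<open>k\<close> is a multiple of \<open>1\<close>.\<close>

lemma base_hopf_hom_eq:
  assumes f: "f \<in> alg_hom K (base_hopf K) B" and g: "g \<in> alg_hom K (base_hopf K) B"
    and x: "x \<in> carrier (base_hopf K)"
  shows "f x = g x"
proof -
  interpret H: hopf_algebra K "base_hopf K" by (rule base_hopf_algebra)
  have x1: "x = x \<odot>\<^bsub>base_hopf K\<^esub> \<one>\<^bsub>base_hopf K\<^esub>" and xK: "x \<in> carrier K"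
    using x by (simp_all add: base_hopf_mod_sel)
  have "f (x \<odot>\<^bsub>base_hopf K\<^esub> \<one>\<^bsub>base_hopf K\<^esub>) = g (x \<odot>\<^bsub>base_hopf K\<^esub> \<one>\<^bsub>base_hopf K\<^esub>)"
    using xK by (simp only: lin_hom_smult[OF alg_hom_lin[OF f]] lin_hom_smult[OF alg_hom_lin[OF g]]
        H.one_closed alg_hom_one[OF f] alg_hom_one[OF g])
  then show ?thesis unfolding x1[symmetric] .
qed

lemma V_universal_rho1:
  "V_universal TYPE('h) K (kxk K) (cosupp K (kxk K) (base_hopf K) (rho1 K)) (base_hopf K) (rho1 K)"
proof (rule V_universalI[OF K base_hopf_algebra trivial_coaction_pair[OF base_hopf_algebra] rho1_ext rho1_coaction])
  show "unital_subalgebra K (End_alg K (kxk K)) (cosupp K (kxk K) (base_hopf K) (rho1 K))"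
    unfolding cosupp_rho1 by (rule scalar_ops_subalgebra[OF K])
next
  fix H :: "('k, 'h) hopf" and h c \<rho>
  assume H: "hopf_algebra K H" and p: "coaction_pair K H h c"
    and \<rho>: "\<And>a. a \<in> carrier (kxk K) \<Longrightarrow> \<rho> a = unital_ext K H (kxk_tens K H h c) a"
    and sub: "cosupp K (kxk K) H \<rho> \<subseteq> cosupp K (kxk K) (base_hopf K) (rho1 K)"
  have hc: "h = \<zero>\<^bsub>H\<^esub>" "c = \<one>\<^bsub>H\<^esub>"
    using cosupp_subset_scalar[OF K H p \<rho> sub[unfolded cosupp_rho1]] by auto
  interpret H: hopf_algebra K H by (rule H)
  have "(\<lambda>x. x \<odot>\<^bsub>H\<^esub> \<one>\<^bsub>H\<^esub>) \<in> alg_hom K (base_hopf K) H"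
    by (intro alg_homI lin_homI)
       (simp_all add: base_hopf_mod_sel H.smult_l_distr H.smult_assoc1 H.smult_mult_left)
  then show "\<exists>\<phi>\<in>alg_hom K (base_hopf K) H. \<phi> \<zero>\<^bsub>base_hopf K\<^esub> = h \<and> \<phi> \<one>\<^bsub>base_hopf K\<^esub> = c"
    by (rule bexI[rotated]) (simp add: hc base_hopf_mod_sel)
qed (assumption | (rule base_hopf_hom_eq; assumption))+

end

section \<open>The Hopf algebras generated by \<open>c, d, h\<close>\<close>

context ring
begin

context
  fixes c d h
  assumes car: "c \<in> carrier R" "d \<in> carrier R" "h \<in> carrier R"
    and cd: "c \<otimes> d = \<one>" and dc: "d \<otimes> c = \<one>" and hh: "h \<otimes> h = h"
    and rel: "h \<otimes> c \<oplus> c \<otimes> h \<oplus> c \<otimes> c = c"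
begin

lemma cdh_cancel:
  assumes "x \<in> carrier R"
  shows "c \<otimes> (d \<otimes> x) = x" "d \<otimes> (c \<otimes> x) = x" "h \<otimes> (h \<otimes> x) = h \<otimes> x"
  using car assms by (simp_all add: m_assoc[symmetric] cd dc hh)

text \<open>The relation between \<open>h\<close> and \<open>c\<close>, multiplied by \<open>d\<close> from both sides.\<close>

lemma cdh_rel_d: "d \<otimes> h = d \<ominus> \<one> \<ominus> h \<otimes> d"
proof -
  have "d \<otimes> ((h \<otimes> c \<oplus> c \<otimes> h \<oplus> c \<otimes> c) \<otimes> d) = d \<otimes> (c \<otimes> d)" by (simp only: rel)
  then have "d \<otimes> h \<oplus> h \<otimes> d \<oplus> \<one> = d"
    using car by (simp add: l_distr r_distr m_assoc cd dc cdh_cancel)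
  then have "d \<ominus> \<one> \<ominus> h \<otimes> d = (d \<otimes> h \<oplus> h \<otimes> d \<oplus> \<one>) \<ominus> \<one> \<ominus> h \<otimes> d" by simp
  also have "\<dots> = d \<otimes> h"
    using car by (simp add: a_minus_def a_assoc r_neg)
  finally show ?thesis by simp
qed

text \<open>
  This and the next identity say that \<open>c \<mapsto> d\<close>, \<open>d \<mapsto> c\<close>, \<open>h \<mapsto> -hd\<close> is compatible with the relations,
  read in the opposite algebra.
\<close>

lemma cdh_antipode_idem: "(\<ominus> (h \<otimes> d)) \<otimes> (\<ominus> (h \<otimes> d)) = \<ominus> (h \<otimes> d)"
proof -
  have "(\<ominus> (h \<otimes> d)) \<otimes> (\<ominus> (h \<otimes> d)) = h \<otimes> ((d \<otimes> h) \<otimes> d)"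
    using car by (simp add: l_minus r_minus m_assoc)
  also have "\<dots> = h \<otimes> ((d \<ominus> \<one> \<ominus> h \<otimes> d) \<otimes> d)" by (simp only: cdh_rel_d)
  also have "\<dots> = h \<otimes> (d \<otimes> d) \<oplus> (\<ominus> (h \<otimes> d) \<oplus> \<ominus> (h \<otimes> (d \<otimes> d)))"
    using car by (simp add: a_minus_def l_distr r_distr l_minus r_minus m_assoc cdh_cancel a_assoc)
  also have "\<dots> = \<ominus> (h \<otimes> d)"
    using car by (simp add: a_lcomm[of "h \<otimes> (d \<otimes> d)" "\<ominus> (h \<otimes> d)"] r_neg)
  finally show ?thesis .
qed

lemma cdh_antipode_rel: "d \<otimes> (\<ominus> (h \<otimes> d)) \<oplus> (\<ominus> (h \<otimes> d)) \<otimes> d \<oplus> d \<otimes> d = d"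
proof -
  have "d \<otimes> (\<ominus> (h \<otimes> d)) \<oplus> (\<ominus> (h \<otimes> d)) \<otimes> d \<oplus> d \<otimes> d = \<ominus> ((d \<otimes> h) \<otimes> d) \<oplus> (\<ominus> (h \<otimes> (d \<otimes> d)) \<oplus> d \<otimes> d)"
    using car by (simp add: l_minus r_minus m_assoc a_assoc)
  also have "(d \<otimes> h) \<otimes> d = d \<otimes> d \<ominus> d \<ominus> h \<otimes> (d \<otimes> d)"
    unfolding cdh_rel_d using car by (simp add: a_minus_def l_distr l_minus m_assoc)
  also have "\<ominus> (d \<otimes> d \<ominus> d \<ominus> h \<otimes> (d \<otimes> d)) \<oplus> (\<ominus> (h \<otimes> (d \<otimes> d)) \<oplus> d \<otimes> d) = d"
  proof -
    have "\<ominus> (u \<ominus> d \<ominus> w) \<oplus> (\<ominus> w \<oplus> u) = d" if "u \<in> carrier R" "w \<in> carrier R" for u w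
      using that car by algebra
    then show ?thesis using car by simp
  qed
  finally show ?thesis .
qed

end

end

text \<open>
  The flag adds the relation \<open>c\<^sup>2 = 1\<close>, so that both quotients of \<open>k\<langle>c,d,h\<rangle>\<close> are treated at once.
\<close>

definition cdh_relations :: "('k, 'b, 'y) module_scheme \<Rightarrow> bool \<Rightarrow> 'b \<Rightarrow> 'b \<Rightarrow> 'b \<Rightarrow> bool"
  where "cdh_relations B extra c d h \<longleftrightarrow> c \<in> carrier B \<and> d \<in> carrier B \<and> h \<in> carrier B \<and>
    c \<otimes>\<^bsub>B\<^esub> d = \<one>\<^bsub>B\<^esub> \<and> d \<otimes>\<^bsub>B\<^esub> c = \<one>\<^bsub>B\<^esub> \<and> h \<otimes>\<^bsub>B\<^esub> h = h \<and>
    h \<otimes>\<^bsub>B\<^esub> c \<oplus>\<^bsub>B\<^esub> c \<otimes>\<^bsub>B\<^esub> h \<oplus>\<^bsub>B\<^esub> c \<otimes>\<^bsub>B\<^esub> c = c \<and> (extra \<longrightarrow> c \<otimes>\<^bsub>B\<^esub> c = \<one>\<^bsub>B\<^esub>)"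

definition cdh_ideal :: "'k ring \<Rightarrow> bool \<Rightarrow> (cdh list \<Rightarrow> 'k) set"
  where "cdh_ideal K extra = (if extra then ideal_II1 K else ideal_I K)"

definition cdh_case :: "'b \<Rightarrow> 'b \<Rightarrow> 'b \<Rightarrow> cdh \<Rightarrow> 'b"
  where "cdh_case c d h x = (case x of Gc \<Rightarrow> c | Gd \<Rightarrow> d | Gh \<Rightarrow> h)"

lemma cdh_case_simps: "cdh_case c d h Gc = c" "cdh_case c d h Gd = d" "cdh_case c d h Gh = h"
  by (simp_all add: cdh_case_def)

context
  fixes K :: "'k ring" and extra :: bool assumes K: "field K"
begin

interpretation K: field K by (rule K)
interpretation F: unital_algebra K "free_alg K :: ('k, cdh list \<Rightarrow> 'k) module"
  by (rule free_alg_unital_algebra[OF K_cring[OF K]])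

lemma cdh_free_gen_closed: "free_gen K (x :: cdh) \<in> carrier (free_alg K)"
  by (rule free_gen_closed[OF K_cring[OF K]])

lemma ideal_I_ideal: "ideal (ideal_I K) (free_alg K)"
  unfolding ideal_I_def Let_def
  by (rule F.genideal_ideal) (auto simp: cdh_free_gen_closed F.minus_closed)

lemma ideal_I1_ideal: "ideal (ideal_I1 K) (free_alg K)"
  unfolding ideal_I1_def Let_def
  by (rule F.genideal_ideal) (auto simp: cdh_free_gen_closed F.minus_closed)

lemma cdh_ideal_ideal: "ideal (cdh_ideal K extra) (free_alg K)"
  unfolding cdh_ideal_def ideal_II1_def
  using ideal_I_ideal F.add_ideals[OF ideal_I_ideal ideal_I1_ideal] by simp

lemma cdh_vanish:
  assumes B: "unital_algebra K B" and rel: "cdh_relations B extra c d h" and n: "n \<in> cdh_ideal K extra"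
  shows "free_eval K B (cdh_case c d h) n = \<zero>\<^bsub>B\<^esub>"
proof -
  interpret B: unital_algebra K B by (rule B)
  note Kc = K_cring[OF K]
  have g: "cdh_case c d h x \<in> carrier B" for x
    using rel by (cases x) (simp_all add: cdh_case_simps cdh_relations_def)
  let ?f = "free_eval K B (cdh_case c d h)"
  have f: "?f \<in> alg_hom K (free_alg K) B" by (rule free_eval_alg_hom[OF Kc B g])
  note fl = alg_hom_lin[OF f]
  have fg: "?f (free_gen K x) = cdh_case c d h x" for x by (rule free_eval_gen[OF Kc B g])
  note fs = lin_hom_minus[OF F.module_axioms B.module_axioms fl] lin_hom_add[OF fl] alg_hom_mult[OF f]
    alg_hom_one[OF f] fg cdh_case_simps cdh_free_gen_closed
  have 1: "?f n = \<zero>\<^bsub>B\<^esub>" if "n \<in> ideal_I K" for n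
    by (rule alg_hom_vanish_genideal[OF Kc F.unital_algebra_axioms B f _ _ that[unfolded ideal_I_def Let_def]])
       (use rel in \<open>auto simp: fs cdh_relations_def F.minus_closed\<close>)
  have 2: "?f n = \<zero>\<^bsub>B\<^esub>" if "n \<in> ideal_I1 K" extra for n
    by (rule alg_hom_vanish_genideal[OF Kc F.unital_algebra_axioms B f _ _ that(1)[unfolded ideal_I1_def Let_def]])
       (use rel that(2) in \<open>auto simp: fs cdh_relations_def F.minus_closed\<close>)
  show ?thesis
  proof (cases extra)
    case True
    then obtain a b where ab: "n = a \<oplus>\<^bsub>free_alg K\<^esub> b" "a \<in> ideal_I K" "b \<in> ideal_I1 K"
      using n unfolding cdh_ideal_def ideal_II1_def by (auto simp: set_add_def')
    then have c: "a \<in> carrier (free_alg K)" "b \<in> carrier (free_alg K)"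
      using ideal.Icarr[OF ideal_I_ideal] ideal.Icarr[OF ideal_I1_ideal] by auto
    show ?thesis unfolding ab(1) using c by (simp add: lin_hom_add[OF fl] 1[OF ab(2)] 2[OF ab(3) True])
  next
    case False
    then show ?thesis using n 1 by (simp add: cdh_ideal_def)
  qed
qed

lemma ideal_I_subset: "ideal_I K \<subseteq> cdh_ideal K extra"
proof (cases extra)
  case True
  have "n \<in> ideal_I K <+>\<^bsub>free_alg K\<^esub> ideal_I1 K" if n: "n \<in> ideal_I K" for n
  proof -
    have "n = n \<oplus>\<^bsub>free_alg K\<^esub> \<zero>\<^bsub>free_alg K\<^esub>" using ideal.Icarr[OF ideal_I_ideal n] by simp
    moreover have "\<zero>\<^bsub>free_alg K\<^esub> \<in> ideal_I1 K"
      using additive_subgroup.zero_closed[OF ideal.axioms(1)[OF ideal_I1_ideal]] .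
    ultimately show ?thesis using n unfolding set_add_def' by blast
  qed
  then show ?thesis using True by (auto simp: cdh_ideal_def ideal_II1_def)
qed (simp add: cdh_ideal_def)

lemma ideal_I1_subset: "extra \<Longrightarrow> ideal_I1 K \<subseteq> cdh_ideal K extra"
proof
  fix n assume e: extra and n: "n \<in> ideal_I1 K"
  have "n = \<zero>\<^bsub>free_alg K\<^esub> \<oplus>\<^bsub>free_alg K\<^esub> n" using ideal.Icarr[OF ideal_I1_ideal n] by simp
  moreover have "\<zero>\<^bsub>free_alg K\<^esub> \<in> ideal_I K"
    using additive_subgroup.zero_closed[OF ideal.axioms(1)[OF ideal_I_ideal]] .
  ultimately show "n \<in> cdh_ideal K extra"
    using n e unfolding cdh_ideal_def ideal_II1_def set_add_def' by auto
qed

end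


text \<open>
  The two operators show that \<open>h \<noteq> 0\<close> and \<open>c \<noteq> 1 - 2h\<close>: the operator \<open>\<phi>(h)\<close> is nonzero, and
  \<open>\<phi>(c) + 2 \<phi>(h)\<close> maps \<open>e\<close> to \<open>1 + e\<close>, so it is not the identity.
\<close>

lemma cosupp_triangular_of_hom:
  fixes K (structure)
  assumes K: "field K" and H: "hopf_algebra K H" and p: "coaction_pair K H h c"
    and \<rho>: "\<And>a. a \<in> carrier (kxk K) \<Longrightarrow> \<rho> a = unital_ext K H (kxk_tens K H h c) a"
    and \<phi>: "\<phi> \<in> alg_hom K H (End_alg K (kxk K))"
    and h: "\<phi> h = kxk_op K \<zero> \<zero> \<one>" and c: "\<phi> c = kxk_op K \<one> \<one> (\<ominus> \<one>)"
  shows "cosupp K (kxk K) H \<rho> = triangular_ops K"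
proof (rule cosupp_triangular[OF K H p \<rho>])
  interpret K: field K by (rule K)
  interpret H: hopf_algebra K H by (rule H)
  interpret A: unital_algebra K "kxk K" by (rule kxk_unital_algebra[OF K_cring[OF K]])
  interpret E: unital_algebra K "End_alg K (kxk K)" by (rule End_alg_unital_algebra[OF A.module_axioms])
  note ops = kxk_op_add[OF K] kxk_op_one[OF K]
  note hc = pair_facts(1,2)[OF K H p]
  show "h \<noteq> \<zero>\<^bsub>H\<^esub>"
  proof
    assume "h = \<zero>\<^bsub>H\<^esub>"
    then have "kxk_op K \<zero> \<zero> \<one> = \<zero>\<^bsub>End_alg K (kxk K)\<^esub>"
      using lin_hom_zero[OF H.module_axioms E.module_axioms alg_hom_lin[OF \<phi>]] h by simp
    then have "kxk_op K \<zero> \<zero> \<one> = kxk_op K \<zero> \<zero> \<zero>" by (simp only: kxk_op_zero[OF K])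
    from kxk_op_inject(3)[OF K _ _ _ _ _ _ this] show False by simp
  qed
  show "c \<noteq> \<one>\<^bsub>H\<^esub> \<ominus>\<^bsub>H\<^esub> (h \<oplus>\<^bsub>H\<^esub> h)"
  proof
    assume "c = \<one>\<^bsub>H\<^esub> \<ominus>\<^bsub>H\<^esub> (h \<oplus>\<^bsub>H\<^esub> h)"
    then have "c \<oplus>\<^bsub>H\<^esub> (h \<oplus>\<^bsub>H\<^esub> h) = \<one>\<^bsub>H\<^esub>"
      using hc by (simp add: a_minus_def H.M.a_assoc H.M.l_neg)
    then have "\<phi> (c \<oplus>\<^bsub>H\<^esub> (h \<oplus>\<^bsub>H\<^esub> h)) = \<one>\<^bsub>End_alg K (kxk K)\<^esub>"
      by (simp add: alg_hom_one[OF \<phi>])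
    then have "\<phi> c \<oplus>\<^bsub>End_alg K (kxk K)\<^esub> (\<phi> h \<oplus>\<^bsub>End_alg K (kxk K)\<^esub> \<phi> h) = \<one>\<^bsub>End_alg K (kxk K)\<^esub>"
      using hc by (simp add: lin_hom_add[OF alg_hom_lin[OF \<phi>]])
    then have "kxk_op K \<one> \<one> (\<ominus> \<one> \<oplus> (\<one> \<oplus> \<one>)) = kxk_op K \<one> \<zero> \<one>"
      by (simp add: ops h c)
    from kxk_op_inject(2)[OF K _ _ _ _ _ _ this] show False by simp
  qed
qed

text \<open>
  After multiplying out, the relation \<open>hc + ch + c\<^sup>2 = c\<close> is used in the second factor for the
  idempotent, and in either factor for the last relation.
\<close>

lemma cdh_relations_tensor:
  fixes Q (structure)
  assumes Q: "unital_algebra K Q" and r: "cdh_relations Q extra c d h"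
  shows "cdh_relations (tensor K Q Q) extra (tens K Q Q c c) (tens K Q Q d d)
    (tens K Q Q h c \<oplus>\<^bsub>tensor K Q Q\<^esub> tens K Q Q \<one> h)"
proof -
  interpret Q: unital_algebra K Q by (rule Q)
  interpret T: unital_algebra K "tensor K Q Q" by (rule tensor_unital_algebra[OF Q Q])
  note r' = r[unfolded cdh_relations_def]
  have car: "c \<in> carrier Q" "d \<in> carrier Q" "h \<in> carrier Q" using r' by auto
  have eqs: "c \<otimes> d = \<one>" "d \<otimes> c = \<one>" "h \<otimes> h = h"
    and rel: "h \<otimes> c \<oplus> c \<otimes> h \<oplus> c \<otimes> c = c" using r' by auto
  let ?t = "tens K Q Q"
  note tc = tens_closed[OF Q Q] and tm = tens_mult[OF Q Q] and t1 = tensor_one[OF Q Q]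
  have addl: "?t (x \<oplus> y) z = ?t x z \<oplus>\<^bsub>tensor K Q Q\<^esub> ?t y z"
    and addr: "?t z (x \<oplus> y) = ?t z x \<oplus>\<^bsub>tensor K Q Q\<^esub> ?t z y"
    if "x \<in> carrier Q" "y \<in> carrier Q" "z \<in> carrier Q" for x y z
    using lin_hom_add[OF tens_lin_left[OF Q Q that(3)] that(1,2)]
      lin_hom_add[OF tens_lin_right[OF Q Q that(3)] that(1,2)] by auto
  have "(?t h c \<oplus>\<^bsub>tensor K Q Q\<^esub> ?t \<one> h) \<otimes>\<^bsub>tensor K Q Q\<^esub> (?t h c \<oplus>\<^bsub>tensor K Q Q\<^esub> ?t \<one> h)
      = ?t h (h \<otimes> c \<oplus> c \<otimes> h \<oplus> c \<otimes> c) \<oplus>\<^bsub>tensor K Q Q\<^esub> ?t \<one> h"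
    using car by (simp add: T.l_distr T.r_distr tc tm eqs addr T.M.a_ac)
  then have idem: "(?t h c \<oplus>\<^bsub>tensor K Q Q\<^esub> ?t \<one> h) \<otimes>\<^bsub>tensor K Q Q\<^esub> (?t h c \<oplus>\<^bsub>tensor K Q Q\<^esub> ?t \<one> h)
      = ?t h c \<oplus>\<^bsub>tensor K Q Q\<^esub> ?t \<one> h"
    by (simp only: rel)
  have "(?t h c \<oplus>\<^bsub>tensor K Q Q\<^esub> ?t \<one> h) \<otimes>\<^bsub>tensor K Q Q\<^esub> ?t c c
      \<oplus>\<^bsub>tensor K Q Q\<^esub> ?t c c \<otimes>\<^bsub>tensor K Q Q\<^esub> (?t h c \<oplus>\<^bsub>tensor K Q Q\<^esub> ?t \<one> h)
      \<oplus>\<^bsub>tensor K Q Q\<^esub> ?t c c \<otimes>\<^bsub>tensor K Q Q\<^esub> ?t c c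
      = ?t (h \<otimes> c \<oplus> c \<otimes> h \<oplus> c \<otimes> c) (c \<otimes> c)
        \<oplus>\<^bsub>tensor K Q Q\<^esub> (?t c (h \<otimes> c) \<oplus>\<^bsub>tensor K Q Q\<^esub> ?t c (c \<otimes> h))"
    using car by (simp add: T.l_distr T.r_distr tc tm addl T.M.a_ac)
  also have "\<dots> = ?t c (h \<otimes> c \<oplus> c \<otimes> h \<oplus> c \<otimes> c)"
  proof -
    have "?t c (c \<otimes> c) \<oplus>\<^bsub>tensor K Q Q\<^esub> (?t c (h \<otimes> c) \<oplus>\<^bsub>tensor K Q Q\<^esub> ?t c (c \<otimes> h))
        = ?t c (h \<otimes> c \<oplus> c \<otimes> h \<oplus> c \<otimes> c)"
      using car by (simp add: tc addr T.M.a_ac)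
    then show ?thesis by (simp only: rel)
  qed
  finally show ?thesis
    unfolding cdh_relations_def using r' idem by (simp add: rel tc tm t1 cong: conj_cong)
qed

lemma cdh_relations_base:
  assumes "cring K" shows "cdh_relations (base_alg K) extra \<one>\<^bsub>K\<^esub> \<one>\<^bsub>K\<^esub> \<zero>\<^bsub>K\<^esub>"
proof -
  interpret K: cring K by fact
  show ?thesis by (simp add: cdh_relations_def base_alg_sel)
qed

text \<open>If \<open>c\<^sup>2 = 1\<close>, then \<open>d = c\<close>, hence \<open>d\<^sup>2 = 1\<close>.\<close>

lemma cdh_relations_opp:
  fixes Q (structure)
  assumes Q: "unital_algebra K Q" and r: "cdh_relations Q extra c d h"
  shows "cdh_relations (opp_alg Q) extra d c (\<ominus> (h \<otimes> d))"
proof -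
  interpret Q: unital_algebra K Q by (rule Q)
  note r' = r[unfolded cdh_relations_def]
  have a: "c \<in> carrier Q" "d \<in> carrier Q" "h \<in> carrier Q" "c \<otimes> d = \<one>" "d \<otimes> c = \<one>" "h \<otimes> h = h"
    "h \<otimes> c \<oplus> c \<otimes> h \<oplus> c \<otimes> c = c" using r' by auto
  have "d \<otimes> d = \<one>" if "c \<otimes> c = \<one>"
  proof -
    have "d = d \<otimes> (c \<otimes> c)" using a by (simp add: that)
    also have "\<dots> = c" using a by (simp add: Q.m_assoc[symmetric])
    finally show ?thesis using that by simp
  qed
  then show ?thesis
    unfolding cdh_relations_def opp_alg_sel
    using r' Q.cdh_antipode_idem[OF a] Q.cdh_antipode_rel[OF a] by auto
qed

context
  fixes K :: "'k ring" (structure) and extra :: bool assumes K: "field K"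
begin

interpretation K: field K by (rule K)

interpretation F: unital_algebra K "free_alg K :: ('k, cdh list \<Rightarrow> 'k) module"
  by (rule free_alg_unital_algebra[OF K_cring[OF K]])

abbreviation (input) "cdh_quot \<equiv> quot_alg (free_alg K) (cdh_ideal K extra)"
abbreviation (input) "qc \<equiv> quot_gen K (cdh_ideal K extra) Gc"
abbreviation (input) "qd \<equiv> quot_gen K (cdh_ideal K extra) Gd"
abbreviation (input) "qh \<equiv> quot_gen K (cdh_ideal K extra) Gh"

lemma cdh_quot_algebra: "unital_algebra K cdh_quot"
  by (rule quot_free_unital_algebra[OF K_cring[OF K] cdh_ideal_ideal[OF K]])

lemma cdh_quot_relations: "cdh_relations cdh_quot extra qc qd qh"
proof -
  note Fa = F.unital_algebra_axioms and I = cdh_ideal_ideal[OF K, of extra]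
  interpret Q: unital_algebra K cdh_quot by (rule cdh_quot_algebra)
  let ?q = "\<lambda>x. cdh_ideal K extra +>\<^bsub>free_alg K\<^esub> x"
  let ?c = "free_gen K Gc" and ?d = "free_gen K Gd" and ?h = "free_gen K Gh"
  note q = quot_map_alg_hom[OF Fa I]
  note ql = alg_hom_lin[OF q]
  note qz = quot_map_zero_iff[OF Fa I]
  note fs = lin_hom_minus[OF F.module_axioms Q.module_axioms ql] lin_hom_add[OF ql] alg_hom_mult[OF q]
    alg_hom_one[OF q] cdh_free_gen_closed[OF K]
  have gens: "S \<subseteq> carrier (free_alg K)"
    if "S = {?c \<otimes>\<^bsub>free_alg K\<^esub> ?d \<ominus>\<^bsub>free_alg K\<^esub> \<one>\<^bsub>free_alg K\<^esub>, ?d \<otimes>\<^bsub>free_alg K\<^esub> ?c \<ominus>\<^bsub>free_alg K\<^esub> \<one>\<^bsub>free_alg K\<^esub>,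
      ?h \<otimes>\<^bsub>free_alg K\<^esub> ?h \<ominus>\<^bsub>free_alg K\<^esub> ?h,
      ?h \<otimes>\<^bsub>free_alg K\<^esub> ?c \<oplus>\<^bsub>free_alg K\<^esub> ?c \<otimes>\<^bsub>free_alg K\<^esub> ?h \<oplus>\<^bsub>free_alg K\<^esub> ?c \<otimes>\<^bsub>free_alg K\<^esub> ?c \<ominus>\<^bsub>free_alg K\<^esub> ?c}" for S
    unfolding that by (auto simp: cdh_free_gen_closed[OF K] F.minus_closed)
  note sub = subset_trans[OF F.genideal_self[OF gens[OF refl]] ideal_I_subset[OF K, of extra, unfolded ideal_I_def Let_def]]
  have r: "?q (?c \<otimes>\<^bsub>free_alg K\<^esub> ?d \<ominus>\<^bsub>free_alg K\<^esub> \<one>\<^bsub>free_alg K\<^esub>) = \<zero>\<^bsub>cdh_quot\<^esub>"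
    "?q (?d \<otimes>\<^bsub>free_alg K\<^esub> ?c \<ominus>\<^bsub>free_alg K\<^esub> \<one>\<^bsub>free_alg K\<^esub>) = \<zero>\<^bsub>cdh_quot\<^esub>"
    "?q (?h \<otimes>\<^bsub>free_alg K\<^esub> ?h \<ominus>\<^bsub>free_alg K\<^esub> ?h) = \<zero>\<^bsub>cdh_quot\<^esub>"
    "?q (?h \<otimes>\<^bsub>free_alg K\<^esub> ?c \<oplus>\<^bsub>free_alg K\<^esub> ?c \<otimes>\<^bsub>free_alg K\<^esub> ?h \<oplus>\<^bsub>free_alg K\<^esub> ?c \<otimes>\<^bsub>free_alg K\<^esub> ?c \<ominus>\<^bsub>free_alg K\<^esub> ?c) = \<zero>\<^bsub>cdh_quot\<^esub>"
    using sub by (simp_all add: qz cdh_free_gen_closed[OF K] F.minus_closed)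
  have s: "?q (?c \<otimes>\<^bsub>free_alg K\<^esub> ?c \<ominus>\<^bsub>free_alg K\<^esub> \<one>\<^bsub>free_alg K\<^esub>) = \<zero>\<^bsub>cdh_quot\<^esub>" if extra
  proof -
    have "{?c \<otimes>\<^bsub>free_alg K\<^esub> ?c \<ominus>\<^bsub>free_alg K\<^esub> \<one>\<^bsub>free_alg K\<^esub>} \<subseteq> carrier (free_alg K)"
      by (auto simp: cdh_free_gen_closed[OF K] F.minus_closed)
    then have "{?c \<otimes>\<^bsub>free_alg K\<^esub> ?c \<ominus>\<^bsub>free_alg K\<^esub> \<one>\<^bsub>free_alg K\<^esub>} \<subseteq> cdh_ideal K extra"
      using F.genideal_self ideal_I1_subset[OF K that] unfolding ideal_I1_def Let_def by blast
    then show ?thesis by (simp add: qz cdh_free_gen_closed[OF K] F.minus_closed)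
  qed
  have cl: "quot_gen K (cdh_ideal K extra) x \<in> carrier cdh_quot" for x
    by (rule quot_gen_closed[OF K_cring[OF K] I])
  have eqs: "?q (free_gen K x) = quot_gen K (cdh_ideal K extra) x" for x by (simp add: quot_gen_def)
  have r': "qc \<otimes>\<^bsub>cdh_quot\<^esub> qd = \<one>\<^bsub>cdh_quot\<^esub>" "qd \<otimes>\<^bsub>cdh_quot\<^esub> qc = \<one>\<^bsub>cdh_quot\<^esub>" "qh \<otimes>\<^bsub>cdh_quot\<^esub> qh = qh"
    "qh \<otimes>\<^bsub>cdh_quot\<^esub> qc \<oplus>\<^bsub>cdh_quot\<^esub> qc \<otimes>\<^bsub>cdh_quot\<^esub> qh \<oplus>\<^bsub>cdh_quot\<^esub> qc \<otimes>\<^bsub>cdh_quot\<^esub> qc = qc"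
    using r by (simp_all add: fs eqs cl)
  have s': "qc \<otimes>\<^bsub>cdh_quot\<^esub> qc = \<one>\<^bsub>cdh_quot\<^esub>" if extra
    using s[OF that] by (simp add: fs eqs cl)
  show ?thesis
    unfolding cdh_relations_def by (intro conjI impI cl r' s')
qed


abbreviation (input) "cdh_H \<equiv> cdh_hopf K (cdh_ideal K extra)"
abbreviation (input) "cdh_D \<equiv> cdh_case (tens K cdh_quot cdh_quot qc qc) (tens K cdh_quot cdh_quot qd qd)
  (tens K cdh_quot cdh_quot qh qc \<oplus>\<^bsub>tensor K cdh_quot cdh_quot\<^esub> tens K cdh_quot cdh_quot \<one>\<^bsub>cdh_quot\<^esub> qh)"
abbreviation (input) "cdh_S \<equiv> cdh_case qd qc (\<ominus>\<^bsub>cdh_quot\<^esub> (qh \<otimes>\<^bsub>cdh_quot\<^esub> qd))"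

lemma cdh_hopf_presented:
  "cdh_H = presented_hopf K (cdh_ideal K extra) cdh_D (cdh_case \<one> \<one> \<zero>) cdh_S"
  by (simp add: cdh_hopf_def Let_def cdh_case_def[abs_def])

lemma cdh_case_closed: "cdh_relations B extra c d h \<Longrightarrow> cdh_case c d h x \<in> carrier B"
  by (cases x) (simp_all add: cdh_case_simps cdh_relations_def)

lemma cdh_D: "cdh_D x \<in> carrier (tensor K cdh_quot cdh_quot)"
    "n \<in> cdh_ideal K extra \<Longrightarrow> free_eval K (tensor K cdh_quot cdh_quot) cdh_D n = \<zero>\<^bsub>tensor K cdh_quot cdh_quot\<^esub>"
  and cdh_E: "cdh_case \<one> \<one> \<zero> x \<in> carrier K"
    "n \<in> cdh_ideal K extra \<Longrightarrow> free_eval K (base_alg K) (cdh_case \<one> \<one> \<zero>) n = \<zero>"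
  and cdh_S: "cdh_S x \<in> carrier cdh_quot"
    "n \<in> cdh_ideal K extra \<Longrightarrow> free_eval K (opp_alg cdh_quot) cdh_S n = \<zero>\<^bsub>cdh_quot\<^esub>"
proof -
  note Kc = K_cring[OF K]
  note Qa = cdh_quot_algebra
  note D = cdh_relations_tensor[OF Qa cdh_quot_relations]
    and E = cdh_relations_base[OF Kc, of extra]
    and S = cdh_relations_opp[OF Qa cdh_quot_relations]
  show "cdh_D x \<in> carrier (tensor K cdh_quot cdh_quot)" "cdh_case \<one> \<one> \<zero> x \<in> carrier K" "cdh_S x \<in> carrier cdh_quot"
    using cdh_case_closed[OF D] cdh_case_closed[OF E] cdh_case_closed[OF S] by (simp_all add: base_alg_sel opp_alg_sel)
  assume n: "n \<in> cdh_ideal K extra"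
  show "free_eval K (tensor K cdh_quot cdh_quot) cdh_D n = \<zero>\<^bsub>tensor K cdh_quot cdh_quot\<^esub>"
    by (rule cdh_vanish[OF K tensor_unital_algebra[OF Qa Qa] D n])
  show "free_eval K (base_alg K) (cdh_case \<one> \<one> \<zero>) n = \<zero>"
    using cdh_vanish[OF K base_alg_unital_algebra[OF Kc] E n] by (simp add: base_alg_sel)
  show "free_eval K (opp_alg cdh_quot) cdh_S n = \<zero>\<^bsub>cdh_quot\<^esub>"
    using cdh_vanish[OF K opp_alg_unital_algebra[OF Qa] S n] by (simp add: opp_alg_sel)
qed

lemmas cdh_data = K_cring[OF K] cdh_ideal_ideal[OF K, of extra]

lemma cdh_tens: "tensor K cdh_H cdh_H = tensor K cdh_quot cdh_quot" "tens K cdh_H cdh_H = tens K cdh_quot cdh_quot"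
  unfolding cdh_hopf_presented by (rule presented_tens[OF cdh_data cdh_D cdh_E cdh_S]; assumption?)+

lemma cdh_sel: "carrier cdh_H = carrier cdh_quot" "monoid.mult cdh_H = monoid.mult cdh_quot" "one cdh_H = one cdh_quot"
  "ring.zero cdh_H = ring.zero cdh_quot" "ring.add cdh_H = ring.add cdh_quot" "smult cdh_H = smult cdh_quot"
  unfolding cdh_hopf_presented by (rule presented_sel[OF cdh_data cdh_D cdh_E cdh_S]; assumption?)+

lemma cdh_values: "comult cdh_H (quot_gen K (cdh_ideal K extra) x) = cdh_D x"
  "counit cdh_H (quot_gen K (cdh_ideal K extra) x) = cdh_case \<one> \<one> \<zero> x"
  "antipode cdh_H (quot_gen K (cdh_ideal K extra) x) = cdh_S x"
  unfolding cdh_hopf_presented by (rule presented_homs[OF cdh_data cdh_D cdh_E cdh_S]; assumption?)+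

lemma cdh_prehopf: "prehopf K cdh_H"
  unfolding cdh_hopf_presented by (rule presented_prehopf[OF cdh_data cdh_D cdh_E cdh_S]; assumption?)+

lemma cdh_truncate: "module.truncate cdh_H = module.truncate cdh_quot"
  unfolding cdh_hopf_presented by (rule presented_hopf_sel)

lemma cdh_relations_H: "cdh_relations cdh_H extra qc qd qh"
  unfolding cdh_relations_def cdh_sel by (rule cdh_quot_relations[unfolded cdh_relations_def])

lemma cdh_hopf_algebra: "hopf_algebra K cdh_H"
proof -
  interpret H: prehopf K cdh_H by (rule cdh_prehopf)
  note r = cdh_relations_H[unfolded cdh_relations_def]
  have mod: "a_inv cdh_quot x = a_inv cdh_H x" for x
    by (simp add: a_inv_def m_inv_def cdh_sel)
  note vals = cdh_values[of Gc] cdh_values[of Gd] cdh_values[of Gh]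
  note v = vals[unfolded cdh_case_simps mod, folded cdh_tens cdh_sel]
  have car: "qc \<in> carrier cdh_H" "qd \<in> carrier cdh_H" "qh \<in> carrier cdh_H" using r by auto
  have c: "hopf_identities K cdh_H qc" and d: "hopf_identities K cdh_H qd"
    by (rule H.hopf_identities_grouplike; use r v in simp)+
  have "(\<ominus>\<^bsub>cdh_H\<^esub> (qh \<otimes>\<^bsub>cdh_H\<^esub> qd)) \<otimes>\<^bsub>cdh_H\<^esub> qc \<oplus>\<^bsub>cdh_H\<^esub> \<one>\<^bsub>cdh_H\<^esub> \<otimes>\<^bsub>cdh_H\<^esub> qh = \<zero>\<^bsub>cdh_H\<^esub>" "qh \<otimes>\<^bsub>cdh_H\<^esub> qd \<oplus>\<^bsub>cdh_H\<^esub> \<one>\<^bsub>cdh_H\<^esub> \<otimes>\<^bsub>cdh_H\<^esub> (\<ominus>\<^bsub>cdh_H\<^esub> (qh \<otimes>\<^bsub>cdh_H\<^esub> qd)) = \<zero>\<^bsub>cdh_H\<^esub>"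
    using car r by (simp_all add: H.l_minus H.m_assoc H.M.l_neg H.M.r_neg)
  then have h: "hopf_identities K cdh_H qh"
    by (intro H.hopf_identities_skew_primitive[of qc "\<one>\<^bsub>cdh_H\<^esub>"])
       (use r v in \<open>simp_all add: H.counit_one H.antipode_one alg_hom_one[OF H.comult_hom]
          tensor_one[OF H.H_alg H.H_alg]\<close>)
  have "hopf_identities K cdh_H (quot_gen K (cdh_ideal K extra) x)" for x
    using c d h by (cases x) simp_all
  then show ?thesis
    using presented_hopf_algebra[OF cdh_data cdh_D cdh_E cdh_S] unfolding cdh_hopf_presented[symmetric] by blast
qed

interpretation H: hopf_algebra K cdh_H by (rule cdh_hopf_algebra)

lemma cdh_coaction_pair: "coaction_pair K cdh_H qh qc"
  using cdh_relations_H cdh_values[of Gc] cdh_values[of Gh]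
  by (simp add: coaction_pair_def[OF K_cring[OF K]] cdh_relations_def cdh_case_simps cdh_tens cdh_sel)

lemma rho3_e_kxk_tens: "rho3_e K (cdh_ideal K extra) = kxk_tens K cdh_H qh qc"
  by (simp add: rho3_e_def kxk_tens_def)

lemma cdh_coaction: "hopf_coaction K (kxk K) cdh_H (unital_ext K cdh_H (rho3_e K (cdh_ideal K extra)))"
  unfolding rho3_e_kxk_tens
  by (rule coaction_pair_coaction[OF K_cring[OF K] cdh_hopf_algebra cdh_coaction_pair])

lemma cdh_coaction_e: "unital_ext K cdh_H (rho3_e K (cdh_ideal K extra)) (elt_e K) = rho3_e K (cdh_ideal K extra)"
proof -
  have "qh \<in> carrier cdh_H" "qc \<in> carrier cdh_H" using cdh_relations_H by (auto simp: cdh_relations_def)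
  then show ?thesis unfolding rho3_e_kxk_tens
    by (intro unital_ext_lin[OF K_cring[OF K]] kxk_tens_closed[OF K_cring[OF K]] H.unital_algebra_axioms)
qed

lemma cdh_hom_exists:
  assumes B: "unital_algebra K B" and r: "cdh_relations B extra c d h"
  obtains \<phi> where "\<phi> \<in> alg_hom K cdh_H B" "\<phi> qc = c" "\<phi> qh = h"
proof -
  note e = quot_free_eval[OF cdh_data B cdh_case_closed[OF r] cdh_vanish[OF K B r]]
  show ?thesis
  proof (rule that)
    show "(\<lambda>Y. the_elem (free_eval K B (cdh_case c d h) ` Y)) \<in> alg_hom K cdh_H B"
      unfolding lin_hom_truncate(2)[OF cdh_truncate refl] by (rule e(1)) assumption
    show "the_elem (free_eval K B (cdh_case c d h) ` qc) = c"
      "the_elem (free_eval K B (cdh_case c d h) ` qh) = h"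
      by (subst e(2); simp add: cdh_case_simps)+
  qed
qed

text \<open>The generator \<open>d\<close> is the inverse of \<open>c\<close>.\<close>

lemma cdh_hom_eq:
  assumes B: "unital_algebra K B" and f: "f \<in> alg_hom K cdh_H B" and g: "g \<in> alg_hom K cdh_H B"
    and eq: "f qh = g qh" "f qc = g qc" and x: "x \<in> carrier cdh_H"
  shows "f x = g x"
proof -
  have "f qd = g qd"
    using cdh_relations_H eq
    by (intro alg_hom_inverse_eq[OF B f g, of qc qd]) (auto simp: cdh_relations_def)
  then have "f (quot_gen K (cdh_ideal K extra) y) = g (quot_gen K (cdh_ideal K extra) y)" for y
    using eq by (cases y) auto
  note gens = this
  show ?thesis
    by (rule quot_free_hom_eq[OF cdh_data f[unfolded lin_hom_truncate(2)[OF cdh_truncate refl]]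
          g[unfolded lin_hom_truncate(2)[OF cdh_truncate refl]] gens x[unfolded cdh_sel]])
qed

text \<open>
  The operators that represent \<open>c\<close> and \<open>h\<close> satisfy also \<open>c\<^sup>2 = 1\<close>, so the same representation serves
  both quotients.
\<close>

lemma cdh_coaction_cosupp:
  "cosupp K (kxk K) cdh_H (unital_ext K cdh_H (rho3_e K (cdh_ideal K extra))) = triangular_ops K"
proof -
  interpret A: unital_algebra K "kxk K" by (rule kxk_unital_algebra[OF K_cring[OF K]])
  note E = End_alg_unital_algebra[OF A.module_axioms]
  let ?c = "kxk_op K \<one> \<one> (\<ominus> \<one>)" and ?h = "kxk_op K \<zero> \<zero> \<one>"
  note ops = kxk_op_closed[OF K] kxk_op_add[OF K] kxk_op_mult[OF K] kxk_op_one[OF K]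
  have "cdh_relations (End_alg K (kxk K)) extra ?c ?c ?h"
    by (simp add: cdh_relations_def ops K.l_minus K.r_minus K.r_neg K.l_neg K.a_assoc)
  then obtain \<phi> where \<phi>: "\<phi> \<in> alg_hom K cdh_H (End_alg K (kxk K))" "\<phi> qc = ?c" "\<phi> qh = ?h"
    by (rule cdh_hom_exists[OF E])
  have ext: "unital_ext K cdh_H (rho3_e K (cdh_ideal K extra)) a = unital_ext K cdh_H (kxk_tens K cdh_H qh qc) a" for a
    by (simp add: rho3_e_kxk_tens)
  show ?thesis
    by (rule cosupp_triangular_of_hom[OF K cdh_hopf_algebra cdh_coaction_pair ext \<phi>(1,3,2)])
qed

end


context
  fixes K :: "'k ring" assumes K: "field K"
begin

interpretation K: field K by (rule K)

lemma H_I_cdh: "H_I K = cdh_hopf K (cdh_ideal K False)" "H_II1 K = cdh_hopf K (cdh_ideal K True)"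
  and rho3_cdh: "rho3 K = unital_ext K (cdh_hopf K (cdh_ideal K False)) (rho3_e K (cdh_ideal K False))"
    "rho3a K = unital_ext K (cdh_hopf K (cdh_ideal K True)) (rho3_e K (cdh_ideal K True))"
  by (simp_all add: H_I_def H_II1_def rho3_def rho3a_def cdh_ideal_def)

lemma cosupp_rho3: "cosupp K (kxk K) (H_I K) (rho3 K) = triangular_ops K"
  "cosupp K (kxk K) (H_II1 K) (rho3a K) = triangular_ops K"
  unfolding H_I_cdh rho3_cdh by (rule cdh_coaction_cosupp[OF K])+

lemma rho3_coaction: "hopf_coaction K (kxk K) (H_I K) (rho3 K)"
  "hopf_coaction K (kxk K) (H_II1 K) (rho3a K)"
  unfolding H_I_cdh rho3_cdh by (rule cdh_coaction[OF K])+

lemma rho3_values: "rho3 K (elt_e K) = rho3_e K (ideal_I K)" "rho3a K (elt_e K) = rho3_e K (ideal_II1 K)"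
  using cdh_coaction_e[OF K, of False] cdh_coaction_e[OF K, of True]
  by (simp_all add: rho3_cdh) (simp_all add: cdh_ideal_def)

text \<open>A pair in \<open>H\<close> satisfies the relations with \<open>d \<mapsto> S(c)\<close>.\<close>

lemma V_universal_rho3:
  "V_universal TYPE('h) K (kxk K) (cosupp K (kxk K) (H_I K) (rho3 K)) (H_I K) (rho3 K)"
  unfolding H_I_cdh rho3_cdh
proof (rule V_universalI[OF K cdh_hopf_algebra[OF K] cdh_coaction_pair[OF K] _ cdh_coaction[OF K]])
  let ?H = "cdh_hopf K (cdh_ideal K False)"
  show "unital_ext K ?H (rho3_e K (cdh_ideal K False)) a = unital_ext K ?H
      (kxk_tens K ?H (quot_gen K (cdh_ideal K False) Gh) (quot_gen K (cdh_ideal K False) Gc)) a" for a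
    by (simp add: rho3_e_kxk_tens[OF K])
  show "unital_subalgebra K (End_alg K (kxk K)) (cosupp K (kxk K) ?H (unital_ext K ?H (rho3_e K (cdh_ideal K False))))"
    unfolding cdh_coaction_cosupp[OF K] by (rule triangular_ops_subalgebra[OF K])
next
  let ?H = "cdh_hopf K (cdh_ideal K False)"
  fix H :: "('k, 'h) hopf" and h c \<rho>
  assume H: "hopf_algebra K H" and p: "coaction_pair K H h c"
  note i = coaction_pair_c_inverse[OF K H p]
  have "cdh_relations H False c (antipode H c) h"
    using p i by (simp add: cdh_relations_def coaction_pair_def[OF K_cring[OF K]])
  then obtain \<phi> where "\<phi> \<in> alg_hom K ?H H" "\<phi> (quot_gen K (cdh_ideal K False) Gc) = c"
    "\<phi> (quot_gen K (cdh_ideal K False) Gh) = h"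
    by (rule cdh_hom_exists[OF K hopf_algebra.axioms(1)[OF H]])
  then show "\<exists>\<phi>\<in>alg_hom K ?H H. \<phi> (quot_gen K (cdh_ideal K False) Gh) = h
      \<and> \<phi> (quot_gen K (cdh_ideal K False) Gc) = c" by blast
next
  fix H :: "('k, 'h) hopf" and f g x
  assume H: "hopf_algebra K H"
  note Ha = hopf_algebra.axioms(1)[OF H]
  note * = cdh_hom_eq[OF K tensor_unital_algebra[OF Ha Ha]] and ** = cdh_hom_eq[OF K Ha]
  show "f x = g x" if "f \<in> alg_hom K (cdh_hopf K (cdh_ideal K False)) (tensor K H H)"
    "g \<in> alg_hom K (cdh_hopf K (cdh_ideal K False)) (tensor K H H)"
    "f (quot_gen K (cdh_ideal K False) Gh) = g (quot_gen K (cdh_ideal K False) Gh)"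
    "f (quot_gen K (cdh_ideal K False) Gc) = g (quot_gen K (cdh_ideal K False) Gc)"
    "x \<in> carrier (cdh_hopf K (cdh_ideal K False))" for f g x
    by (rule *[OF that])
  show "f x = g x" if "f \<in> alg_hom K (cdh_hopf K (cdh_ideal K False)) H"
    "g \<in> alg_hom K (cdh_hopf K (cdh_ideal K False)) H"
    "f (quot_gen K (cdh_ideal K False) Gh) = g (quot_gen K (cdh_ideal K False) Gh)"
    "f (quot_gen K (cdh_ideal K False) Gc) = g (quot_gen K (cdh_ideal K False) Gc)"
    "x \<in> carrier (cdh_hopf K (cdh_ideal K False))" for f g x
    by (rule **[OF that])
qed (rule cdh_hom_eq[OF K base_alg_unital_algebra[OF K_cring[OF K]]]; assumption)

text \<open>The map \<open>a \<mapsto> a 1\<close> is a homomorphism from a field to a nonzero ring.\<close>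

lemma scalars_subfield:
  assumes A: "unital_algebra K A" and nz: "\<one>\<^bsub>A\<^esub> \<noteq> \<zero>\<^bsub>A\<^esub>" shows "subfield (scalars K A) A"
proof -
  interpret A: unital_algebra K A by (rule A)
  have "(\<lambda>a. a \<odot>\<^bsub>A\<^esub> \<one>\<^bsub>A\<^esub>) \<in> ring_hom K A"
    by (rule ring_hom_memI) (simp_all add: A.smult_l_distr A.smult_mult_left A.smult_assoc1)
  then interpret h: ring_hom_ring K A "\<lambda>a. a \<odot>\<^bsub>A\<^esub> \<one>\<^bsub>A\<^esub>"
    by (intro ring_hom_ringI2 K.ring_axioms A.ring_axioms)
  have "subfield (carrier K) K" using K.subfield_iff(1)[of "carrier K"] K by simp
  then show ?thesis unfolding scalars_def by (rule h.img_is_subfield(2)[OF _ nz])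
qed

text \<open>The coefficients are multiples of \<open>1\<close> and therefore commute with \<open>g\<close>.\<close>

lemma Span_left_mult:
  fixes A (structure)
  assumes A: "unital_algebra K A" and nz: "\<one> \<noteq> \<zero>" and us: "set us \<subseteq> carrier A" and g: "g \<in> carrier A"
    and gu: "\<And>u. u \<in> set us \<Longrightarrow> g \<otimes> u \<in> ring.Span A (scalars K A) us"
    and v: "v \<in> ring.Span A (scalars K A) us"
  shows "g \<otimes> v \<in> ring.Span A (scalars K A) us"
proof -
  interpret A: unital_algebra K A by (rule A)
  note F = scalars_subfield[OF A nz]
  note sub = A.Span_subgroup_props[OF F us] and sm = A.Span_smult_closed[OF F us]
  have "g \<otimes> A.combine ks ws \<in> A.Span (scalars K A) us"
    if "set ks \<subseteq> scalars K A" "set ws \<subseteq> set us" for ks ws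
    using that
  proof (induction ks ws rule: A.combine.induct)
    case (1 k ks w ws)
    then obtain a where a: "a \<in> carrier K" "k = a \<odot> \<one>" by (auto simp: scalars_def)
    have c: "w \<in> carrier A" "A.combine ks ws \<in> carrier A"
      using 1 us a by (auto simp: scalars_def intro!: A.combine_in_carrier[OF _ subset_trans[OF _ us]])
    have "g \<otimes> A.combine (k # ks) (w # ws) = k \<otimes> (g \<otimes> w) \<oplus> g \<otimes> A.combine ks ws"
      using c g a by (simp add: A.r_distr A.smult_mult_left A.smult_mult_right)
    also have "\<dots> \<in> A.Span (scalars K A) us"
    proof (rule sub(3))
      show "k \<otimes> (g \<otimes> w) \<in> A.Span (scalars K A) us" using 1 by (intro sm gu) auto
      show "g \<otimes> A.combine ks ws \<in> A.Span (scalars K A) us" using 1 by (simp del: A.Span.simps)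
    qed
    finally show ?case .
  qed (use g sub(2) in simp_all)
  then show ?thesis using v unfolding A.Span_eq_combine_set[OF F us] by auto
qed

text \<open>
  With \<open>c\<^sup>2 = 1\<close> one has \<open>d = c\<close> and \<open>hc = c - ch - 1\<close>. Hence \<open>c\<close> can be moved to the left of \<open>h\<close>,
  and the span of \<open>1\<close>, \<open>c\<close>, \<open>h\<close>, \<open>ch\<close> is stable under left multiplication by the generators; it
  contains \<open>1\<close> and so it is everything.
\<close>

lemma H_II1_finite_dim: "finite_dim_alg K (H_II1 K)"
  unfolding H_I_cdh
proof -
  let ?J = "cdh_ideal K True" and ?H = "cdh_hopf K (cdh_ideal K True)"
  interpret H: hopf_algebra K ?H by (rule cdh_hopf_algebra[OF K])
  define c d h where "c = quot_gen K ?J Gc" and "d = quot_gen K ?J Gd" and "h = quot_gen K ?J Gh"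
  have car: "c \<in> carrier ?H" "d \<in> carrier ?H" "h \<in> carrier ?H"
    and r: "d \<otimes>\<^bsub>?H\<^esub> c = \<one>\<^bsub>?H\<^esub>" "h \<otimes>\<^bsub>?H\<^esub> h = h" "c \<otimes>\<^bsub>?H\<^esub> c = \<one>\<^bsub>?H\<^esub>"
    and rel: "h \<otimes>\<^bsub>?H\<^esub> c \<oplus>\<^bsub>?H\<^esub> c \<otimes>\<^bsub>?H\<^esub> h \<oplus>\<^bsub>?H\<^esub> c \<otimes>\<^bsub>?H\<^esub> c = c"
    using cdh_relations_H[OF K, of True] by (auto simp: cdh_relations_def c_def d_def h_def)
  have "d = d \<otimes>\<^bsub>?H\<^esub> (c \<otimes>\<^bsub>?H\<^esub> c)" using car by (simp add: r)
  also have "\<dots> = c" using car by (simp only: H.m_assoc[symmetric] r(1) H.l_one)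
  finally have dc: "d = c" .
  (* The relation \<open>hc + ch + c\<^sup>2 = c\<close>, solved for \<open>hc\<close>. *)
  have hc: "h \<otimes>\<^bsub>?H\<^esub> c = c \<oplus>\<^bsub>?H\<^esub> (\<ominus>\<^bsub>?H\<^esub> (c \<otimes>\<^bsub>?H\<^esub> h) \<oplus>\<^bsub>?H\<^esub> \<ominus>\<^bsub>?H\<^esub> \<one>\<^bsub>?H\<^esub>)"
  proof -
    have "c \<oplus>\<^bsub>?H\<^esub> (\<ominus>\<^bsub>?H\<^esub> (c \<otimes>\<^bsub>?H\<^esub> h) \<oplus>\<^bsub>?H\<^esub> \<ominus>\<^bsub>?H\<^esub> \<one>\<^bsub>?H\<^esub>)
      = (h \<otimes>\<^bsub>?H\<^esub> c \<oplus>\<^bsub>?H\<^esub> c \<otimes>\<^bsub>?H\<^esub> h \<oplus>\<^bsub>?H\<^esub> \<one>\<^bsub>?H\<^esub>) \<oplus>\<^bsub>?H\<^esub> (\<ominus>\<^bsub>?H\<^esub> (c \<otimes>\<^bsub>?H\<^esub> h) \<oplus>\<^bsub>?H\<^esub> \<ominus>\<^bsub>?H\<^esub> \<one>\<^bsub>?H\<^esub>)"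
      using rel by (simp only: r)
    also have "\<dots> = h \<otimes>\<^bsub>?H\<^esub> c"
      using car by (simp add: H.M.a_assoc H.M.a_lcomm[of "\<one>\<^bsub>?H\<^esub>" "\<ominus>\<^bsub>?H\<^esub> (c \<otimes>\<^bsub>?H\<^esub> h)"] H.M.r_neg)
    finally show ?thesis by simp
  qed
  have cch: "c \<otimes>\<^bsub>?H\<^esub> (c \<otimes>\<^bsub>?H\<^esub> h) = h" using car by (simp add: H.m_assoc[symmetric] r)
  have hch: "h \<otimes>\<^bsub>?H\<^esub> (c \<otimes>\<^bsub>?H\<^esub> h) = \<ominus>\<^bsub>?H\<^esub> h"
  proof -
    have "h \<otimes>\<^bsub>?H\<^esub> (c \<otimes>\<^bsub>?H\<^esub> h) = (c \<oplus>\<^bsub>?H\<^esub> (\<ominus>\<^bsub>?H\<^esub> (c \<otimes>\<^bsub>?H\<^esub> h) \<oplus>\<^bsub>?H\<^esub> \<ominus>\<^bsub>?H\<^esub> \<one>\<^bsub>?H\<^esub>)) \<otimes>\<^bsub>?H\<^esub> h"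
      using car by (simp add: H.m_assoc[symmetric] hc)
    also have "\<dots> = \<ominus>\<^bsub>?H\<^esub> h"
      using car by (simp add: H.l_distr H.l_minus H.m_assoc r H.M.r_neg1 H.M.a_assoc[symmetric] H.M.r_neg)
    finally show ?thesis .
  qed
  have nz: "\<one>\<^bsub>?H\<^esub> \<noteq> \<zero>\<^bsub>?H\<^esub>"
    using lin_hom_zero[OF H.module_axioms unital_algebra_module[OF base_alg_unital_algebra[OF K_cring[OF K]]]
        alg_hom_lin[OF H.counit_hom]] alg_hom_one[OF H.counit_hom] by (auto simp: base_alg_sel)
  let ?us = "[\<one>\<^bsub>?H\<^esub>, c, h, c \<otimes>\<^bsub>?H\<^esub> h]" and ?F = "scalars K ?H"
  note F = scalars_subfield[OF H.unital_algebra_axioms nz]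
  have us: "set ?us \<subseteq> carrier ?H" using car by simp
  note sub = H.Span_subgroup_props[OF F us] and sm = H.Span_smult_closed[OF F us]
  have "u \<in> H.Span ?F ?us" if "u \<in> set ?us" for u using H.Span_base_incl[OF F us] that by blast
  then have mem: "\<one>\<^bsub>?H\<^esub> \<in> H.Span ?F ?us" "c \<in> H.Span ?F ?us" "h \<in> H.Span ?F ?us"
    "c \<otimes>\<^bsub>?H\<^esub> h \<in> H.Span ?F ?us" by simp_all
  have left: "g \<otimes>\<^bsub>?H\<^esub> v \<in> H.Span ?F ?us" if "g \<in> {c, h}" "v \<in> H.Span ?F ?us" for g v
  proof (rule Span_left_mult[OF H.unital_algebra_axioms nz us _ _ that(2)])
    show "g \<in> carrier ?H" using that car by auto
    show "g \<otimes>\<^bsub>?H\<^esub> u \<in> H.Span ?F ?us" if "u \<in> set ?us" for u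
    proof -
      have "u = \<one>\<^bsub>?H\<^esub> \<or> u = c \<or> u = h \<or> u = c \<otimes>\<^bsub>?H\<^esub> h" using that by simp
      then show ?thesis using \<open>g \<in> {c, h}\<close> mem sub(3,4) car
        by (elim disjE) (auto simp del: H.Span.simps simp: r cch hch hc)
    qed
  qed
  have gen: "quot_gen K ?J x \<in> {c, h}" for x using dc by (cases x) (simp_all add: c_def d_def h_def)
  have "y \<in> H.Span ?F ?us" if "y \<in> carrier (quot_alg (free_alg K) ?J)" for y
    using that
  proof (rule quot_free_induct[OF cdh_data[OF K]])
    show "a \<odot>\<^bsub>quot_alg (free_alg K) ?J\<^esub> y \<in> H.Span ?F ?us"
      if "a \<in> carrier K" "y \<in> carrier (quot_alg (free_alg K) ?J)" "y \<in> H.Span ?F ?us" for a y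
    proof -
      have "(a \<odot>\<^bsub>?H\<^esub> \<one>\<^bsub>?H\<^esub>) \<otimes>\<^bsub>?H\<^esub> y \<in> H.Span ?F ?us" using that by (intro sm) (auto simp: scalars_def)
      then show ?thesis using that by (simp add: H.smult_mult_left cdh_sel[OF K, of True, symmetric])
    qed
  qed (use mem left[OF gen] sub in \<open>simp_all del: H.Span.simps add: cdh_sel[OF K, of True, symmetric]\<close>)
  then have "carrier ?H = H.Span ?F ?us" using sub(1) by (auto simp del: H.Span.simps simp: cdh_sel[OF K])
  then show "finite_dim_alg K ?H"
    using H.Span_finite_dimension[OF F us] by (simp only: finite_dim_alg_def)
qed

end


section \<open>The Sweedler algebra\<close>

definition sweedler_relations :: "('k, 'b, 'y) module_scheme \<Rightarrow> 'b \<Rightarrow> 'b \<Rightarrow> bool"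
  where "sweedler_relations B c v \<longleftrightarrow> c \<in> carrier B \<and> v \<in> carrier B \<and>
    c \<otimes>\<^bsub>B\<^esub> c = \<one>\<^bsub>B\<^esub> \<and> v \<otimes>\<^bsub>B\<^esub> v = \<zero>\<^bsub>B\<^esub> \<and> v \<otimes>\<^bsub>B\<^esub> c \<oplus>\<^bsub>B\<^esub> c \<otimes>\<^bsub>B\<^esub> v = \<zero>\<^bsub>B\<^esub>"

definition sweedler_case :: "'b \<Rightarrow> 'b \<Rightarrow> sweedler_gen \<Rightarrow> 'b"
  where "sweedler_case c v x = (case x of Sc \<Rightarrow> c | Sv \<Rightarrow> v)"

lemma sweedler_case_simps: "sweedler_case c v Sc = c" "sweedler_case c v Sv = v"
  by (simp_all add: sweedler_case_def)

lemma sweedler_case_closed: "sweedler_relations B c v \<Longrightarrow> sweedler_case c v x \<in> carrier B"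
  by (cases x) (simp_all add: sweedler_case_simps sweedler_relations_def)

lemma sweedler_relations_rules:
  fixes B (structure)
  assumes B: "unital_algebra K B" and r: "sweedler_relations B c v"
  shows "v \<otimes> c = \<ominus> (c \<otimes> v)" "c \<otimes> (c \<otimes> v) = v" "(c \<otimes> v) \<otimes> c = \<ominus> v"
    "(c \<otimes> v) \<otimes> (c \<otimes> v) = \<zero>"
proof -
  interpret B: unital_algebra K B by (rule B)
  have car: "c \<in> carrier B" "v \<in> carrier B" and eqs: "c \<otimes> c = \<one>" "v \<otimes> v = \<zero>"
    and rel: "v \<otimes> c \<oplus> c \<otimes> v = \<zero>" using r by (auto simp: sweedler_relations_def)
  show vc: "v \<otimes> c = \<ominus> (c \<otimes> v)" using car rel by (intro B.M.minus_equality[symmetric]) auto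
  show ccv: "c \<otimes> (c \<otimes> v) = v" using car by (simp add: B.m_assoc[symmetric] eqs)
  show cvc: "(c \<otimes> v) \<otimes> c = \<ominus> v" using car by (simp add: B.m_assoc vc B.r_minus ccv)
  have "(c \<otimes> v) \<otimes> (c \<otimes> v) = ((c \<otimes> v) \<otimes> c) \<otimes> v" using car by (simp add: B.m_assoc)
  also have "\<dots> = \<zero>" using car by (simp add: cvc B.l_minus eqs)
  finally show "(c \<otimes> v) \<otimes> (c \<otimes> v) = \<zero>" .
qed

lemma sweedler_relations_tensor:
  fixes Q (structure)
  assumes Q: "unital_algebra K Q" and r: "sweedler_relations Q c v"
  shows "sweedler_relations (tensor K Q Q) (tens K Q Q c c)
    (tens K Q Q c v \<oplus>\<^bsub>tensor K Q Q\<^esub> tens K Q Q v \<one>)"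
proof -
  interpret Q: unital_algebra K Q by (rule Q)
  interpret T: unital_algebra K "tensor K Q Q" by (rule tensor_unital_algebra[OF Q Q])
  have car: "c \<in> carrier Q" "v \<in> carrier Q" and eqs: "c \<otimes> c = \<one>" "v \<otimes> v = \<zero>"
    using r by (auto simp: sweedler_relations_def)
  note vc = sweedler_relations_rules(1)[OF Q r]
  let ?t = "tens K Q Q"
  note tc = tens_closed[OF Q Q] and tm = tens_mult[OF Q Q] and t1 = tensor_one[OF Q Q]
  have neg: "?t (\<ominus> x) z = \<ominus>\<^bsub>tensor K Q Q\<^esub> ?t x z" "?t z (\<ominus> x) = \<ominus>\<^bsub>tensor K Q Q\<^esub> ?t z x"
    and zero: "?t \<zero> z = \<zero>\<^bsub>tensor K Q Q\<^esub>" "?t z \<zero> = \<zero>\<^bsub>tensor K Q Q\<^esub>"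
    if "x \<in> carrier Q" "z \<in> carrier Q" for x z
    using lin_hom_neg[OF Q.module_axioms T.module_axioms tens_lin_left[OF Q Q that(2)] that(1)]
      lin_hom_neg[OF Q.module_axioms T.module_axioms tens_lin_right[OF Q Q that(2)] that(1)]
      lin_hom_zero[OF Q.module_axioms T.module_axioms tens_lin_left[OF Q Q that(2)]]
      lin_hom_zero[OF Q.module_axioms T.module_axioms tens_lin_right[OF Q Q that(2)]] by auto
  show ?thesis
    unfolding sweedler_relations_def
    using car by (simp add: T.l_distr T.r_distr tc tm t1 eqs vc neg zero[OF car(1)] zero[OF car(2)]
        zero[OF Q.one_closed Q.one_closed] T.M.a_ac T.M.r_neg T.M.l_neg T.M.r_neg1 T.M.r_neg2)
qed

lemma sweedler_relations_opp:
  fixes Q (structure)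
  assumes Q: "unital_algebra K Q" and r: "sweedler_relations Q c v"
  shows "sweedler_relations (opp_alg Q) c (\<ominus> (c \<otimes> v))"
proof -
  interpret Q: unital_algebra K Q by (rule Q)
  have car: "c \<in> carrier Q" "v \<in> carrier Q" and eqs: "c \<otimes> c = \<one>"
    using r by (auto simp: sweedler_relations_def)
  show ?thesis
    unfolding sweedler_relations_def opp_alg_sel
    using car by (simp add: eqs Q.l_minus Q.r_minus sweedler_relations_rules[OF Q r] Q.M.l_neg)
qed

context
  fixes K :: "'k ring" (structure) assumes K: "field K"
begin

interpretation K: field K by (rule K)
interpretation F: unital_algebra K "free_alg K :: ('k, sweedler_gen list \<Rightarrow> 'k) module"
  by (rule free_alg_unital_algebra[OF K_cring[OF K]])

lemma sweedler_gens: "free_gen K (x :: sweedler_gen) \<in> carrier (free_alg K)"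
  by (rule free_gen_closed[OF K_cring[OF K]])

lemma sweedler_ideal_ideal: "ideal (sweedler_ideal K) (free_alg K)"
  unfolding sweedler_ideal_def Let_def
  by (rule F.genideal_ideal) (auto simp: sweedler_gens F.minus_closed)

lemma sweedler_vanish:
  assumes B: "unital_algebra K B" and rel: "sweedler_relations B c v" and n: "n \<in> sweedler_ideal K"
  shows "free_eval K B (sweedler_case c v) n = \<zero>\<^bsub>B\<^esub>"
proof -
  interpret B: unital_algebra K B by (rule B)
  note Kc = K_cring[OF K]
  note g = sweedler_case_closed[OF rel]
  let ?f = "free_eval K B (sweedler_case c v)"
  have f: "?f \<in> alg_hom K (free_alg K) B" by (rule free_eval_alg_hom[OF Kc B g])
  note fl = alg_hom_lin[OF f]
  have fg: "?f (free_gen K x) = sweedler_case c v x" for x by (rule free_eval_gen[OF Kc B g])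
  note fs = lin_hom_minus[OF F.module_axioms B.module_axioms fl] lin_hom_add[OF fl] alg_hom_mult[OF f]
    alg_hom_one[OF f] fg sweedler_case_simps sweedler_gens
  show ?thesis
    by (rule alg_hom_vanish_genideal[OF Kc F.unital_algebra_axioms B f _ _ n[unfolded sweedler_ideal_def Let_def]])
       (use rel in \<open>auto simp: fs sweedler_relations_def F.minus_closed\<close>)
qed

abbreviation (input) "sw_Q \<equiv> quot_alg (free_alg K) (sweedler_ideal K)"
abbreviation (input) "sw_H \<equiv> sweedler_hopf K"
abbreviation (input) "sc \<equiv> sweedler_c K"
abbreviation (input) "sv \<equiv> sweedler_v K"
abbreviation (input) "sw_D \<equiv> sweedler_case (tens K sw_Q sw_Q sc sc)
  (tens K sw_Q sw_Q sc sv \<oplus>\<^bsub>tensor K sw_Q sw_Q\<^esub> tens K sw_Q sw_Q sv \<one>\<^bsub>sw_Q\<^esub>)"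
abbreviation (input) "sw_S \<equiv> sweedler_case sc (\<ominus>\<^bsub>sw_Q\<^esub> (sc \<otimes>\<^bsub>sw_Q\<^esub> sv))"

lemma sweedler_quot_algebra: "unital_algebra K sw_Q"
  by (rule quot_free_unital_algebra[OF K_cring[OF K] sweedler_ideal_ideal])

lemma sweedler_quot_relations: "sweedler_relations sw_Q sc sv"
proof -
  note Fa = F.unital_algebra_axioms and I = sweedler_ideal_ideal
  interpret Q: unital_algebra K sw_Q by (rule sweedler_quot_algebra)
  let ?q = "\<lambda>x. sweedler_ideal K +>\<^bsub>free_alg K\<^esub> x"
  let ?c = "free_gen K Sc" and ?v = "free_gen K Sv"
  note q = quot_map_alg_hom[OF Fa I]
  note ql = alg_hom_lin[OF q]
  note qz = quot_map_zero_iff[OF Fa I]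
  note fs = lin_hom_minus[OF F.module_axioms Q.module_axioms ql] lin_hom_add[OF ql] alg_hom_mult[OF q]
    alg_hom_one[OF q] sweedler_gens
  have gens: "S \<subseteq> carrier (free_alg K)"
    if "S = {?c \<otimes>\<^bsub>free_alg K\<^esub> ?c \<ominus>\<^bsub>free_alg K\<^esub> \<one>\<^bsub>free_alg K\<^esub>, ?v \<otimes>\<^bsub>free_alg K\<^esub> ?v,
      ?v \<otimes>\<^bsub>free_alg K\<^esub> ?c \<oplus>\<^bsub>free_alg K\<^esub> ?c \<otimes>\<^bsub>free_alg K\<^esub> ?v}" for S
    unfolding that by (auto simp: sweedler_gens F.minus_closed)
  note sub = F.genideal_self[OF gens[OF refl], folded sweedler_ideal_def[unfolded Let_def]]
  have r: "?q (?c \<otimes>\<^bsub>free_alg K\<^esub> ?c \<ominus>\<^bsub>free_alg K\<^esub> \<one>\<^bsub>free_alg K\<^esub>) = \<zero>\<^bsub>sw_Q\<^esub>"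
    "?q (?v \<otimes>\<^bsub>free_alg K\<^esub> ?v) = \<zero>\<^bsub>sw_Q\<^esub>"
    "?q (?v \<otimes>\<^bsub>free_alg K\<^esub> ?c \<oplus>\<^bsub>free_alg K\<^esub> ?c \<otimes>\<^bsub>free_alg K\<^esub> ?v) = \<zero>\<^bsub>sw_Q\<^esub>"
    using sub by (simp_all add: qz sweedler_gens F.minus_closed)
  have cl: "sc \<in> carrier sw_Q" "sv \<in> carrier sw_Q"
    unfolding sweedler_c_def sweedler_v_def by (rule quot_gen_closed[OF K_cring[OF K] I])+
  have eqs: "?q ?c = sc" "?q ?v = sv" by (simp_all add: quot_gen_def sweedler_c_def sweedler_v_def)
  have "sc \<otimes>\<^bsub>sw_Q\<^esub> sc = \<one>\<^bsub>sw_Q\<^esub>" "sv \<otimes>\<^bsub>sw_Q\<^esub> sv = \<zero>\<^bsub>sw_Q\<^esub>" "sv \<otimes>\<^bsub>sw_Q\<^esub> sc \<oplus>\<^bsub>sw_Q\<^esub> sc \<otimes>\<^bsub>sw_Q\<^esub> sv = \<zero>\<^bsub>sw_Q\<^esub>"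
    using r cl by (simp_all add: fs eqs)
  then show ?thesis
    unfolding sweedler_relations_def using cl by blast
qed

lemma sweedler_presented:
  "sw_H = presented_hopf K (sweedler_ideal K) sw_D (sweedler_case \<one> \<zero>) sw_S"
  by (simp add: sweedler_hopf_def Let_def sweedler_case_def[abs_def])

lemma sw_D: "sw_D x \<in> carrier (tensor K sw_Q sw_Q)"
    "n \<in> sweedler_ideal K \<Longrightarrow> free_eval K (tensor K sw_Q sw_Q) sw_D n = \<zero>\<^bsub>tensor K sw_Q sw_Q\<^esub>"
  and sw_E: "sweedler_case \<one> \<zero> x \<in> carrier K"
    "n \<in> sweedler_ideal K \<Longrightarrow> free_eval K (base_alg K) (sweedler_case \<one> \<zero>) n = \<zero>"
  and sw_S: "sw_S x \<in> carrier sw_Q"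
    "n \<in> sweedler_ideal K \<Longrightarrow> free_eval K (opp_alg sw_Q) sw_S n = \<zero>\<^bsub>sw_Q\<^esub>"
proof -
  note Kc = K_cring[OF K]
  note Qa = sweedler_quot_algebra
  note D = sweedler_relations_tensor[OF Qa sweedler_quot_relations]
    and S = sweedler_relations_opp[OF Qa sweedler_quot_relations]
  have E: "sweedler_relations (base_alg K) \<one> \<zero>" by (simp add: sweedler_relations_def base_alg_sel)
  show "sw_D x \<in> carrier (tensor K sw_Q sw_Q)" "sweedler_case \<one> \<zero> x \<in> carrier K" "sw_S x \<in> carrier sw_Q"
    using sweedler_case_closed[OF D] sweedler_case_closed[OF E] sweedler_case_closed[OF S]
    by (simp_all add: base_alg_sel opp_alg_sel)
  assume n: "n \<in> sweedler_ideal K"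
  show "free_eval K (tensor K sw_Q sw_Q) sw_D n = \<zero>\<^bsub>tensor K sw_Q sw_Q\<^esub>"
    by (rule sweedler_vanish[OF tensor_unital_algebra[OF Qa Qa] D n])
  show "free_eval K (base_alg K) (sweedler_case \<one> \<zero>) n = \<zero>"
    using sweedler_vanish[OF base_alg_unital_algebra[OF Kc] E n] by (simp add: base_alg_sel)
  show "free_eval K (opp_alg sw_Q) sw_S n = \<zero>\<^bsub>sw_Q\<^esub>"
    using sweedler_vanish[OF opp_alg_unital_algebra[OF Qa] S n] by (simp add: opp_alg_sel)
qed

lemmas sw_data = K_cring[OF K] sweedler_ideal_ideal

lemma sw_tens: "tensor K sw_H sw_H = tensor K sw_Q sw_Q" "tens K sw_H sw_H = tens K sw_Q sw_Q"
  unfolding sweedler_presented by (rule presented_tens[OF sw_data sw_D sw_E sw_S]; assumption?)+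

lemma sw_sel: "carrier sw_H = carrier sw_Q" "monoid.mult sw_H = monoid.mult sw_Q" "one sw_H = one sw_Q"
  "ring.zero sw_H = ring.zero sw_Q" "ring.add sw_H = ring.add sw_Q" "smult sw_H = smult sw_Q"
  unfolding sweedler_presented by (rule presented_sel[OF sw_data sw_D sw_E sw_S]; assumption?)+

lemma sw_values: "comult sw_H (quot_gen K (sweedler_ideal K) x) = sw_D x"
  "counit sw_H (quot_gen K (sweedler_ideal K) x) = sweedler_case \<one> \<zero> x"
  "antipode sw_H (quot_gen K (sweedler_ideal K) x) = sw_S x"
  unfolding sweedler_presented by (rule presented_homs[OF sw_data sw_D sw_E sw_S]; assumption?)+

lemma sw_prehopf: "prehopf K sw_H"
  unfolding sweedler_presented by (rule presented_prehopf[OF sw_data sw_D sw_E sw_S]; assumption?)+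

lemma sweedler_relations_H: "sweedler_relations sw_H sc sv"
  unfolding sweedler_relations_def sw_sel by (rule sweedler_quot_relations[unfolded sweedler_relations_def])

lemma sweedler_values:
  "comult sw_H sc = tens K sw_H sw_H sc sc" "counit sw_H sc = \<one>" "antipode sw_H sc = sc"
  "comult sw_H sv = tens K sw_H sw_H sc sv \<oplus>\<^bsub>tensor K sw_H sw_H\<^esub> tens K sw_H sw_H sv \<one>\<^bsub>sw_H\<^esub>"
  "counit sw_H sv = \<zero>" "antipode sw_H sv = \<ominus>\<^bsub>sw_H\<^esub> (sc \<otimes>\<^bsub>sw_H\<^esub> sv)"
proof -
  have mod: "a_inv sw_Q x = a_inv sw_H x" for x
    by (simp add: a_inv_def m_inv_def sw_sel)
  note v = sw_values[of Sc, folded sweedler_c_def] sw_values[of Sv, folded sweedler_v_def]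
  show "comult sw_H sc = tens K sw_H sw_H sc sc" "counit sw_H sc = \<one>" "antipode sw_H sc = sc"
    "comult sw_H sv = tens K sw_H sw_H sc sv \<oplus>\<^bsub>tensor K sw_H sw_H\<^esub> tens K sw_H sw_H sv \<one>\<^bsub>sw_H\<^esub>"
    "counit sw_H sv = \<zero>" "antipode sw_H sv = \<ominus>\<^bsub>sw_H\<^esub> (sc \<otimes>\<^bsub>sw_H\<^esub> sv)"
    using v unfolding sweedler_case_simps mod sw_tens sw_sel by simp_all
qed

lemma sweedler_hopf_algebra: "hopf_algebra K sw_H"
proof -
  interpret H: prehopf K sw_H by (rule sw_prehopf)
  interpret HH: unital_algebra K "tensor K sw_H sw_H" by (rule H.HH_alg)
  note r = sweedler_relations_H[unfolded sweedler_relations_def]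
  note rr = sweedler_relations_rules[OF H.H_alg sweedler_relations_H]
  note v = sweedler_values
  have car: "sc \<in> carrier sw_H" "sv \<in> carrier sw_H" using r by auto
  have c: "hopf_identities K sw_H sc"
    by (rule H.hopf_identities_grouplike; use r v in simp)
  have "comult sw_H sv = tens K sw_H sw_H sv \<one>\<^bsub>sw_H\<^esub> \<oplus>\<^bsub>tensor K sw_H sw_H\<^esub> tens K sw_H sw_H sc sv"
    unfolding v(4) using car by (intro HH.M.a_comm tens_closed H.H_alg H.one_closed)
  then have h: "hopf_identities K sw_H sv"
    by (rule H.hopf_identities_skew_primitive[of "\<one>\<^bsub>sw_H\<^esub>" sc sv, rotated 7])
       (use car v(1-3,5,6) in \<open>simp_all add: H.counit_one H.antipode_one alg_hom_one[OF H.comult_hom]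
          tensor_one[OF H.H_alg H.H_alg] H.r_minus rr H.M.l_neg H.M.r_neg\<close>)
  have gen: "hopf_identities K sw_H (quot_gen K (sweedler_ideal K) x)" for x
    using c h by (cases x) (simp_all add: sweedler_c_def sweedler_v_def)
  show ?thesis
    using presented_hopf_algebra[OF sw_data sw_D sw_E sw_S] gen unfolding sweedler_presented[symmetric] by blast
qed

lemma sweedler_hom_exists:
  assumes B: "unital_algebra K B" and r: "sweedler_relations B c v"
  obtains \<phi> where "\<phi> \<in> alg_hom K sw_H B" "\<phi> sc = c" "\<phi> sv = v"
proof -
  have t: "module.truncate sw_H = module.truncate sw_Q"
    unfolding sweedler_presented by (rule presented_hopf_sel)
  note e = quot_free_eval[OF sw_data B sweedler_case_closed[OF r] sweedler_vanish[OF B r]]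
  show ?thesis
  proof (rule that)
    show "(\<lambda>Y. the_elem (free_eval K B (sweedler_case c v) ` Y)) \<in> alg_hom K sw_H B"
      unfolding lin_hom_truncate(2)[OF t refl] by (rule e(1)) assumption
    show "the_elem (free_eval K B (sweedler_case c v) ` sc) = c"
      "the_elem (free_eval K B (sweedler_case c v) ` sv) = v"
      unfolding sweedler_c_def sweedler_v_def by (subst e(2); simp add: sweedler_case_simps)+
  qed
qed

lemma two_not_zero:
  assumes "ring_char K \<noteq> 2" shows "\<one> \<oplus> \<one> \<noteq> \<zero>"
proof
  assume z: "\<one> \<oplus> \<one> = \<zero>"
  note id = group.pow_eq_id[OF K.a_group, of "\<one>"]
  let ?n = "group.ord (add_monoid K) \<one>"
  have "\<one> [^]\<^bsub>add_monoid K\<^esub> (2::nat) = \<zero>" using z by (simp add: numeral_2_eq_2 nat_pow_def)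
  then have "?n dvd 2" using id[of 2] by simp
  moreover have "?n \<noteq> 1"
  proof
    assume "?n = 1"
    then have "\<one> [^]\<^bsub>add_monoid K\<^esub> (1::nat) = \<zero>" using id[of 1] by simp
    then show False by (simp add: nat_pow_def)
  qed
  ultimately have "?n = 2" by (metis One_nat_def prime_nat_iff two_is_prime_nat)
  then show False using assms by (simp add: ring_char_def)
qed

lemma half:
  assumes "ring_char K \<noteq> 2"
  shows "inv (\<one> \<oplus> \<one>) \<in> carrier K"
    and "a \<in> carrier K \<Longrightarrow> inv (\<one> \<oplus> \<one>) \<otimes> (a \<oplus> a) = a"
proof -
  have u: "\<one> \<oplus> \<one> \<in> Units K" using two_not_zero[OF assms] by (simp add: K.field_Units)
  then show i: "inv (\<one> \<oplus> \<one>) \<in> carrier K" by simp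
  show "inv (\<one> \<oplus> \<one>) \<otimes> (a \<oplus> a) = a" if a: "a \<in> carrier K"
  proof -
    have "a \<oplus> a = (\<one> \<oplus> \<one>) \<otimes> a" using a by (simp add: K.l_distr)
    then show ?thesis using a i u by (simp add: K.m_assoc[symmetric])
  qed
qed

lemma smult_half:
  assumes M: "module K M" and ch: "ring_char K \<noteq> 2" and x: "x \<in> carrier M"
  shows "inv (\<one> \<oplus> \<one>) \<odot>\<^bsub>M\<^esub> (x \<oplus>\<^bsub>M\<^esub> x) = x"
proof -
  interpret M: module K M by (rule M)
  have "x \<oplus>\<^bsub>M\<^esub> x = (\<one> \<oplus> \<one>) \<odot>\<^bsub>M\<^esub> x" using x by (simp add: M.smult_l_distr)
  then show ?thesis
    using half(1)[OF ch] half(2)[OF ch K.one_closed] x by (simp add: M.smult_assoc1[symmetric])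
qed

interpretation H: hopf_algebra K sw_H by (rule sweedler_hopf_algebra)

abbreviation (input) "sww \<equiv> sc \<otimes>\<^bsub>sw_H\<^esub> sv"
abbreviation (input) "swy \<equiv> \<one>\<^bsub>sw_H\<^esub> \<oplus>\<^bsub>sw_H\<^esub> (\<ominus>\<^bsub>sw_H\<^esub> sc \<oplus>\<^bsub>sw_H\<^esub> sww)"
abbreviation (input) "swhalf \<equiv> inv (\<one> \<oplus> \<one>)"
abbreviation (input) "swh \<equiv> swhalf \<odot>\<^bsub>sw_H\<^esub> swy"

lemma sweedler_closed: "sc \<in> carrier sw_H" "sv \<in> carrier sw_H" "sww \<in> carrier sw_H"
  using sweedler_relations_H by (auto simp: sweedler_relations_def)

text \<open>For \<open>y = 1 - c + cv\<close> these are the relations of \<open>h = y/2\<close>, before division by \<open>2\<close>.\<close>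

lemma sweedler_y_square: "swy \<otimes>\<^bsub>sw_H\<^esub> swy = swy \<oplus>\<^bsub>sw_H\<^esub> swy"
  and sweedler_y_c: "swy \<otimes>\<^bsub>sw_H\<^esub> sc \<oplus>\<^bsub>sw_H\<^esub> sc \<otimes>\<^bsub>sw_H\<^esub> swy = (sc \<ominus>\<^bsub>sw_H\<^esub> \<one>\<^bsub>sw_H\<^esub>) \<oplus>\<^bsub>sw_H\<^esub> (sc \<ominus>\<^bsub>sw_H\<^esub> \<one>\<^bsub>sw_H\<^esub>)"
proof -
  note r = sweedler_relations_rules[OF H.unital_algebra_axioms sweedler_relations_H]
  have cc: "sc \<otimes>\<^bsub>sw_H\<^esub> sc = \<one>\<^bsub>sw_H\<^esub>" using sweedler_relations_H by (auto simp: sweedler_relations_def)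
  note cl = sweedler_closed
  have cy: "sc \<otimes>\<^bsub>sw_H\<^esub> swy = sc \<oplus>\<^bsub>sw_H\<^esub> (\<ominus>\<^bsub>sw_H\<^esub> \<one>\<^bsub>sw_H\<^esub> \<oplus>\<^bsub>sw_H\<^esub> sv)"
    using cl by (simp add: H.r_distr H.r_minus cc r)
  have yc: "swy \<otimes>\<^bsub>sw_H\<^esub> sc = sc \<oplus>\<^bsub>sw_H\<^esub> (\<ominus>\<^bsub>sw_H\<^esub> \<one>\<^bsub>sw_H\<^esub> \<oplus>\<^bsub>sw_H\<^esub> \<ominus>\<^bsub>sw_H\<^esub> sv)"
    using cl by (simp add: H.l_distr H.l_minus cc r)
  have wy: "sww \<otimes>\<^bsub>sw_H\<^esub> swy = sww \<oplus>\<^bsub>sw_H\<^esub> sv"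
    using cl by (simp add: H.r_distr H.r_minus r)
  have "swy \<otimes>\<^bsub>sw_H\<^esub> swy = swy \<oplus>\<^bsub>sw_H\<^esub> (\<ominus>\<^bsub>sw_H\<^esub> (sc \<otimes>\<^bsub>sw_H\<^esub> swy) \<oplus>\<^bsub>sw_H\<^esub> sww \<otimes>\<^bsub>sw_H\<^esub> swy)"
    using cl by (simp only: H.l_distr H.l_minus H.l_one H.M.a_closed H.M.a_inv_closed H.one_closed)
  also have "\<ominus>\<^bsub>sw_H\<^esub> (sc \<otimes>\<^bsub>sw_H\<^esub> swy) \<oplus>\<^bsub>sw_H\<^esub> sww \<otimes>\<^bsub>sw_H\<^esub> swy = swy"
    unfolding cy wy using cl
    by (simp add: H.M.minus_add H.M.a_ac H.M.a_lcomm[of sww "\<ominus>\<^bsub>sw_H\<^esub> sv" sv] H.M.l_neg H.M.r_neg H.M.r_neg1 H.M.r_neg2)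
  finally show "swy \<otimes>\<^bsub>sw_H\<^esub> swy = swy \<oplus>\<^bsub>sw_H\<^esub> swy" .
  show "swy \<otimes>\<^bsub>sw_H\<^esub> sc \<oplus>\<^bsub>sw_H\<^esub> sc \<otimes>\<^bsub>sw_H\<^esub> swy = (sc \<ominus>\<^bsub>sw_H\<^esub> \<one>\<^bsub>sw_H\<^esub>) \<oplus>\<^bsub>sw_H\<^esub> (sc \<ominus>\<^bsub>sw_H\<^esub> \<one>\<^bsub>sw_H\<^esub>)"
    unfolding cy yc using cl by (simp add: a_minus_def H.M.a_ac H.M.r_neg H.M.r_neg1 H.M.r_neg2 H.M.l_neg)
qed

context
  assumes char: "ring_char K \<noteq> 2"
begin

lemma sweedler_h_closed: "swh \<in> carrier sw_H"
  using sweedler_closed half(1)[OF char] by simp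

text \<open>
  Since \<open>2e = 1 + (1, -1)\<close>, the equation \<open>\<rho>(1, -1) = (1, -1) \<otimes> c + (1, 1) \<otimes> cv\<close> amounts to
  \<open>\<rho>(e) = 1 \<otimes> h + e \<otimes> c\<close> with \<open>h = 1/2 (1 - c + cv)\<close>.
\<close>

lemma sweedler_coaction_pair: "coaction_pair K sw_H swh sc"
proof -
  note cl = sweedler_closed and s = half(1)[OF char]
  note Ha = H.unital_algebra_axioms
  interpret T: unital_algebra K "tensor K sw_H sw_H" by (rule tensor_unital_algebra[OF Ha Ha])
  have yc: "swy \<in> carrier sw_H" using cl by simp
  have cc: "sc \<otimes>\<^bsub>sw_H\<^esub> sc = \<one>\<^bsub>sw_H\<^esub>" using sweedler_relations_H by (auto simp: sweedler_relations_def)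
  have hh: "swh \<otimes>\<^bsub>sw_H\<^esub> swh = swh"
    using s yc by (simp only: H.smult_mult_left H.smult_mult_right H.smult_closed sweedler_y_square
        smult_half[OF H.module_axioms char])
  have "swh \<otimes>\<^bsub>sw_H\<^esub> sc \<oplus>\<^bsub>sw_H\<^esub> sc \<otimes>\<^bsub>sw_H\<^esub> swh = swhalf \<odot>\<^bsub>sw_H\<^esub> (swy \<otimes>\<^bsub>sw_H\<^esub> sc \<oplus>\<^bsub>sw_H\<^esub> sc \<otimes>\<^bsub>sw_H\<^esub> swy)"
    using s yc cl by (simp only: H.smult_mult_left H.smult_mult_right H.smult_r_distr H.m_closed)
  also have "\<dots> = sc \<ominus>\<^bsub>sw_H\<^esub> \<one>\<^bsub>sw_H\<^esub>"
    unfolding sweedler_y_c using cl by (intro smult_half[OF H.module_axioms char]) simp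
  finally have rel: "swh \<otimes>\<^bsub>sw_H\<^esub> sc \<oplus>\<^bsub>sw_H\<^esub> sc \<otimes>\<^bsub>sw_H\<^esub> swh \<oplus>\<^bsub>sw_H\<^esub> sc \<otimes>\<^bsub>sw_H\<^esub> sc = sc"
    unfolding cc using cl by (simp add: a_minus_def H.M.a_assoc H.M.l_neg)
  let ?t = "tens K sw_H sw_H" and ?a = "ring.add (tensor K sw_H sw_H)" and ?n = "a_inv (tensor K sw_H sw_H)"
  note tc = tens_closed[OF Ha Ha] and tm = tens_mult[OF Ha Ha]
  note D = alg_hom_lin[OF H.comult_hom]
  note v = sweedler_values
  have Dw: "comult sw_H sww = ?a (?t \<one>\<^bsub>sw_H\<^esub> sww) (?t sww sc)"
    using cl by (simp add: alg_hom_mult[OF H.comult_hom] v tm tc T.r_distr cc)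
  have Dy: "comult sw_H swy = ?a (?t \<one>\<^bsub>sw_H\<^esub> \<one>\<^bsub>sw_H\<^esub>) (?a (?n (?t sc sc)) (?a (?t \<one>\<^bsub>sw_H\<^esub> sww) (?t sww sc)))"
    using cl by (simp only: lin_hom_add[OF D] lin_hom_neg[OF H.module_axioms T.module_axioms D] Dw v
        alg_hom_one[OF H.comult_hom] tensor_one[OF Ha Ha] H.M.a_closed H.M.a_inv_closed H.one_closed)
  have yl: "?t swy sc = ?a (?t \<one>\<^bsub>sw_H\<^esub> sc) (?a (?n (?t sc sc)) (?t sww sc))"
    using cl by (simp only: lin_hom_add[OF tens_lin_left[OF Ha Ha cl(1)]]
        lin_hom_neg[OF H.module_axioms T.module_axioms tens_lin_left[OF Ha Ha cl(1)]]
        H.M.a_closed H.M.a_inv_closed H.one_closed)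
  have yr: "?t \<one>\<^bsub>sw_H\<^esub> swy = ?a (?t \<one>\<^bsub>sw_H\<^esub> \<one>\<^bsub>sw_H\<^esub>) (?a (?n (?t \<one>\<^bsub>sw_H\<^esub> sc)) (?t \<one>\<^bsub>sw_H\<^esub> sww))"
    using cl by (simp only: lin_hom_add[OF tens_lin_right[OF Ha Ha H.one_closed]]
        lin_hom_neg[OF H.module_axioms T.module_axioms tens_lin_right[OF Ha Ha H.one_closed]]
        H.M.a_closed H.M.a_inv_closed H.one_closed)
  have cancel: "?a p (?a q (?a x y)) = ?a (?a z (?a q y)) (?a p (?a (?n z) x))"
    if "p \<in> carrier (tensor K sw_H sw_H)" "q \<in> carrier (tensor K sw_H sw_H)" "x \<in> carrier (tensor K sw_H sw_H)"
      "y \<in> carrier (tensor K sw_H sw_H)" "z \<in> carrier (tensor K sw_H sw_H)" for p q x y z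
  proof -
    have "?a (?a z (?a q y)) (?a p (?a (?n z) x)) = ?a (?a z (?n z)) (?a p (?a q (?a x y)))"
      using that by (simp only: T.M.a_ac T.M.a_closed T.M.a_inv_closed)
    then show ?thesis using that by (simp add: T.M.r_neg)
  qed
  have Dy': "comult sw_H swy = ?a (?t swy sc) (?t \<one>\<^bsub>sw_H\<^esub> swy)"
    unfolding Dy yl yr using cl by (intro cancel tc T.M.a_inv_closed H.one_closed)
  have "comult sw_H swh = ?a (?t swh sc) (?t \<one>\<^bsub>sw_H\<^esub> swh)"
    using cl yc s by (simp only: lin_hom_smult[OF D] Dy' T.smult_r_distr tc H.one_closed
        lin_hom_smult[OF tens_lin_left[OF Ha Ha cl(1)]] lin_hom_smult[OF tens_lin_right[OF Ha Ha H.one_closed]])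
  moreover have "counit sw_H swh = \<zero>"
  proof -
    note E = alg_hom_lin[OF H.counit_hom]
    note B = unital_algebra_module[OF base_alg_unital_algebra[OF K_cring[OF K]]]
    have n: "a_inv (base_alg K) = a_inv K" by (simp add: fun_eq_iff a_inv_def m_inv_def base_alg_sel)
    have "counit sw_H sww = \<zero>"
      using cl by (simp add: alg_hom_mult[OF H.counit_hom] v base_alg_sel)
    then have "counit sw_H swy = \<zero>"
      using cl alg_hom_one[OF H.counit_hom]
      by (simp add: lin_hom_add[OF E] lin_hom_neg[OF H.module_axioms B E] v base_alg_sel n K.r_neg)
    then show ?thesis using yc s by (simp only: lin_hom_smult[OF E] base_alg_sel K.r_null)
  qed
  ultimately show ?thesis
    using hh rel sweedler_h_closed cl v by (simp add: coaction_pair_def[OF K_cring[OF K]])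
qed

lemma rho3b_f_kxk_tens: "rho3b_f K = kxk_tens K sw_H (\<ominus>\<^bsub>sw_H\<^esub> sc \<oplus>\<^bsub>sw_H\<^esub> sww) (sc \<oplus>\<^bsub>sw_H\<^esub> sc)"
proof -
  note cl = sweedler_closed and Kc = K_cring[OF K] and Ha = H.unital_algebra_axioms
  have 1: "tens K (kxk K) sw_H (\<one>, \<ominus> \<one>) sc = kxk_tens K sw_H (\<ominus>\<^bsub>sw_H\<^esub> sc) (sc \<oplus>\<^bsub>sw_H\<^esub> sc)"
    using cl by (subst tens_kxk[OF Kc Ha]) (simp_all add: kxk_sel a_minus_def H.smult_l_minus H.smult_l_distr)
  have 2: "tens K (kxk K) sw_H (\<one>, \<one>) sww = kxk_tens K sw_H sww \<zero>\<^bsub>sw_H\<^esub>"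
    using cl by (subst tens_kxk[OF Kc Ha]) (simp_all add: kxk_sel a_minus_def K.r_neg)
  show ?thesis
    unfolding rho3b_f_def 1 2 using cl by (subst kxk_tens_add[OF Kc Ha]) simp_all
qed

lemma rho3b_ext:
  assumes p: "p \<in> carrier (kxk K)"
  shows "rho3b K p = unital_ext K sw_H (kxk_tens K sw_H swh sc) p"
proof -
  note cl = sweedler_closed and Kc = K_cring[OF K] and Ha = H.unital_algebra_axioms and s = half[OF char]
  have c: "fst p \<in> carrier K" "snd p \<in> carrier K" using p by (auto simp: kxk_sel)
  let ?q = "fst p \<ominus> snd p" and ?z = "\<ominus>\<^bsub>sw_H\<^esub> sc \<oplus>\<^bsub>sw_H\<^esub> sww"
  have q: "?q \<in> carrier K" and z: "?z \<in> carrier sw_H" using c cl by auto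
  note kt = kxk_tens_smult[OF Kc Ha] kxk_tens_add[OF Kc Ha] kxk_tens_one[OF Kc Ha]
  have L: "rho3b K p = kxk_tens K sw_H
      ((swhalf \<otimes> (fst p \<oplus> snd p)) \<odot>\<^bsub>sw_H\<^esub> \<one>\<^bsub>sw_H\<^esub> \<oplus>\<^bsub>sw_H\<^esub> (swhalf \<otimes> ?q) \<odot>\<^bsub>sw_H\<^esub> ?z)
      ((swhalf \<otimes> (fst p \<oplus> snd p)) \<odot>\<^bsub>sw_H\<^esub> \<zero>\<^bsub>sw_H\<^esub> \<oplus>\<^bsub>sw_H\<^esub> (swhalf \<otimes> ?q) \<odot>\<^bsub>sw_H\<^esub> (sc \<oplus>\<^bsub>sw_H\<^esub> sc))"
    unfolding rho3b_def Let_def rho3b_f_kxk_tens using c q s(1) cl z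
    by (simp only: kt K.m_closed K.a_closed H.one_closed H.zero_closed H.M.a_closed H.smult_closed H.M.a_inv_closed)
  have R: "unital_ext K sw_H (kxk_tens K sw_H swh sc) p = kxk_tens K sw_H
      (snd p \<odot>\<^bsub>sw_H\<^esub> \<one>\<^bsub>sw_H\<^esub> \<oplus>\<^bsub>sw_H\<^esub> ?q \<odot>\<^bsub>sw_H\<^esub> swh) (snd p \<odot>\<^bsub>sw_H\<^esub> \<zero>\<^bsub>sw_H\<^esub> \<oplus>\<^bsub>sw_H\<^esub> ?q \<odot>\<^bsub>sw_H\<^esub> sc)"
    unfolding unital_ext_def Let_def using c q cl sweedler_h_closed
    by (simp only: kt H.one_closed H.zero_closed H.smult_closed)
  have 1: "(swhalf \<otimes> (fst p \<oplus> snd p)) \<odot>\<^bsub>sw_H\<^esub> \<one>\<^bsub>sw_H\<^esub> \<oplus>\<^bsub>sw_H\<^esub> (swhalf \<otimes> ?q) \<odot>\<^bsub>sw_H\<^esub> ?z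
      = snd p \<odot>\<^bsub>sw_H\<^esub> \<one>\<^bsub>sw_H\<^esub> \<oplus>\<^bsub>sw_H\<^esub> ?q \<odot>\<^bsub>sw_H\<^esub> swh"
  proof -
    have "fst p \<oplus> snd p = (snd p \<oplus> snd p) \<oplus> ?q"
      using c by (simp add: a_minus_def K.a_ac K.r_neg)
    then have "swhalf \<otimes> (fst p \<oplus> snd p) = snd p \<oplus> swhalf \<otimes> ?q"
      using c q s by (simp only: K.r_distr s K.a_closed)
    moreover have "?q \<odot>\<^bsub>sw_H\<^esub> swh = (swhalf \<otimes> ?q) \<odot>\<^bsub>sw_H\<^esub> \<one>\<^bsub>sw_H\<^esub> \<oplus>\<^bsub>sw_H\<^esub> (swhalf \<otimes> ?q) \<odot>\<^bsub>sw_H\<^esub> ?z"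
      using q s(1) cl by (simp add: K.m_comm[of swhalf ?q] H.smult_assoc1 H.smult_r_distr)
    ultimately show ?thesis
      using c q s(1) z by (simp only: H.smult_l_distr H.M.a_assoc K.m_closed H.one_closed H.smult_closed)
  qed
  have 2: "(swhalf \<otimes> (fst p \<oplus> snd p)) \<odot>\<^bsub>sw_H\<^esub> \<zero>\<^bsub>sw_H\<^esub> \<oplus>\<^bsub>sw_H\<^esub> (swhalf \<otimes> ?q) \<odot>\<^bsub>sw_H\<^esub> (sc \<oplus>\<^bsub>sw_H\<^esub> sc)
      = snd p \<odot>\<^bsub>sw_H\<^esub> \<zero>\<^bsub>sw_H\<^esub> \<oplus>\<^bsub>sw_H\<^esub> ?q \<odot>\<^bsub>sw_H\<^esub> sc"
    using c q s(1) cl smult_half[OF H.module_axioms char cl(1)]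
    by (simp add: K.m_comm[of swhalf ?q] H.smult_assoc1)
  show ?thesis unfolding L R 1 2 ..
qed

lemma rho3b_coaction: "hopf_coaction K (kxk K) sw_H (rho3b K)"
  by (rule hopf_coaction_cong[OF coaction_pair_coaction[OF K_cring[OF K] sweedler_hopf_algebra
        sweedler_coaction_pair]]) (rule rho3b_ext[symmetric])

lemma rho3b_value: "rho3b K (\<one>, \<ominus> \<one>) = rho3b_f K"
proof -
  note cl = sweedler_closed and Kc = K_cring[OF K] and Ha = H.unital_algebra_axioms and s = half[OF char]
  interpret A: unital_algebra K "kxk K" by (rule kxk_unital_algebra[OF Kc])
  interpret T: unital_algebra K "tensor K (kxk K) sw_H" by (rule tensor_unital_algebra[OF A.unital_algebra_axioms Ha])
  have f: "rho3b_f K \<in> carrier (tensor K (kxk K) sw_H)"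
    unfolding rho3b_f_kxk_tens using cl by (intro kxk_tens_closed[OF Kc Ha]) auto
  show ?thesis
    unfolding rho3b_def Let_def using f s(1) s(2)[OF K.one_closed] by (simp add: K.r_neg a_minus_def)
qed

text \<open>
  With \<open>v\<close> represented by \<open>1 \<mapsto> 0\<close>, \<open>e \<mapsto> 1\<close>, the element \<open>1/2 (1 - c + cv)\<close> acts as \<open>1 \<mapsto> 0\<close>, \<open>e \<mapsto> e\<close>.
\<close>

lemma cosupp_rho3b: "cosupp K (kxk K) sw_H (rho3b K) = triangular_ops K"
proof -
  interpret A: unital_algebra K "kxk K" by (rule kxk_unital_algebra[OF K_cring[OF K]])
  note E = End_alg_unital_algebra[OF A.module_axioms]
  interpret E: unital_algebra K "End_alg K (kxk K)" by (rule E)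
  let ?c = "kxk_op K \<one> \<one> (\<ominus> \<one>)" and ?v = "kxk_op K \<zero> \<one> \<zero>"
  note ops = kxk_op_closed[OF K] kxk_op_add[OF K] kxk_op_mult[OF K] kxk_op_one[OF K] kxk_op_zero[OF K]
    kxk_op_smult[OF K]
  have "sweedler_relations (End_alg K (kxk K)) ?c ?v"
    by (simp add: sweedler_relations_def ops K.l_minus K.r_minus K.r_neg K.l_neg)
  then obtain \<phi> where \<phi>: "\<phi> \<in> alg_hom K sw_H (End_alg K (kxk K))" "\<phi> sc = ?c" "\<phi> sv = ?v"
    by (rule sweedler_hom_exists[OF E])
  note cl = sweedler_closed and s = half[OF char]
  have neg: "\<ominus>\<^bsub>End_alg K (kxk K)\<^esub> ?c = kxk_op K (\<ominus> \<one>) (\<ominus> \<one>) \<one>"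
    by (intro E.M.minus_equality) (simp_all add: ops K.l_neg K.r_neg)
  note \<phi>l = alg_hom_lin[OF \<phi>(1)]
  have "\<phi> swh = swhalf \<odot>\<^bsub>End_alg K (kxk K)\<^esub> (\<one>\<^bsub>End_alg K (kxk K)\<^esub> \<oplus>\<^bsub>End_alg K (kxk K)\<^esub>
      (\<ominus>\<^bsub>End_alg K (kxk K)\<^esub> ?c \<oplus>\<^bsub>End_alg K (kxk K)\<^esub> ?c \<otimes>\<^bsub>End_alg K (kxk K)\<^esub> ?v))"
    using cl s(1) by (simp only: lin_hom_smult[OF \<phi>l] lin_hom_add[OF \<phi>l] alg_hom_one[OF \<phi>(1)] alg_hom_mult[OF \<phi>(1)]
        lin_hom_neg[OF H.module_axioms E.module_axioms \<phi>l] \<phi> H.M.a_closed H.M.a_inv_closed H.one_closed)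
  also have "\<dots> = kxk_op K \<zero> \<zero> \<one>"
    using s(1) s(2)[OF K.one_closed] by (simp add: neg ops K.r_neg K.l_neg)
  finally have h: "\<phi> swh = kxk_op K \<zero> \<zero> \<one>" .
  show ?thesis
    by (rule cosupp_triangular_of_hom[OF K sweedler_hopf_algebra sweedler_coaction_pair rho3b_ext \<phi>(1) h \<phi>(2)])
qed

end

end


section \<open>The dual of the group algebra of \<open>C\<^sub>2\<close>\<close>

lemma unital_algebra_transport:
  assumes A: "unital_algebra K A" and f: "bij_betw f (carrier A) (carrier B)"
    and add: "\<And>x y. \<lbrakk>x \<in> carrier A; y \<in> carrier A\<rbrakk> \<Longrightarrow> f (x \<oplus>\<^bsub>A\<^esub> y) = f x \<oplus>\<^bsub>B\<^esub> f y"
    and mult: "\<And>x y. \<lbrakk>x \<in> carrier A; y \<in> carrier A\<rbrakk> \<Longrightarrow> f (x \<otimes>\<^bsub>A\<^esub> y) = f x \<otimes>\<^bsub>B\<^esub> f y"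
    and smult: "\<And>a x. \<lbrakk>a \<in> carrier K; x \<in> carrier A\<rbrakk> \<Longrightarrow> f (a \<odot>\<^bsub>A\<^esub> x) = a \<odot>\<^bsub>B\<^esub> f x"
    and one: "f \<one>\<^bsub>A\<^esub> = \<one>\<^bsub>B\<^esub>" and zero: "f \<zero>\<^bsub>A\<^esub> = \<zero>\<^bsub>B\<^esub>"
  shows "unital_algebra K B"
proof -
  interpret A: unital_algebra K A by (rule A)
  have B: "carrier B = f ` carrier A" using f by (simp add: bij_betw_def)
  have neg: "\<exists>y\<in>carrier A. f (x \<oplus>\<^bsub>A\<^esub> y) = f \<zero>\<^bsub>A\<^esub>" if "x \<in> carrier A" for x
    using that by (intro bexI[of _ "\<ominus>\<^bsub>A\<^esub> x"]) (simp_all add: A.M.r_neg)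
  note s = add[symmetric] mult[symmetric] smult[symmetric] one[symmetric] zero[symmetric]
  show ?thesis
    by (rule unital_algebraI[OF unital_algebra_cring[OF A]])
       (auto simp: B s A.M.a_ac A.m_assoc A.l_distr A.r_distr A.smult_l_distr A.smult_r_distr
          A.smult_assoc1 A.smult_mult_left A.smult_mult_right neg)
qed

context
  fixes K :: "'k ring" (structure) assumes K: "field K"
begin

interpretation K: field K by (rule K)

abbreviation (input) "C2 \<equiv> integer_mod_group 2"
abbreviation (input) "kB \<equiv> monoid_alg K C2"
abbreviation (input) "kD \<equiv> kC2_dual K"

lemma C2_sel: "carrier C2 = {0, 1}" "x \<otimes>\<^bsub>C2\<^esub> y = (x + y) mod 2" "\<one>\<^bsub>C2\<^esub> = 0"
  by (auto simp: carrier_integer_mod_group mult_integer_mod_group one_integer_mod_group)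

lemma C2_monoid: "monoid C2"
  using group_integer_mod_group[of 2] by (rule group.is_monoid)

interpretation B: unital_algebra K kB by (rule monoid_alg_unital_algebra[OF K_cring[OF K] C2_monoid])

lemmas kB_rules = monoid_alg_carrier_iff[OF K_cring[OF K] C2_monoid]
  monoid_alg_add_apply[OF K_cring[OF K] C2_monoid] monoid_alg_smult_apply[OF K_cring[OF K] C2_monoid]

lemma kC2_truncate: "module.truncate (kC2 K) = module.truncate kB"
  by (simp add: kC2_def group_hopf_def Let_def module.defs hopf.defs)

lemma kC2_sel: "carrier (kC2 K) = carrier kB" "monoid.mult (kC2 K) = monoid.mult kB" "one (kC2 K) = one kB"
  using kC2_truncate unfolding truncate_eq_iff by simp_all

lemma kD_sel: "carrier kD = lin_hom K (kC2 K) (base_alg K) \<inter> extensional (carrier kB)"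
  "f \<otimes>\<^bsub>kD\<^esub> g = (\<lambda>x\<in>carrier kB. tlift K (base_alg K) (\<lambda>y z. f y \<otimes> g z) (comult (kC2 K) x))"
  "\<one>\<^bsub>kD\<^esub> = restrict (counit (kC2 K)) (carrier kB)" "\<zero>\<^bsub>kD\<^esub> = (\<lambda>x\<in>carrier kB. \<zero>)"
  "f \<oplus>\<^bsub>kD\<^esub> g = (\<lambda>x\<in>carrier kB. f x \<oplus> g x)" "a \<odot>\<^bsub>kD\<^esub> f = (\<lambda>x\<in>carrier kB. a \<otimes> f x)"
  "comult kD f = (THE T. T \<in> carrier (tensor K kD kD) \<and> (\<forall>x\<in>carrier kB. \<forall>y\<in>carrier kB.
      tlift K (base_alg K) (\<lambda>g g'. g x \<otimes> g' y) T = f (x \<otimes>\<^bsub>kB\<^esub> y)))"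
  "counit kD f = f \<one>\<^bsub>kB\<^esub>" "antipode kD f = (\<lambda>x\<in>carrier kB. f (antipode (kC2 K) x))"
proof -
  let ?D = "dual_alg K (kC2 K)"
  have t: "module.truncate kD = module.truncate ?D"
    by (simp add: kC2_dual_def dual_hopf_def Let_def module.defs hopf.defs)
  note tens = tens_cong[OF t t]
  have s: "carrier kD = carrier ?D" "monoid.mult kD = monoid.mult ?D" "one kD = one ?D"
    "ring.zero kD = ring.zero ?D" "ring.add kD = ring.add ?D" "smult kD = smult ?D"
    using t unfolding truncate_eq_iff by simp_all
  show "carrier kD = lin_hom K (kC2 K) (base_alg K) \<inter> extensional (carrier kB)"
    "f \<otimes>\<^bsub>kD\<^esub> g = (\<lambda>x\<in>carrier kB. tlift K (base_alg K) (\<lambda>y z. f y \<otimes> g z) (comult (kC2 K) x))"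
    "\<one>\<^bsub>kD\<^esub> = restrict (counit (kC2 K)) (carrier kB)" "\<zero>\<^bsub>kD\<^esub> = (\<lambda>x\<in>carrier kB. \<zero>)"
    "f \<oplus>\<^bsub>kD\<^esub> g = (\<lambda>x\<in>carrier kB. f x \<oplus> g x)" "a \<odot>\<^bsub>kD\<^esub> f = (\<lambda>x\<in>carrier kB. a \<otimes> f x)"
    unfolding s by (simp_all add: dual_alg_def kC2_sel)
  show "comult kD f = (THE T. T \<in> carrier (tensor K kD kD) \<and> (\<forall>x\<in>carrier kB. \<forall>y\<in>carrier kB.
      tlift K (base_alg K) (\<lambda>g g'. g x \<otimes> g' y) T = f (x \<otimes>\<^bsub>kB\<^esub> y)))"
    "counit kD f = f \<one>\<^bsub>kB\<^esub>" "antipode kD f = (\<lambda>x\<in>carrier kB. f (antipode (kC2 K) x))"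
    unfolding tens by (simp_all add: kC2_dual_def dual_hopf_def Let_def module.defs hopf.defs kC2_sel)
qed

text \<open>The functional with the values \<open>a\<close> and \<open>b\<close> at the two group elements.\<close>

definition dual_pair :: "'k \<Rightarrow> 'k \<Rightarrow> (int \<Rightarrow> 'k) \<Rightarrow> 'k"
  where "dual_pair a b = (\<lambda>x\<in>carrier kB. a \<otimes> x 0 \<oplus> b \<otimes> x 1)"

abbreviation (input) "bas i \<equiv> basis_elt K (i::int)"

lemma kB_coeff: "x \<in> carrier kB \<Longrightarrow> x i \<in> carrier K"
  by (simp add: kB_rules)

lemma kB_supp: "x \<in> carrier kB \<Longrightarrow> supp K x \<subseteq> {0, 1}"
  by (simp add: kB_rules C2_sel)

lemma bas_closed: "bas 0 \<in> carrier kB" "bas 1 \<in> carrier kB"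
  by (rule basis_elt_carrier[OF K_cring[OF K] C2_monoid]; simp add: C2_sel)+

lemma kB_lin_ext:
  assumes N: "module K N" and \<phi>: "\<phi> 0 \<in> carrier N" "\<phi> 1 \<in> carrier N" and x: "x \<in> carrier kB"
  shows "lin_ext K N \<phi> x = x 0 \<odot>\<^bsub>N\<^esub> \<phi> 0 \<oplus>\<^bsub>N\<^esub> x 1 \<odot>\<^bsub>N\<^esub> \<phi> 1"
proof -
  interpret N: module K N by (rule N)
  have "lin_ext K N \<phi> x = (\<Oplus>\<^bsub>N\<^esub>i\<in>{0,1}. x i \<odot>\<^bsub>N\<^esub> \<phi> i)"
    by (rule lin_ext_eq[OF K_cring[OF K] C2_monoid N _ x])
       (use \<phi> kB_supp[OF x] in \<open>auto simp: C2_sel\<close>)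
  also have "\<dots> = x 0 \<odot>\<^bsub>N\<^esub> \<phi> 0 \<oplus>\<^bsub>N\<^esub> x 1 \<odot>\<^bsub>N\<^esub> \<phi> 1"
    using \<phi> x kB_coeff[OF x] by simp
  finally show ?thesis .
qed

lemma kB_mult_coeff:
  assumes x: "x \<in> carrier kB" and y: "y \<in> carrier kB"
  shows "(x \<otimes>\<^bsub>kB\<^esub> y) 0 = x 0 \<otimes> y 0 \<oplus> x 1 \<otimes> y 1"
    and "(x \<otimes>\<^bsub>kB\<^esub> y) 1 = x 0 \<otimes> y 1 \<oplus> x 1 \<otimes> y 0"
proof -
  have fin: "finite {0, 1 :: int}" by simp
  note eq = monoid_alg_mult_eq[OF K_cring[OF K] C2_monoid x y _ kB_supp[OF x] _ kB_supp[OF y]]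
  have s: "{p \<in> {0, 1} \<times> {0, 1}. fst p \<otimes>\<^bsub>C2\<^esub> snd p = 0} = {(0, 0), (1, 1)}"
    "{p \<in> {0, 1} \<times> {0, 1}. fst p \<otimes>\<^bsub>C2\<^esub> snd p = 1} = {(0, 1), (1, 0)}"
    by (auto simp: C2_sel)
  show "(x \<otimes>\<^bsub>kB\<^esub> y) 0 = x 0 \<otimes> y 0 \<oplus> x 1 \<otimes> y 1"
    using kB_coeff[OF x] kB_coeff[OF y] by (simp only: eq[OF fin fin] s) simp
  show "(x \<otimes>\<^bsub>kB\<^esub> y) 1 = x 0 \<otimes> y 1 \<oplus> x 1 \<otimes> y 0"
    using kB_coeff[OF x] kB_coeff[OF y] by (simp only: eq[OF fin fin] s) simp
qed

lemma kC2_hopf_ops: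
  assumes x: "x \<in> carrier kB"
  shows "comult (kC2 K) x = x 0 \<odot>\<^bsub>tensor K kB kB\<^esub> tens K kB kB (bas 0) (bas 0)
      \<oplus>\<^bsub>tensor K kB kB\<^esub> x 1 \<odot>\<^bsub>tensor K kB kB\<^esub> tens K kB kB (bas 1) (bas 1)"
    and "counit (kC2 K) x = x 0 \<oplus> x 1" and "antipode (kC2 K) x = x"
proof -
  note Ba = B.unital_algebra_axioms
  have d: "comult (kC2 K) = lin_ext K (tensor K kB kB) (\<lambda>g. tens K kB kB (bas g) (bas g))"
    "counit (kC2 K) = lin_ext K (base_alg K) (\<lambda>g. \<one>)"
    "antipode (kC2 K) = lin_ext K kB (\<lambda>g. bas (inv\<^bsub>C2\<^esub> g))"
    by (simp_all add: kC2_def group_hopf_def Let_def module.defs hopf.defs)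
  show "comult (kC2 K) x = x 0 \<odot>\<^bsub>tensor K kB kB\<^esub> tens K kB kB (bas 0) (bas 0)
      \<oplus>\<^bsub>tensor K kB kB\<^esub> x 1 \<odot>\<^bsub>tensor K kB kB\<^esub> tens K kB kB (bas 1) (bas 1)"
    unfolding d by (rule kB_lin_ext[OF unital_algebra_module[OF tensor_unital_algebra[OF Ba Ba]] _ _ x])
      (intro tens_closed[OF Ba Ba] bas_closed)+
  show "counit (kC2 K) x = x 0 \<oplus> x 1"
    unfolding d using kB_coeff[OF x]
    by (subst kB_lin_ext[OF unital_algebra_module[OF base_alg_unital_algebra[OF K_cring[OF K]]] _ _ x])
       (simp_all add: base_alg_sel)
  have i: "inv\<^bsub>C2\<^esub> 0 = 0" "inv\<^bsub>C2\<^esub> 1 = 1" by (simp_all add: inv_integer_mod_group carrier_integer_mod_group)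
  have "lin_ext K kB (\<lambda>g. bas (inv\<^bsub>C2\<^esub> g)) x = x 0 \<odot>\<^bsub>kB\<^esub> bas 0 \<oplus>\<^bsub>kB\<^esub> x 1 \<odot>\<^bsub>kB\<^esub> bas 1"
    using kB_lin_ext[OF B.module_axioms _ _ x, of "\<lambda>g. bas (inv\<^bsub>C2\<^esub> g)"] by (simp add: i bas_closed)
  also have "\<dots> = x"
  proof
    fix i
    have "x i = \<zero>" if "i \<noteq> 0" "i \<noteq> 1" using kB_supp[OF x] that by (auto simp: supp_def)
    then show "(x 0 \<odot>\<^bsub>kB\<^esub> bas 0 \<oplus>\<^bsub>kB\<^esub> x 1 \<odot>\<^bsub>kB\<^esub> bas 1) i = x i"
      using kB_coeff[OF x] by (auto simp: kB_rules basis_elt_def)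
  qed
  finally show "antipode (kC2 K) x = x" unfolding d .
qed

lemma kD_lin: "f \<in> carrier kD \<Longrightarrow> f \<in> lin_hom K kB (base_alg K)"
  unfolding kD_sel using lin_hom_truncate(1)[OF kC2_truncate refl, of K "base_alg K"] by simp

lemma dual_pair_closed:
  assumes "a \<in> carrier K" "b \<in> carrier K" shows "dual_pair a b \<in> carrier kD"
proof -
  have "dual_pair a b \<in> lin_hom K kB (base_alg K)"
    by (intro lin_homI)
       (use assms in \<open>simp_all add: dual_pair_def base_alg_sel kB_coeff kB_rules(2,3) K.r_distr K.a_ac K.m_ac\<close>)
  then show ?thesis
    unfolding kD_sel using lin_hom_truncate(1)[OF kC2_truncate refl, of K "base_alg K"]
    by (simp add: dual_pair_def)
qed

lemma dual_pair_values:
  "\<lbrakk>a \<in> carrier K; b \<in> carrier K\<rbrakk> \<Longrightarrow> dual_pair a b (bas 0) = a"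
  "\<lbrakk>a \<in> carrier K; b \<in> carrier K\<rbrakk> \<Longrightarrow> dual_pair a b (bas 1) = b"
  using bas_closed by (simp_all add: dual_pair_def) (simp_all add: basis_elt_def)

lemma kD_values: "f \<in> carrier kD \<Longrightarrow> f (bas 0) \<in> carrier K \<and> f (bas 1) \<in> carrier K"
  using lin_hom_closed[OF kD_lin] bas_closed by (simp add: base_alg_sel)

lemma kD_eqI:
  assumes f: "f \<in> carrier kD" "g \<in> carrier kD" and eq: "f (bas 0) = g (bas 0)" "f (bas 1) = g (bas 1)"
  shows "f = g"
proof (rule extensionalityI)
  show "f \<in> extensional (carrier kB)" "g \<in> extensional (carrier kB)" using f by (auto simp: kD_sel)
  show "f x = g x" if "x \<in> carrier kB" for x
    by (rule monoid_alg_lin_eq[OF K_cring[OF K] C2_monoid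
          unital_algebra_module[OF base_alg_unital_algebra[OF K_cring[OF K]]] kD_lin[OF f(1)] kD_lin[OF f(2)] _ that])
       (use eq in \<open>auto simp: C2_sel\<close>)
qed

lemma dual_pair_eq: "f \<in> carrier kD \<Longrightarrow> f = dual_pair (f (bas 0)) (f (bas 1))"
  using kD_values by (intro kD_eqI dual_pair_closed) (auto simp: dual_pair_values)

lemma dual_pair_inject:
  "\<lbrakk>a \<in> carrier K; b \<in> carrier K; a' \<in> carrier K; b' \<in> carrier K\<rbrakk>
    \<Longrightarrow> dual_pair a b = dual_pair a' b' \<longleftrightarrow> a = a' \<and> b = b'"
  by (metis dual_pair_values)

lemma dual_pair_add:
  "\<lbrakk>a \<in> carrier K; b \<in> carrier K; a' \<in> carrier K; b' \<in> carrier K\<rbrakk>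
    \<Longrightarrow> dual_pair a b \<oplus>\<^bsub>kD\<^esub> dual_pair a' b' = dual_pair (a \<oplus> a') (b \<oplus> b')"
  by (auto simp: kD_sel dual_pair_def restrict_def kB_coeff K.l_distr K.a_ac)

lemma dual_pair_smult:
  "\<lbrakk>s \<in> carrier K; a \<in> carrier K; b \<in> carrier K\<rbrakk> \<Longrightarrow> s \<odot>\<^bsub>kD\<^esub> dual_pair a b = dual_pair (s \<otimes> a) (s \<otimes> b)"
  by (auto simp: kD_sel dual_pair_def restrict_def kB_coeff K.r_distr K.m_assoc)

lemma dual_pair_zero: "\<zero>\<^bsub>kD\<^esub> = dual_pair \<zero> \<zero>"
  by (auto simp: kD_sel dual_pair_def restrict_def kB_coeff)

lemma dual_pair_one: "\<one>\<^bsub>kD\<^esub> = dual_pair \<one> \<one>"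
  by (auto simp: kD_sel dual_pair_def restrict_def kB_coeff kC2_hopf_ops)

lemma dual_pair_mult:
  assumes a: "a \<in> carrier K" "b \<in> carrier K" "a' \<in> carrier K" "b' \<in> carrier K"
  shows "dual_pair a b \<otimes>\<^bsub>kD\<^esub> dual_pair a' b' = dual_pair (a \<otimes> a') (b \<otimes> b')"
proof -
  note Ba = B.unital_algebra_axioms
  note M = unital_algebra_module[OF base_alg_unital_algebra[OF K_cring[OF K]]]
  have \<beta>: "(\<lambda>y z. dual_pair a b y \<otimes> dual_pair a' b' z) \<in> bilin K kB kB (base_alg K)"
    using bilin_mult[OF base_alg_unital_algebra[OF K_cring[OF K]] kD_lin[OF dual_pair_closed[OF a(1,2)]]
        kD_lin[OF dual_pair_closed[OF a(3,4)]]] by (simp add: base_alg_sel)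
  note l = tlift_lin[OF Ba Ba M \<beta>]
  interpret T: unital_algebra K "tensor K kB kB" by (rule tensor_unital_algebra[OF Ba Ba])
  have "tlift K (base_alg K) (\<lambda>y z. dual_pair a b y \<otimes> dual_pair a' b' z) (comult (kC2 K) x)
      = (a \<otimes> a') \<otimes> x 0 \<oplus> (b \<otimes> b') \<otimes> x 1" if x: "x \<in> carrier kB" for x
    unfolding kC2_hopf_ops[OF x] using a kB_coeff[OF x]
    by (simp add: lin_hom_add[OF l] lin_hom_smult[OF l] tens_closed[OF Ba Ba] bas_closed
        tlift_tens[OF Ba Ba M \<beta>] dual_pair_values base_alg_sel K.m_ac)
  then show ?thesis by (auto simp: kD_sel dual_pair_def restrict_def)
qed

lemmas dual_pair_ops = dual_pair_add dual_pair_smult dual_pair_zero dual_pair_one dual_pair_mult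

lemma delta_dual_pair: "delta K 0 = dual_pair \<one> \<zero>" "delta K 1 = dual_pair \<zero> \<one>"
  by (auto simp: delta_def kC2_sel dual_pair_def restrict_def kB_coeff)

lemma kxk_to_dual_pair: "p \<in> carrier (kxk K) \<Longrightarrow> kxk_to_dual K p = dual_pair (fst p) (snd p)"
  by (auto simp: kxk_to_dual_def delta_dual_pair dual_pair_ops kxk_sel)

lemma kxk_to_dual_bij: "bij_betw (kxk_to_dual K) (carrier (kxk K)) (carrier kD)"
proof (rule bij_betwI)
  show "kxk_to_dual K \<in> carrier (kxk K) \<rightarrow> carrier kD"
    by (auto simp: kxk_to_dual_pair) (auto simp: kxk_sel intro!: dual_pair_closed)
  show "(\<lambda>f. (f (bas 0), f (bas 1))) \<in> carrier kD \<rightarrow> carrier (kxk K)"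
    using kD_values by (auto simp: kxk_sel)
  show "(kxk_to_dual K p (bas 0), kxk_to_dual K p (bas 1)) = p" if "p \<in> carrier (kxk K)" for p
    using that by (auto simp: kxk_to_dual_pair) (auto simp: kxk_sel dual_pair_values)
  show "kxk_to_dual K (f (bas 0), f (bas 1)) = f" if "f \<in> carrier kD" for f
    using kD_values[OF that] dual_pair_eq[OF that] by (simp add: kxk_to_dual_pair kxk_sel)
qed

lemma kxk_to_dual_ops:
  assumes p: "p \<in> carrier (kxk K)" and q: "q \<in> carrier (kxk K)"
  shows "kxk_to_dual K (p \<oplus>\<^bsub>kxk K\<^esub> q) = kxk_to_dual K p \<oplus>\<^bsub>kD\<^esub> kxk_to_dual K q"
    and "kxk_to_dual K (p \<otimes>\<^bsub>kxk K\<^esub> q) = kxk_to_dual K p \<otimes>\<^bsub>kD\<^esub> kxk_to_dual K q"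
    and "s \<in> carrier K \<Longrightarrow> kxk_to_dual K (s \<odot>\<^bsub>kxk K\<^esub> p) = s \<odot>\<^bsub>kD\<^esub> kxk_to_dual K p"
  using p q by (auto simp: kxk_to_dual_pair kxk_sel dual_pair_ops)

lemma kxk_to_dual_consts: "kxk_to_dual K \<one>\<^bsub>kxk K\<^esub> = \<one>\<^bsub>kD\<^esub>" "kxk_to_dual K \<zero>\<^bsub>kxk K\<^esub> = \<zero>\<^bsub>kD\<^esub>"
  by (subst kxk_to_dual_pair; simp add: kxk_sel dual_pair_ops)+

lemma kC2_dual_algebra: "unital_algebra K kD"
  by (rule unital_algebra_transport[OF kxk_unital_algebra[OF K_cring[OF K]] kxk_to_dual_bij])
     (simp_all add: kxk_to_dual_ops kxk_to_dual_consts)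

lemma kxk_to_dual_iso: "kxk_to_dual K \<in> alg_iso K (kxk K) kD"
proof -
  have "kxk_to_dual K \<in> alg_hom K (kxk K) kD"
    by (intro alg_homI lin_homI)
       (use kxk_to_dual_bij in \<open>auto simp: kxk_to_dual_ops kxk_to_dual_consts bij_betw_def\<close>)
  then show ?thesis using kxk_to_dual_bij by (simp add: alg_iso_def)
qed

abbreviation (input) "kDD \<equiv> tensor K kD kD"
abbreviation (input) "tD \<equiv> tens K kD kD"
abbreviation (input) "ev x y \<equiv> tlift K (base_alg K) (\<lambda>g g'. g x \<otimes> g' y)"

interpretation D: unital_algebra K kD by (rule kC2_dual_algebra)
lemmas Da = kC2_dual_algebra
interpretation DD: unital_algebra K kDD by (rule tensor_unital_algebra[OF Da Da])

lemmas base_algebra = base_alg_unital_algebra[OF K_cring[OF K]]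
lemmas base_module = unital_algebra_module[OF base_algebra]

lemma dual_eval_lin: "x \<in> carrier kB \<Longrightarrow> (\<lambda>g. g x) \<in> lin_hom K kD (base_alg K)"
proof -
  assume x: "x \<in> carrier kB"
  have c: "g x \<in> carrier K" if "g \<in> carrier kD" for g
    using lin_hom_closed[OF kD_lin[OF that] x] by (simp add: base_alg_sel)
  show ?thesis by (intro lin_homI) (use x c in \<open>simp_all add: base_alg_sel kD_sel(5,6)\<close>)
qed

lemma dual_eval_bilin:
  "\<lbrakk>x \<in> carrier kB; y \<in> carrier kB\<rbrakk> \<Longrightarrow> (\<lambda>g g'. g x \<otimes> g' y) \<in> bilin K kD kD (base_alg K)"
  using bilin_mult[OF base_algebra dual_eval_lin dual_eval_lin] by (simp add: base_alg_sel)

lemmas ev_lin = tlift_lin[OF Da Da base_module dual_eval_bilin]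
lemmas ev_tens = tlift_tens[OF Da Da base_module dual_eval_bilin]

lemma dual_decomp:
  assumes f: "f \<in> carrier kD"
  shows "f = f (bas 0) \<odot>\<^bsub>kD\<^esub> delta K 0 \<oplus>\<^bsub>kD\<^esub> f (bas 1) \<odot>\<^bsub>kD\<^esub> delta K 1"
  using kD_values[OF f] dual_pair_eq[OF f] by (simp add: delta_dual_pair dual_pair_ops)

lemma delta_closed: "delta K 0 \<in> carrier kD" "delta K 1 \<in> carrier kD"
  by (simp_all add: delta_dual_pair dual_pair_closed)

definition dual_expand where
  "dual_expand a b c d = (a \<odot>\<^bsub>kDD\<^esub> tD (delta K 0) (delta K 0) \<oplus>\<^bsub>kDD\<^esub> b \<odot>\<^bsub>kDD\<^esub> tD (delta K 0) (delta K 1))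
    \<oplus>\<^bsub>kDD\<^esub> (c \<odot>\<^bsub>kDD\<^esub> tD (delta K 1) (delta K 0) \<oplus>\<^bsub>kDD\<^esub> d \<odot>\<^bsub>kDD\<^esub> tD (delta K 1) (delta K 1))"

lemmas delta_tens_closed = tens_closed[OF Da Da delta_closed(1) delta_closed(1)]
  tens_closed[OF Da Da delta_closed(1) delta_closed(2)] tens_closed[OF Da Da delta_closed(2) delta_closed(1)]
  tens_closed[OF Da Da delta_closed(2) delta_closed(2)]

text \<open>
  The tensors \<open>\<delta>\<^sub>i \<otimes> \<delta>\<^sub>j\<close> span, with the evaluations at pairs of group elements as coordinates.
  Consequently equations between such tensors can be verified by evaluation.
\<close>

lemma dual_tensor_decomp:
  assumes t: "t \<in> carrier kDD"
  shows "t = dual_expand (ev (bas 0) (bas 0) t) (ev (bas 0) (bas 1) t) (ev (bas 1) (bas 0) t) (ev (bas 1) (bas 1) t)"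
proof (rule tensor_lin_eq[OF Da Da lin_hom_id _ _ t])
  note b = bas_closed
  show "(\<lambda>t. dual_expand (ev (bas 0) (bas 0) t) (ev (bas 0) (bas 1) t) (ev (bas 1) (bas 0) t) (ev (bas 1) (bas 1) t))
      \<in> lin_hom K kDD kDD"
    unfolding dual_expand_def
    by (intro lin_hom_plus[OF DD.module_axioms] lin_hom_scalar[OF DD.module_axioms] ev_lin b delta_tens_closed)
  fix f g assume f: "f \<in> carrier kD" and g: "g \<in> carrier kD"
  note v = kD_values[OF f] kD_values[OF g]
  let ?d0 = "delta K 0" and ?d1 = "delta K 1"
  note r = tens_lin_right[OF Da Da f]
  have "tD f g = g (bas 0) \<odot>\<^bsub>kDD\<^esub> tD f ?d0 \<oplus>\<^bsub>kDD\<^esub> g (bas 1) \<odot>\<^bsub>kDD\<^esub> tD f ?d1"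
    by (subst dual_decomp[OF g])
       (use v delta_closed in \<open>simp only: lin_hom_add[OF r] lin_hom_smult[OF r] D.smult_closed\<close>)
  moreover have "tD f u = f (bas 0) \<odot>\<^bsub>kDD\<^esub> tD ?d0 u \<oplus>\<^bsub>kDD\<^esub> f (bas 1) \<odot>\<^bsub>kDD\<^esub> tD ?d1 u" if u: "u \<in> carrier kD" for u
    by (subst dual_decomp[OF f])
       (use v delta_closed in \<open>simp only: lin_hom_add[OF tens_lin_left[OF Da Da u]]
          lin_hom_smult[OF tens_lin_left[OF Da Da u]] D.smult_closed\<close>)
  note l0 = this[OF delta_closed(1)] and l1 = this[OF delta_closed(2)]
  have e: "ev x y (tD f g) = f x \<otimes> g y" if "x \<in> carrier kB" "y \<in> carrier kB" for x y
    by (rule ev_tens[OF that f g])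
  ultimately show "tD f g = dual_expand (ev (bas 0) (bas 0) (tD f g)) (ev (bas 0) (bas 1) (tD f g))
      (ev (bas 1) (bas 0) (tD f g)) (ev (bas 1) (bas 1) (tD f g))"
    unfolding e[OF b(1) b(1)] e[OF b(1) b(2)] e[OF b(2) b(1)] e[OF b(2) b(2)] dual_expand_def
    using v delta_tens_closed
    by (simp add: l0 l1 DD.smult_r_distr DD.smult_assoc1[symmetric] K.m_comm DD.M.a_ac)
qed

lemma dual_tensor_eqI:
  assumes t: "t \<in> carrier kDD" "t' \<in> carrier kDD"
    and eq: "\<And>x y. \<lbrakk>x \<in> {bas 0, bas 1}; y \<in> {bas 0, bas 1}\<rbrakk> \<Longrightarrow> ev x y t = ev x y t'"
  shows "t = t'"
proof -
  have "t = dual_expand (ev (bas 0) (bas 0) t') (ev (bas 0) (bas 1) t') (ev (bas 1) (bas 0) t') (ev (bas 1) (bas 1) t')"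
    using dual_tensor_decomp[OF t(1)] by (simp add: eq)
  then show ?thesis using dual_tensor_decomp[OF t(2)] by simp
qed

lemma ev_dual_expand:
  assumes xy: "x \<in> carrier kB" "y \<in> carrier kB" and a: "a \<in> carrier K" "b \<in> carrier K" "c \<in> carrier K" "d \<in> carrier K"
  shows "ev x y (dual_expand a b c d) = (a \<otimes> (x 0 \<otimes> y 0) \<oplus> b \<otimes> (x 0 \<otimes> y 1))
    \<oplus> (c \<otimes> (x 1 \<otimes> y 0) \<oplus> d \<otimes> (x 1 \<otimes> y 1))"
proof -
  note l = ev_lin[OF xy]
  have dv: "delta K i z = z i" if "z \<in> carrier kB" for i z
    using that by (simp add: delta_def kC2_sel)
  have e: "ev x y (tD f g) = f x \<otimes> g y" if "f \<in> carrier kD" "g \<in> carrier kD" for f g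
    by (rule ev_tens[OF xy that])
  show ?thesis
    unfolding dual_expand_def using a delta_tens_closed delta_closed xy
    by (simp add: lin_hom_add[OF l] lin_hom_smult[OF l] e dv base_alg_sel)
qed

text \<open>
  The functional \<open>x \<otimes> y \<mapsto> f(xy)\<close> is the tensor with the coefficient \<open>f(ij)\<close> at \<open>\<delta>\<^sub>i \<otimes> \<delta>\<^sub>j\<close>; the
  tensor is determined by its values on group elements, so that it is the value of the definite
  description.
\<close>

lemma dual_comult:
  assumes f: "f \<in> carrier kD"
  shows "comult kD f \<in> carrier kDD"
    and "\<lbrakk>x \<in> carrier kB; y \<in> carrier kB\<rbrakk> \<Longrightarrow> ev x y (comult kD f) = f (x \<otimes>\<^bsub>kB\<^esub> y)"
proof -
  note b = bas_closed and v = kD_values[OF f]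
  let ?P = "\<lambda>t. t \<in> carrier kDD \<and> (\<forall>x\<in>carrier kB. \<forall>y\<in>carrier kB. ev x y t = f (x \<otimes>\<^bsub>kB\<^esub> y))"
  (* The coefficient at \<open>\<delta>\<^sub>i \<otimes> \<delta>\<^sub>j\<close> is \<open>f\<close> at the sum of \<open>i\<close> and \<open>j\<close> modulo \<open>2\<close>. *)
  let ?t = "dual_expand (f (bas 0)) (f (bas 1)) (f (bas 1)) (f (bas 0))"
  have "?P ?t"
  proof (intro conjI ballI)
    show "?t \<in> carrier kDD"
      unfolding dual_expand_def using v delta_tens_closed by simp
    fix x y assume xy: "x \<in> carrier kB" "y \<in> carrier kB"
    note c = kB_coeff[OF xy(1)] kB_coeff[OF xy(2)]
    have "f (x \<otimes>\<^bsub>kB\<^esub> y) = f (bas 0) \<otimes> (x \<otimes>\<^bsub>kB\<^esub> y) 0 \<oplus> f (bas 1) \<otimes> (x \<otimes>\<^bsub>kB\<^esub> y) 1"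
      by (subst dual_pair_eq[OF f]) (use xy in \<open>simp add: dual_pair_def\<close>)
    then show "ev x y ?t = f (x \<otimes>\<^bsub>kB\<^esub> y)"
      using v c by (simp add: ev_dual_expand xy kB_mult_coeff[OF xy] K.r_distr K.a_ac)
  qed
  moreover have "t = ?t" if "?P t" for t
    using that calculation b by (intro dual_tensor_eqI) auto
  ultimately have "?P (THE t. ?P t)" by (rule theI[of ?P])
  then have "?P (comult kD f)" unfolding kD_sel(7) .
  then show "comult kD f \<in> carrier kDD"
    "\<lbrakk>x \<in> carrier kB; y \<in> carrier kB\<rbrakk> \<Longrightarrow> ev x y (comult kD f) = f (x \<otimes>\<^bsub>kB\<^esub> y)" by auto
qed

lemma bas_mult: "bas 0 \<otimes>\<^bsub>kB\<^esub> bas 0 = bas 0" "bas 0 \<otimes>\<^bsub>kB\<^esub> bas 1 = bas 1" "bas 1 \<otimes>\<^bsub>kB\<^esub> bas 0 = bas 1" "bas 1 \<otimes>\<^bsub>kB\<^esub> bas 1 = bas 0"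
  by (subst basis_elt_mult[OF K_cring[OF K] C2_monoid]; simp add: C2_sel)+

lemma dual_mult_value:
  assumes "f \<in> carrier kD" "g \<in> carrier kD" "z \<in> {bas 0, bas 1}" shows "(f \<otimes>\<^bsub>kD\<^esub> g) z = f z \<otimes> g z"
  using kD_values[OF assms(1)] kD_values[OF assms(2)] assms(3)
  by (subst dual_pair_eq[OF assms(1)], subst dual_pair_eq[OF assms(2)]) (auto simp: dual_pair_ops dual_pair_values)

lemma dual_one_value: "z \<in> {bas 0, bas 1} \<Longrightarrow> \<one>\<^bsub>kD\<^esub> z = \<one>"
  by (auto simp: dual_pair_ops dual_pair_values)

lemma dual_value_closed: "\<lbrakk>f \<in> carrier kD; z \<in> {bas 0, bas 1}\<rbrakk> \<Longrightarrow> f z \<in> carrier K"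
  using kD_values by auto

text \<open>The evaluation at a pair of group elements is multiplicative, because these are group-like.\<close>

lemma ev_alg_hom:
  assumes xy: "x \<in> {bas 0, bas 1}" "y \<in> {bas 0, bas 1}"
  shows "ev x y \<in> alg_hom K kDD (base_alg K)"
proof -
  have c: "x \<in> carrier kB" "y \<in> carrier kB" using xy bas_closed by auto
  show ?thesis
    by (rule tlift_alg_hom[OF Da Da base_algebra dual_eval_bilin[OF c]])
       (use dual_value_closed[OF _ xy(1)] dual_value_closed[OF _ xy(2)] dual_one_value[OF xy(1)]
          dual_one_value[OF xy(2)] dual_mult_value[OF _ _ xy(1)] dual_mult_value[OF _ _ xy(2)]
        in \<open>simp_all add: base_alg_sel K.m_ac\<close>)
qed

lemma dual_antipode: "f \<in> carrier kD \<Longrightarrow> antipode kD f = f"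
proof (rule extensionalityI)
  assume f: "f \<in> carrier kD"
  show "f \<in> extensional (carrier kB)" using f by (simp add: kD_sel(1))
qed (simp_all add: kD_sel(9) kC2_hopf_ops(3))

lemma dual_counit: "counit kD f = f (bas 0)"
  by (simp add: kD_sel(8) monoid_alg_one[OF K_cring[OF K] C2_monoid] C2_sel)

text \<open>
  After evaluation at a pair of group elements \<open>x\<close>, \<open>y\<close>, the element \<open>\<Delta>f\<close> becomes \<open>f(xy)\<close>, and
  products of functionals become products of values.
\<close>

lemma dual_prehopf: "prehopf K kD"
proof (intro prehopf.intro prehopf_axioms.intro Da)
  note b = bas_closed
  have bc: "x \<in> carrier kB" if "x \<in> {bas 0, bas 1}" for x using that b by auto
  have bm: "x \<otimes>\<^bsub>kB\<^esub> y \<in> {bas 0, bas 1}" if "x \<in> {bas 0, bas 1}" "y \<in> {bas 0, bas 1}" for x y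
    using that by (auto simp: bas_mult)
  have add: "(f \<oplus>\<^bsub>kD\<^esub> g) z = f z \<oplus> g z" "(a \<odot>\<^bsub>kD\<^esub> f) z = a \<otimes> f z" if "z \<in> {bas 0, bas 1}" for f g z a
    using bc[OF that] by (simp_all add: kD_sel(5,6))
  show "comult kD \<in> alg_hom K kD kDD"
  proof (intro alg_homI lin_homI)
    show "comult kD f \<in> carrier kDD" if "f \<in> carrier kD" for f by (rule dual_comult(1)[OF that])
    show "comult kD (f \<oplus>\<^bsub>kD\<^esub> g) = comult kD f \<oplus>\<^bsub>kDD\<^esub> comult kD g"
      if f: "f \<in> carrier kD" and g: "g \<in> carrier kD" for f g
    proof (rule dual_tensor_eqI)
      fix x y assume xy: "x \<in> {bas 0, bas 1}" "y \<in> {bas 0, bas 1}"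
      note l = lin_hom_add[OF ev_lin[OF bc[OF xy(1)] bc[OF xy(2)]]]
      show "ev x y (comult kD (f \<oplus>\<^bsub>kD\<^esub> g)) = ev x y (comult kD f \<oplus>\<^bsub>kDD\<^esub> comult kD g)"
        unfolding l[OF dual_comult(1)[OF f] dual_comult(1)[OF g]] base_alg_sel
        using f g by (simp only: dual_comult(2)[OF _ bc[OF xy(1)] bc[OF xy(2)]] D.M.a_closed add(1)[OF bm[OF xy]])
    qed (use f g in \<open>simp_all add: dual_comult(1)\<close>)
    show "comult kD (a \<odot>\<^bsub>kD\<^esub> f) = a \<odot>\<^bsub>kDD\<^esub> comult kD f"
      if a: "a \<in> carrier K" and f: "f \<in> carrier kD" for a f
    proof (rule dual_tensor_eqI)
      fix x y assume xy: "x \<in> {bas 0, bas 1}" "y \<in> {bas 0, bas 1}"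
      note l = lin_hom_smult[OF ev_lin[OF bc[OF xy(1)] bc[OF xy(2)]]]
      show "ev x y (comult kD (a \<odot>\<^bsub>kD\<^esub> f)) = ev x y (a \<odot>\<^bsub>kDD\<^esub> comult kD f)"
        unfolding l[OF a dual_comult(1)[OF f]] base_alg_sel
        using f a by (simp only: dual_comult(2)[OF _ bc[OF xy(1)] bc[OF xy(2)]] D.smult_closed add(2)[OF bm[OF xy]])
    qed (use f a in \<open>simp_all add: dual_comult(1)\<close>)
    show "comult kD \<one>\<^bsub>kD\<^esub> = \<one>\<^bsub>kDD\<^esub>"
    proof (rule dual_tensor_eqI)
      fix x y assume xy: "x \<in> {bas 0, bas 1}" "y \<in> {bas 0, bas 1}"
      show "ev x y (comult kD \<one>\<^bsub>kD\<^esub>) = ev x y \<one>\<^bsub>kDD\<^esub>"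
        unfolding alg_hom_one[OF ev_alg_hom[OF xy]] base_alg_sel
        by (simp only: dual_comult(2)[OF D.one_closed bc[OF xy(1)] bc[OF xy(2)]] dual_one_value[OF bm[OF xy]])
    qed (simp_all add: dual_comult(1))
    show "comult kD (f \<otimes>\<^bsub>kD\<^esub> g) = comult kD f \<otimes>\<^bsub>kDD\<^esub> comult kD g"
      if f: "f \<in> carrier kD" and g: "g \<in> carrier kD" for f g
    proof (rule dual_tensor_eqI)
      fix x y assume xy: "x \<in> {bas 0, bas 1}" "y \<in> {bas 0, bas 1}"
      show "ev x y (comult kD (f \<otimes>\<^bsub>kD\<^esub> g)) = ev x y (comult kD f \<otimes>\<^bsub>kDD\<^esub> comult kD g)"
        unfolding alg_hom_mult[OF ev_alg_hom[OF xy] dual_comult(1)[OF f] dual_comult(1)[OF g]] base_alg_sel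
        using f g by (simp only: dual_comult(2)[OF _ bc[OF xy(1)] bc[OF xy(2)]] D.m_closed
            dual_mult_value[OF _ _ bm[OF xy]])
    qed (use f g in \<open>simp_all add: dual_comult(1)\<close>)
  qed
  show "counit kD \<in> alg_hom K kD (base_alg K)"
    by (intro alg_homI lin_homI)
       (simp_all add: dual_counit base_alg_sel add dual_mult_value dual_one_value dual_value_closed)
  note S = dual_antipode
  show "antipode kD \<in> lin_hom K kD kD"
    by (rule lin_hom_cong[OF D.module_axioms lin_hom_id]) (simp add: S)
  show "antipode kD \<one>\<^bsub>kD\<^esub> = \<one>\<^bsub>kD\<^esub>" by (rule S[OF D.one_closed])
  show "antipode kD (f \<otimes>\<^bsub>kD\<^esub> g) = antipode kD g \<otimes>\<^bsub>kD\<^esub> antipode kD f"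
    if f: "f \<in> carrier kD" and g: "g \<in> carrier kD" for f g
    unfolding S[OF f] S[OF g] S[OF D.m_closed[OF f g]]
    using f g dual_value_closed[OF f] dual_value_closed[OF g]
    by (intro kD_eqI D.m_closed) (simp_all add: dual_mult_value K.m_comm)
qed

abbreviation (input) "dh \<equiv> dual_pair \<zero> \<one>"
abbreviation (input) "dc \<equiv> dual_pair \<one> (\<ominus> \<one>)"

lemma dual_comult_values:
  "comult kD dc = tD dc dc" "comult kD dh = tD dh dc \<oplus>\<^bsub>kDD\<^esub> tD \<one>\<^bsub>kD\<^esub> dh"
  "comult kD (delta K 0) = tD (delta K 0) (delta K 0) \<oplus>\<^bsub>kDD\<^esub> tD (delta K 1) (delta K 1)"
proof -
  note b = bas_closed
  have bc: "x \<in> carrier kB" if "x \<in> {bas 0, bas 1}" for x using that b by auto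
  note tc = tens_closed[OF Da Da]
  have h: "dh \<in> carrier kD" "dc \<in> carrier kD" by (simp_all add: dual_pair_closed)
  show "comult kD dc = tD dc dc"
  proof (rule dual_tensor_eqI)
    fix x y assume xy: "x \<in> {bas 0, bas 1}" "y \<in> {bas 0, bas 1}"
    note c = bc[OF xy(1)] bc[OF xy(2)]
    show "ev x y (comult kD dc) = ev x y (tD dc dc)"
      unfolding dual_comult(2)[OF h(2) c] ev_tens[OF c h(2) h(2)]
      using xy by (auto simp: bas_mult dual_pair_values K.l_minus K.r_minus)
  qed (use h tc in \<open>simp_all add: dual_comult(1)\<close>)
  show "comult kD dh = tD dh dc \<oplus>\<^bsub>kDD\<^esub> tD \<one>\<^bsub>kD\<^esub> dh"
  proof (rule dual_tensor_eqI)
    fix x y assume xy: "x \<in> {bas 0, bas 1}" "y \<in> {bas 0, bas 1}"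
    note c = bc[OF xy(1)] bc[OF xy(2)]
    show "ev x y (comult kD dh) = ev x y (tD dh dc \<oplus>\<^bsub>kDD\<^esub> tD \<one>\<^bsub>kD\<^esub> dh)"
      unfolding dual_comult(2)[OF h(1) c] lin_hom_add[OF ev_lin[OF c] tc[OF h] tc[OF D.one_closed h(1)]]
        ev_tens[OF c h] ev_tens[OF c D.one_closed h(1)] base_alg_sel
      using xy by (auto simp: bas_mult dual_pair_values dual_pair_ops K.l_minus K.r_minus K.l_neg)
  qed (use h tc in \<open>simp_all add: dual_comult(1)\<close>)
  note d = delta_closed
  show "comult kD (delta K 0) = tD (delta K 0) (delta K 0) \<oplus>\<^bsub>kDD\<^esub> tD (delta K 1) (delta K 1)"
  proof (rule dual_tensor_eqI)
    fix x y assume xy: "x \<in> {bas 0, bas 1}" "y \<in> {bas 0, bas 1}"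
    note c = bc[OF xy(1)] bc[OF xy(2)]
    show "ev x y (comult kD (delta K 0)) = ev x y (tD (delta K 0) (delta K 0) \<oplus>\<^bsub>kDD\<^esub> tD (delta K 1) (delta K 1))"
      unfolding dual_comult(2)[OF d(1) c] lin_hom_add[OF ev_lin[OF c] tc[OF d(1,1)] tc[OF d(2,2)]]
        ev_tens[OF c d(1,1)] ev_tens[OF c d(2,2)] base_alg_sel
      using xy by (auto simp: bas_mult dual_pair_values delta_dual_pair)
  qed (use d tc in \<open>simp_all add: dual_comult(1)\<close>)
qed

lemma dual_span:
  assumes f: "f \<in> carrier kD"
  shows "f = f (bas 0) \<odot>\<^bsub>kD\<^esub> \<one>\<^bsub>kD\<^esub> \<oplus>\<^bsub>kD\<^esub> (f (bas 1) \<ominus> f (bas 0)) \<odot>\<^bsub>kD\<^esub> dh"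
  using kD_values[OF f] dual_pair_eq[OF f]
  by (simp add: dual_pair_ops a_minus_def K.a_lcomm[of "f (bas 0)"] K.r_neg)

lemma kC2_dual_hopf_algebra: "hopf_algebra K kD"
proof -
  interpret H: prehopf K kD by (rule dual_prehopf)
  have h: "dh \<in> carrier kD" "dc \<in> carrier kD" by (simp_all add: dual_pair_closed)
  have one: "comult kD \<one>\<^bsub>kD\<^esub> = tD \<one>\<^bsub>kD\<^esub> \<one>\<^bsub>kD\<^esub>"
    by (simp add: alg_hom_one[OF H.comult_hom] tensor_one[OF Da Da])
  have e: "counit kD dc = \<one>" "counit kD dh = \<zero>" by (simp_all add: dual_counit dual_pair_values)
  have "antipode kD dh \<otimes>\<^bsub>kD\<^esub> dc \<oplus>\<^bsub>kD\<^esub> antipode kD \<one>\<^bsub>kD\<^esub> \<otimes>\<^bsub>kD\<^esub> dh = \<zero>\<^bsub>kD\<^esub>"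
    "dh \<otimes>\<^bsub>kD\<^esub> antipode kD dc \<oplus>\<^bsub>kD\<^esub> \<one>\<^bsub>kD\<^esub> \<otimes>\<^bsub>kD\<^esub> antipode kD dh = \<zero>\<^bsub>kD\<^esub>"
    unfolding dual_antipode[OF h(1)] dual_antipode[OF h(2)] dual_antipode[OF D.one_closed]
    by (simp_all add: dual_pair_ops K.l_neg)
  note * = H.hopf_identities_skew_primitive[OF h(2) dual_comult_values(1) e(1) D.one_closed one H.counit_one
      h(1) dual_comult_values(2) e(2) this]
  show ?thesis
  proof (rule H.hopf_algebraI)
    fix f assume f: "f \<in> carrier kD"
    have v: "f (bas 0) \<in> carrier K" "f (bas 1) \<ominus> f (bas 0) \<in> carrier K" using kD_values[OF f] by auto
    have "hopf_identities K kD (f (bas 0) \<odot>\<^bsub>kD\<^esub> \<one>\<^bsub>kD\<^esub> \<oplus>\<^bsub>kD\<^esub> (f (bas 1) \<ominus> f (bas 0)) \<odot>\<^bsub>kD\<^esub> dh)"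
      by (intro H.hopf_identities_add H.hopf_identities_smult H.hopf_identities_one * v h D.smult_closed D.one_closed)
    then show "hopf_identities K kD f" unfolding dual_span[OF f, symmetric] .
  qed
qed

interpretation H: hopf_algebra K kD by (rule kC2_dual_hopf_algebra)

lemma dual_neg: "\<lbrakk>a \<in> carrier K; b \<in> carrier K\<rbrakk> \<Longrightarrow> \<ominus>\<^bsub>kD\<^esub> dual_pair a b = dual_pair (\<ominus> a) (\<ominus> b)"
  by (intro D.M.minus_equality) (simp_all add: dual_pair_ops dual_pair_closed K.l_neg)

lemma dual_coaction_pair: "coaction_pair K kD dh dc"
  unfolding coaction_pair_def[OF K_cring[OF K]]
  by (simp add: dual_comult_values dual_counit dual_pair_values dual_pair_closed dual_pair_ops K.a_assoc K.l_neg K.l_minus K.r_minus)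

lemma dual_c: "dc = \<one>\<^bsub>kD\<^esub> \<ominus>\<^bsub>kD\<^esub> (dh \<oplus>\<^bsub>kD\<^esub> dh)"
  by (simp add: a_minus_def dual_pair_ops dual_neg K.minus_add K.a_assoc[symmetric] K.r_neg)

text \<open>
  The isomorphism sends \<open>e\<close> to \<open>\<delta>\<^sub>0\<close>, for which \<open>\<Delta>\<delta>\<^sub>0 = \<delta>\<^sub>0 \<otimes> \<delta>\<^sub>0 + \<delta>\<^sub>1 \<otimes> \<delta>\<^sub>1\<close>. Going back in the
  first factor gives \<open>e \<otimes> \<delta>\<^sub>0 + (1 - e) \<otimes> \<delta>\<^sub>1 = 1 \<otimes> \<delta>\<^sub>1 + e \<otimes> (\<delta>\<^sub>0 - \<delta>\<^sub>1)\<close>.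
\<close>

lemma rho2_ext:
  assumes a: "a \<in> carrier (kxk K)"
  shows "rho2 K a = unital_ext K kD (kxk_tens K kD dh dc) a"
proof -
  note Kc = K_cring[OF K] and A = kxk_unital_algebra[OF K_cring[OF K]]
  let ?f = "kxk_to_dual K" and ?g = "inv_into (carrier (kxk K)) (kxk_to_dual K)"
  interpret A: unital_algebra K "kxk K" by (rule A)
  interpret T: unital_algebra K "tensor K (kxk K) kD" by (rule tensor_unital_algebra[OF A Da])
  have f: "?f \<in> alg_hom K (kxk K) kD" using kxk_to_dual_iso by (simp add: alg_iso_def)
  have gf: "?g (?f p) = p" if "p \<in> carrier (kxk K)" for p
    using bij_betw_inv_into_left[OF kxk_to_dual_bij that] .
  have im: "\<exists>p\<in>carrier (kxk K). x = ?f p" if "x \<in> carrier kD" for x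
    using kxk_to_dual_bij that by (auto simp: bij_betw_def)
  have g: "?g \<in> alg_hom K kD (kxk K)"
  proof (intro alg_homI lin_homI)
    show "?g \<one>\<^bsub>kD\<^esub> = \<one>\<^bsub>kxk K\<^esub>" using gf[OF A.one_closed] by (simp add: kxk_to_dual_consts)
    show "?g (x \<otimes>\<^bsub>kD\<^esub> y) = ?g x \<otimes>\<^bsub>kxk K\<^esub> ?g y" if "x \<in> carrier kD" "y \<in> carrier kD" for x y
      using im[OF that(1)] im[OF that(2)] by (auto simp: alg_hom_mult[OF f, symmetric] gf)
    show "?g (x \<oplus>\<^bsub>kD\<^esub> y) = ?g x \<oplus>\<^bsub>kxk K\<^esub> ?g y" if "x \<in> carrier kD" "y \<in> carrier kD" for x y
      using im[OF that(1)] im[OF that(2)] by (auto simp: lin_hom_add[OF alg_hom_lin[OF f], symmetric] gf)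
    show "?g (s \<odot>\<^bsub>kD\<^esub> x) = s \<odot>\<^bsub>kxk K\<^esub> ?g x" if "s \<in> carrier K" "x \<in> carrier kD" for s x
      using im[OF that(2)] that(1) by (auto simp: lin_hom_smult[OF alg_hom_lin[OF f], symmetric] gf)
    show "?g x \<in> carrier (kxk K)" if "x \<in> carrier kD" for x using im[OF that] by (auto simp: gf)
  qed
  note m = tmap_alg_hom[OF A Da Da Da g alg_hom_id]
  note mt = tmap_tens[OF A Da Da Da alg_hom_lin[OF g] lin_hom_id]
  have r: "rho2 K \<in> alg_hom K (kxk K) (tensor K (kxk K) kD)"
    unfolding rho2_def by (rule alg_hom_comp[OF alg_hom_comp[OF f H.comult_hom] m])
  have hc: "dh \<in> carrier kD" "dc \<in> carrier kD" by (simp_all add: dual_pair_closed)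
  note d = delta_closed
  have p: "(\<one>, \<zero>) \<in> carrier (kxk K)" "(\<zero>, \<one>) \<in> carrier (kxk K)" by (simp_all add: kxk_sel)
  have fd: "?f (\<one>, \<zero>) = delta K 0" "?f (\<zero>, \<one>) = delta K 1"
    by (simp_all add: kxk_to_dual_pair[OF p(1)] kxk_to_dual_pair[OF p(2)] delta_dual_pair)
  have gd: "?g (delta K 0) = (\<one>, \<zero>)" "?g (delta K 1) = (\<zero>, \<one>)"
    using gf[OF p(1)] gf[OF p(2)] by (simp_all only: fd)
  have "rho2 K (elt_e K) = tens K (kxk K) kD (\<one>, \<zero>) (delta K 0)
      \<oplus>\<^bsub>tensor K (kxk K) kD\<^esub> tens K (kxk K) kD (\<zero>, \<one>) (delta K 1)"
    unfolding rho2_def elt_e_def fd dual_comult_values(3)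
      lin_hom_add[OF alg_hom_lin[OF m] tens_closed[OF Da Da d(1,1)] tens_closed[OF Da Da d(2,2)]]
      mt[OF d(1,1)] mt[OF d(2,2)] gd ..
  also have "\<dots> = kxk_tens K kD dh dc"
    unfolding tens_kxk[OF Kc Da p(1) d(1)] tens_kxk[OF Kc Da p(2) d(2)]
    by (subst kxk_tens_add[OF Kc Da])
       (simp_all add: d D.smult_closed, simp_all add: delta_dual_pair dual_pair_ops a_minus_def)
  finally have re: "rho2 K (elt_e K) = kxk_tens K kD dh dc" .
  note u = unital_ext_lin[OF Kc Da kxk_tens_closed[OF Kc Da hc]]
  show ?thesis
    by (rule kxk_lin_eq[OF Kc T.module_axioms alg_hom_lin[OF r] u(1) _ _ a])
       (simp only: u(2) alg_hom_one[OF r], simp only: u(3) re)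
qed

lemma rho2_coaction: "hopf_coaction K (kxk K) kD (rho2 K)"
  by (rule hopf_coaction_cong[OF coaction_pair_coaction[OF K_cring[OF K] kC2_dual_hopf_algebra
        dual_coaction_pair]]) (rule rho2_ext[symmetric])

lemma cosupp_rho2: "cosupp K (kxk K) kD (rho2 K) = symmetric_ops K"
proof (rule cosupp_symmetric[OF K kC2_dual_hopf_algebra dual_coaction_pair rho2_ext _ dual_c])
  show "dh \<noteq> \<zero>\<^bsub>kD\<^esub>" by (simp add: dual_pair_ops dual_pair_inject)
qed

lemma dual_hom_eq:
  assumes f: "f \<in> alg_hom K kD B" and g: "g \<in> alg_hom K kD B" and eq: "f dh = g dh" and x: "x \<in> carrier kD"
  shows "f x = g x"
proof -
  have v: "x (bas 0) \<in> carrier K" "x (bas 1) \<ominus> x (bas 0) \<in> carrier K" using kD_values[OF x] by auto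
  have h: "dh \<in> carrier kD" by (simp add: dual_pair_closed)
  let ?x = "x (bas 0) \<odot>\<^bsub>kD\<^esub> \<one>\<^bsub>kD\<^esub> \<oplus>\<^bsub>kD\<^esub> (x (bas 1) \<ominus> x (bas 0)) \<odot>\<^bsub>kD\<^esub> dh"
  have "f ?x = g ?x"
    using v h by (simp only: lin_hom_add[OF alg_hom_lin[OF f]] lin_hom_add[OF alg_hom_lin[OF g]]
        lin_hom_smult[OF alg_hom_lin[OF f]] lin_hom_smult[OF alg_hom_lin[OF g]] D.smult_closed D.one_closed
        alg_hom_one[OF f] alg_hom_one[OF g] eq)
  then show ?thesis unfolding dual_span[OF x, symmetric] .
qed

text \<open>
  An idempotent \<open>h\<close> and its complement \<open>1 - h\<close> are orthogonal with sum \<open>1\<close>, like \<open>\<delta>\<^sub>1\<close> and \<open>\<delta>\<^sub>0\<close>.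
\<close>

lemma dual_hom_exists:
  assumes A: "unital_algebra K A" and h: "h \<in> carrier A" "h \<otimes>\<^bsub>A\<^esub> h = h"
  obtains \<phi> where "\<phi> \<in> alg_hom K kD A" "\<phi> dh = h"
proof -
  interpret A: unital_algebra K A by (rule A)
  let ?u = "\<one>\<^bsub>A\<^esub> \<ominus>\<^bsub>A\<^esub> h" and ?\<phi> = "\<lambda>f. f (bas 0) \<odot>\<^bsub>A\<^esub> (\<one>\<^bsub>A\<^esub> \<ominus>\<^bsub>A\<^esub> h) \<oplus>\<^bsub>A\<^esub> f (bas 1) \<odot>\<^bsub>A\<^esub> h"
  have u: "?u \<in> carrier A" using h by simp
  have m: "?u \<otimes>\<^bsub>A\<^esub> h = \<zero>\<^bsub>A\<^esub>" "h \<otimes>\<^bsub>A\<^esub> ?u = \<zero>\<^bsub>A\<^esub>" "?u \<otimes>\<^bsub>A\<^esub> ?u = ?u"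
    using h by (simp_all add: a_minus_def A.l_distr A.r_distr A.l_minus A.r_minus A.M.r_neg A.M.l_neg)
  have l: "?\<phi> \<in> lin_hom K kD A"
    by (intro lin_hom_plus lin_hom_scalar A.module_axioms dual_eval_lin bas_closed u h)
  have \<phi>: "?\<phi> \<in> alg_hom K kD A"
  proof (rule alg_homI[OF l])
    show "?\<phi> \<one>\<^bsub>kD\<^esub> = \<one>\<^bsub>A\<^esub>" using h by (simp add: dual_one_value a_minus_def A.M.a_assoc A.M.l_neg)
    show "?\<phi> (f \<otimes>\<^bsub>kD\<^esub> g) = ?\<phi> f \<otimes>\<^bsub>A\<^esub> ?\<phi> g" if f: "f \<in> carrier kD" and g: "g \<in> carrier kD" for f g
      using kD_values[OF f] kD_values[OF g] u h f g
      by (simp add: dual_mult_value A.l_distr A.r_distr A.smult_mult_left A.smult_mult_right m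
          A.smult_assoc1[symmetric] K.m_comm)
  qed
  show ?thesis by (rule that[OF \<phi>]) (use h u in \<open>simp add: dual_pair_values\<close>)
qed

lemma V_universal_rho2:
  "V_universal TYPE('h) K (kxk K) (cosupp K (kxk K) kD (rho2 K)) kD (rho2 K)"
proof (rule V_universalI[OF K kC2_dual_hopf_algebra dual_coaction_pair rho2_ext rho2_coaction])
  show "unital_subalgebra K (End_alg K (kxk K)) (cosupp K (kxk K) kD (rho2 K))"
    unfolding cosupp_rho2 by (rule symmetric_ops_subalgebra[OF K])
next
  fix H :: "('k, 'h) hopf" and h c \<rho>
  assume H: "hopf_algebra K H" and p: "coaction_pair K H h c"
    and \<rho>: "\<And>a. a \<in> carrier (kxk K) \<Longrightarrow> \<rho> a = unital_ext K H (kxk_tens K H h c) a"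
    and sub: "cosupp K (kxk K) H \<rho> \<subseteq> cosupp K (kxk K) kD (rho2 K)"
  interpret H': hopf_algebra K H by (rule H)
  have c: "c = \<one>\<^bsub>H\<^esub> \<ominus>\<^bsub>H\<^esub> (h \<oplus>\<^bsub>H\<^esub> h)"
    by (rule cosupp_subset_symmetric[OF K H p \<rho> sub[unfolded cosupp_rho2]])
  note pf = pair_facts(1,3)[OF K H p]
  obtain \<phi> where \<phi>: "\<phi> \<in> alg_hom K kD H" "\<phi> dh = h" by (rule dual_hom_exists[OF H'.unital_algebra_axioms pf])
  have h: "dh \<in> carrier kD" by (simp add: dual_pair_closed)
  have "\<phi> (\<one>\<^bsub>kD\<^esub> \<ominus>\<^bsub>kD\<^esub> (dh \<oplus>\<^bsub>kD\<^esub> dh)) = c"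
    unfolding c using h by (simp only: lin_hom_minus[OF D.module_axioms H'.module_axioms alg_hom_lin[OF \<phi>(1)]]
        lin_hom_add[OF alg_hom_lin[OF \<phi>(1)]] \<phi>(2) alg_hom_one[OF \<phi>(1)] D.one_closed D.M.a_closed)
  then have "\<phi> dc = c" by (simp only: dual_c)
  then show "\<exists>\<phi>\<in>alg_hom K kD H. \<phi> dh = h \<and> \<phi> dc = c" using \<phi> by blast
qed (assumption | (frule (3) dual_hom_eq, assumption))+

end

theorem theorem4p5:
  fixes K :: "'k ring"
  assumes "field K"
  shows
    "(\<comment> \<open>every unital Hopf algebra coaction is equivalent to one of the three\<close>
      \<forall>(H :: ('k, 'h) hopf) \<rho>. hopf_coaction K (kxk K) H \<rho> \<longrightarrow>
        coaction_equiv_via K (\<lambda>a. a) (kxk K) H \<rho> (kxk K) (base_hopf K) (rho1 K) \<or>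
        coaction_equiv_via K (\<lambda>a. a) (kxk K) H \<rho> (kxk K) (kC2_dual K) (rho2 K) \<or>
        coaction_equiv_via K (\<lambda>a. a) (kxk K) H \<rho> (kxk K) (H_I K) (rho3 K))
    \<and> \<comment> \<open>(1)\<close>
      hopf_coaction K (kxk K) (base_hopf K) (rho1 K)
    \<and> has_dim K (End_alg K (kxk K)) (cosupp K (kxk K) (base_hopf K) (rho1 K)) 1
    \<and> cosupp K (kxk K) (base_hopf K) (rho1 K)
        = {\<lambda>x\<in>carrier (kxk K). \<alpha> \<odot>\<^bsub>kxk K\<^esub> x | \<alpha>. \<alpha> \<in> carrier K}
    \<and> \<comment> \<open>(2)\<close>
      kxk_to_dual K \<in> alg_iso K (kxk K) (kC2_dual K)
    \<and> hopf_coaction K (kxk K) (kC2_dual K) (rho2 K)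
    \<and> has_dim K (End_alg K (kxk K)) (cosupp K (kxk K) (kC2_dual K) (rho2 K)) 2
    \<and> cosupp K (kxk K) (kC2_dual K) (rho2 K)
        = {f \<in> carrier (End_alg K (kxk K)). \<exists>\<alpha>\<in>carrier K. \<exists>\<beta>\<in>carrier K.
            has_matrix K (kxk K) [(\<one>\<^bsub>K\<^esub>, \<zero>\<^bsub>K\<^esub>), (\<zero>\<^bsub>K\<^esub>, \<one>\<^bsub>K\<^esub>)] f (\<lambda>i j. if i = j then \<alpha> else \<beta>)}
    \<and> \<comment> \<open>(3)\<close>
      hopf_coaction K (kxk K) (H_I K) (rho3 K)
    \<and> rho3 K (elt_e K)
        = tens K (kxk K) (H_I K) \<one>\<^bsub>kxk K\<^esub> (quot_gen K (ideal_I K) Gh)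
            \<oplus>\<^bsub>tensor K (kxk K) (H_I K)\<^esub>
          tens K (kxk K) (H_I K) (elt_e K) (quot_gen K (ideal_I K) Gc)
    \<and> has_dim K (End_alg K (kxk K)) (cosupp K (kxk K) (H_I K) (rho3 K)) 3
    \<and> cosupp K (kxk K) (H_I K) (rho3 K)
        = {f \<in> carrier (End_alg K (kxk K)). \<exists>M.
            has_matrix K (kxk K) [\<one>\<^bsub>kxk K\<^esub>, elt_e K] f M \<and> (\<forall>i<2. \<forall>j<i. M i j = \<zero>\<^bsub>K\<^esub>)}
    \<and> \<comment> \<open>(3a)\<close>
      finite_dim_alg K (H_II1 K)
    \<and> hopf_coaction K (kxk K) (H_II1 K) (rho3a K)
    \<and> rho3a K (elt_e K)
        = tens K (kxk K) (H_II1 K) \<one>\<^bsub>kxk K\<^esub> (quot_gen K (ideal_II1 K) Gh)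
            \<oplus>\<^bsub>tensor K (kxk K) (H_II1 K)\<^esub>
          tens K (kxk K) (H_II1 K) (elt_e K) (quot_gen K (ideal_II1 K) Gc)
    \<and> coaction_equiv_via K (\<lambda>a. a) (kxk K) (H_II1 K) (rho3a K) (kxk K) (H_I K) (rho3 K)
    \<and> \<comment> \<open>(3b)\<close>
      (ring_char K \<noteq> 2 \<longrightarrow>
        hopf_coaction K (kxk K) (sweedler_hopf K) (rho3b K) \<and>
        rho3b K (\<one>\<^bsub>K\<^esub>, \<ominus>\<^bsub>K\<^esub> \<one>\<^bsub>K\<^esub>)
          = tens K (kxk K) (sweedler_hopf K) (\<one>\<^bsub>K\<^esub>, \<ominus>\<^bsub>K\<^esub> \<one>\<^bsub>K\<^esub>) (sweedler_c K)
              \<oplus>\<^bsub>tensor K (kxk K) (sweedler_hopf K)\<^esub>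
            tens K (kxk K) (sweedler_hopf K) (\<one>\<^bsub>K\<^esub>, \<one>\<^bsub>K\<^esub>)
              (sweedler_c K \<otimes>\<^bsub>sweedler_hopf K\<^esub> sweedler_v K) \<and>
        coaction_equiv_via K (\<lambda>a. a) (kxk K) (sweedler_hopf K) (rho3b K) (kxk K) (H_I K) (rho3 K))
    \<and> \<comment> \<open>universality of the three coactions\<close>
      V_universal TYPE('h) K (kxk K) (cosupp K (kxk K) (base_hopf K) (rho1 K)) (base_hopf K) (rho1 K)
    \<and> V_universal TYPE('h) K (kxk K) (cosupp K (kxk K) (kC2_dual K) (rho2 K)) (kC2_dual K) (rho2 K)
    \<and> V_universal TYPE('h) K (kxk K) (cosupp K (kxk K) (H_I K) (rho3 K)) (H_I K) (rho3 K)"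
proof -
  note K = assms and A = kxk_unital_algebra[OF K_cring[OF assms]]
  note cosupps = cosupp_rho1[OF K] cosupp_rho2[OF K] cosupp_rho3[OF K]
  have classification: "coaction_equiv_via K (\<lambda>a. a) (kxk K) H \<rho> (kxk K) (base_hopf K) (rho1 K) \<or>
      coaction_equiv_via K (\<lambda>a. a) (kxk K) H \<rho> (kxk K) (kC2_dual K) (rho2 K) \<or>
      coaction_equiv_via K (\<lambda>a. a) (kxk K) H \<rho> (kxk K) (H_I K) (rho3 K)"
    if co: "hopf_coaction K (kxk K) H \<rho>" for H :: "('k, 'h) hopf" and \<rho>
  proof -
    have H: "hopf_algebra K H" using co by (simp add: hopf_coaction_def)
    obtain h c where p: "coaction_pair K H h c"
      and "\<forall>a\<in>carrier (kxk K). \<rho> a = unital_ext K H (kxk_tens K H h c) a"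
      by (rule coaction_has_pair[OF K_cring[OF K] co])
    then have \<rho>: "\<rho> a = unital_ext K H (kxk_tens K H h c) a" if "a \<in> carrier (kxk K)" for a
      using that by blast
    show ?thesis
      unfolding coaction_equiv_id_iff[OF A] cosupps by (rule cosupp_trichotomy[OF K H p \<rho>])
  qed
  have rho3b: "hopf_coaction K (kxk K) (sweedler_hopf K) (rho3b K) \<and>
      rho3b K (\<one>\<^bsub>K\<^esub>, \<ominus>\<^bsub>K\<^esub> \<one>\<^bsub>K\<^esub>)
        = tens K (kxk K) (sweedler_hopf K) (\<one>\<^bsub>K\<^esub>, \<ominus>\<^bsub>K\<^esub> \<one>\<^bsub>K\<^esub>) (sweedler_c K)
            \<oplus>\<^bsub>tensor K (kxk K) (sweedler_hopf K)\<^esub>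
          tens K (kxk K) (sweedler_hopf K) (\<one>\<^bsub>K\<^esub>, \<one>\<^bsub>K\<^esub>) (sweedler_c K \<otimes>\<^bsub>sweedler_hopf K\<^esub> sweedler_v K) \<and>
      coaction_equiv_via K (\<lambda>a. a) (kxk K) (sweedler_hopf K) (rho3b K) (kxk K) (H_I K) (rho3 K)"
    if char: "ring_char K \<noteq> 2"
    unfolding coaction_equiv_id_iff[OF A] cosupps cosupp_rho3b[OF K char]
    using rho3b_coaction[OF K char] rho3b_value[OF K char] by (simp add: rho3b_f_def)
  have rho3_e: "rho3 K (elt_e K)
        = tens K (kxk K) (H_I K) \<one>\<^bsub>kxk K\<^esub> (quot_gen K (ideal_I K) Gh)
            \<oplus>\<^bsub>tensor K (kxk K) (H_I K)\<^esub> tens K (kxk K) (H_I K) (elt_e K) (quot_gen K (ideal_I K) Gc)"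
    "rho3a K (elt_e K)
        = tens K (kxk K) (H_II1 K) \<one>\<^bsub>kxk K\<^esub> (quot_gen K (ideal_II1 K) Gh)
            \<oplus>\<^bsub>tensor K (kxk K) (H_II1 K)\<^esub> tens K (kxk K) (H_II1 K) (elt_e K) (quot_gen K (ideal_II1 K) Gc)"
    unfolding rho3_values[OF K] by (simp_all add: rho3_e_def H_I_def H_II1_def)
  have equiv_3a: "coaction_equiv_via K (\<lambda>a. a) (kxk K) (H_II1 K) (rho3a K) (kxk K) (H_I K) (rho3 K)"
    unfolding coaction_equiv_id_iff[OF A] cosupps ..
  note dims = has_dim_scalar_ops[OF K] has_dim_symmetric_ops[OF K] has_dim_triangular_ops[OF K]
  show ?thesis
    by (intro conjI allI impI rho1_coaction[OF K] rho2_coaction[OF K] rho3_coaction[OF K]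
        dims[folded cosupps] cosupps[unfolded scalar_ops_eq[OF K] symmetric_ops_eq[OF K] triangular_ops_eq[OF K]]
        kxk_to_dual_iso[OF K] rho3_e H_II1_finite_dim[OF K] equiv_3a
        V_universal_rho1[OF K] V_universal_rho2[OF K] V_universal_rho3[OF K])
       (rule classification rho3b[THEN conjunct1] rho3b[THEN conjunct2, THEN conjunct1]
          rho3b[THEN conjunct2, THEN conjunct2]; assumption)+
qed

end
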